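(* Assume Hypotheses (H) on the data $(\Omega,\Gamma^D,\Gamma^N,N_0,P_0,N^D,P^D,\Psi^D,m,M)$ (see context), and assume that the initial and boundary conditions satisfy the quasi-neutrality relations $P_0-N_0=0$ and $P^D-N^D=0$. Let $T>0$, $\xi>0$, $\beta>0$. Then there exists a constant $K_F$, depending only on $\Omega,T,m,M,N^D,P^D,\Psi^D,\beta$ and $\xi$, such that the following holds for every admissible mesh $\mathcal M=(\mathcal T,\mathcal E,\mathcal P)$ of $\Omega$ with $\mathrm d(x_K,\sigma)\ge\xi\,\mathrm{diam}(K)$ for all $K\in\mathcal T$, $\sigma\in\mathcal E_K$ and $\mathrm{card}(\mathcal E_K)\le\beta$ for all $K\in\mathcal T$, every $\Delta t>0$ and every $\lambda\ge0$: with $N_T=\lfloor T/\Delta t\rfloor$, every solution $(N_{\mathcal T}^n,P_{\mathcal T}^n,\Psi_{\mathcal T}^n)_{0\le n\le N_T}$ to the scheme $(\mathcal S_\lambda)$ satisfies $$\sum_{n=0}^{N_T-1}\Delta t\sum_{\sigma\in\mathcal E}\tau_\sigma\,D_\sigma\Psi^{n+1}\Big((D_\sigma P^{n+1})^2+(D_\sigma N^{n+1})^2\Big)\le K_F(1+\lambda^2),$$ $$\sum_{n=0}^{N_T-1}\Delta t\sum_{\sigma\in\mathcal E}\tau_\sigma(D_\sigma N^{n+1})^2+\sum_{n=0}^{N_T-1}\Delta t\sum_{\sigma\in\mathcal E}\tau_\sigma(D_\sigma P^{n+1})^2\le K_F(1+\lambda^2),$$ $$\sum_{n=0}^{N_T-1}\Delta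 t\sum_{\sigma\in\mathcal E}\tau_\sigma(D_\sigma\Psi^{n+1})^2\le K_F(1+\lambda^2).$$
   Context: **Hypotheses (H).** $\Omega$ is an open bounded subset of $\mathbb R^d$ ($d\ge1$), $\partial\Omega=\Gamma^D\cup\Gamma^N$ with $\Gamma^D\cap\Gamma^N=\emptyset$ and $\mathrm m(\Gamma^D)>0$. The boundary data $N^D,P^D,\Psi^D$ are traces of functions defined on all of $\Omega$, denoted the same way. Moreover $N_0,P_0\in L^\infty(\Omega)$, $N^D,P^D\in L^\infty(\Omega)\cap H^1(\Omega)$, $\Psi^D\in H^1(\Omega)$, and $m>0$, $M>0$ are constants such that $m\le N_0,P_0,N^D,P^D\le M$ a.e. on $\Omega$. **Admissible mesh.** $\mathcal M=(\mathcal T,\mathcal E,\mathcal P)$ where $\mathcal T$ is a finite family of pairwise disjoint open polygonal (polyhedral) convex subsets of $\Omega$ (control volumes), $\mathcal E$ is a finite family of edges (faces), i.e. subsets of $\overline\Omega$ contained in hyperplanes with positive $(d-1)$-dimensional measure, and $\mathcal P=(x_K)_{K\in\mathcal T}$ is a family of points, such that: the closure of the union of the control volumes is $\overline\Omega$; for each $K$ there is $\mathcal E_K\subset\mathcal E$ with $\partial K=\bigcup_{\sigma\in\mathcal E_K}\overline\sigma$, and $\mathcal E=\bigcup_K\mathcal E_K$; for $K\ne L$, either $\overline K\cap\overline L$ has zero $(d-1)$-measure or $\overline K\cap\overline L=\overline\sigma$ for some $\sigma\in\mathcal E$, then denoted $\sigma=K|L$; $x_K\in\overline K$, and if $\sigma=K|L$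 then $x_K\neq x_L$ and the line through $x_K,x_L$ is orthogonal to $\sigma$; if $\sigma\in\mathcal E_K$, $\sigma\subset\partial\Omega$ and $x_K\notin\sigma$, the line through $x_K$ orthogonal to $\sigma$ meets $\sigma$. Edges are split as $\mathcal E=\mathcal E_{int}\cup\mathcal E_{ext}$ (interior edges $K|L$; edges in $\partial\Omega$), and $\mathcal E_{ext}=\mathcal E_{ext}^D\cup\mathcal E_{ext}^N$ (edges included in $\Gamma^D$, resp. $\Gamma^N$); likewise $\mathcal E_K=\mathcal E_{K,int}\cup\mathcal E_{K,ext}^D\cup\mathcal E_{K,ext}^N$. Set $\mathrm d_\sigma=\mathrm d(x_K,x_L)$ if $\sigma=K|L$, $\mathrm d_\sigma=\mathrm d(x_K,\sigma)$ if $\sigma\in\mathcal E_{ext}\cap\mathcal E_K$, and $\tau_\sigma=\mathrm m(\sigma)/\mathrm d_\sigma$, where $\mathrm m$ denotes Lebesgue measure in dimension $d$ or $d-1$ as appropriate. **Discrete vectors.** For $u_{\mathcal M}=((u_K)_{K\in\mathcal T},(u_\sigma)_{\sigma\in\mathcal E_{ext}^D})$, $K\in\mathcal T$, $\sigma\in\mathcal E_K$: $u_{K,\sigma}=u_L$ if $\sigma=K|L$, $u_{K,\sigma}=u_\sigma$ if $\sigma\in\mathcal E_{K,ext}^D$, $u_{K,\sigma}=u_K$ if $\sigma\in\mathcal E_{K,ext}^N$; $Du_{K,\sigma}=u_{K,\sigma}-u_K$; $D_\sigma u=|Du_{K,\sigma}|$ (independent of the choice of $K$ with $\sigma\in\mathcal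 E_K$). **Scheme $(\mathcal S_\lambda)$.** $B(0)=1$, $B(x)=x/(e^x-1)$ for $x\ne0$. Initial values: $(N_K^0,P_K^0)=\frac1{\mathrm m(K)}\int_K(N_0,P_0)\,dx$. Boundary values, for $\sigma\in\mathcal E_{ext}^D$ and all $n\ge0$: $(N_\sigma^n,P_\sigma^n,\Psi_\sigma^n)=\frac1{\mathrm m(\sigma)}\int_\sigma(N^D,P^D,\Psi^D)\,d\gamma$. The equations, for all $K\in\mathcal T$, $n\ge0$, are $$\mathrm m(K)\frac{N_K^{n+1}-N_K^n}{\Delta t}+\sum_{\sigma\in\mathcal E_K}\mathcal F_{K,\sigma}^{n+1}=0,\qquad \mathrm m(K)\frac{P_K^{n+1}-P_K^n}{\Delta t}+\sum_{\sigma\in\mathcal E_K}\mathcal G_{K,\sigma}^{n+1}=0,$$ $$-\lambda^2\sum_{\sigma\in\mathcal E_K}\tau_\sigma D\Psi_{K,\sigma}^n=\mathrm m(K)(P_K^n-N_K^n),$$ with $$\mathcal F_{K,\sigma}^{n+1}=\tau_\sigma\big(B(-D\Psi_{K,\sigma}^{n+1})N_K^{n+1}-B(D\Psi_{K,\sigma}^{n+1})N_{K,\sigma}^{n+1}\big),$$ $$\mathcal G_{K,\sigma}^{n+1}=\tau_\sigma\big(B(D\Psi_{K,\sigma}^{n+1})P_K^{n+1}-B(-D\Psi_{K,\sigma}^{n+1})P_{K,\sigma}^{n+1}\big).$$ For $\lambda=0$ (with $P_0=N_0$, $P^D=N^D$) the same system with $\lambda=0$ is equivalently: for all $K\in\mathcal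 T$, $n\ge0$, $$\mathrm m(K)\frac{N_K^{n+1}-N_K^n}{\Delta t}-\sum_{\sigma\in\mathcal E_K}\tau_\sigma\frac{B(D\Psi_{K,\sigma}^{n+1})+B(-D\Psi_{K,\sigma}^{n+1})}{2}DN_{K,\sigma}^{n+1}=0,$$ $$-\sum_{\sigma\in\mathcal E_K}\tau_\sigma D\Psi_{K,\sigma}^{n+1}(N_K^{n+1}+N_{K,\sigma}^{n+1})=0,\qquad P_K^n-N_K^n=0$$ (in this case $\Psi^0_K$ is not constrained). A solution $(\cdot)_{0\le n\le N_T}$ is one satisfying these equations at all time levels up to $N_T$.
   Formalization: Interior edges K|L are required to meet ∂Ω only in a set of zero (d-1)-measure; this is automatic unless Ω has cracks along mesh edges, where the scheme would couple across the crack and the uniform bound can fail. *)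

theory Defs
  imports "HOL-Analysis.Analysis"
begin

section \<open>Measures of dimension d - 1\<close>

text \<open>Hausdorff outer measure of dimension s, normalised so that it agrees with Lebesgue measure
  on s-dimensional planes. The convention that the s-th power of the diameter of the empty set
  is 0 matters for s = 0, where the result is the counting measure.\<close>

definition hausdorff_size :: "nat \<Rightarrow> 'a::euclidean_space set \<Rightarrow> ennreal" where
  "hausdorff_size s C =
     (if C = {} then 0 else ennreal (unit_ball_vol (real s) * (diameter C / 2) ^ s))"

definition hausdorff_measure :: "nat \<Rightarrow> 'a::euclidean_space set \<Rightarrow> ennreal" where
  "hausdorff_measure s A =
     (SUP \<delta>\<in>{0::real<..}.
        INF C\<in>{C::nat \<Rightarrow> 'a set. A \<subseteq> (\<Union>i. C i) \<and> (\<forall>i. bounded (C i) \<and> diameter (C i) \<le> \<delta>)}.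
          (\<Sum>i. hausdorff_size s (C i)))"

text \<open>Lebesgue measure of dimension d - 1 on the hyperplane of equation \<open>\<nu> \<bullet> x = c\<close>, for a unit
  vector \<open>\<nu>\<close>: the slab of thickness 1 above the hyperplane is the product of the hyperplane with
  a unit interval, and its d-dimensional Lebesgue measure is projected onto the hyperplane.\<close>

definition hyperplane_lebesgue :: "'a::euclidean_space \<Rightarrow> real \<Rightarrow> 'a measure" where
  "hyperplane_lebesgue \<nu> c =
     completion (distr (restrict_space lborel {x. c \<le> \<nu> \<bullet> x \<and> \<nu> \<bullet> x \<le> c + 1}) borel
       (\<lambda>x. x - (\<nu> \<bullet> x - c) *\<^sub>R \<nu>))"

definition flat :: "'a::euclidean_space set \<Rightarrow> bool" where
  "flat A \<longleftrightarrow> (\<exists>\<nu> c. norm \<nu> = 1 \<and> A \<subseteq> {x. \<nu> \<bullet> x = c})"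

text \<open>The measure carried by a hyperplane containing the flat set A. When several hyperplanes
  contain A, then A is a null set for each of them, unless they only differ by the sign of the
  normal, which does not change the measure of subsets of the hyperplane.\<close>

definition surf :: "'a::euclidean_space set \<Rightarrow> 'a measure" where
  "surf A = (let (\<nu>, c) = (SOME (\<nu>, c). norm \<nu> = 1 \<and> A \<subseteq> {x. \<nu> \<bullet> x = c})
             in hyperplane_lebesgue \<nu> c)"

definition surf_meas :: "'a::euclidean_space set \<Rightarrow> real" where
  "surf_meas A = measure (surf A) A"


section \<open>Function spaces and traces\<close>

text \<open>Elements of \<open>L\<^sup>\<infinity>\<close> and \<open>H\<^sup>1\<close> are represented by functions on the whole space, of which only
  the restriction to the domain matters.\<close>

definition Linf :: "'a::euclidean_space set \<Rightarrow> ('a \<Rightarrow> real) set" where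
  "Linf \<Omega> = {u. u \<in> borel_measurable (lebesgue_on \<Omega>) \<and>
                (\<exists>C. AE x in lebesgue_on \<Omega>. \<bar>u x\<bar> \<le> C)}"

definition L2 :: "'a::euclidean_space set \<Rightarrow> ('a \<Rightarrow> 'b::euclidean_space) set" where
  "L2 \<Omega> = {u. u \<in> borel_measurable (lebesgue_on \<Omega>) \<and>
              integrable (lebesgue_on \<Omega>) (\<lambda>x. (norm (u x))\<^sup>2)}"

definition C1_gradient :: "('a::euclidean_space \<Rightarrow> real) \<Rightarrow> ('a \<Rightarrow> 'a) \<Rightarrow> bool" where
  "C1_gradient \<phi> D\<phi> \<longleftrightarrow> (\<forall>x. GDERIV \<phi> x :> D\<phi> x) \<and> continuous_on UNIV D\<phi>"

text \<open>Weak gradients in \<open>L\<^sup>2\<close>, with compactly supported \<open>C\<^sup>1\<close> test functions.\<close>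

definition weak_gradient ::
    "'a::euclidean_space set \<Rightarrow> ('a \<Rightarrow> real) \<Rightarrow> ('a \<Rightarrow> 'a) \<Rightarrow> bool" where
  "weak_gradient \<Omega> u w \<longleftrightarrow> w \<in> L2 \<Omega> \<and>
     (\<forall>\<phi> D\<phi> C. C1_gradient \<phi> D\<phi> \<and> compact C \<and> C \<subseteq> \<Omega> \<and> (\<forall>x. x \<notin> C \<longrightarrow> \<phi> x = 0) \<longrightarrow>
       (\<forall>i\<in>Basis. integral\<^sup>L (lebesgue_on \<Omega>) (\<lambda>x. u x * (D\<phi> x \<bullet> i)) =
                 - integral\<^sup>L (lebesgue_on \<Omega>) (\<lambda>x. (w x \<bullet> i) * \<phi> x)))"

definition H1 :: "'a::euclidean_space set \<Rightarrow> ('a \<Rightarrow> real) set" where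
  "H1 \<Omega> = {u. u \<in> L2 \<Omega> \<and> (\<exists>w. weak_gradient \<Omega> u w)}"

text \<open>\<open>trace_on U S u g\<close>: the trace on \<open>S\<close>, a flat part of the boundary of \<open>U\<close>, of
  \<open>u \<in> H\<^sup>1(U)\<close> is \<open>g \<in> L\<^sup>2(S)\<close>. As usual for Lipschitz U (here: convex polytopes), the trace operator
  is the continuous extension of the restriction to the boundary of functions that are \<open>C\<^sup>1\<close> up to
  the boundary.\<close>

definition trace_on ::
    "'a::euclidean_space set \<Rightarrow> 'a set \<Rightarrow> ('a \<Rightarrow> real) \<Rightarrow> ('a \<Rightarrow> real) \<Rightarrow> bool" where
  "trace_on U S u g \<longleftrightarrow>
     u \<in> L2 U \<and> g \<in> borel_measurable (surf S) \<and>
     (\<exists>w \<phi> D\<phi>. weak_gradient U u w \<and> (\<forall>k::nat. C1_gradient (\<phi> k) (D\<phi> k)) \<and>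
       (\<lambda>k. \<integral>\<^sup>+x. ennreal ((\<phi> k x - u x)\<^sup>2) \<partial>lebesgue_on U) \<longlonglongrightarrow> 0 \<and>
       (\<lambda>k. \<integral>\<^sup>+x. ennreal ((norm (D\<phi> k x - w x))\<^sup>2) \<partial>lebesgue_on U) \<longlonglongrightarrow> 0 \<and>
       (\<lambda>k. \<integral>\<^sup>+x. ennreal ((\<phi> k x - g x)\<^sup>2) * indicator S x \<partial>surf S) \<longlonglongrightarrow> 0)"

text \<open>a is the mean value over S of the trace of u.\<close>

definition trace_mean :: "'a::euclidean_space set \<Rightarrow> 'a set \<Rightarrow> ('a \<Rightarrow> real) \<Rightarrow> real \<Rightarrow> bool" where
  "trace_mean U S u a \<longleftrightarrow>
     (\<exists>g. trace_on U S u g \<and> a = set_lebesgue_integral (surf S) S g / surf_meas S)"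

definition polytopal_cell :: "'a::euclidean_space set \<Rightarrow> bool" where
  "polytopal_cell K \<longleftrightarrow> open K \<and> convex K \<and> polytope (closure K)"

text \<open>The trace of u on \<open>\<Gamma>\<close>, a part of the boundary of \<open>\<Omega>\<close>, vanishes. The set \<open>\<Omega>\<close> is not assumed
  to be Lipschitz; traces are taken from the convex polytopes contained in \<open>\<Omega>\<close> that have a
  boundary part of positive measure in common with \<open>\<Gamma>\<close>. In particular the condition holds if u
  vanishes almost everywhere in \<open>\<Omega>\<close>.\<close>

definition zero_trace_on :: "'a::euclidean_space set \<Rightarrow> 'a set \<Rightarrow> ('a \<Rightarrow> real) \<Rightarrow> bool" where
  "zero_trace_on \<Omega> \<Gamma> u \<longleftrightarrow>
     (\<forall>U S. polytopal_cell U \<and> U \<subseteq> \<Omega> \<and> S \<subseteq> frontier U \<inter> \<Gamma> \<and> flat S \<and> 0 < surf_meas S \<longrightarrow>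
        trace_on U S u (\<lambda>_. 0))"


section \<open>Data and meshes\<close>

definition hypotheses_H ::
    "'a::euclidean_space set \<Rightarrow> 'a set \<Rightarrow> 'a set \<Rightarrow> ('a \<Rightarrow> real) \<Rightarrow> ('a \<Rightarrow> real) \<Rightarrow>
     ('a \<Rightarrow> real) \<Rightarrow> ('a \<Rightarrow> real) \<Rightarrow> ('a \<Rightarrow> real) \<Rightarrow> real \<Rightarrow> real \<Rightarrow> bool" where
  "hypotheses_H \<Omega> \<Gamma>D \<Gamma>N N0 P0 ND PD \<Psi>D m M \<longleftrightarrow>
     open \<Omega> \<and> bounded \<Omega> \<and>
     frontier \<Omega> = \<Gamma>D \<union> \<Gamma>N \<and> \<Gamma>D \<inter> \<Gamma>N = {} \<and> 0 < hausdorff_measure (DIM('a) - 1) \<Gamma>D \<and>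
     N0 \<in> Linf \<Omega> \<and> P0 \<in> Linf \<Omega> \<and>
     ND \<in> Linf \<Omega> \<inter> H1 \<Omega> \<and> PD \<in> Linf \<Omega> \<inter> H1 \<Omega> \<and> \<Psi>D \<in> H1 \<Omega> \<and>
     0 < m \<and> 0 < M \<and>
     (\<forall>f\<in>{N0, P0, ND, PD}. AE x in lebesgue_on \<Omega>. m \<le> f x \<and> f x \<le> M)"

record 'a mesh =
  cells :: "'a set set"
  edges :: "'a set set"
  cell_edges :: "'a set \<Rightarrow> 'a set set"
  center :: "'a set \<Rightarrow> 'a"

text \<open>Edges of the form \<open>K|L\<close>.\<close>

definition int_edges :: "'a::euclidean_space mesh \<Rightarrow> 'a set set" where
  "int_edges \<M> = {\<sigma>. \<exists>K\<in>cells \<M>. \<exists>L\<in>cells \<M>. K \<noteq> L \<and> \<sigma> \<in> cell_edges \<M> K \<inter> cell_edges \<M> L}"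

definition ext_edges :: "'a::euclidean_space set \<Rightarrow> 'a mesh \<Rightarrow> 'a set set" where
  "ext_edges \<Omega> \<M> = {\<sigma> \<in> edges \<M>. \<sigma> \<subseteq> frontier \<Omega>}"

text \<open>In the clause on pairs of cells, the edge whose closure is \<open>closure K \<inter> closure L\<close> is the unique
  edge common to K and L, so that the notation \<open>K|L\<close> is unambiguous. Interior edges may meet the
  boundary of \<open>\<Omega>\<close> only in a null set; this excludes cracks of \<open>\<Omega>\<close> running along them.\<close>

definition admissible_mesh ::
    "'a::euclidean_space set \<Rightarrow> 'a set \<Rightarrow> 'a set \<Rightarrow> 'a mesh \<Rightarrow> bool" where
  "admissible_mesh \<Omega> \<Gamma>D \<Gamma>N \<M> \<longleftrightarrow>
     finite (cells \<M>) \<and> disjoint (cells \<M>) \<and>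
     (\<forall>K\<in>cells \<M>. polytopal_cell K \<and> K \<subseteq> \<Omega>) \<and>
     closure (\<Union> (cells \<M>)) = closure \<Omega> \<and>
     finite (edges \<M>) \<and>
     (\<forall>\<sigma>\<in>edges \<M>. \<sigma> \<subseteq> closure \<Omega> \<and> flat \<sigma> \<and> 0 < surf_meas \<sigma>) \<and>
     (\<forall>K\<in>cells \<M>. frontier K = (\<Union>\<sigma>\<in>cell_edges \<M> K. closure \<sigma>)) \<and>
     edges \<M> = (\<Union>K\<in>cells \<M>. cell_edges \<M> K) \<and>
     (\<forall>K\<in>cells \<M>. \<forall>L\<in>cells \<M>. K \<noteq> L \<longrightarrow>
        surf_meas (closure K \<inter> closure L) = 0 \<or>
        (\<exists>\<sigma>\<in>edges \<M>. closure K \<inter> closure L = closure \<sigma> \<and>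
           cell_edges \<M> K \<inter> cell_edges \<M> L = {\<sigma>} \<and>
           center \<M> K \<noteq> center \<M> L \<and>
           (\<forall>y\<in>\<sigma>. \<forall>z\<in>\<sigma>. (center \<M> K - center \<M> L) \<bullet> (y - z) = 0))) \<and>
     (\<forall>K\<in>cells \<M>. center \<M> K \<in> closure K) \<and>
     (\<forall>K\<in>cells \<M>. \<forall>\<sigma>\<in>cell_edges \<M> K. \<sigma> \<subseteq> frontier \<Omega> \<and> center \<M> K \<notin> \<sigma> \<longrightarrow>
        (\<exists>p\<in>\<sigma>. \<forall>y\<in>\<sigma>. \<forall>z\<in>\<sigma>. (p - center \<M> K) \<bullet> (y - z) = 0)) \<and>
     edges \<M> = int_edges \<M> \<union> ext_edges \<Omega> \<M> \<and>
     (\<forall>\<sigma>\<in>int_edges \<M>. measure (surf \<sigma>) (closure \<sigma> \<inter> frontier \<Omega>) = 0) \<and>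
     (\<forall>\<sigma>\<in>ext_edges \<Omega> \<M>. \<sigma> \<subseteq> \<Gamma>D \<or> \<sigma> \<subseteq> \<Gamma>N)"

definition dirichlet_edges :: "'a::euclidean_space set \<Rightarrow> 'a set \<Rightarrow> 'a mesh \<Rightarrow> 'a set set" where
  "dirichlet_edges \<Omega> \<Gamma>D \<M> = {\<sigma> \<in> ext_edges \<Omega> \<M>. \<sigma> \<subseteq> \<Gamma>D}"

definition neighbour :: "'a::euclidean_space mesh \<Rightarrow> 'a set \<Rightarrow> 'a set \<Rightarrow> 'a set" where
  "neighbour \<M> K \<sigma> = (THE L. L \<in> cells \<M> \<and> L \<noteq> K \<and> \<sigma> \<in> cell_edges \<M> L)"

text \<open>Some cell having \<open>\<sigma>\<close> among its edges; what is computed from it below does not depend on the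
  choice.\<close>

definition side :: "'a::euclidean_space mesh \<Rightarrow> 'a set \<Rightarrow> 'a set" where
  "side \<M> \<sigma> = (SOME K. K \<in> cells \<M> \<and> \<sigma> \<in> cell_edges \<M> K)"

definition edge_dist :: "'a::euclidean_space mesh \<Rightarrow> 'a set \<Rightarrow> real" where
  "edge_dist \<M> \<sigma> = (let K = side \<M> \<sigma> in
     if \<sigma> \<in> int_edges \<M> then dist (center \<M> K) (center \<M> (neighbour \<M> K \<sigma>))
     else infdist (center \<M> K) \<sigma>)"

definition transm :: "'a::euclidean_space mesh \<Rightarrow> 'a set \<Rightarrow> real" where
  "transm \<M> \<sigma> = surf_meas \<sigma> / edge_dist \<M> \<sigma>"


section \<open>The scheme\<close>

text \<open>Discrete vectors: values on the cells, and values on the Dirichlet edges.\<close>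

type_synonym 'a dvec = "('a set \<Rightarrow> real) \<times> ('a set \<Rightarrow> real)"

definition nbval ::
    "'a::euclidean_space set \<Rightarrow> 'a set \<Rightarrow> 'a mesh \<Rightarrow> 'a dvec \<Rightarrow> 'a set \<Rightarrow> 'a set \<Rightarrow> real" where
  "nbval \<Omega> \<Gamma>D \<M> u K \<sigma> =
     (if \<sigma> \<in> int_edges \<M> then fst u (neighbour \<M> K \<sigma>)
      else if \<sigma> \<in> dirichlet_edges \<Omega> \<Gamma>D \<M> then snd u \<sigma>
      else fst u K)"

definition Ddiff ::
    "'a::euclidean_space set \<Rightarrow> 'a set \<Rightarrow> 'a mesh \<Rightarrow> 'a dvec \<Rightarrow> 'a set \<Rightarrow> 'a set \<Rightarrow> real" where
  "Ddiff \<Omega> \<Gamma>D \<M> u K \<sigma> = nbval \<Omega> \<Gamma>D \<M> u K \<sigma> - fst u K"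

definition Dabs ::
    "'a::euclidean_space set \<Rightarrow> 'a set \<Rightarrow> 'a mesh \<Rightarrow> 'a dvec \<Rightarrow> 'a set \<Rightarrow> real" where
  "Dabs \<Omega> \<Gamma>D \<M> u \<sigma> = \<bar>Ddiff \<Omega> \<Gamma>D \<M> u (side \<M> \<sigma>) \<sigma>\<bar>"

definition bernoulli_fun :: "real \<Rightarrow> real" where
  "bernoulli_fun x = (if x = 0 then 1 else x / (exp x - 1))"

definition flux_N ::
    "'a::euclidean_space set \<Rightarrow> 'a set \<Rightarrow> 'a mesh \<Rightarrow> 'a dvec \<Rightarrow> 'a dvec \<Rightarrow> 'a set \<Rightarrow> 'a set \<Rightarrow> real" where
  "flux_N \<Omega> \<Gamma>D \<M> N \<Psi> K \<sigma> = transm \<M> \<sigma> *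
     (bernoulli_fun (- Ddiff \<Omega> \<Gamma>D \<M> \<Psi> K \<sigma>) * fst N K
      - bernoulli_fun (Ddiff \<Omega> \<Gamma>D \<M> \<Psi> K \<sigma>) * nbval \<Omega> \<Gamma>D \<M> N K \<sigma>)"

definition flux_P ::
    "'a::euclidean_space set \<Rightarrow> 'a set \<Rightarrow> 'a mesh \<Rightarrow> 'a dvec \<Rightarrow> 'a dvec \<Rightarrow> 'a set \<Rightarrow> 'a set \<Rightarrow> real" where
  "flux_P \<Omega> \<Gamma>D \<M> P \<Psi> K \<sigma> = transm \<M> \<sigma> *
     (bernoulli_fun (Ddiff \<Omega> \<Gamma>D \<M> \<Psi> K \<sigma>) * fst P K
      - bernoulli_fun (- Ddiff \<Omega> \<Gamma>D \<M> \<Psi> K \<sigma>) * nbval \<Omega> \<Gamma>D \<M> P K \<sigma>)"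

text \<open>Solutions up to time level \<open>NT\<close>. For \<open>lam = 0\<close> the Poisson equation reduces to
  \<open>P = N\<close> on every cell, and half the sum and the difference of the equations for N and P are the
  two equations of the quasi-neutral scheme.\<close>

definition scheme_solution ::
    "'a::euclidean_space set \<Rightarrow> 'a set \<Rightarrow> ('a \<Rightarrow> real) \<Rightarrow> ('a \<Rightarrow> real) \<Rightarrow>
     ('a \<Rightarrow> real) \<Rightarrow> ('a \<Rightarrow> real) \<Rightarrow> ('a \<Rightarrow> real) \<Rightarrow> 'a mesh \<Rightarrow> real \<Rightarrow> real \<Rightarrow> nat \<Rightarrow>
     (nat \<Rightarrow> 'a dvec) \<Rightarrow> (nat \<Rightarrow> 'a dvec) \<Rightarrow> (nat \<Rightarrow> 'a dvec) \<Rightarrow> bool" where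
  "scheme_solution \<Omega> \<Gamma>D N0 P0 ND PD \<Psi>D \<M> \<Delta>t lam NT N P \<Psi> \<longleftrightarrow>
     (\<forall>K\<in>cells \<M>.
        fst (N 0) K = integral\<^sup>L (lebesgue_on K) N0 / measure lebesgue K \<and>
        fst (P 0) K = integral\<^sup>L (lebesgue_on K) P0 / measure lebesgue K) \<and>
     (\<forall>n\<le>NT. \<forall>K\<in>cells \<M>. \<forall>\<sigma>\<in>cell_edges \<M> K \<inter> dirichlet_edges \<Omega> \<Gamma>D \<M>.
        trace_mean K \<sigma> ND (snd (N n) \<sigma>) \<and>
        trace_mean K \<sigma> PD (snd (P n) \<sigma>) \<and>
        trace_mean K \<sigma> \<Psi>D (snd (\<Psi> n) \<sigma>)) \<and>
     (\<forall>n<NT. \<forall>K\<in>cells \<M>.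
        measure lebesgue K * ((fst (N (Suc n)) K - fst (N n) K) / \<Delta>t)
          + (\<Sum>\<sigma>\<in>cell_edges \<M> K. flux_N \<Omega> \<Gamma>D \<M> (N (Suc n)) (\<Psi> (Suc n)) K \<sigma>) = 0 \<and>
        measure lebesgue K * ((fst (P (Suc n)) K - fst (P n) K) / \<Delta>t)
          + (\<Sum>\<sigma>\<in>cell_edges \<M> K. flux_P \<Omega> \<Gamma>D \<M> (P (Suc n)) (\<Psi> (Suc n)) K \<sigma>) = 0) \<and>
     (\<forall>n\<le>NT. \<forall>K\<in>cells \<M>.
        - (lam\<^sup>2) * (\<Sum>\<sigma>\<in>cell_edges \<M> K. transm \<M> \<sigma> * Ddiff \<Omega> \<Gamma>D \<M> (\<Psi> n) K \<sigma>)
          = measure lebesgue K * (fst (P n) K - fst (N n) K))"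

end

theory Submission
  imports Defs
begin

text \<open>A discrete maximum principle keeps N and P between m and M. Convexity of the relative entropy of
  (N, P) with respect to the boundary data, together with the Poisson equation, then bounds the
  dissipation, which is a sum over the edges of the squared differences of the quasi-Fermi potentials
  \<open>ln N - \<Psi>\<close> and \<open>ln P + \<Psi>\<close>. Testing the two evolution equations with N and P minus the boundary data
  gives the sum of \<open>(B(D\<Psi>) + B(-D\<Psi>)) / 2 \<cdot> ((DN)\<^sup>2 + (DP)\<^sup>2)\<close> up to a drift term with a
  sign by the Poisson equation and terms controlled by the dissipation;
  the weight is at least 1 and at least \<open>\<bar>D\<Psi>\<bar> / 2\<close>, whence the first two estimates, and \<open>D\<Psi>\<close> is then read off
  from the quasi-Fermi potentials.

  All this requires a discrete \<open>H\<^sup>1\<close> bound for the boundary data. They are discretised by their means over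
  balls contained in the cells. The divergence theorem on a cone compares the mean over an edge with
  the mean over the cone, and a Poincare inequality on the segments joining the two sets compares
  the latter with the mean over a ball; mollification replaces a density theorem. Only segments inside \<open>\<Omega>\<close> occur, so
  that no regularity of \<open>\<Omega>\<close> is needed.\<close>

section \<open>Integration over hyperplanes and cones\<close>

text \<open>The bound has to survive lam = 0, where the Poisson equation no longer controls the
  potential. Control of \<open>\<Psi>\<close> therefore passes through the quasi-Fermi potentials:
  the entropy contains lam^2 times the electrostatic energy, but its dissipation carries no lam. The
  factor 1 + lam^2 has one source, the electrostatic energy at time 0, which P0 = N0 bounds by lam^2
  times that of the discretised \<open>\<Psi>D\<close>. Equality of ND and PD on the boundary lets
  one reference vector serve both densities and makes N^2 - P^2 an admissible test function in the
  Poisson equation, where it has the good sign. The constants must not see the mesh size. Comparing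
  an edge mean with a ball mean costs the distance from the centre to the hyperplane of the edge,
  and this is bounded by the \<open>edge_dist\<close> in the denominator of \<open>transm\<close>,
  so that no power of the cell diameter is left. What remains depends on the dimension, on the ratio
  of ball radius to cell diameter (from \<xi>) and on the number of edges per cell
  (\<beta>).\<close>

definition hyp_proj :: "'a::euclidean_space \<Rightarrow> real \<Rightarrow> 'a \<Rightarrow> 'a" where
  "hyp_proj \<nu> c x = x - (\<nu> \<bullet> x - c) *\<^sub>R \<nu>"

text \<open>The Borel version of \<open>hyperplane_lebesgue\<close>, which is its completion. Fubini
  and changes of variables are carried out on this measure.\<close>

definition hyp_borel :: "'a::euclidean_space \<Rightarrow> real \<Rightarrow> 'a measure" where
  "hyp_borel \<nu> c = distr (restrict_space lborel {x. c \<le> \<nu> \<bullet> x \<and> \<nu> \<bullet> x \<le> c + 1}) borel (hyp_proj \<nu> c)"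

lemma hyperplane_lebesgue_eq: "hyperplane_lebesgue \<nu> c = completion (hyp_borel \<nu> c)"
  unfolding hyperplane_lebesgue_def hyp_borel_def hyp_proj_def ..

lemma hyp_proj_measurable [measurable]: "hyp_proj \<nu> c \<in> borel_measurable borel"
  unfolding hyp_proj_def by measurable

lemma sets_hyp_borel [simp, measurable_cong]: "sets (hyp_borel \<nu> c) = sets borel"
  by (simp add: hyp_borel_def)

lemma space_hyp_borel [simp]: "space (hyp_borel \<nu> c) = UNIV"
  by (simp add: hyp_borel_def)

lemma inner_unit_self: "norm (\<nu>::'a::euclidean_space) = 1 \<Longrightarrow> \<nu> \<bullet> \<nu> = 1"
  by (simp add: norm_eq_1)

lemma inner_hyp_proj: "norm \<nu> = 1 \<Longrightarrow> \<nu> \<bullet> hyp_proj \<nu> c x = c"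
  by (simp add: hyp_proj_def inner_diff_right inner_unit_self)

lemma hyp_proj_id: "\<nu> \<bullet> x = c \<Longrightarrow> hyp_proj \<nu> c x = x"
  by (simp add: hyp_proj_def)

lemma hyp_proj_add_normal: "norm \<nu> = 1 \<Longrightarrow> hyp_proj \<nu> c (x + t *\<^sub>R \<nu>) = hyp_proj \<nu> c x"
  by (simp add: hyp_proj_def inner_add_right inner_unit_self algebra_simps)

lemma nn_integral_hyp_borel:
  assumes [measurable]: "f \<in> borel_measurable borel"
  shows "(\<integral>\<^sup>+p. f p \<partial>hyp_borel \<nu> c) =
    (\<integral>\<^sup>+x. f (hyp_proj \<nu> c x) * indicator {0..1} (\<nu> \<bullet> x - c) \<partial>lborel)"
proof -
  have S: "{x. c \<le> \<nu> \<bullet> x \<and> \<nu> \<bullet> x \<le> c + 1} \<inter> space lborel \<in> sets lborel"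
    by measurable
  have "(\<integral>\<^sup>+p. f p \<partial>hyp_borel \<nu> c) =
    (\<integral>\<^sup>+x. f (hyp_proj \<nu> c x) \<partial>restrict_space lborel {x. c \<le> \<nu> \<bullet> x \<and> \<nu> \<bullet> x \<le> c + 1})"
    unfolding hyp_borel_def
    by (subst nn_integral_distr) (auto intro!: measurable_restrict_space1)
  also have "\<dots> = (\<integral>\<^sup>+x. f (hyp_proj \<nu> c x) * indicator {x. c \<le> \<nu> \<bullet> x \<and> \<nu> \<bullet> x \<le> c + 1} x \<partial>lborel)"
    by (rule nn_integral_restrict_space[OF S])
  also have "\<dots> = (\<integral>\<^sup>+x. f (hyp_proj \<nu> c x) * indicator {0..1} (\<nu> \<bullet> x - c) \<partial>lborel)"
    by (intro nn_integral_cong) (auto simp: indicator_def)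
  finally show ?thesis .
qed

lemma emeasure_hyp_borel:
  assumes "A \<in> sets borel"
  shows "emeasure (hyp_borel \<nu> c) A =
    emeasure lborel {x. hyp_proj \<nu> c x \<in> A \<and> 0 \<le> \<nu> \<bullet> x - c \<and> \<nu> \<bullet> x - c \<le> 1}"
proof -
  have [measurable]: "A \<in> sets borel" by fact
  have "emeasure (hyp_borel \<nu> c) A = (\<integral>\<^sup>+p. indicator A p \<partial>hyp_borel \<nu> c)"
    using assms by simp
  also have "\<dots> = (\<integral>\<^sup>+x. indicator A (hyp_proj \<nu> c x) * indicator {0..1} (\<nu> \<bullet> x - c) \<partial>lborel)"
    by (rule nn_integral_hyp_borel) measurable
  also have "\<dots> = (\<integral>\<^sup>+x. indicator {x. hyp_proj \<nu> c x \<in> A \<and> 0 \<le> \<nu> \<bullet> x - c \<and> \<nu> \<bullet> x - c \<le> 1} x \<partial>lborel)"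
    by (intro nn_integral_cong) (auto simp: indicator_def)
  also have "\<dots> = emeasure lborel {x. hyp_proj \<nu> c x \<in> A \<and> 0 \<le> \<nu> \<bullet> x - c \<and> \<nu> \<bullet> x - c \<le> 1}"
    by (rule nn_integral_indicator) measurable
  finally show ?thesis .
qed

lemma nn_integral_lborel_shift:
  fixes a :: "'a::euclidean_space"
  assumes [measurable]: "f \<in> borel_measurable borel"
  shows "(\<integral>\<^sup>+x. f (x + a) \<partial>lborel) = (\<integral>\<^sup>+x. f x \<partial>lborel)"
proof -
  have "(\<integral>\<^sup>+x. f x \<partial>lborel) = (\<integral>\<^sup>+x. f x \<partial>distr lborel borel ((+) a))"
    by (simp add: lborel_distr_plus)
  also have "\<dots> = (\<integral>\<^sup>+x. f (a + x) \<partial>lborel)"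
    by (subst nn_integral_distr) auto
  finally show ?thesis by (simp add: add.commute)
qed

lemma nn_integral_lborel_scale:
  fixes z :: "'a::euclidean_space"
  assumes [measurable]: "f \<in> borel_measurable borel" and "c \<noteq> 0"
  shows "(\<integral>\<^sup>+x. f x \<partial>lborel) = ennreal (\<bar>c\<bar> ^ DIM('a)) * (\<integral>\<^sup>+x. f (z + c *\<^sub>R x) \<partial>lborel)"
  by (subst lborel_affine[OF assms(2), of z])
     (simp add: nn_integral_density nn_integral_distr nn_integral_cmult)

text \<open>Integrating \<open>1\<^bsub>slab\<^esub>(y - \<tau>\<nu>) f(y)\<close> over \<open>y\<close> and \<open>\<tau>\<close> in both orders: translation invariance
  replaces a decomposition of the space as a product.\<close>

lemma nn_integral_slices:
  fixes f :: "'a::euclidean_space \<Rightarrow> ennreal"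
  assumes [measurable]: "f \<in> borel_measurable borel" and \<nu>: "norm \<nu> = 1"
    and [measurable]: "\<psi> \<in> borel_measurable borel" and \<psi>: "(\<integral>\<^sup>+t. \<psi> t \<partial>lborel) = 1"
  shows "(\<integral>\<^sup>+y. (\<integral>\<^sup>+t. f (hyp_proj \<nu> c y + t *\<^sub>R \<nu>) \<partial>lborel) * \<psi> (\<nu> \<bullet> y - c) \<partial>lborel) =
    (\<integral>\<^sup>+x. f x \<partial>lborel)"
proof -
  \<comment> \<open>\<open>hyp_proj\<close> displaces \<open>y\<close> along \<open>\<nu>\<close>
    only, and the integral over all \<open>t\<close> absorbs such a displacement.\<close>
  have inner: "(\<integral>\<^sup>+t. f (hyp_proj \<nu> c y + t *\<^sub>R \<nu>) \<partial>lborel) = (\<integral>\<^sup>+t. f (y + t *\<^sub>R \<nu>) \<partial>lborel)" for y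
  proof -
    have "(\<integral>\<^sup>+t. f (hyp_proj \<nu> c y + t *\<^sub>R \<nu>) \<partial>lborel) =
      (\<integral>\<^sup>+t. f (hyp_proj \<nu> c y + (t + (\<nu> \<bullet> y - c)) *\<^sub>R \<nu>) \<partial>lborel)"
      by (rule nn_integral_lborel_shift[symmetric]) measurable
    then show ?thesis by (simp add: hyp_proj_def algebra_simps)
  qed
  have "(\<integral>\<^sup>+y. (\<integral>\<^sup>+t. f (hyp_proj \<nu> c y + t *\<^sub>R \<nu>) \<partial>lborel) * \<psi> (\<nu> \<bullet> y - c) \<partial>lborel)
    = (\<integral>\<^sup>+y. (\<integral>\<^sup>+t. f (y + t *\<^sub>R \<nu>) * \<psi> (\<nu> \<bullet> y - c) \<partial>lborel) \<partial>lborel)"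
    unfolding inner by (intro nn_integral_cong nn_integral_multc[symmetric]) measurable
  also have "\<dots> = (\<integral>\<^sup>+t. (\<integral>\<^sup>+y. f (y + t *\<^sub>R \<nu>) * \<psi> (\<nu> \<bullet> y - c) \<partial>lborel) \<partial>lborel)"
    by (rule lborel_pair.Fubini') measurable
  also have "\<dots> = (\<integral>\<^sup>+t. (\<integral>\<^sup>+y. f y * \<psi> (\<nu> \<bullet> y - c + - t) \<partial>lborel) \<partial>lborel)"
  proof (rule nn_integral_cong)
    fix t :: real
    have "(\<integral>\<^sup>+y. f y * \<psi> (\<nu> \<bullet> y - c + - t) \<partial>lborel) =
      (\<integral>\<^sup>+y. f (y + t *\<^sub>R \<nu>) * \<psi> (\<nu> \<bullet> (y + t *\<^sub>R \<nu>) - c + - t) \<partial>lborel)"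
      by (rule nn_integral_lborel_shift[where f="\<lambda>y. f y * \<psi> (\<nu> \<bullet> y - c + - t)" and a="t *\<^sub>R \<nu>", symmetric]) measurable
    then show "(\<integral>\<^sup>+y. f (y + t *\<^sub>R \<nu>) * \<psi> (\<nu> \<bullet> y - c) \<partial>lborel) =
       (\<integral>\<^sup>+y. f y * \<psi> (\<nu> \<bullet> y - c + - t) \<partial>lborel)"
      using \<nu> by (simp add: inner_add_right inner_unit_self)
  qed
  also have "\<dots> = (\<integral>\<^sup>+y. (\<integral>\<^sup>+t. f y * \<psi> (\<nu> \<bullet> y - c + - t) \<partial>lborel) \<partial>lborel)"
    by (rule lborel_pair.Fubini'[symmetric]) measurable
  also have "\<dots> = (\<integral>\<^sup>+y. f y \<partial>lborel)"
  proof (intro nn_integral_cong)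
    fix y :: 'a
    have "(\<integral>\<^sup>+t. f y * \<psi> (\<nu> \<bullet> y - c + - t) \<partial>lborel) = f y * (\<integral>\<^sup>+t. \<psi> ((\<nu> \<bullet> y - c) + (-1) * t) \<partial>lborel)"
      by (subst nn_integral_cmult[symmetric]) auto
    also have "(\<integral>\<^sup>+t. \<psi> ((\<nu> \<bullet> y - c) + (-1) * t) \<partial>lborel) = 1"
      using nn_integral_real_affine[of \<psi> "-1" "\<nu> \<bullet> y - c"] \<psi> by simp
    finally show "(\<integral>\<^sup>+t. f y * \<psi> (\<nu> \<bullet> y - c + - t) \<partial>lborel) = f y" by simp
  qed
  finally show ?thesis .
qed

text \<open>Fubini for a hyperplane and its normal direction: the unit slab in
  \<open>hyp_borel\<close> is one choice of the profile \<open>\<psi>\<close> of total mass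
  1.\<close>

lemma nn_integral_hyp_slices:
  fixes f :: "'a::euclidean_space \<Rightarrow> ennreal"
  assumes [measurable]: "f \<in> borel_measurable borel" and \<nu>: "norm \<nu> = 1"
  shows "(\<integral>\<^sup>+p. (\<integral>\<^sup>+t. f (p + t *\<^sub>R \<nu>) \<partial>lborel) \<partial>hyp_borel \<nu> c) = (\<integral>\<^sup>+x. f x \<partial>lborel)"
  by (subst nn_integral_hyp_borel, measurable)
     (rule nn_integral_slices[OF assms], auto)

text \<open>The unit thickness of the slab in \<open>hyp_borel\<close> is arbitrary, because a
  profile across the hyperplane contributes only its total mass. A dilation changes the thickness,
  which is why \<open>nn_integral_hyp_scale\<close> rests on this.\<close>

lemma nn_integral_hyp_borel_weight:
  fixes g :: "'a::euclidean_space \<Rightarrow> ennreal"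
  assumes [measurable]: "g \<in> borel_measurable borel" and \<nu>: "norm \<nu> = 1"
    and [measurable]: "\<psi> \<in> borel_measurable borel" 
  shows "(\<integral>\<^sup>+y. g (hyp_proj \<nu> c y) * \<psi> (\<nu> \<bullet> y - c) \<partial>lborel) =
    (\<integral>\<^sup>+t. \<psi> t \<partial>lborel) * (\<integral>\<^sup>+p. g p \<partial>hyp_borel \<nu> c)"
proof -
  let ?f = "\<lambda>x. g (hyp_proj \<nu> c x) * \<psi> (\<nu> \<bullet> x - c)"
  have "(\<integral>\<^sup>+x. ?f x \<partial>lborel) = (\<integral>\<^sup>+y. (\<integral>\<^sup>+t. ?f (hyp_proj \<nu> c y + t *\<^sub>R \<nu>) \<partial>lborel) * indicator {0..1} (\<nu> \<bullet> y - c) \<partial>lborel)"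
    by (rule nn_integral_slices[symmetric, OF _ \<nu>]) auto
  also have "\<dots> = (\<integral>\<^sup>+y. (\<integral>\<^sup>+t. \<psi> t \<partial>lborel) * (g (hyp_proj \<nu> c y) * indicator {0..1} (\<nu> \<bullet> y - c)) \<partial>lborel)"
  proof (intro nn_integral_cong)
    fix y :: 'a
    have "(\<integral>\<^sup>+t. ?f (hyp_proj \<nu> c y + t *\<^sub>R \<nu>) \<partial>lborel) = (\<integral>\<^sup>+t. g (hyp_proj \<nu> c y) * \<psi> t \<partial>lborel)"
      using \<nu> by (intro nn_integral_cong)
        (simp add: hyp_proj_add_normal hyp_proj_id inner_hyp_proj inner_add_right inner_unit_self)
    also have "\<dots> = g (hyp_proj \<nu> c y) * (\<integral>\<^sup>+t. \<psi> t \<partial>lborel)"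
      by (rule nn_integral_cmult) measurable
    finally show "(\<integral>\<^sup>+t. ?f (hyp_proj \<nu> c y + t *\<^sub>R \<nu>) \<partial>lborel) * indicator {0..1} (\<nu> \<bullet> y - c) =
       (\<integral>\<^sup>+t. \<psi> t \<partial>lborel) * (g (hyp_proj \<nu> c y) * indicator {0..1} (\<nu> \<bullet> y - c))"
      by (simp add: ac_simps)
  qed
  also have "\<dots> = (\<integral>\<^sup>+t. \<psi> t \<partial>lborel) * (\<integral>\<^sup>+y. g (hyp_proj \<nu> c y) * indicator {0..1} (\<nu> \<bullet> y - c) \<partial>lborel)"
    by (rule nn_integral_cmult) measurable
  finally show ?thesis by (simp add: nn_integral_hyp_borel)
qed

text \<open>Dilating the whole space about \<open>z\<close> gives the full power of
  \<open>\<bar>t\<bar>\<close>; the slab profile becomes \<open>?I (t * s)\<close>, whose mass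
  \<open>1 / \<bar>t\<bar>\<close> removes one power.\<close>

lemma nn_integral_hyp_scale:
  fixes g :: "'a::euclidean_space \<Rightarrow> ennreal"
  assumes [measurable]: "g \<in> borel_measurable borel" and \<nu>: "norm \<nu> = 1"
    and z: "\<nu> \<bullet> z = c" and t: "t \<noteq> 0"
  shows "(\<integral>\<^sup>+p. g p \<partial>hyp_borel \<nu> c) =
    ennreal (\<bar>t\<bar> ^ (DIM('a) - 1)) * (\<integral>\<^sup>+q. g (z + t *\<^sub>R (q - z)) \<partial>hyp_borel \<nu> c)"
proof -
  let ?I = "indicator {0..1} :: real \<Rightarrow> ennreal"
  have at: "ennreal \<bar>t\<bar> * (\<integral>\<^sup>+s. ?I (0 + t * s) \<partial>lborel) = 1"
    by (subst nn_integral_real_affine[symmetric]) (use t in auto)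
  define J where "J = (\<integral>\<^sup>+q. g (z + t *\<^sub>R (q - z)) \<partial>hyp_borel \<nu> c)"
  have "(\<integral>\<^sup>+p. g p \<partial>hyp_borel \<nu> c) = (\<integral>\<^sup>+x. g (hyp_proj \<nu> c x) * ?I (\<nu> \<bullet> x - c) \<partial>lborel)"
    by (rule nn_integral_hyp_borel) measurable
  also have "\<dots> = ennreal (\<bar>t\<bar> ^ DIM('a)) *
      (\<integral>\<^sup>+x. g (hyp_proj \<nu> c ((z - t *\<^sub>R z) + t *\<^sub>R x)) * ?I (\<nu> \<bullet> ((z - t *\<^sub>R z) + t *\<^sub>R x) - c) \<partial>lborel)"
    by (rule nn_integral_lborel_scale) (use t in auto)
  also have "(\<integral>\<^sup>+x. g (hyp_proj \<nu> c ((z - t *\<^sub>R z) + t *\<^sub>R x)) * ?I (\<nu> \<bullet> ((z - t *\<^sub>R z) + t *\<^sub>R x) - c) \<partial>lborel)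
    = (\<integral>\<^sup>+x. g (z + t *\<^sub>R (hyp_proj \<nu> c x - z)) * ?I (t * (\<nu> \<bullet> x - c)) \<partial>lborel)"
  proof (intro nn_integral_cong)
    fix x
    have 1: "\<nu> \<bullet> ((z - t *\<^sub>R z) + t *\<^sub>R x) - c = t * (\<nu> \<bullet> x - c)"
      using z by (simp add: inner_add_right inner_diff_right algebra_simps)
    have 2: "hyp_proj \<nu> c ((z - t *\<^sub>R z) + t *\<^sub>R x) = z + t *\<^sub>R (hyp_proj \<nu> c x - z)"
      unfolding hyp_proj_def 1 by (simp add: algebra_simps)
    show "g (hyp_proj \<nu> c ((z - t *\<^sub>R z) + t *\<^sub>R x)) * ?I (\<nu> \<bullet> ((z - t *\<^sub>R z) + t *\<^sub>R x) - c) =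
      g (z + t *\<^sub>R (hyp_proj \<nu> c x - z)) * ?I (t * (\<nu> \<bullet> x - c))" unfolding 1 2 ..
  qed
  also have "\<dots> = (\<integral>\<^sup>+s. ?I (t * s) \<partial>lborel) * J" unfolding J_def
    by (rule nn_integral_hyp_borel_weight[of "\<lambda>p. g (z + t *\<^sub>R (p - z))" \<nu> "\<lambda>s. ?I (t * s)"]) (use \<nu> in auto)
  finally have *: "(\<integral>\<^sup>+p. g p \<partial>hyp_borel \<nu> c) = ennreal (\<bar>t\<bar> ^ DIM('a)) * ((\<integral>\<^sup>+s. ?I (t * s) \<partial>lborel) * J)" .
  have "DIM('a) = Suc (DIM('a) - 1)" using DIM_positive[where 'a='a] by simp
  then have "\<bar>t\<bar> ^ DIM('a) = \<bar>t\<bar> ^ (DIM('a) - 1) * \<bar>t\<bar>" by (metis power_Suc2)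
  then have "ennreal (\<bar>t\<bar> ^ DIM('a)) = ennreal (\<bar>t\<bar> ^ (DIM('a) - 1)) * ennreal \<bar>t\<bar>"
    by (simp add: ennreal_mult)
  with * at show ?thesis unfolding J_def
    by (simp add: mult.assoc[symmetric]) (simp add: mult.assoc)
qed

lemma emeasure_hyp_borel_ball_finite:
  assumes \<nu>: "norm \<nu> = 1"
  shows "emeasure (hyp_borel \<nu> c) (ball 0 r) \<noteq> \<infinity>"
proof -
  have "{x. hyp_proj \<nu> c x \<in> ball 0 r \<and> 0 \<le> \<nu> \<bullet> x - c \<and> \<nu> \<bullet> x - c \<le> 1} \<subseteq> ball 0 (r + 1)"
  proof (clarsimp)
    fix x assume x: "norm (hyp_proj \<nu> c x) < r" "c \<le> \<nu> \<bullet> x" "\<nu> \<bullet> x - c \<le> 1"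
    have "x = hyp_proj \<nu> c x + (\<nu> \<bullet> x - c) *\<^sub>R \<nu>" by (simp add: hyp_proj_def)
    then have "norm x \<le> norm (hyp_proj \<nu> c x) + norm ((\<nu> \<bullet> x - c) *\<^sub>R \<nu>)" by (metis norm_triangle_ineq)
    then show "norm x < r + 1" using x \<nu> by simp
  qed
  from emeasure_mono[OF this, of lborel] 
  have "emeasure (hyp_borel \<nu> c) (ball 0 r) \<le> emeasure lborel (ball 0 (r+1) :: 'a set)"
    by (subst emeasure_hyp_borel) auto
  also have "\<dots> < \<infinity>" by (rule emeasure_lborel_ball_finite)
  finally show ?thesis by simp
qed

lemma sigma_finite_hyp_borel:
  assumes \<nu>: "norm \<nu> = 1"
  shows "sigma_finite_measure (hyp_borel \<nu> c)"
proof
  let ?A = "range (\<lambda>n::nat. ball 0 (real n))"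
  have "\<Union> ?A = (UNIV :: 'a set)"
    by (auto simp: reals_Archimedean2)
  then show "\<exists>A. countable A \<and> A \<subseteq> sets (hyp_borel \<nu> c) \<and> \<Union> A = space (hyp_borel \<nu> c) \<and>
    (\<forall>a\<in>A. emeasure (hyp_borel \<nu> c) a \<noteq> \<infinity>)"
    using emeasure_hyp_borel_ball_finite[OF \<nu>] by (intro exI[of _ ?A]) auto
qed

text \<open>Polar-type coordinates with apex \<open>z\<close> outside the hyperplane.\<close>

lemma nn_integral_cone:
  fixes f :: "'a::euclidean_space \<Rightarrow> ennreal"
  assumes [measurable]: "f \<in> borel_measurable borel" and \<nu>: "norm \<nu> = 1" and z: "\<nu> \<bullet> z \<noteq> c"
  shows "(\<integral>\<^sup>+x. f x \<partial>lborel) = (\<integral>\<^sup>+t. ennreal (\<bar>c - \<nu> \<bullet> z\<bar> * \<bar>t\<bar> ^ (DIM('a) - 1)) *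
     (\<integral>\<^sup>+q. f (z + t *\<^sub>R (q - z)) \<partial>hyp_borel \<nu> c) \<partial>lborel)"
proof -
  define e where "e = c - \<nu> \<bullet> z"
  have e: "e \<noteq> 0" using z by (simp add: e_def)
  interpret H: sigma_finite_measure "hyp_borel \<nu> c" by (rule sigma_finite_hyp_borel[OF \<nu>])
  interpret P: pair_sigma_finite "lborel :: real measure" "hyp_borel \<nu> c" ..
  \<comment> \<open>The foot of the perpendicular from the apex, used as the centre of dilations
    inside the hyperplane.\<close>
  define z0 where "z0 = z + e *\<^sub>R \<nu>"
  have z0: "\<nu> \<bullet> z0 = c" using \<nu> by (simp add: z0_def inner_add_right inner_unit_self e_def)
  have "(\<integral>\<^sup>+x. f x \<partial>lborel) = (\<integral>\<^sup>+p. (\<integral>\<^sup>+t. f (p + t *\<^sub>R \<nu>) \<partial>lborel) \<partial>hyp_borel \<nu> c)"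
    by (rule nn_integral_hyp_slices[symmetric]) (use \<nu> in auto)
  also have "\<dots> = (\<integral>\<^sup>+t. (\<integral>\<^sup>+p. f (p + t *\<^sub>R \<nu>) \<partial>hyp_borel \<nu> c) \<partial>lborel)"
    by (rule P.Fubini') measurable
  \<comment> \<open>The height \<open>- e + e * t\<close> runs from the apex at \<open>t = 0\<close>
    to the hyperplane at \<open>t = 1\<close>. Negative \<open>t\<close> gives the opposite half of
    the double cone, hence the absolute values.\<close>
  also have "\<dots> = ennreal \<bar>e\<bar> * (\<integral>\<^sup>+t. (\<integral>\<^sup>+p. f (p + (- e + e * t) *\<^sub>R \<nu>) \<partial>hyp_borel \<nu> c) \<partial>lborel)"
    by (rule nn_integral_real_affine) (use e in measurable)
  also have "\<dots> = (\<integral>\<^sup>+t. ennreal \<bar>e\<bar> * (\<integral>\<^sup>+p. f (p + (- e + e * t) *\<^sub>R \<nu>) \<partial>hyp_borel \<nu> c) \<partial>lborel)"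
    by (rule nn_integral_cmult[symmetric]) measurable
  also have "\<dots> = (\<integral>\<^sup>+t. ennreal (\<bar>e\<bar> * \<bar>t\<bar> ^ (DIM('a) - 1)) *
     (\<integral>\<^sup>+q. f (z + t *\<^sub>R (q - z)) \<partial>hyp_borel \<nu> c) \<partial>lborel)"
  proof (intro nn_integral_cong_AE)
    have "AE t in lborel. t \<noteq> (0::real)" by (rule AE_lborel_singleton)
    then show "AE t in lborel. ennreal \<bar>e\<bar> * (\<integral>\<^sup>+p. f (p + (- e + e * t) *\<^sub>R \<nu>) \<partial>hyp_borel \<nu> c) =
      ennreal (\<bar>e\<bar> * \<bar>t\<bar> ^ (DIM('a) - 1)) * (\<integral>\<^sup>+q. f (z + t *\<^sub>R (q - z)) \<partial>hyp_borel \<nu> c)"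
    proof eventually_elim
      fix t :: real assume t: "t \<noteq> 0"
      have "(\<integral>\<^sup>+p. f (p + (- e + e * t) *\<^sub>R \<nu>) \<partial>hyp_borel \<nu> c) = ennreal (\<bar>t\<bar> ^ (DIM('a) - 1)) *
        (\<integral>\<^sup>+q. f (z0 + t *\<^sub>R (q - z0) + (- e + e * t) *\<^sub>R \<nu>) \<partial>hyp_borel \<nu> c)"
        by (rule nn_integral_hyp_scale[OF _ \<nu> z0 t]) measurable
      also have "(\<lambda>q. z0 + t *\<^sub>R (q - z0) + (- e + e * t) *\<^sub>R \<nu>) = (\<lambda>q. z + t *\<^sub>R (q - z))"
        by (simp add: z0_def algebra_simps)
      finally show "ennreal \<bar>e\<bar> * (\<integral>\<^sup>+p. f (p + (- e + e * t) *\<^sub>R \<nu>) \<partial>hyp_borel \<nu> c) =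
        ennreal (\<bar>e\<bar> * \<bar>t\<bar> ^ (DIM('a) - 1)) * (\<integral>\<^sup>+q. f (z + t *\<^sub>R (q - z)) \<partial>hyp_borel \<nu> c)"
        by (simp add: ennreal_mult mult.assoc)
    qed
  qed
  finally show ?thesis by (simp add: e_def)
qed

text \<open>Fixes the hyperplane that the choice in \<open>surf\<close> selects. It depends on the
  set alone, so the two cells at an interior edge work with the same \<open>\<nu>\<close> and
  \<open>c\<close>.\<close>

lemma surf_flat:
  assumes "flat A"
  obtains \<nu> c where "norm \<nu> = 1" "A \<subseteq> {x. \<nu> \<bullet> x = c}" "surf A = completion (hyp_borel \<nu> c)"
proof -
  let ?P = "\<lambda>(\<nu>, c). norm \<nu> = 1 \<and> A \<subseteq> {x. \<nu> \<bullet> x = c}"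
  obtain \<nu> c where s: "(SOME p. ?P p) = (\<nu>, c)" by (cases "SOME p. ?P p")
  have "\<exists>p. ?P p" using assms by (auto simp: flat_def)
  then have "?P (SOME p. ?P p)" by (rule someI_ex)
  then show ?thesis using that[of \<nu> c] by (simp add: s surf_def hyperplane_lebesgue_eq)
qed

lemma emeasure_hyp_borel_bounded:
  assumes "norm \<nu> = 1" "bounded A"
  shows "emeasure (hyp_borel \<nu> c) A < \<infinity>"
proof -
  obtain r where "A \<subseteq> ball 0 r" using assms(2) bounded_subset_ballD by blast
  then have "emeasure (hyp_borel \<nu> c) A \<le> emeasure (hyp_borel \<nu> c) (ball 0 r)"
    by (intro emeasure_mono) auto
  also have "\<dots> < \<infinity>" using emeasure_hyp_borel_ball_finite[OF assms(1)] by (simp add: top.not_eq_extremum)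
  finally show ?thesis .
qed

lemma AE_hyp_borel: "norm \<nu> = 1 \<Longrightarrow> AE q in hyp_borel \<nu> c. \<nu> \<bullet> q = c"
  unfolding hyp_borel_def
  by (subst AE_distr_iff) (auto simp: inner_hyp_proj intro!: measurable_restrict_space1)

text \<open>Applied to indicators, \<open>nn_integral_cone\<close> says that \<open>lborel\<close>
  is the image under \<open>\<Theta>\<close> of a weighted product measure. Integrability then
  transfers to the product, and Fubini applies to signed functions.\<close>

lemma integral_cone:
  fixes f :: "'a::euclidean_space \<Rightarrow> real"
  assumes f: "integrable lborel f" and \<nu>: "norm \<nu> = 1" and z: "\<nu> \<bullet> z \<noteq> c"
  shows "(\<integral>x. f x \<partial>lborel) =
    (\<integral>q. (\<integral>t. \<bar>c - \<nu> \<bullet> z\<bar> * \<bar>t\<bar> ^ (DIM('a) - 1) * f (z + t *\<^sub>R (q - z)) \<partial>lborel) \<partial>hyp_borel \<nu> c)"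
proof -
  interpret H: sigma_finite_measure "hyp_borel \<nu> c" by (rule sigma_finite_hyp_borel[OF \<nu>])
  interpret P: pair_sigma_finite "lborel :: real measure" "hyp_borel \<nu> c" ..
  define J where "J = (\<lambda>t::real. \<bar>c - \<nu> \<bullet> z\<bar> * \<bar>t\<bar> ^ (DIM('a) - 1))"
  define M where "M = density (lborel \<Otimes>\<^sub>M hyp_borel \<nu> c) (\<lambda>p. ennreal (J (fst p)))"
  define \<Theta> where "\<Theta> = (\<lambda>p. z + fst p *\<^sub>R (snd p - z))"
  have [measurable]: "\<Theta> \<in> borel_measurable (lborel \<Otimes>\<^sub>M hyp_borel \<nu> c)" "J \<in> borel_measurable borel"
    unfolding \<Theta>_def J_def by measurable
  have [measurable]: "f \<in> borel_measurable borel" using f by simp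
  have "distr M borel \<Theta> = lborel"
  proof (rule measure_eqI)
    fix A assume "A \<in> sets (distr M borel \<Theta>)"
    then have [measurable]: "A \<in> sets borel" by simp
    have "emeasure (distr M borel \<Theta>) A = (\<integral>\<^sup>+x. indicator A x \<partial>distr M borel \<Theta>)" by simp
    also have "\<dots> = (\<integral>\<^sup>+p. ennreal (J (fst p)) * indicator A (\<Theta> p) \<partial>(lborel \<Otimes>\<^sub>M hyp_borel \<nu> c))"
      unfolding M_def by (subst nn_integral_distr) (auto simp: nn_integral_density)
    also have "\<dots> = (\<integral>\<^sup>+t. \<integral>\<^sup>+q. ennreal (J t) * indicator A (z + t *\<^sub>R (q - z)) \<partial>hyp_borel \<nu> c \<partial>lborel)"
      by (subst H.nn_integral_fst[symmetric]) (auto simp: \<Theta>_def)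
    also have "\<dots> = (\<integral>\<^sup>+t. ennreal (J t) * \<integral>\<^sup>+q. indicator A (z + t *\<^sub>R (q - z)) \<partial>hyp_borel \<nu> c \<partial>lborel)"
      by (intro nn_integral_cong nn_integral_cmult) measurable
    also have "\<dots> = (\<integral>\<^sup>+x. indicator A x \<partial>lborel)"
      unfolding J_def by (rule nn_integral_cone[symmetric, OF _ \<nu> z]) measurable
    finally show "emeasure (distr M borel \<Theta>) A = emeasure lborel A" by simp
  qed simp
  note eq = this
  have f': "integrable (distr M borel \<Theta>) f" unfolding eq by (rule f)
  have int: "integrable (lborel \<Otimes>\<^sub>M hyp_borel \<nu> c) (\<lambda>p. J (fst p) * f (\<Theta> p))"
    using f' unfolding M_def
    by (subst (asm) integrable_distr_eq, simp, simp, subst (asm) integrable_density) (auto simp: J_def)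
  have "(\<integral>x. f x \<partial>lborel) = (\<integral>x. f x \<partial>distr M borel \<Theta>)" unfolding eq ..
  also have "\<dots> = (\<integral>p. J (fst p) * f (\<Theta> p) \<partial>(lborel \<Otimes>\<^sub>M hyp_borel \<nu> c))"
    unfolding M_def by (subst integral_distr, simp, simp, subst integral_density) (auto simp: J_def)
  also have "\<dots> = (\<integral>q. (\<integral>t. J t * f (z + t *\<^sub>R (q - z)) \<partial>lborel) \<partial>hyp_borel \<nu> c)"
    using P.integral_snd[of "\<lambda>t q. J t * f (z + t *\<^sub>R (q - z))"] int
    by (simp add: \<Theta>_def case_prod_beta')
  finally show ?thesis by (simp add: J_def)
qed

section \<open>Cones over flat sets and the divergence theorem on them\<close>

definition open_cone :: "'a::euclidean_space \<Rightarrow> 'a set \<Rightarrow> 'a set" where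
  "open_cone z A = {z + t *\<^sub>R (q - z) |t q. q \<in> A \<and> 0 < t \<and> t < 1}"

text \<open>The parameter \<open>t\<close> of the point \<open>z + t(q - z)\<close>, for \<open>q\<close> in the hyperplane \<open>\<nu> \<bullet> x = c\<close>.\<close>

definition cone_par :: "'a::euclidean_space \<Rightarrow> real \<Rightarrow> 'a \<Rightarrow> 'a \<Rightarrow> real" where
  "cone_par \<nu> c z x = \<nu> \<bullet> (x - z) / (c - \<nu> \<bullet> z)"

lemma cone_par_ray:
  assumes "\<nu> \<bullet> q = c" "\<nu> \<bullet> z \<noteq> c"
  shows "cone_par \<nu> c z (z + t *\<^sub>R (q - z)) = t"
  using assms by (simp add: cone_par_def inner_diff_right)

lemma mem_open_cone_ray:
  assumes "A \<subseteq> {x. \<nu> \<bullet> x = c}" "\<nu> \<bullet> q = c" "\<nu> \<bullet> z \<noteq> c" "t \<noteq> 0"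
  shows "z + t *\<^sub>R (q - z) \<in> open_cone z A \<longleftrightarrow> 0 < t \<and> t < 1 \<and> q \<in> A"
proof
  assume "z + t *\<^sub>R (q - z) \<in> open_cone z A"
  then obtain s p where sp: "z + t *\<^sub>R (q - z) = z + s *\<^sub>R (p - z)" "p \<in> A" "0 < s" "s < 1"
    by (auto simp: open_cone_def)
  have "\<nu> \<bullet> p = c" using sp(2) assms(1) by blast
  then have "t = s"
    using cone_par_ray[OF assms(2,3), of t] cone_par_ray[of \<nu> p c z s] sp(1) assms(3) by simp
  moreover from this have "q = p" using sp(1) assms(4) by simp
  ultimately show "0 < t \<and> t < 1 \<and> q \<in> A" using sp by simp
qed (auto simp: open_cone_def)

text \<open>Solving for the parameter turns membership into a Borel condition and exhibits the
  parameter as a number strictly between 0 and 1 on the cone.\<close>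

lemma open_cone_eq:
  assumes "A \<subseteq> {x. \<nu> \<bullet> x = c}" "\<nu> \<bullet> z \<noteq> c"
  shows "open_cone z A = {x. 0 < cone_par \<nu> c z x \<and> cone_par \<nu> c z x < 1 \<and>
    z + (1 / cone_par \<nu> c z x) *\<^sub>R (x - z) \<in> A}"
proof (intro equalityI subsetI)
  fix x assume "x \<in> open_cone z A"
  then obtain s p where sp: "x = z + s *\<^sub>R (p - z)" "p \<in> A" "0 < s" "s < 1"
    by (auto simp: open_cone_def)
  moreover from this have "\<nu> \<bullet> p = c" using assms(1) by blast
  ultimately have "cone_par \<nu> c z x = s" using assms(2) cone_par_ray[of \<nu> p c z s] by simp
  with sp show "x \<in> {x. 0 < cone_par \<nu> c z x \<and> cone_par \<nu> c z x < 1 \<and>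
    z + (1 / cone_par \<nu> c z x) *\<^sub>R (x - z) \<in> A}" by simp
next
  fix x assume x: "x \<in> {x. 0 < cone_par \<nu> c z x \<and> cone_par \<nu> c z x < 1 \<and>
    z + (1 / cone_par \<nu> c z x) *\<^sub>R (x - z) \<in> A}"
  define t where "t = cone_par \<nu> c z x"
  have "x = z + t *\<^sub>R ((z + (1 / t) *\<^sub>R (x - z)) - z)" using x by (simp add: t_def)
  with x show "x \<in> open_cone z A" unfolding open_cone_def t_def by blast
qed

lemma cone_par_measurable [measurable]: "cone_par \<nu> c z \<in> borel_measurable borel"
  unfolding cone_par_def by measurable

lemma open_cone_borel:
  assumes "A \<subseteq> {x. \<nu> \<bullet> x = c}" "\<nu> \<bullet> z \<noteq> c" and [measurable]: "A \<in> sets borel"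
  shows "open_cone z A \<in> sets borel"
  unfolding open_cone_eq[OF assms(1,2)] by measurable

lemma open_cone_subset_cball:
  assumes "\<And>q. q \<in> A \<Longrightarrow> dist z q \<le> R"
  shows "open_cone z A \<subseteq> cball z R"
proof
  fix x assume "x \<in> open_cone z A"
  then obtain s p where sp: "x = z + s *\<^sub>R (p - z)" "p \<in> A" "0 < s" "s < 1"
    by (auto simp: open_cone_def)
  have "dist z x = s * norm (p - z)" using sp by (simp add: dist_norm)
  also have "\<dots> \<le> norm (p - z)" using sp by (simp add: mult_left_le_one_le)
  also have "\<dots> \<le> R" using assms[OF sp(2)] by (simp add: dist_norm norm_minus_commute)
  finally show "x \<in> cball z R" by simp
qed

lemma C1_gradient_continuous:
  assumes "C1_gradient \<phi> D\<phi>"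
  shows "continuous_on UNIV \<phi>" "continuous_on UNIV D\<phi>"
  using assms unfolding C1_gradient_def gderiv_def
  by (auto intro!: continuous_at_imp_continuous_on intro: has_derivative_continuous)

lemma C1_gradient_ray:
  assumes "C1_gradient \<phi> D\<phi>"
  shows "((\<lambda>t. \<phi> (x + t *\<^sub>R v)) has_vector_derivative D\<phi> (x + t *\<^sub>R v) \<bullet> v) (at t within S)"
proof -
  have "(\<phi> has_derivative (\<lambda>h. h \<bullet> D\<phi> (x + t *\<^sub>R v))) (at (x + t *\<^sub>R v))"
    using assms by (simp add: C1_gradient_def gderiv_def)
  moreover have "((\<lambda>t. x + t *\<^sub>R v) has_derivative (\<lambda>h. h *\<^sub>R v)) (at t within S)"
    by (auto intro!: derivative_eq_intros)
  ultimately have "((\<lambda>t. \<phi> (x + t *\<^sub>R v)) has_derivative (\<lambda>h. (h *\<^sub>R v) \<bullet> D\<phi> (x + t *\<^sub>R v))) (at t within S)"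
    by (rule has_derivative_compose[rotated])
  then show ?thesis by (simp add: has_vector_derivative_def inner_commute)
qed

text \<open>The divergence theorem for \<open>\<phi>(x) t(x)\<^sup>k (x - z)\<close> on the cone of apex \<open>z\<close>, where \<open>t\<close> is the parameter
  along the rays. The field is tangential on the lateral boundary; for large \<open>k\<close> the
  volume integral concentrates near the base.\<close>

lemma cone_divergence:
  fixes \<phi> :: "'a::euclidean_space \<Rightarrow> real" and k :: nat
  assumes \<phi>: "C1_gradient \<phi> D\<phi>" and \<nu>: "norm \<nu> = 1" and z: "\<nu> \<bullet> z \<noteq> c"
    and A: "A \<in> sets borel" "bounded A" "A \<subseteq> {x. \<nu> \<bullet> x = c}"
  defines "G \<equiv> \<lambda>x. cone_par \<nu> c z x ^ k * (real (DIM('a) + k) * \<phi> x + D\<phi> x \<bullet> (x - z))"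
  shows "set_integrable lborel (open_cone z A) G"
    and "(LINT x:open_cone z A|lborel. G x) = \<bar>c - \<nu> \<bullet> z\<bar> * (LINT q:A|hyp_borel \<nu> c. \<phi> q)"
proof -
  note [measurable] = A(1) open_cone_borel[OF A(3) z A(1)]
  have cont\<phi>: "continuous_on UNIV \<phi>" "continuous_on UNIV D\<phi>"
    by (rule C1_gradient_continuous[OF \<phi>])+
  have contG: "continuous_on UNIV G"
    unfolding G_def cone_par_def by (intro continuous_intros cont\<phi>) (use z in auto)
  have "bounded (insert z A)" using A by simp
  then obtain R where R: "\<And>q. q \<in> A \<Longrightarrow> dist z q \<le> R"
    unfolding bounded_any_center[where a=z] by auto
  have "set_integrable lborel (cball z R) G"
    unfolding set_integrable_def
    by (rule borel_integrable_compact) (auto intro: continuous_on_subset[OF contG])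
  then show int: "set_integrable lborel (open_cone z A) G"
    by (rule set_integrable_subset) (use open_cone_subset_cball[OF R] in auto)
  have "(LINT x:open_cone z A|lborel. G x) =
    (\<integral>q. (\<integral>t. \<bar>c - \<nu> \<bullet> z\<bar> * \<bar>t\<bar> ^ (DIM('a) - 1) * (indicator (open_cone z A) (z + t *\<^sub>R (q - z)) *\<^sub>R G (z + t *\<^sub>R (q - z))) \<partial>lborel) \<partial>hyp_borel \<nu> c)"
    unfolding set_lebesgue_integral_def
    by (rule integral_cone[OF _ \<nu> z]) (use int in \<open>simp add: set_integrable_def\<close>)
  also have "\<dots> = (\<integral>q. \<bar>c - \<nu> \<bullet> z\<bar> * (indicator A q *\<^sub>R \<phi> q) \<partial>hyp_borel \<nu> c)"
  proof (rule integral_cong_AE)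
    have [measurable]: "G \<in> borel_measurable borel" "\<phi> \<in> borel_measurable borel"
      using contG cont\<phi> by (auto intro: borel_measurable_continuous_onI)
    show "(\<lambda>q. (\<integral>t. \<bar>c - \<nu> \<bullet> z\<bar> * \<bar>t\<bar> ^ (DIM('a) - 1) * (indicator (open_cone z A) (z + t *\<^sub>R (q - z)) *\<^sub>R G (z + t *\<^sub>R (q - z))) \<partial>lborel)) \<in> borel_measurable (hyp_borel \<nu> c)"
      by measurable
    show "(\<lambda>q. \<bar>c - \<nu> \<bullet> z\<bar> * (indicator A q *\<^sub>R \<phi> q)) \<in> borel_measurable (hyp_borel \<nu> c)"
      by measurable
    show "AE q in hyp_borel \<nu> c. (\<integral>t. \<bar>c - \<nu> \<bullet> z\<bar> * \<bar>t\<bar> ^ (DIM('a) - 1) * (indicator (open_cone z A) (z + t *\<^sub>R (q - z)) *\<^sub>R G (z + t *\<^sub>R (q - z))) \<partial>lborel)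
       = \<bar>c - \<nu> \<bullet> z\<bar> * (indicator A q *\<^sub>R \<phi> q)"
      using AE_hyp_borel[OF \<nu>]
    proof eventually_elim
      fix q assume q: "\<nu> \<bullet> q = c"
      \<comment> \<open>With the Jacobian \<open>t ^ (d - 1)\<close> included, the integrand along a
        ray is the derivative of \<open>F\<close>. So the divergence theorem reduces to the
        fundamental theorem of calculus on each ray; the apex contributes nothing since the exponent
        \<open>DIM('a) + k\<close> is positive.\<close>
      define F where "F = (\<lambda>t. t ^ (DIM('a) + k) * \<phi> (z + t *\<^sub>R (q - z)))"
      define F' where "F' = (\<lambda>t. t ^ (DIM('a) - 1) * G (z + t *\<^sub>R (q - z)))"
      define m where "m = DIM('a) - 1"
      have dim: "DIM('a) = Suc m" using DIM_positive[where 'a='a] by (simp add: m_def)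
      have F': "(F has_vector_derivative F' t) (at t within S)" for t S
      proof -
        have "((\<lambda>t. t ^ Suc (m + k)) has_vector_derivative real (Suc (m + k)) * t ^ (m + k)) (at t within S)"
          unfolding has_real_derivative_iff_has_vector_derivative[symmetric]
          using has_field_derivative_at_within[OF DERIV_pow[of "Suc (m + k)" t]] by simp
        from has_vector_derivative_mult[OF this C1_gradient_ray[OF \<phi>, of z "q - z" t S]]
        have "(F has_vector_derivative
          (t ^ Suc (m + k) * (D\<phi> (z + t *\<^sub>R (q - z)) \<bullet> (q - z)) +
           (real (Suc (m + k)) * t ^ (m + k)) * \<phi> (z + t *\<^sub>R (q - z)))) (at t within S)"
          unfolding F_def dim by simp
        also have "(t ^ Suc (m + k) * (D\<phi> (z + t *\<^sub>R (q - z)) \<bullet> (q - z)) +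
           (real (Suc (m + k)) * t ^ (m + k)) * \<phi> (z + t *\<^sub>R (q - z))) = F' t"
          unfolding F'_def G_def cone_par_ray[OF q z] m_def[symmetric] unfolding dim
          by (simp add: power_add algebra_simps)
        finally show ?thesis .
      qed
      have "(\<integral>t. \<bar>c - \<nu> \<bullet> z\<bar> * \<bar>t\<bar> ^ (DIM('a) - 1) * (indicator (open_cone z A) (z + t *\<^sub>R (q - z)) *\<^sub>R G (z + t *\<^sub>R (q - z))) \<partial>lborel)
        = (\<integral>t. \<bar>c - \<nu> \<bullet> z\<bar> * indicator A q * (indicator {0..1} t *\<^sub>R F' t) \<partial>lborel)"
      proof (rule integral_cong_AE)
        have "AE t in lborel. t \<noteq> (0::real)" "AE t in lborel. t \<noteq> (1::real)" by (rule AE_lborel_singleton)+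
        then show "AE t in lborel. \<bar>c - \<nu> \<bullet> z\<bar> * \<bar>t\<bar> ^ (DIM('a) - 1) * (indicator (open_cone z A) (z + t *\<^sub>R (q - z)) *\<^sub>R G (z + t *\<^sub>R (q - z))) =
          \<bar>c - \<nu> \<bullet> z\<bar> * indicator A q * (indicator {0..1} t *\<^sub>R F' t)"
        proof eventually_elim
          fix t :: real assume t: "t \<noteq> 0" "t \<noteq> 1"
          have "indicator (open_cone z A) (z + t *\<^sub>R (q - z)) = (indicator A q * indicator {0..1} t :: real)"
            using mem_open_cone_ray[OF A(3) q z t(1)] t by (auto simp: indicator_def)
          then show "\<bar>c - \<nu> \<bullet> z\<bar> * \<bar>t\<bar> ^ (DIM('a) - 1) * (indicator (open_cone z A) (z + t *\<^sub>R (q - z)) *\<^sub>R G (z + t *\<^sub>R (q - z))) =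
            \<bar>c - \<nu> \<bullet> z\<bar> * indicator A q * (indicator {0..1} t *\<^sub>R F' t)"
            by (auto simp: F'_def indicator_def)
        qed
      qed (unfold F'_def, measurable)
      also have "\<dots> = \<bar>c - \<nu> \<bullet> z\<bar> * indicator A q * (F 1 - F 0)"
      proof -
        have "continuous_on {0..1} F'"
          unfolding F'_def
          by (intro continuous_intros continuous_on_compose2[OF contG]) auto
        then show ?thesis
          by (subst integral_mult_right_zero, subst integral_FTC_atLeastAtMost[where F=F]) (auto intro: F')
      qed
      finally show "(\<integral>t. \<bar>c - \<nu> \<bullet> z\<bar> * \<bar>t\<bar> ^ (DIM('a) - 1) * (indicator (open_cone z A) (z + t *\<^sub>R (q - z)) *\<^sub>R G (z + t *\<^sub>R (q - z))) \<partial>lborel)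
         = \<bar>c - \<nu> \<bullet> z\<bar> * (indicator A q *\<^sub>R \<phi> q)"
        by (simp add: F_def)
    qed
  qed
  also have "\<dots> = \<bar>c - \<nu> \<bullet> z\<bar> * (LINT q:A|hyp_borel \<nu> c. \<phi> q)"
    by (simp add: set_lebesgue_integral_def)
  finally show "(LINT x:open_cone z A|lborel. G x) = \<bar>c - \<nu> \<bullet> z\<bar> * (LINT q:A|hyp_borel \<nu> c. \<phi> q)" .
qed

section \<open>Traces on flat boundary pieces\<close>

lemma abs_le_one_plus_square: "\<bar>x\<bar> \<le> 1 + x\<^sup>2" for x :: real
proof -
  have "0 \<le> (\<bar>x\<bar> - 1)\<^sup>2" by simp
  then have "2 * \<bar>x\<bar> \<le> 1 + x\<^sup>2" by (simp add: power2_diff)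
  then show ?thesis by (smt (verit) abs_ge_zero)
qed

lemma (in finite_measure) integrable_square_imp_integrable:
  fixes h :: "'a \<Rightarrow> real"
  assumes "h \<in> borel_measurable M" "(\<integral>\<^sup>+x. ennreal ((h x)\<^sup>2) \<partial>M) < \<infinity>"
  shows "integrable M h"
proof -
  have "integrable M (\<lambda>x. (h x)\<^sup>2)"
    using assms by (intro integrableI_bounded) auto
  then have "integrable M (\<lambda>x. 1 + (h x)\<^sup>2)" by simp
  then show ?thesis
    by (rule Bochner_Integration.integrable_bound) (use assms abs_le_one_plus_square in auto)
qed

text \<open>Cauchy-Schwarz against the constant 1 on a finite measure. Integrability of
  \<open>g\<close> follows from a single \<open>f j\<close> at finite L2 distance.\<close>

lemma (in finite_measure) integral_tendsto_L2:
  fixes f :: "nat \<Rightarrow> 'a \<Rightarrow> real"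
  assumes f: "\<And>j. integrable M (f j)" and g: "g \<in> borel_measurable M"
    and lim: "(\<lambda>j. \<integral>\<^sup>+x. ennreal ((f j x - g x)\<^sup>2) \<partial>M) \<longlonglongrightarrow> 0"
  shows "integrable M g" "(\<lambda>j. integral\<^sup>L M (f j)) \<longlonglongrightarrow> integral\<^sup>L M g"
proof -
  note [measurable] = g f[THEN borel_measurable_integrable]
  have "eventually (\<lambda>j. (\<integral>\<^sup>+x. ennreal ((f j x - g x)\<^sup>2) \<partial>M) < 1) sequentially"
    using lim by (rule order_tendstoD) simp
  then obtain j where "(\<integral>\<^sup>+x. ennreal ((f j x - g x)\<^sup>2) \<partial>M) < 1"
    by (auto simp: eventually_sequentially)
  then have "(\<integral>\<^sup>+x. ennreal ((f j x - g x)\<^sup>2) \<partial>M) < \<infinity>"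
    by (rule order.strict_trans) simp
  then have "integrable M (\<lambda>x. f j x - g x)"
    by (intro integrable_square_imp_integrable) auto
  from Bochner_Integration.integrable_diff[OF f[of j] this] show g': "integrable M g" by simp
  have bound: "ennreal ((integral\<^sup>L M (f j) - integral\<^sup>L M g)\<^sup>2) \<le>
     emeasure M (space M) * (\<integral>\<^sup>+x. ennreal ((f j x - g x)\<^sup>2) \<partial>M)" for j
  proof -
    have int: "integrable M (\<lambda>x. f j x - g x)" using f g' by simp
    have "ennreal \<bar>integral\<^sup>L M (f j) - integral\<^sup>L M g\<bar> \<le> (\<integral>\<^sup>+x. ennreal \<bar>f j x - g x\<bar> \<partial>M)"
      using integral_norm_bound_ennreal[OF int] f g' by simp
    then have "(ennreal \<bar>integral\<^sup>L M (f j) - integral\<^sup>L M g\<bar>)\<^sup>2 \<le> (\<integral>\<^sup>+x. 1 * ennreal \<bar>f j x - g x\<bar> \<partial>M)\<^sup>2"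
      by (simp add: power_mono)
    also have "\<dots> \<le> (\<integral>\<^sup>+x. 1\<^sup>2 \<partial>M) * (\<integral>\<^sup>+x. (ennreal \<bar>f j x - g x\<bar>)\<^sup>2 \<partial>M)"
      by (rule Cauchy_Schwarz_nn_integral) auto
    finally show ?thesis by (simp add: ennreal_power)
  qed
  have "(\<lambda>j. emeasure M (space M) * (\<integral>\<^sup>+x. ennreal ((f j x - g x)\<^sup>2) \<partial>M)) \<longlonglongrightarrow> emeasure M (space M) * 0"
    by (rule ennreal_tendsto_cmult[OF _ lim]) (simp add: less_top[symmetric])
  then have b: "(\<lambda>j. emeasure M (space M) * (\<integral>\<^sup>+x. ennreal ((f j x - g x)\<^sup>2) \<partial>M)) \<longlonglongrightarrow> 0" by simp
  have "(\<lambda>j. ennreal ((integral\<^sup>L M (f j) - integral\<^sup>L M g)\<^sup>2)) \<longlonglongrightarrow> 0"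
    by (rule tendsto_sandwich[OF _ _ tendsto_const b])
       (auto intro!: bound always_eventually)
  then have "(\<lambda>j. (integral\<^sup>L M (f j) - integral\<^sup>L M g)\<^sup>2) \<longlonglongrightarrow> 0"
    by (subst (asm) ennreal_tendsto_0_iff) auto
  from tendsto_real_sqrt[OF this] have "(\<lambda>j. \<bar>integral\<^sup>L M (f j) - integral\<^sup>L M g\<bar>) \<longlonglongrightarrow> 0" by simp
  then show "(\<lambda>j. integral\<^sup>L M (f j)) \<longlonglongrightarrow> integral\<^sup>L M g"
    by (simp add: tendsto_rabs_zero_iff LIM_zero_iff)
qed

lemma finite_measure_lebesgue_on:
  fixes K :: "'a::euclidean_space set"
  assumes "open K" "bounded K"
  shows "finite_measure (lebesgue_on K)"
proof
  show "emeasure (lebesgue_on K) (space (lebesgue_on K)) \<noteq> \<infinity>"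
    using assms emeasure_bounded_finite[OF assms(2)] 
    by (simp add: emeasure_restrict_space borel_open)
qed

lemma L2_measurable [measurable_dest]: "u \<in> L2 K \<Longrightarrow> u \<in> borel_measurable (lebesgue_on K)"
  by (simp add: L2_def)

lemma borel_measurable_lebesgue_on: "f \<in> borel_measurable borel \<Longrightarrow> f \<in> borel_measurable (lebesgue_on K)"
  by (intro measurable_restrict_space1) (auto intro: measurable_completion)

lemma L2_integrable:
  fixes u :: "'a::euclidean_space \<Rightarrow> real"
  assumes "open K" "bounded K" "u \<in> L2 K" "b \<in> borel_measurable borel" "\<And>x. x \<in> K \<Longrightarrow> \<bar>b x\<bar> \<le> B"
  shows "integrable (lebesgue_on K) (\<lambda>x. b x * u x)"
proof -
  interpret finite_measure "lebesgue_on K" by (rule finite_measure_lebesgue_on) fact+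
  note [measurable] = L2_measurable[OF assms(3)] borel_measurable_lebesgue_on[OF assms(4)]
  have "integrable (lebesgue_on K) (\<lambda>x. (u x)\<^sup>2)" using assms(3) by (simp add: L2_def)
  then have i: "integrable (lebesgue_on K) (\<lambda>x. B * (1 + (u x)\<^sup>2))" by simp
  show ?thesis
  proof (rule Bochner_Integration.integrable_bound[OF i])
    show "AE x in lebesgue_on K. norm (b x * u x) \<le> norm (B * (1 + (u x)\<^sup>2))"
    proof (rule AE_I2)
      fix x assume "x \<in> space (lebesgue_on K)"
      then have b: "\<bar>b x\<bar> \<le> B" using assms(5) by (simp add: space_restrict_space)
      then have "\<bar>b x\<bar> * \<bar>u x\<bar> \<le> B * (1 + (u x)\<^sup>2)"
        by (intro mult_mono abs_le_one_plus_square) auto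
      also have "\<dots> \<le> norm (B * (1 + (u x)\<^sup>2))" by simp
      finally show "norm (b x * u x) \<le> norm (B * (1 + (u x)\<^sup>2))" by (simp add: abs_mult)
    qed
  qed measurable
qed

text \<open>Traces are stated over \<open>lebesgue_on K\<close>, cone integrals over
  \<open>lborel\<close>; this is the passage between the two for a Borel part of
  \<open>K\<close>.\<close>

lemma integral_lebesgue_on_borel:
  fixes f :: "'a::euclidean_space \<Rightarrow> real"
  assumes K: "open K" and C: "C \<subseteq> K" "C \<in> sets borel" and f: "set_borel_measurable borel C f"
  shows "integral\<^sup>L (lebesgue_on K) (\<lambda>x. indicator C x * f x) = (LINT x:C|lborel. f x)"
    and "integrable (lebesgue_on K) (\<lambda>x. indicator C x * f x) \<longleftrightarrow> set_integrable lborel C f"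
proof -
  have *: "indicator K x * (indicator C x * f x) = indicator C x * f x" for x
    using C by (auto simp: indicator_def)
  have m: "(\<lambda>x. indicator C x * f x) \<in> borel_measurable lborel" using f by (simp add: set_borel_measurable_def)
  have "integral\<^sup>L (lebesgue_on K) (\<lambda>x. indicator C x * f x) = (\<integral>x. indicator C x * f x \<partial>lebesgue)"
    using K by (subst integral_restrict_space) (auto simp: * borel_open)
  also have "\<dots> = (\<integral>x. indicator C x * f x \<partial>lborel)" by (rule integral_completion[OF m])
  finally show "integral\<^sup>L (lebesgue_on K) (\<lambda>x. indicator C x * f x) = (LINT x:C|lborel. f x)"
    by (simp add: set_lebesgue_integral_def)
  show "integrable (lebesgue_on K) (\<lambda>x. indicator C x * f x) \<longleftrightarrow> set_integrable lborel C f"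
    using K by (subst integrable_restrict_space)
      (auto simp: * borel_open integrable_completion[OF m] set_integrable_def)
qed

text \<open>The segment from an interior point of a convex set to a point of its closure stays
  inside except possibly at its end; \<open>open_cone\<close> leaves out \<open>t = 1\<close> for
  this reason.\<close>

lemma open_cone_subset_convex:
  assumes "open K" "convex K" "z \<in> K" "A \<subseteq> closure K"
  shows "open_cone z A \<subseteq> K"
proof
  fix x assume "x \<in> open_cone z A"
  then obtain t q where x: "x = z + t *\<^sub>R (q - z)" and q: "q \<in> A" and t: "0 < t" "t < 1"
    by (auto simp: open_cone_def)
  have zi: "z \<in> interior K" using assms by (simp add: interior_open)
  show "x \<in> K"
  proof (cases "q = z")
    case True then show ?thesis using x assms by simp
  next
    case False
    have "x = (1 - t) *\<^sub>R z + t *\<^sub>R q" using x by (simp add: algebra_simps)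
    then have "x \<in> open_segment z q" using False t by (auto simp: in_segment)
    then show ?thesis
      using in_interior_closure_convex_segment[OF assms(2) zi, of q] q assms interior_subset by blast
  qed
qed

text \<open>An edge is measurable only for the completed measure, while cones should be Borel. Cones
  are therefore erected over the Borel \<open>main_part\<close>, which has the same measure.
  Measurability of the edge itself follows from \<open>0 < surf_meas \<sigma>\<close>, since a
  non-measurable set has \<open>measure\<close> 0.\<close>

lemma main_part_flat:
  fixes \<sigma> :: "'a::euclidean_space set"
  assumes "surf \<sigma> = completion (hyp_borel \<nu> c)" "0 < surf_meas \<sigma>"
  shows "\<sigma> \<in> sets (completion (hyp_borel \<nu> c))"
    "main_part (hyp_borel \<nu> c) \<sigma> \<subseteq> \<sigma>"
    "main_part (hyp_borel \<nu> c) \<sigma> \<in> sets borel"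
    "measure (hyp_borel \<nu> c) (main_part (hyp_borel \<nu> c) \<sigma>) = surf_meas \<sigma>"
proof -
  show s: "\<sigma> \<in> sets (completion (hyp_borel \<nu> c))"
    using assms(2) measure_notin_sets[of \<sigma> "surf \<sigma>"] by (auto simp: surf_meas_def assms(1))
  show "main_part (hyp_borel \<nu> c) \<sigma> \<subseteq> \<sigma>" using main_part_null_part_Un[OF s] by blast
  show "main_part (hyp_borel \<nu> c) \<sigma> \<in> sets borel" using main_part_sets[OF s] by simp
  show "measure (hyp_borel \<nu> c) (main_part (hyp_borel \<nu> c) \<sigma>) = surf_meas \<sigma>"
    by (simp add: surf_meas_def assms(1) measure_def emeasure_completion[OF s])
qed

lemma trace_surf_limit:
  fixes \<phi> :: "nat \<Rightarrow> 'a::euclidean_space \<Rightarrow> real"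
  assumes \<phi>: "\<And>j. C1_gradient (\<phi> j) (D\<phi> j)"
    and b\<sigma>: "bounded \<sigma>" and \<sigma>: "surf \<sigma> = completion (hyp_borel \<nu> c)" "0 < surf_meas \<sigma>"
    and \<nu>: "norm \<nu> = 1"
    and lg: "(\<lambda>k. \<integral>\<^sup>+x. ennreal ((\<phi> k x - g x)\<^sup>2) * indicator \<sigma> x \<partial>surf \<sigma>) \<longlonglongrightarrow> 0"
    and g: "g \<in> borel_measurable (surf \<sigma>)"
  shows "(\<lambda>j. LINT q:main_part (hyp_borel \<nu> c) \<sigma>|hyp_borel \<nu> c. \<phi> j q) \<longlonglongrightarrow>
    set_lebesgue_integral (surf \<sigma>) \<sigma> g"
proof -
  let ?A = "main_part (hyp_borel \<nu> c) \<sigma>"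
  note \<sigma>s = main_part_flat(1)[OF \<sigma>]
  have A: "?A \<in> sets borel" "bounded ?A"
    using main_part_flat[OF \<sigma>] bounded_subset[OF b\<sigma>] by auto
  have cont: "continuous_on UNIV (\<phi> j)" for j
    using C1_gradient_continuous[OF \<phi>] by auto
  have [measurable]: "\<phi> j \<in> borel_measurable borel" for j
    using cont by (auto intro: borel_measurable_continuous_onI)
  define M where "M = restrict_space (surf \<sigma>) \<sigma>"
  have \<sigma>s': "\<sigma> \<inter> space (surf \<sigma>) \<in> sets (surf \<sigma>)" using \<sigma>s by (simp add: \<sigma>(1))
  have "emeasure (surf \<sigma>) \<sigma> < \<infinity>"
  proof -
    have "emeasure (surf \<sigma>) \<sigma> = emeasure (hyp_borel \<nu> c) ?A" by (simp add: \<sigma>(1) emeasure_completion[OF \<sigma>s])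
    also have "\<dots> < \<infinity>" by (rule emeasure_hyp_borel_bounded[OF \<nu> A(2)])
    finally show ?thesis .
  qed
  then interpret M: finite_measure M
    unfolding M_def using \<sigma>s' by (intro finite_measureI) (simp add: emeasure_restrict_space \<sigma>(1))
  have eq: "integral\<^sup>L M (\<phi> j) = (LINT q:?A|hyp_borel \<nu> c. \<phi> j q)"
    "integrable M (\<phi> j)" for j
  proof -
    have ae: "AE q in surf \<sigma>. indicator \<sigma> q *\<^sub>R \<phi> j q = indicator ?A q *\<^sub>R \<phi> j q"
      unfolding \<sigma>(1)
      using AE_completion[OF AE_in_main_part[OF \<sigma>s]] by eventually_elim (auto simp: indicator_def)
    have m: "(\<lambda>q. indicator ?A q *\<^sub>R \<phi> j q) \<in> borel_measurable (hyp_borel \<nu> c)"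
      using A(1) by measurable
    have m': "(\<lambda>q. indicator \<sigma> q *\<^sub>R \<phi> j q) \<in> borel_measurable (surf \<sigma>)"
      using \<sigma>s' unfolding \<sigma>(1)
      by (intro borel_measurable_scaleR borel_measurable_indicator measurable_completion) auto
    have "integral\<^sup>L M (\<phi> j) = (\<integral>q. indicator \<sigma> q *\<^sub>R \<phi> j q \<partial>surf \<sigma>)"
      unfolding M_def by (rule integral_restrict_space[OF \<sigma>s'])
    also have "\<dots> = (\<integral>q. indicator ?A q *\<^sub>R \<phi> j q \<partial>surf \<sigma>)"
      by (rule integral_cong_AE[OF m' _ ae]) (unfold \<sigma>(1), rule measurable_completion[OF m])
    also have "\<dots> = (LINT q:?A|hyp_borel \<nu> c. \<phi> j q)"
      unfolding \<sigma>(1) set_lebesgue_integral_def by (rule integral_completion[OF m])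
    finally show "integral\<^sup>L M (\<phi> j) = (LINT q:?A|hyp_borel \<nu> c. \<phi> j q)" .
    obtain B where B: "\<And>x. x \<in> closure \<sigma> \<Longrightarrow> \<bar>\<phi> j x\<bar> \<le> B"
    proof -
      have "compact (closure \<sigma>)" using b\<sigma> by simp
      then have "bounded (\<phi> j ` closure \<sigma>)"
        by (intro compact_imp_bounded compact_continuous_image continuous_on_subset[OF cont]) auto
      then show ?thesis using that by (auto simp: bounded_iff)
    qed
    show "integrable M (\<phi> j)"
    proof (rule M.integrable_const_bound[of _ B])
      show "AE x in M. norm (\<phi> j x) \<le> B"
        using B closure_subset by (intro AE_I2) (auto simp: M_def space_restrict_space)
      show "\<phi> j \<in> borel_measurable M" unfolding M_def \<sigma>(1)
        by (intro measurable_restrict_space1 measurable_completion) auto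
    qed
  qed
  have "(\<lambda>j. integral\<^sup>L M (\<phi> j)) \<longlonglongrightarrow> integral\<^sup>L M g"
  proof (rule M.integral_tendsto_L2(2))
    show "g \<in> borel_measurable M" using g unfolding M_def by (rule measurable_restrict_space1)
    show "(\<lambda>j. \<integral>\<^sup>+x. ennreal ((\<phi> j x - g x)\<^sup>2) \<partial>M) \<longlonglongrightarrow> 0"
      using lg unfolding M_def by (simp add: nn_integral_restrict_space[OF \<sigma>s'])
  qed (rule eq)
  also have "integral\<^sup>L M g = set_lebesgue_integral (surf \<sigma>) \<sigma> g"
    unfolding M_def set_lebesgue_integral_def by (rule integral_restrict_space[OF \<sigma>s'])
  finally show ?thesis unfolding eq(1) .
qed

text \<open>The divergence theorem on the cone passes to the limit in the definition of the trace.\<close>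

lemma trace_cone_identity:
  fixes u :: "'a::euclidean_space \<Rightarrow> real"
  assumes K: "open K" "bounded K" "convex K" "z \<in> K"
    and \<sigma>: "\<sigma> \<subseteq> closure K" "\<sigma> \<subseteq> {x. \<nu> \<bullet> x = c}" "surf \<sigma> = completion (hyp_borel \<nu> c)" "0 < surf_meas \<sigma>"
    and \<nu>: "norm \<nu> = 1" "\<nu> \<bullet> z \<noteq> c"
    and tr: "trace_on K \<sigma> u g"
  defines "C \<equiv> open_cone z (main_part (hyp_borel \<nu> c) \<sigma>)"
  obtains w where "weak_gradient K u w"
    "\<And>k. \<bar>c - \<nu> \<bullet> z\<bar> * set_lebesgue_integral (surf \<sigma>) \<sigma> g =
       (LINT x|lebesgue_on K. indicator C x * (cone_par \<nu> c z x ^ k * (real (DIM('a) + k) * u x + w x \<bullet> (x - z))))"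
proof -
  let ?A = "main_part (hyp_borel \<nu> c) \<sigma>"
  interpret finite_measure "lebesgue_on K" by (rule finite_measure_lebesgue_on[OF K(1,2)])
  note A\<sigma> = main_part_flat(2)[OF \<sigma>(3,4)]
  have b\<sigma>: "bounded \<sigma>" using K(2) \<sigma>(1) bounded_closure bounded_subset by blast
  have A: "?A \<in> sets borel" "bounded ?A" "?A \<subseteq> {x. \<nu> \<bullet> x = c}" "?A \<subseteq> closure K"
    using main_part_flat(3)[OF \<sigma>(3,4)] A\<sigma> \<sigma> b\<sigma> bounded_subset[OF b\<sigma> A\<sigma>] by auto
  have CK: "C \<subseteq> K" unfolding C_def by (rule open_cone_subset_convex[OF K(1,3,4) A(4)])
  have C[measurable]: "C \<in> sets borel" unfolding C_def by (rule open_cone_borel[OF A(3) \<nu>(2) A(1)])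
  have "bounded (insert z ?A)" using A by simp
  then obtain R where R: "\<And>q. q \<in> ?A \<Longrightarrow> dist z q \<le> R"
    unfolding bounded_any_center[where a=z] by auto
  have par: "\<bar>cone_par \<nu> c z x\<bar> \<le> 1" "norm (x - z) \<le> R" if "x \<in> C" for x
    using that open_cone_eq[OF A(3) \<nu>(2)] open_cone_subset_cball[of ?A z R] R
    by (auto simp: C_def dist_norm norm_minus_commute)
  obtain w \<phi> D\<phi> where w: "weak_gradient K u w" and \<phi>: "\<And>j::nat. C1_gradient (\<phi> j) (D\<phi> j)"
    and lu: "(\<lambda>k. \<integral>\<^sup>+x. ennreal ((\<phi> k x - u x)\<^sup>2) \<partial>lebesgue_on K) \<longlonglongrightarrow> 0"
    and lw: "(\<lambda>k. \<integral>\<^sup>+x. ennreal ((norm (D\<phi> k x - w x))\<^sup>2) \<partial>lebesgue_on K) \<longlonglongrightarrow> 0"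
    and lg: "(\<lambda>k. \<integral>\<^sup>+x. ennreal ((\<phi> k x - g x)\<^sup>2) * indicator \<sigma> x \<partial>surf \<sigma>) \<longlonglongrightarrow> 0"
    and u: "u \<in> L2 K" and g: "g \<in> borel_measurable (surf \<sigma>)"
    using tr unfolding trace_on_def by blast
  have wL: "w \<in> L2 K" using w by (simp add: weak_gradient_def)
  note [measurable] = L2_measurable[OF u] L2_measurable[OF wL]
  have cont: "continuous_on UNIV (\<phi> j)" "continuous_on UNIV (D\<phi> j)" for j
    using C1_gradient_continuous[OF \<phi>] by auto
  have [measurable]: "\<phi> j \<in> borel_measurable borel" "D\<phi> j \<in> borel_measurable borel" for j
    using cont by (auto intro: borel_measurable_continuous_onI)
  have [measurable]: "\<phi> j \<in> borel_measurable (lebesgue_on K)" "D\<phi> j \<in> borel_measurable (lebesgue_on K)" for j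
    by (auto intro: borel_measurable_lebesgue_on)
  have surf_lim: "(\<lambda>j. LINT q:?A|hyp_borel \<nu> c. \<phi> j q) \<longlonglongrightarrow> set_lebesgue_integral (surf \<sigma>) \<sigma> g"
    by (rule trace_surf_limit[OF \<phi> b\<sigma> \<sigma>(3,4) \<nu>(1) lg g])
  have "\<bar>c - \<nu> \<bullet> z\<bar> * set_lebesgue_integral (surf \<sigma>) \<sigma> g =
       (LINT x|lebesgue_on K. indicator C x * (cone_par \<nu> c z x ^ k * (real (DIM('a) + k) * u x + w x \<bullet> (x - z))))" for k
  proof -
    define d where "d = real (DIM('a) + k)"
    define F where "F = (\<lambda>j x. indicator C x * (cone_par \<nu> c z x ^ k * (d * \<phi> j x + D\<phi> j x \<bullet> (x - z))))"
    define G where "G = (\<lambda>x. indicator C x * (cone_par \<nu> c z x ^ k * (d * u x + w x \<bullet> (x - z))))"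
    have [measurable]: "(indicator C :: 'a \<Rightarrow> real) \<in> borel_measurable (lebesgue_on K)"
      "cone_par \<nu> c z \<in> borel_measurable (lebesgue_on K)" "(\<lambda>x. x) \<in> borel_measurable (lebesgue_on K)"
      by (auto intro!: borel_measurable_lebesgue_on)
    have div: "set_integrable lborel C (\<lambda>x. cone_par \<nu> c z x ^ k * (d * \<phi> j x + D\<phi> j x \<bullet> (x - z)))"
      "(LINT x:C|lborel. cone_par \<nu> c z x ^ k * (d * \<phi> j x + D\<phi> j x \<bullet> (x - z))) =
         \<bar>c - \<nu> \<bullet> z\<bar> * (LINT q:?A|hyp_borel \<nu> c. \<phi> j q)" for j
      unfolding C_def d_def using cone_divergence[OF \<phi> \<nu> A(1-3)] by auto
    have bm: "set_borel_measurable borel C (\<lambda>x. cone_par \<nu> c z x ^ k * (d * \<phi> j x + D\<phi> j x \<bullet> (x - z)))" for j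
      unfolding set_borel_measurable_def by measurable
    have intF: "integral\<^sup>L (lebesgue_on K) (F j) = \<bar>c - \<nu> \<bullet> z\<bar> * (LINT q:?A|hyp_borel \<nu> c. \<phi> j q)" for j
      unfolding F_def using integral_lebesgue_on_borel(1)[OF K(1) CK C bm] div(2) by simp
    have "(\<lambda>j. integral\<^sup>L (lebesgue_on K) (F j)) \<longlonglongrightarrow> integral\<^sup>L (lebesgue_on K) G"
    proof (rule integral_tendsto_L2(2))
      show "integrable (lebesgue_on K) (F j)" for j
        unfolding F_def using integral_lebesgue_on_borel(2)[OF K(1) CK C bm] div(1) by simp
      show "G \<in> borel_measurable (lebesgue_on K)" unfolding G_def by measurable
      \<comment> \<open>On \<open>C\<close> the parameter is at most 1 and
        \<open>norm (x - z)\<close> at most \<open>R\<close>; the two coefficients come from this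
        and from \<open>(a + e)\<^sup>2 \<le> 2 * a\<^sup>2 + 2 * e\<^sup>2\<close>.\<close>
      let ?b = "\<lambda>j. ennreal (2 * d\<^sup>2) * (\<integral>\<^sup>+x. ennreal ((\<phi> j x - u x)\<^sup>2) \<partial>lebesgue_on K) +
        ennreal (2 * R\<^sup>2) * (\<integral>\<^sup>+x. ennreal ((norm (D\<phi> j x - w x))\<^sup>2) \<partial>lebesgue_on K)"
      have "?b \<longlonglongrightarrow> ennreal (2 * d\<^sup>2) * 0 + ennreal (2 * R\<^sup>2) * 0"
        by (intro tendsto_add ennreal_tendsto_cmult lu lw) auto
      then have b: "?b \<longlonglongrightarrow> 0" by simp
      have le: "(\<integral>\<^sup>+x. ennreal ((F j x - G x)\<^sup>2) \<partial>lebesgue_on K) \<le> ?b j" for j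
      proof -
        have "(\<integral>\<^sup>+x. ennreal ((F j x - G x)\<^sup>2) \<partial>lebesgue_on K) \<le>
          (\<integral>\<^sup>+x. ennreal (2 * d\<^sup>2) * ennreal ((\<phi> j x - u x)\<^sup>2) + ennreal (2 * R\<^sup>2) * ennreal ((norm (D\<phi> j x - w x))\<^sup>2) \<partial>lebesgue_on K)"
        proof (intro nn_integral_mono)
          fix x
          have "(F j x - G x)\<^sup>2 \<le> 2 * d\<^sup>2 * (\<phi> j x - u x)\<^sup>2 + 2 * R\<^sup>2 * (norm (D\<phi> j x - w x))\<^sup>2"
          proof (cases "x \<in> C")
            case True
            define a where "a = d * (\<phi> j x - u x)"
            define e where "e = (D\<phi> j x - w x) \<bullet> (x - z)"
            have "F j x - G x = cone_par \<nu> c z x ^ k * (a + e)"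
              using True by (simp add: F_def G_def a_def e_def algebra_simps)
            then have "\<bar>F j x - G x\<bar> \<le> 1 * \<bar>a + e\<bar>"
              using par(1)[OF True] by (simp add: abs_mult power_abs mult_left_le_one_le power_le_one)
            then have "(F j x - G x)\<^sup>2 \<le> (a + e)\<^sup>2" by (simp add: abs_le_square_iff)
            also have "\<dots> \<le> 2 * a\<^sup>2 + 2 * e\<^sup>2" using sum_squares_bound[of a e] by (simp add: power2_sum)
            also have "e\<^sup>2 \<le> (R * norm (D\<phi> j x - w x))\<^sup>2"
            proof -
              have "\<bar>e\<bar> \<le> norm (D\<phi> j x - w x) * norm (x - z)"
                unfolding e_def by (rule Cauchy_Schwarz_ineq2)
              also have "\<dots> \<le> norm (D\<phi> j x - w x) * R" by (intro mult_left_mono par True) auto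
              finally show ?thesis by (intro power2_le_iff_abs_le[THEN iffD2]) (auto simp: mult.commute intro: order_trans)
            qed
            finally show ?thesis by (simp add: a_def power_mult_distrib)
          qed (simp add: F_def G_def)
          then show "ennreal ((F j x - G x)\<^sup>2) \<le> ennreal (2 * d\<^sup>2) * ennreal ((\<phi> j x - u x)\<^sup>2) + ennreal (2 * R\<^sup>2) * ennreal ((norm (D\<phi> j x - w x))\<^sup>2)"
            by (simp add: ennreal_mult[symmetric] ennreal_plus[symmetric] ennreal_leI del: ennreal_plus)
        qed
        also have "\<dots> = ?b j"
          by (subst nn_integral_add) (auto simp: nn_integral_cmult)
        finally show ?thesis .
      qed
      show "(\<lambda>j. \<integral>\<^sup>+x. ennreal ((F j x - G x)\<^sup>2) \<partial>lebesgue_on K) \<longlonglongrightarrow> 0"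
        by (rule tendsto_sandwich[OF _ _ tendsto_const b]) (auto intro!: le always_eventually)
    qed
    moreover have "(\<lambda>j. integral\<^sup>L (lebesgue_on K) (F j)) \<longlonglongrightarrow> \<bar>c - \<nu> \<bullet> z\<bar> * set_lebesgue_integral (surf \<sigma>) \<sigma> g"
      unfolding intF by (intro tendsto_intros surf_lim)
    ultimately show ?thesis unfolding G_def d_def using LIMSEQ_unique by blast
  qed
  with w show thesis by (rule that)
qed

text \<open>The divergence identity for the constant function 1. For \<open>k = 0\<close> it is the
  volume formula height times base over dimension; for general \<open>k\<close> it gives the total
  mass of the weights in \<open>trace_cone_limit\<close>.\<close>

lemma measure_open_cone:
  fixes A :: "'a::euclidean_space set"
  assumes \<nu>: "norm \<nu> = 1" and z: "\<nu> \<bullet> z \<noteq> c"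
    and A: "A \<in> sets borel" "bounded A" "A \<subseteq> {x. \<nu> \<bullet> x = c}"
  shows "(LINT x:open_cone z A|lborel. cone_par \<nu> c z x ^ k * real (DIM('a) + k)) =
      \<bar>c - \<nu> \<bullet> z\<bar> * measure (hyp_borel \<nu> c) A"
    and "real (DIM('a)) * measure lborel (open_cone z A) = \<bar>c - \<nu> \<bullet> z\<bar> * measure (hyp_borel \<nu> c) A"
    and "set_integrable lborel (open_cone z A) (\<lambda>x. cone_par \<nu> c z x ^ k * real (DIM('a) + k))"
proof -
  have 1: "C1_gradient (\<lambda>_::'a. 1) (\<lambda>_. 0)" by (simp add: C1_gradient_def GDERIV_const)
  have eq: "(LINT q:A|hyp_borel \<nu> c. 1) = measure (hyp_borel \<nu> c) A"
    using A(1) by (simp add: set_lebesgue_integral_def)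
  note cone = cone_divergence[OF 1 \<nu> z A, unfolded eq]
  show *: "(LINT x:open_cone z A|lborel. cone_par \<nu> c z x ^ k * real (DIM('a) + k)) =
      \<bar>c - \<nu> \<bullet> z\<bar> * measure (hyp_borel \<nu> c) A" for k
    using cone(2)[of k] by simp
  show "set_integrable lborel (open_cone z A) (\<lambda>x. cone_par \<nu> c z x ^ k * real (DIM('a) + k))"
    using cone(1)[of k] by simp
  show "real (DIM('a)) * measure lborel (open_cone z A) = \<bar>c - \<nu> \<bullet> z\<bar> * measure (hyp_borel \<nu> c) A"
    using *[of 0] by (simp add: set_lebesgue_integral_def mult.commute)
qed

text \<open>For large \<open>k\<close> the gradient term of the cone identity disappears, so the integral of the trace is
  determined by \<open>u\<close> alone.\<close>

lemma trace_cone_limit: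
  fixes u :: "'a::euclidean_space \<Rightarrow> real"
  assumes K: "open K" "bounded K" "convex K" "z \<in> K"
    and \<sigma>: "\<sigma> \<subseteq> closure K" "\<sigma> \<subseteq> {x. \<nu> \<bullet> x = c}" "surf \<sigma> = completion (hyp_borel \<nu> c)" "0 < surf_meas \<sigma>"
    and \<nu>: "norm \<nu> = 1" "\<nu> \<bullet> z \<noteq> c"
    and tr: "trace_on K \<sigma> u g"
  defines "b \<equiv> \<lambda>k x. indicator (open_cone z (main_part (hyp_borel \<nu> c) \<sigma>)) x * (cone_par \<nu> c z x ^ k * real (DIM('a) + k))"
  shows "\<And>k. integrable (lebesgue_on K) (\<lambda>x. b k x * u x)"
    and "(\<lambda>k. LINT x|lebesgue_on K. b k x * u x) \<longlonglongrightarrow> \<bar>c - \<nu> \<bullet> z\<bar> * set_lebesgue_integral (surf \<sigma>) \<sigma> g"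
proof -
  let ?A = "main_part (hyp_borel \<nu> c) \<sigma>"
  define C where "C = open_cone z ?A"
  obtain w where w: "weak_gradient K u w"
    and id: "\<And>k. \<bar>c - \<nu> \<bullet> z\<bar> * set_lebesgue_integral (surf \<sigma>) \<sigma> g =
       (LINT x|lebesgue_on K. indicator C x * (cone_par \<nu> c z x ^ k * (real (DIM('a) + k) * u x + w x \<bullet> (x - z))))"
    using trace_cone_identity[OF assms(1-11)] unfolding C_def by blast
  have u: "u \<in> L2 K" and wL: "w \<in> L2 K"
    using tr w by (simp_all add: trace_on_def weak_gradient_def)
  have A: "?A \<in> sets borel" "?A \<subseteq> {x. \<nu> \<bullet> x = c}" "?A \<subseteq> closure K"
    using main_part_flat[OF \<sigma>(3,4)] \<sigma> by auto
  have [measurable]: "C \<in> sets borel" unfolding C_def by (rule open_cone_borel[OF A(2) \<nu>(2) A(1)])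
  have par: "0 < cone_par \<nu> c z x" "cone_par \<nu> c z x < 1" if "x \<in> C" for x
    using that open_cone_eq[OF A(2) \<nu>(2)] by (auto simp: C_def)
  have par1: "\<bar>cone_par \<nu> c z x ^ k\<bar> \<le> 1" if "x \<in> C" for x k
    using par[OF that] by (auto simp: power_abs intro: power_le_one)
  show intb: "integrable (lebesgue_on K) (\<lambda>x. b k x * u x)" for k
  proof (rule L2_integrable[OF K(1,2) u])
    show "b k \<in> borel_measurable borel" unfolding b_def C_def[symmetric] by measurable
    show "\<bar>b k x\<bar> \<le> real (DIM('a) + k)" for x
      unfolding b_def C_def[symmetric] using par1[of x k]
      by (auto simp: indicator_def abs_mult intro: mult_left_le_one_le)
  qed
  have "bounded (insert z K)" using K by simp
  then obtain R where R: "\<And>x. x \<in> K \<Longrightarrow> dist z x \<le> R"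
    unfolding bounded_any_center[where a=z] by auto
  define h where "h = (\<lambda>x. w x \<bullet> (x - z))"
  have [measurable]: "w \<in> borel_measurable (lebesgue_on K)" using wL by (rule L2_measurable)
  have [measurable]: "(indicator C :: 'a \<Rightarrow> real) \<in> borel_measurable (lebesgue_on K)"
    "cone_par \<nu> c z \<in> borel_measurable (lebesgue_on K)" "(\<lambda>x. x) \<in> borel_measurable (lebesgue_on K)"
    by (auto intro!: borel_measurable_lebesgue_on)
  have hm[measurable]: "h \<in> borel_measurable (lebesgue_on K)" unfolding h_def by measurable
  have "(\<lambda>x. norm (w x)) \<in> L2 K" using wL by (auto simp: L2_def)
  from L2_integrable[OF K(1,2) this, of "\<lambda>_. R" "\<bar>R\<bar>"]
  have iR: "integrable (lebesgue_on K) (\<lambda>x. R * norm (w x))" by simp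
  have hb: "norm (h x) \<le> R * norm (w x)" if "x \<in> K" for x
  proof -
    have "norm (h x) \<le> norm (w x) * norm (x - z)" unfolding h_def real_norm_def by (rule Cauchy_Schwarz_ineq2)
    also have "\<dots> \<le> norm (w x) * R" using R[OF that] by (intro mult_left_mono) (auto simp: dist_norm norm_minus_commute)
    finally show ?thesis by (simp add: mult.commute)
  qed
  have dom: "AE x in lebesgue_on K. norm (indicator C x * (cone_par \<nu> c z x ^ k * h x)) \<le> R * norm (w x)" for k
  proof (rule AE_I2)
    fix x assume "x \<in> space (lebesgue_on K)"
    then have x: "x \<in> K" by (simp add: space_restrict_space)
    have "norm (indicator C x * (cone_par \<nu> c z x ^ k * h x)) \<le> norm (h x)"
      using par1[of x k] by (auto simp: indicator_def abs_mult intro: mult_left_le_one_le)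
    then show "norm (indicator C x * (cone_par \<nu> c z x ^ k * h x)) \<le> R * norm (w x)" using hb[OF x] by simp
  qed
  \<comment> \<open>On the open cone the parameter is strictly below 1, so its powers tend to 0
    pointwise; \<open>R * norm (w x)\<close> dominates.\<close>
  have lim: "(\<lambda>k. LINT x|lebesgue_on K. indicator C x * (cone_par \<nu> c z x ^ k * h x)) \<longlonglongrightarrow> (LINT x|lebesgue_on K. 0)"
  proof (rule integral_dominated_convergence[where w="\<lambda>x. R * norm (w x)"])
    show "AE x in lebesgue_on K. (\<lambda>k. indicator C x * (cone_par \<nu> c z x ^ k * h x)) \<longlonglongrightarrow> 0"
    proof (rule AE_I2)
      fix x
      show "(\<lambda>k. indicator C x * (cone_par \<nu> c z x ^ k * h x)) \<longlonglongrightarrow> 0"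
      proof (cases "x \<in> C")
        case True
        have "(\<lambda>k. cone_par \<nu> c z x ^ k * h x) \<longlonglongrightarrow> 0 * h x"
          using par[OF True] by (intro tendsto_mult LIMSEQ_realpow_zero tendsto_const) auto
        then show ?thesis using True by simp
      qed simp
    qed
  qed (use iR dom in auto)
  have split: "(LINT x|lebesgue_on K. b k x * u x) = \<bar>c - \<nu> \<bullet> z\<bar> * set_lebesgue_integral (surf \<sigma>) \<sigma> g -
      (LINT x|lebesgue_on K. indicator C x * (cone_par \<nu> c z x ^ k * h x))" for k
  proof -
    have "integrable (lebesgue_on K) (\<lambda>x. indicator C x * (cone_par \<nu> c z x ^ k * h x))"
      by (rule Bochner_Integration.integrable_bound[OF iR])
        (use dom[of k] in \<open>auto elim!: eventually_mono order_trans\<close>)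
    from Bochner_Integration.integral_add[OF intb[of k] this]
    show ?thesis unfolding id[of k] by (simp add: b_def C_def h_def algebra_simps)
  qed
  show "(\<lambda>k. LINT x|lebesgue_on K. b k x * u x) \<longlonglongrightarrow> \<bar>c - \<nu> \<bullet> z\<bar> * set_lebesgue_integral (surf \<sigma>) \<sigma> g"
    unfolding split using tendsto_diff[OF tendsto_const lim] by simp
qed

section \<open>Hyperplanes carrying a set of positive surface measure\<close>

lemma negligible_imp_hyp_null:
  assumes "A \<in> sets borel" "negligible {x. hyp_proj \<nu> c x \<in> A}"
  shows "measure (hyp_borel \<nu> c) A = 0"
proof -
  have [measurable]: "A \<in> sets borel" by fact
  let ?S = "{x. hyp_proj \<nu> c x \<in> A}"
  have "?S \<in> sets borel" by measurable
  then have "emeasure lborel ?S = 0"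
    using assms(2) by (metis emeasure_completion main_part negligible_iff_emeasure0 sets_completionI_sets sets_lborel)
  moreover have "emeasure (hyp_borel \<nu> c) A \<le> emeasure lborel ?S"
    unfolding emeasure_hyp_borel[OF assms(1)] by (rule emeasure_mono) (auto simp: \<open>?S \<in> sets borel\<close>)
  ultimately show ?thesis by (simp add: measure_def)
qed

text \<open>If \<open>a\<close> had a component \<open>a'\<close> orthogonal to
  \<open>\<nu>\<close>, the preimage of \<open>A\<close> under the projection would lie in a
  hyperplane with normal \<open>a'\<close>, which is null, and \<open>A\<close> would have measure
  0.\<close>

lemma hyperplane_unique:
  assumes \<nu>: "norm \<nu> = 1" and A: "A \<in> sets borel" "A \<subseteq> {x. \<nu> \<bullet> x = c}" "0 < measure (hyp_borel \<nu> c) A"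
    and a: "a \<noteq> 0" "A \<subseteq> {x. a \<bullet> x = b}"
  obtains s where "s \<noteq> 0" "a = s *\<^sub>R \<nu>" "b = s * c"
proof -
  define s where "s = a \<bullet> \<nu>"
  define a' where "a' = a - s *\<^sub>R \<nu>"
  have "a' = 0"
  proof (rule ccontr)
    assume nz: "a' \<noteq> 0"
    have "{x. hyp_proj \<nu> c x \<in> A} \<subseteq> {x. a' \<bullet> x = b - s * c}"
    proof
      fix x assume "x \<in> {x. hyp_proj \<nu> c x \<in> A}"
      then have "a \<bullet> hyp_proj \<nu> c x = b" using a by auto
      then show "x \<in> {x. a' \<bullet> x = b - s * c}"
        by (simp add: hyp_proj_def a'_def s_def inner_diff_right inner_diff_left algebra_simps)
    qed
    moreover have "negligible {x. a' \<bullet> x = b - s * c}" using nz by (intro negligible_hyperplane) simp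
    ultimately have "negligible {x. hyp_proj \<nu> c x \<in> A}" by (rule negligible_subset[rotated])
    then show False using negligible_imp_hyp_null[OF A(1)] A(3) by simp
  qed
  then have as: "a = s *\<^sub>R \<nu>" by (simp add: a'_def)
  have "s \<noteq> 0" using a as by auto
  have "A \<noteq> {}" using A(3) by auto
  then obtain q where "q \<in> A" by auto
  then have "b = s * c" using a A as by (auto simp: subset_iff)
  with \<open>s \<noteq> 0\<close> as show thesis by (rule that)
qed

text \<open>A flat piece of the boundary of a convex open set with positive surface measure spans a supporting
  hyperplane: otherwise its preimage under the projection would lie in the boundary of a convex set.\<close>

lemma hyperplane_disjoint_convex:
  assumes \<nu>: "norm \<nu> = 1" and A: "A \<in> sets borel" "A \<subseteq> {x. \<nu> \<bullet> x = c}" "0 < measure (hyp_borel \<nu> c) A"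
    and K: "open K" "convex K" "A \<subseteq> frontier K" and p: "p \<in> K"
  shows "\<nu> \<bullet> p \<noteq> c"
proof
  assume pc: "\<nu> \<bullet> p = c"
  \<comment> \<open>The cylinder over the section of \<open>K\<close> by the hyperplane: open and
    convex, being a preimage under an affine map.\<close>
  define K' where "K' = hyp_proj \<nu> c -` K"
  have aff: "hyp_proj \<nu> c ((1 - t) *\<^sub>R x + t *\<^sub>R y) = (1 - t) *\<^sub>R hyp_proj \<nu> c x + t *\<^sub>R hyp_proj \<nu> c y" for t x y
    by (simp add: hyp_proj_def inner_add_right algebra_simps)
  have cont: "continuous_on UNIV (hyp_proj \<nu> c)" unfolding hyp_proj_def by (intro continuous_intros)
  have oK': "open K'" unfolding K'_def using K(1) cont by (simp add: open_vimage)
  have cK': "convex K'"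
    unfolding convex_alt using K(2) by (auto simp: K'_def aff convex_alt)
  have "{x. hyp_proj \<nu> c x \<in> A} \<subseteq> frontier K'"
  proof
    fix x assume "x \<in> {x. hyp_proj \<nu> c x \<in> A}"
    then have x: "hyp_proj \<nu> c x \<in> frontier K" using K by auto
    then have nx: "hyp_proj \<nu> c x \<notin> K" and cx: "hyp_proj \<nu> c x \<in> closure K"
      using K(1) by (auto simp: frontier_def interior_open)
    \<comment> \<open>As \<open>p\<close> lies in the hyperplane it is its own projection, so the
      segment from \<open>x\<close> to \<open>p\<close> projects to one from a boundary point of
      \<open>K\<close> to an interior point. Hence \<open>x\<close> is a limit of points of
      \<open>K'\<close>.\<close>
    have seg: "(1 - t) *\<^sub>R x + t *\<^sub>R p \<in> K'" if t: "0 < t" "t < 1" for t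
    proof -
      have "p \<in> interior K" using K p by (simp add: interior_open)
      then have sub: "open_segment p (hyp_proj \<nu> c x) \<subseteq> interior K"
        by (rule in_interior_closure_convex_segment[OF K(2) _ cx])
      have ne: "p \<noteq> hyp_proj \<nu> c x" using nx p by auto
      have "(1 - (1 - t)) *\<^sub>R p + (1 - t) *\<^sub>R hyp_proj \<nu> c x \<in> open_segment p (hyp_proj \<nu> c x)"
        unfolding in_segment using ne t by (intro conjI exI[of _ "1 - t"]) auto
      then show ?thesis using sub interior_subset unfolding K'_def vimage_def mem_Collect_eq aff
        by (auto simp: hyp_proj_id[OF pc] add.commute)
    qed
    have "(\<lambda>n. (1 - inverse (real (Suc (Suc n)))) *\<^sub>R x + inverse (real (Suc (Suc n))) *\<^sub>R p) \<longlonglongrightarrow> (1 - 0) *\<^sub>R x + 0 *\<^sub>R p"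
      by (intro tendsto_intros LIMSEQ_Suc[OF LIMSEQ_inverse_real_of_nat])
    moreover have "(1 - inverse (real (Suc (Suc n)))) *\<^sub>R x + inverse (real (Suc (Suc n))) *\<^sub>R p \<in> K'" for n
      by (rule seg) (auto simp: field_simps)
    ultimately have "x \<in> closure K'"
      unfolding closure_sequential by (intro exI conjI) auto
    then show "x \<in> frontier K'"
      using nx oK' by (simp add: frontier_def interior_open K'_def)
  qed
  then have "negligible {x. hyp_proj \<nu> c x \<in> A}"
    using negligible_convex_frontier[OF cK'] negligible_subset by blast
  then show False using negligible_imp_hyp_null[OF A(1)] A(3) by simp
qed

lemma facet_hyperplane:
  assumes K: "open K" "convex K" and \<sigma>: "\<sigma> \<subseteq> frontier K" "flat \<sigma>" "0 < surf_meas \<sigma>"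
  obtains \<nu> c where "norm \<nu> = 1" "\<sigma> \<subseteq> {x. \<nu> \<bullet> x = c}" "surf \<sigma> = completion (hyp_borel \<nu> c)"
    "\<And>x. x \<in> K \<Longrightarrow> \<nu> \<bullet> x \<noteq> c"
proof -
  obtain \<nu> c where \<nu>: "norm \<nu> = 1" "\<sigma> \<subseteq> {x. \<nu> \<bullet> x = c}" "surf \<sigma> = completion (hyp_borel \<nu> c)"
    using surf_flat[OF \<sigma>(2)] .
  note mp = main_part_flat[OF \<nu>(3) \<sigma>(3)]
  have "\<nu> \<bullet> x \<noteq> c" if "x \<in> K" for x
    by (rule hyperplane_disjoint_convex[OF \<nu>(1) mp(3) _ _ K _ that]) (use mp \<nu> \<sigma> in auto)
  with \<nu> show thesis by (rule that)
qed

section \<open>Mean values of traces\<close>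

lemma trace_mean_integral:
  assumes "trace_mean K \<sigma> u a" "0 < surf_meas \<sigma>"
  obtains g where "trace_on K \<sigma> u g" "set_lebesgue_integral (surf \<sigma>) \<sigma> g = a * surf_meas \<sigma>"
  using assms by (auto simp: trace_mean_def)

text \<open>The cone limit is linear in the function: the weighted integrals of \<open>u\<close> and
  \<open>v\<close> differ by those of \<open>u - v\<close>, which tend to 0.\<close>

lemma trace_mean_eq:
  assumes K: "open K" "bounded K" "convex K"
    and \<sigma>: "\<sigma> \<subseteq> frontier K" "flat \<sigma>" "0 < surf_meas \<sigma>"
    and u: "trace_mean K \<sigma> u a" and v: "trace_mean K \<sigma> v b"
    and 0: "trace_on K \<sigma> (\<lambda>x. u x - v x) (\<lambda>_. 0)"
  shows "a = b"
proof -
  obtain \<nu> c where \<nu>: "norm \<nu> = 1" "\<sigma> \<subseteq> {x. \<nu> \<bullet> x = c}" "surf \<sigma> = completion (hyp_borel \<nu> c)"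
    "\<And>x. x \<in> K \<Longrightarrow> \<nu> \<bullet> x \<noteq> c"
    using facet_hyperplane[OF K(1,3) \<sigma>] by blast
  have "K \<noteq> {}" using \<sigma> by (auto simp: surf_meas_def)
  then obtain z where z: "z \<in> K" by auto
  have \<sigma>c: "\<sigma> \<subseteq> closure K" using \<sigma>(1) by (auto simp: frontier_def)
  obtain g where g: "trace_on K \<sigma> u g" "set_lebesgue_integral (surf \<sigma>) \<sigma> g = a * surf_meas \<sigma>"
    using trace_mean_integral[OF u \<sigma>(3)] .
  obtain h where h: "trace_on K \<sigma> v h" "set_lebesgue_integral (surf \<sigma>) \<sigma> h = b * surf_meas \<sigma>"
    using trace_mean_integral[OF v \<sigma>(3)] .
  note lim = trace_cone_limit[OF K z \<sigma>c \<nu>(2,3) \<sigma>(3) \<nu>(1) \<nu>(4)[OF z]]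
  note lg = lim[OF g(1)] and lh = lim[OF h(1)] and l0 = lim[OF 0]
  from tendsto_diff[OF lg(2) lh(2)]
  have "(\<lambda>k. LINT x|lebesgue_on K. indicator (open_cone z (main_part (hyp_borel \<nu> c) \<sigma>)) x *
      (cone_par \<nu> c z x ^ k * real (DIM('a) + k)) * (u x - v x)) \<longlonglongrightarrow>
      \<bar>c - \<nu> \<bullet> z\<bar> * set_lebesgue_integral (surf \<sigma>) \<sigma> g - \<bar>c - \<nu> \<bullet> z\<bar> * set_lebesgue_integral (surf \<sigma>) \<sigma> h"
    unfolding Bochner_Integration.integral_diff[OF lg(1) lh(1), symmetric] by (simp only: right_diff_distrib)
  from LIMSEQ_unique[OF this l0(2)]
  show ?thesis using \<nu>(4)[OF z] \<sigma>(3) g(2) h(2) by (auto simp: set_lebesgue_integral_def)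
qed

lemma trace_on_zero:
  assumes "open K" "trace_on K \<sigma> u g" "0 < surf_meas \<sigma>"
  shows "trace_on K \<sigma> (\<lambda>x. 0) (\<lambda>_. 0)"
proof -
  have 1: "weak_gradient K (\<lambda>x. 0) (\<lambda>x. 0)" by (simp add: weak_gradient_def L2_def)
  have 2: "C1_gradient (\<lambda>_::'a. 0) (\<lambda>_. 0)" by (simp add: C1_gradient_def GDERIV_const)
  show ?thesis
    unfolding trace_on_def
    by (intro conjI exI[of _ "\<lambda>x. 0"] exI[of _ "\<lambda>_ x. 0"]) (auto simp: 1 2 L2_def)
qed

text \<open>\<open>trace_mean\<close> is a relation; its uniqueness is what makes the Dirichlet
  values of the scheme the same at all time levels.\<close>

lemma trace_mean_unique:
  assumes K: "open K" "bounded K" "convex K"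
    and \<sigma>: "\<sigma> \<subseteq> frontier K" "flat \<sigma>" "0 < surf_meas \<sigma>"
    and u: "trace_mean K \<sigma> u a" "trace_mean K \<sigma> u b"
  shows "a = b"
proof (rule trace_mean_eq[OF K \<sigma> u])
  obtain g where "trace_on K \<sigma> u g" using u(1) by (auto simp: trace_mean_def)
  then show "trace_on K \<sigma> (\<lambda>x. u x - u x) (\<lambda>_. 0)" using trace_on_zero[OF K(1) _ \<sigma>(3)] by simp
qed

text \<open>The weights of the cone limit are nonnegative and their total mass does not depend on
  \<open>k\<close>. Bounds on \<open>u\<close> thus pass to the weighted integrals and then to their
  limit.\<close>

lemma trace_mean_bounds:
  assumes K: "open K" "bounded K" "convex K"
    and \<sigma>: "\<sigma> \<subseteq> frontier K" "flat \<sigma>" "0 < surf_meas \<sigma>"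
    and u: "trace_mean K \<sigma> u a" and ae: "AE x in lebesgue_on K. m \<le> u x \<and> u x \<le> M"
  shows "m \<le> a" "a \<le> M"
proof -
  obtain \<nu> c where \<nu>: "norm \<nu> = 1" "\<sigma> \<subseteq> {x. \<nu> \<bullet> x = c}" "surf \<sigma> = completion (hyp_borel \<nu> c)"
    "\<And>x. x \<in> K \<Longrightarrow> \<nu> \<bullet> x \<noteq> c"
    using facet_hyperplane[OF K(1,3) \<sigma>] by blast
  have "K \<noteq> {}" using \<sigma> by (auto simp: surf_meas_def)
  then obtain z where z: "z \<in> K" by auto
  have \<sigma>c: "\<sigma> \<subseteq> closure K" using \<sigma>(1) by (auto simp: frontier_def)
  obtain g where g: "trace_on K \<sigma> u g" "set_lebesgue_integral (surf \<sigma>) \<sigma> g = a * surf_meas \<sigma>"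
    using trace_mean_integral[OF u \<sigma>(3)] .
  note lim = trace_cone_limit[OF K z \<sigma>c \<nu>(2,3) \<sigma>(3) \<nu>(1) \<nu>(4)[OF z] g(1), unfolded g(2)]
  let ?A = "main_part (hyp_borel \<nu> c) \<sigma>"
  note mp = main_part_flat[OF \<nu>(3) \<sigma>(3)]
  have A: "?A \<in> sets borel" "bounded ?A" "?A \<subseteq> {x. \<nu> \<bullet> x = c}" "?A \<subseteq> closure K"
    using mp \<nu> \<sigma>c K(2) bounded_subset[OF bounded_closure[OF K(2)]] by auto
  have CK: "open_cone z ?A \<subseteq> K" by (rule open_cone_subset_convex[OF K(1,3) z A(4)])
  have C[measurable]: "open_cone z ?A \<in> sets borel" by (rule open_cone_borel[OF A(3) \<nu>(4)[OF z] A(1)])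
  let ?b = "\<lambda>k x. indicator (open_cone z ?A) x * (cone_par \<nu> c z x ^ k * real (DIM('a) + k))"
  have bm: "set_borel_measurable borel (open_cone z ?A) (\<lambda>x. cone_par \<nu> c z x ^ k * real (DIM('a) + k))" for k
    unfolding set_borel_measurable_def by measurable
  note cone = measure_open_cone[OF \<nu>(1) \<nu>(4)[OF z] A(1-3)]
  note tr = integral_lebesgue_on_borel[OF K(1) CK C bm]
  have ib: "integrable (lebesgue_on K) (?b k)" for k using tr(2) cone(3) by blast
  have Ib: "(LINT x|lebesgue_on K. ?b k x) = \<bar>c - \<nu> \<bullet> z\<bar> * surf_meas \<sigma>" for k
    using tr(1) cone(1)[of k] mp(4) by simp
  have pos: "0 \<le> ?b k x" for k x
    using open_cone_eq[OF A(3) \<nu>(4)[OF z]] by (auto simp: indicator_def)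
  have lo: "m * (\<bar>c - \<nu> \<bullet> z\<bar> * surf_meas \<sigma>) \<le> (LINT x|lebesgue_on K. ?b k x * u x)" for k
  proof -
    have "(LINT x|lebesgue_on K. m * ?b k x) \<le> (LINT x|lebesgue_on K. ?b k x * u x)"
    proof (rule integral_mono_AE)
      show "AE x in lebesgue_on K. m * ?b k x \<le> ?b k x * u x"
        using ae
      proof eventually_elim
        case (elim x)
        then have "m * ?b k x \<le> u x * ?b k x" using pos by (intro mult_right_mono) auto
        then show ?case by (simp add: mult.commute)
      qed
    qed (use ib lim(1) in auto)
    then show ?thesis using ib Ib by simp
  qed
  have hi: "(LINT x|lebesgue_on K. ?b k x * u x) \<le> M * (\<bar>c - \<nu> \<bullet> z\<bar> * surf_meas \<sigma>)" for k
  proof -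
    have "(LINT x|lebesgue_on K. ?b k x * u x) \<le> (LINT x|lebesgue_on K. M * ?b k x)"
    proof (rule integral_mono_AE)
      show "AE x in lebesgue_on K. ?b k x * u x \<le> M * ?b k x"
        using ae
      proof eventually_elim
        case (elim x)
        then have "u x * ?b k x \<le> M * ?b k x" using pos by (intro mult_right_mono) auto
        then show ?case by (simp add: mult.commute)
      qed
    qed (use ib lim(1) in auto)
    then show ?thesis using ib Ib by simp
  qed
  have e: "0 < \<bar>c - \<nu> \<bullet> z\<bar> * surf_meas \<sigma>" using \<nu>(4)[OF z] \<sigma>(3) by simp
  have "m * (\<bar>c - \<nu> \<bullet> z\<bar> * surf_meas \<sigma>) \<le> \<bar>c - \<nu> \<bullet> z\<bar> * (a * surf_meas \<sigma>)"
    by (rule LIMSEQ_le_const[OF lim(2)]) (use lo in auto)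
  then show "m \<le> a" using e by (simp add: mult_le_cancel_right mult.left_commute[of "\<bar>c - \<nu> \<bullet> z\<bar>" a] not_less)
  have "\<bar>c - \<nu> \<bullet> z\<bar> * (a * surf_meas \<sigma>) \<le> M * (\<bar>c - \<nu> \<bullet> z\<bar> * surf_meas \<sigma>)"
    by (rule LIMSEQ_le_const2[OF lim(2)]) (use hi in auto)
  then show "a \<le> M" using e by (simp add: mult_le_cancel_right mult.left_commute[of "\<bar>c - \<nu> \<bullet> z\<bar>" a] not_less)
qed

section \<open>Poincare and trace inequalities for smooth functions\<close>

lemma nn_integral_square_le:
  assumes [measurable]: "h \<in> borel_measurable M"
  shows "(\<integral>\<^sup>+x. h x \<partial>M)\<^sup>2 \<le> emeasure M (space M) * (\<integral>\<^sup>+x. (h x)\<^sup>2 \<partial>M)"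
proof -
  have "(\<integral>\<^sup>+x. 1 * h x \<partial>M)\<^sup>2 \<le> (\<integral>\<^sup>+x. 1\<^sup>2 \<partial>M) * (\<integral>\<^sup>+x. (h x)\<^sup>2 \<partial>M)"
    by (rule Cauchy_Schwarz_nn_integral) auto
  then show ?thesis by simp
qed

section \<open>Means over two sets and the Poincare inequality on segments\<close>

definition avg :: "'a::euclidean_space set \<Rightarrow> ('a \<Rightarrow> real) \<Rightarrow> real" where
  "avg A f = integral\<^sup>L (restrict_space lborel A) f / measure lborel A"

text \<open>Fundamental theorem of calculus along the segment, then Cauchy-Schwarz in the
  parameter.\<close>

lemma C1_gradient_segment:
  assumes \<phi>: "C1_gradient \<phi> D\<phi>" and D: "norm (y - z) \<le> D"
  shows "ennreal ((\<phi> y - \<phi> z)\<^sup>2) \<le>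
    ennreal (D\<^sup>2) * (\<integral>\<^sup>+t. ennreal ((norm (D\<phi> (z + t *\<^sub>R (y - z))))\<^sup>2) * indicator {0..1} t \<partial>lborel)"
proof -
  have cont: "continuous_on UNIV D\<phi>" using C1_gradient_continuous[OF \<phi>] by simp
  have [measurable]: "D\<phi> \<in> borel_measurable borel" using cont by (rule borel_measurable_continuous_onI)
  define F where "F = (\<lambda>t. D\<phi> (z + t *\<^sub>R (y - z)) \<bullet> (y - z))"
  have cF: "continuous_on {0..1} F" unfolding F_def
    by (intro continuous_intros continuous_on_compose2[OF cont]) auto
  have eq: "(\<integral>t. indicator {0..1} t *\<^sub>R F t \<partial>lborel) = \<phi> y - \<phi> z"
    using integral_FTC_atLeastAtMost[of 0 1 "\<lambda>t. \<phi> (z + t *\<^sub>R (y - z))" F] C1_gradient_ray[OF \<phi>, of z "y - z"] cF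
    by (simp add: F_def)
  have int: "integrable lborel (\<lambda>t. indicator {0..1} t *\<^sub>R F t)"
    using borel_integrable_atLeastAtMost'[OF cF] by (simp add: set_integrable_def)
  have "ennreal \<bar>\<phi> y - \<phi> z\<bar> \<le> (\<integral>\<^sup>+t. norm (indicator {0..1} t *\<^sub>R F t) \<partial>lborel)"
    using integral_norm_bound_ennreal[OF int] unfolding eq by simp
  then have "(ennreal \<bar>\<phi> y - \<phi> z\<bar>)\<^sup>2 \<le> (\<integral>\<^sup>+t. norm (indicator {0..1} t *\<^sub>R F t) \<partial>lborel)\<^sup>2"
    by (rule power_mono) simp
  also have "(\<integral>\<^sup>+t. norm (indicator {0..1} t *\<^sub>R F t) \<partial>lborel) =
    (\<integral>\<^sup>+t. indicator {0..1} t * (ennreal \<bar>F t\<bar> * indicator {0..1} t) \<partial>lborel)"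
    by (intro nn_integral_cong) (auto simp: indicator_def)
  also have "\<dots>\<^sup>2 \<le> (\<integral>\<^sup>+t. (indicator {0..1::real} t)\<^sup>2 \<partial>lborel) * (\<integral>\<^sup>+t. (ennreal \<bar>F t\<bar> * indicator {0..1} t)\<^sup>2 \<partial>lborel)"
    by (rule Cauchy_Schwarz_nn_integral) (auto simp: F_def)
  also have "(\<integral>\<^sup>+t. (indicator {0..1::real} t)\<^sup>2 \<partial>lborel) = (\<integral>\<^sup>+t. indicator {0..1} (t::real) \<partial>lborel)"
    by (intro nn_integral_cong) (auto simp: indicator_def)
  also have "\<dots> = 1" by simp
  also have "1 * (\<integral>\<^sup>+t. (ennreal \<bar>F t\<bar> * indicator {0..1} t)\<^sup>2 \<partial>lborel) \<le>
    (\<integral>\<^sup>+t. ennreal (D\<^sup>2) * (ennreal ((norm (D\<phi> (z + t *\<^sub>R (y - z))))\<^sup>2) * indicator {0..1} t) \<partial>lborel)"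
    unfolding mult_1
  proof (intro nn_integral_mono)
    fix t
    have "\<bar>F t\<bar> \<le> norm (D\<phi> (z + t *\<^sub>R (y - z))) * norm (y - z)"
      unfolding F_def by (rule Cauchy_Schwarz_ineq2)
    also have "\<dots> \<le> norm (D\<phi> (z + t *\<^sub>R (y - z))) * D" by (intro mult_left_mono D) auto
    finally have "\<bar>F t\<bar>\<^sup>2 \<le> (D * norm (D\<phi> (z + t *\<^sub>R (y - z))))\<^sup>2"
      by (intro power_mono) (auto simp: mult.commute)
    then have "ennreal (\<bar>F t\<bar>\<^sup>2) \<le> ennreal (D\<^sup>2 * (norm (D\<phi> (z + t *\<^sub>R (y - z))))\<^sup>2)"
      by (intro ennreal_leI) (simp add: power_mult_distrib)
    then show "(ennreal \<bar>F t\<bar> * indicator {0..1} t)\<^sup>2 \<le>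
      ennreal (D\<^sup>2) * (ennreal ((norm (D\<phi> (z + t *\<^sub>R (y - z))))\<^sup>2) * indicator {0..1} t)"
      by (auto simp: indicator_def ennreal_power ennreal_mult)
  qed
  also have "\<dots> = ennreal (D\<^sup>2) * (\<integral>\<^sup>+t. ennreal ((norm (D\<phi> (z + t *\<^sub>R (y - z))))\<^sup>2) * indicator {0..1} t \<partial>lborel)"
    by (rule nn_integral_cmult) measurable
  finally show ?thesis by (simp add: ennreal_power)
qed

text \<open>Averaging over the endpoint that is weighted by at least 1/2 costs at most a factor \<open>2\<^sup>d\<close>.\<close>

lemma nn_integral_contraction:
  fixes f :: "'a::euclidean_space \<Rightarrow> ennreal"
  assumes [measurable]: "f \<in> borel_measurable borel" "S \<in> sets borel" "B \<in> sets borel"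
    and s: "1/2 \<le> s" and sub: "\<And>x. x \<in> B \<Longrightarrow> a + s *\<^sub>R x \<in> S"
  shows "(\<integral>\<^sup>+x\<in>B. f (a + s *\<^sub>R x) \<partial>lborel) \<le> 2 ^ DIM('a) * (\<integral>\<^sup>+x\<in>S. f x \<partial>lborel)"
proof -
  have "(\<integral>\<^sup>+x\<in>B. f (a + s *\<^sub>R x) \<partial>lborel) \<le> (\<integral>\<^sup>+x. f (a + s *\<^sub>R x) * indicator S (a + s *\<^sub>R x) \<partial>lborel)"
    using sub by (intro nn_integral_mono) (auto simp: indicator_def)
  also have "\<dots> \<le> 2 ^ DIM('a) * (ennreal (\<bar>s\<bar> ^ DIM('a)) * (\<integral>\<^sup>+x. f (a + s *\<^sub>R x) * indicator S (a + s *\<^sub>R x) \<partial>lborel))"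
  proof -
    have "1 \<le> (2 * s) ^ DIM('a)" using s by (intro one_le_power) simp
    then have "ennreal 1 \<le> ennreal (2 ^ DIM('a) * \<bar>s\<bar> ^ DIM('a))"
      using s by (intro ennreal_leI) (simp add: power_mult_distrib)
    then have "1 \<le> 2 ^ DIM('a) * ennreal (\<bar>s\<bar> ^ DIM('a))"
      by (simp add: ennreal_mult ennreal_power[symmetric])
    from mult_right_mono[OF this, of "\<integral>\<^sup>+x. f (a + s *\<^sub>R x) * indicator S (a + s *\<^sub>R x) \<partial>lborel"]
    show ?thesis by (simp add: mult.assoc)
  qed
  also have "ennreal (\<bar>s\<bar> ^ DIM('a)) * (\<integral>\<^sup>+x. f (a + s *\<^sub>R x) * indicator S (a + s *\<^sub>R x) \<partial>lborel) = (\<integral>\<^sup>+x\<in>S. f x \<partial>lborel)"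
    by (rule nn_integral_lborel_scale[symmetric]) (use s in auto)
  finally show ?thesis .
qed

lemma integral_restrict_lborel:
  fixes f :: "'a::euclidean_space \<Rightarrow> real"
  assumes "A \<in> sets borel"
  shows "integral\<^sup>L (restrict_space lborel A) f = (LINT x:A|lborel. f x)"
  using assms by (simp add: integral_restrict_space set_lebesgue_integral_def)

lemma finite_measure_restrict_lborel:
  "A \<in> sets borel \<Longrightarrow> emeasure lborel A < \<infinity> \<Longrightarrow> finite_measure (restrict_space lborel A)"
  by (intro finite_measureI) (simp add: emeasure_restrict_space)

text \<open>With the denominators cleared, the difference of the means is a double integral of
  \<open>\<phi> y - \<phi> z\<close>, the quantity that the segment estimate controls.\<close>

lemma avg_diff_nn_bound:
  fixes \<phi> :: "'a::euclidean_space \<Rightarrow> real"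
  assumes A: "A \<in> sets borel" "emeasure lborel A < \<infinity>" and B: "B \<in> sets borel" "emeasure lborel B < \<infinity>"
    and iA: "integrable (restrict_space lborel A) \<phi>" and iB: "integrable (restrict_space lborel B) \<phi>"
  shows "ennreal \<bar>measure lborel B * integral\<^sup>L (restrict_space lborel A) \<phi> - measure lborel A * integral\<^sup>L (restrict_space lborel B) \<phi>\<bar>
     \<le> (\<integral>\<^sup>+y. \<integral>\<^sup>+z. ennreal \<bar>\<phi> y - \<phi> z\<bar> \<partial>restrict_space lborel B \<partial>restrict_space lborel A)"
proof -
  interpret A: finite_measure "restrict_space lborel A" by (rule finite_measure_restrict_lborel[OF A])
  interpret B: finite_measure "restrict_space lborel B" by (rule finite_measure_restrict_lborel[OF B])
  have mA: "measure (restrict_space lborel A) (space (restrict_space lborel A)) = measure lborel A"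
    "measure (restrict_space lborel B) (space (restrict_space lborel B)) = measure lborel B"
    using A B by (auto simp: measure_def emeasure_restrict_space)
  define h where "h = (\<lambda>y. measure lborel B * \<phi> y - integral\<^sup>L (restrict_space lborel B) \<phi>)"
  have ih: "integrable (restrict_space lborel A) h" unfolding h_def using iA by simp
  have "integral\<^sup>L (restrict_space lborel A) h = measure lborel B * integral\<^sup>L (restrict_space lborel A) \<phi> - measure lborel A * integral\<^sup>L (restrict_space lborel B) \<phi>"
    unfolding h_def using iA by (simp add: mA mult.commute)
  then have "ennreal \<bar>measure lborel B * integral\<^sup>L (restrict_space lborel A) \<phi> - measure lborel A * integral\<^sup>L (restrict_space lborel B) \<phi>\<bar>
    \<le> (\<integral>\<^sup>+y. ennreal \<bar>h y\<bar> \<partial>restrict_space lborel A)"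
    using integral_norm_bound_ennreal[OF ih] by simp
  also have "\<dots> \<le> (\<integral>\<^sup>+y. \<integral>\<^sup>+z. ennreal \<bar>\<phi> y - \<phi> z\<bar> \<partial>restrict_space lborel B \<partial>restrict_space lborel A)"
  proof (intro nn_integral_mono)
    fix y
    have i: "integrable (restrict_space lborel B) (\<lambda>z. \<phi> y - \<phi> z)" using iB by simp
    have "integral\<^sup>L (restrict_space lborel B) (\<lambda>z. \<phi> y - \<phi> z) = h y"
      unfolding h_def using iB by (simp add: mA mult.commute)
    then show "ennreal \<bar>h y\<bar> \<le> (\<integral>\<^sup>+z. ennreal \<bar>\<phi> y - \<phi> z\<bar> \<partial>restrict_space lborel B)"
      using integral_norm_bound_ennreal[OF i] by simp
  qed
  finally show ?thesis .
qed

text \<open>The parameter is split at 1/2. For \<open>t \<le> 1/2\<close> and fixed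
  \<open>y\<close>, the point of the segment is an affine function of \<open>z\<close> with factor
  \<open>1 - t \<ge> 1/2\<close>, so \<open>nn_integral_contraction\<close> applies in
  \<open>z\<close>; for \<open>t \<ge> 1/2\<close> the roles of \<open>y\<close> and
  \<open>z\<close> are exchanged. The first case contributes the volume of \<open>A\<close>, the
  second that of \<open>B\<close>. The set \<open>S\<close> only has to be Borel and to contain the
  segments.\<close>

lemma nn_poincare:
  fixes \<phi> :: "'a::euclidean_space \<Rightarrow> real"
  assumes \<phi>: "C1_gradient \<phi> D\<phi>"
    and A: "A \<in> sets borel" "emeasure lborel A < \<infinity>" and B: "B \<in> sets borel" "emeasure lborel B < \<infinity>"
    and S: "S \<in> sets borel" and seg: "\<And>y z t. y \<in> A \<Longrightarrow> z \<in> B \<Longrightarrow> 0 \<le> t \<Longrightarrow> t \<le> 1 \<Longrightarrow> z + t *\<^sub>R (y - z) \<in> S"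
    and D: "\<And>y z. y \<in> A \<Longrightarrow> z \<in> B \<Longrightarrow> norm (y - z) \<le> D"
  shows "(\<integral>\<^sup>+y. \<integral>\<^sup>+z. ennreal ((\<phi> y - \<phi> z)\<^sup>2) \<partial>restrict_space lborel B \<partial>restrict_space lborel A)
     \<le> ennreal (D\<^sup>2) * (2 ^ DIM('a) * (emeasure lborel A + emeasure lborel B)) * (\<integral>\<^sup>+x\<in>S. ennreal ((norm (D\<phi> x))\<^sup>2) \<partial>lborel)"
proof -
  note [measurable] = A(1) B(1) S
  define f where "f = (\<lambda>x. ennreal ((norm (D\<phi> x))\<^sup>2))"
  define I where "I = (\<integral>\<^sup>+x\<in>S. f x \<partial>lborel)"
  have [measurable]: "D\<phi> \<in> borel_measurable borel" "\<phi> \<in> borel_measurable borel"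
    using C1_gradient_continuous[OF \<phi>] by (auto intro: borel_measurable_continuous_onI)
  have [measurable]: "f \<in> borel_measurable borel" unfolding f_def by measurable
  define G where "G = (\<lambda>y z t. f (z + t *\<^sub>R (y - z)) * (indicator A y * indicator B z * indicator {0..1::real} t))"
  have "(\<integral>\<^sup>+y. \<integral>\<^sup>+z. ennreal ((\<phi> y - \<phi> z)\<^sup>2) \<partial>restrict_space lborel B \<partial>restrict_space lborel A) =
    (\<integral>\<^sup>+y. (\<integral>\<^sup>+z. ennreal ((\<phi> y - \<phi> z)\<^sup>2) * indicator B z \<partial>lborel) * indicator A y \<partial>lborel)"
    using A B by (simp add: nn_integral_restrict_space)
  also have "\<dots> = (\<integral>\<^sup>+y. (\<integral>\<^sup>+z. ennreal ((\<phi> y - \<phi> z)\<^sup>2) * indicator B z * indicator A y \<partial>lborel) \<partial>lborel)"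
    by (intro nn_integral_cong nn_integral_multc[symmetric]) measurable
  also have "\<dots> \<le> (\<integral>\<^sup>+y. (\<integral>\<^sup>+z. ennreal (D\<^sup>2) * (\<integral>\<^sup>+t. G y z t \<partial>lborel) \<partial>lborel) \<partial>lborel)"
  proof (intro nn_integral_mono)
    fix y z :: 'a
    show "ennreal ((\<phi> y - \<phi> z)\<^sup>2) * indicator B z * indicator A y \<le> ennreal (D\<^sup>2) * (\<integral>\<^sup>+t. G y z t \<partial>lborel)"
      using C1_gradient_segment[OF \<phi> D, of y z] by (auto simp: indicator_def G_def f_def)
  qed
  also have "\<dots> = (\<integral>\<^sup>+y. ennreal (D\<^sup>2) * (\<integral>\<^sup>+z. (\<integral>\<^sup>+t. G y z t \<partial>lborel) \<partial>lborel) \<partial>lborel)"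
    unfolding G_def by (intro nn_integral_cong nn_integral_cmult) measurable
  also have "\<dots> = ennreal (D\<^sup>2) * (\<integral>\<^sup>+y. (\<integral>\<^sup>+z. (\<integral>\<^sup>+t. G y z t \<partial>lborel) \<partial>lborel) \<partial>lborel)"
    unfolding G_def by (intro nn_integral_cmult) measurable
  finally have 1: "(\<integral>\<^sup>+y. \<integral>\<^sup>+z. ennreal ((\<phi> y - \<phi> z)\<^sup>2) \<partial>restrict_space lborel B \<partial>restrict_space lborel A) \<le>
    ennreal (D\<^sup>2) * (\<integral>\<^sup>+y. (\<integral>\<^sup>+z. (\<integral>\<^sup>+t. G y z t \<partial>lborel) \<partial>lborel) \<partial>lborel)" .
  have "(\<integral>\<^sup>+y. (\<integral>\<^sup>+z. (\<integral>\<^sup>+t. G y z t \<partial>lborel) \<partial>lborel) \<partial>lborel) =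
    (\<integral>\<^sup>+y. (\<integral>\<^sup>+t. (\<integral>\<^sup>+z. G y z t \<partial>lborel) \<partial>lborel) \<partial>lborel)"
    unfolding G_def by (intro nn_integral_cong lborel_pair.Fubini') measurable
  also have "\<dots> = (\<integral>\<^sup>+t. (\<integral>\<^sup>+y. (\<integral>\<^sup>+z. G y z t \<partial>lborel) \<partial>lborel) \<partial>lborel)"
    unfolding G_def by (rule lborel_pair.Fubini') measurable
  also have "\<dots> \<le> (\<integral>\<^sup>+t. 2 ^ DIM('a) * (emeasure lborel A + emeasure lborel B) * I * indicator {0..1::real} t \<partial>lborel)"
  proof (intro nn_integral_mono)
    fix t :: real
    have near: "(\<integral>\<^sup>+y. (\<integral>\<^sup>+z. G y z t \<partial>lborel) \<partial>lborel) \<le> emeasure lborel A * (2 ^ DIM('a) * I)"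
      if t: "0 \<le> t" "t \<le> 1/2"
    proof -
      have "(\<integral>\<^sup>+y. (\<integral>\<^sup>+z. G y z t \<partial>lborel) \<partial>lborel) \<le> (\<integral>\<^sup>+y. 2 ^ DIM('a) * I * indicator A y \<partial>lborel)"
      proof (intro nn_integral_mono)
        fix y :: 'a
        show "(\<integral>\<^sup>+z. G y z t \<partial>lborel) \<le> 2 ^ DIM('a) * I * indicator A y"
        proof (cases "y \<in> A")
          case True
          have "(\<integral>\<^sup>+z. G y z t \<partial>lborel) = (\<integral>\<^sup>+z\<in>B. f (t *\<^sub>R y + (1 - t) *\<^sub>R z) \<partial>lborel)"
            unfolding G_def using t True by (intro nn_integral_cong) (auto simp: indicator_def algebra_simps)
          also have "\<dots> \<le> 2 ^ DIM('a) * I" unfolding I_def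
          proof (rule nn_integral_contraction)
            show "t *\<^sub>R y + (1 - t) *\<^sub>R x \<in> S" if "x \<in> B" for x
              using seg[OF True that, of t] t by (simp add: algebra_simps)
          qed (use t in auto)
          finally show ?thesis using True by simp
        qed (simp add: G_def)
      qed
      also have "\<dots> = emeasure lborel A * (2 ^ DIM('a) * I)"
        by (subst nn_integral_cmult_indicator) (auto simp: mult.commute)
      finally show ?thesis .
    qed
    have far: "(\<integral>\<^sup>+y. (\<integral>\<^sup>+z. G y z t \<partial>lborel) \<partial>lborel) \<le> emeasure lborel B * (2 ^ DIM('a) * I)"
      if t: "1/2 \<le> t" "t \<le> 1"
    proof -
      have "(\<integral>\<^sup>+y. (\<integral>\<^sup>+z. G y z t \<partial>lborel) \<partial>lborel) = (\<integral>\<^sup>+z. (\<integral>\<^sup>+y. G y z t \<partial>lborel) \<partial>lborel)"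
        unfolding G_def by (rule lborel_pair.Fubini') measurable
      also have "\<dots> \<le> (\<integral>\<^sup>+z. 2 ^ DIM('a) * I * indicator B z \<partial>lborel)"
      proof (intro nn_integral_mono)
        fix z :: 'a
        show "(\<integral>\<^sup>+y. G y z t \<partial>lborel) \<le> 2 ^ DIM('a) * I * indicator B z"
        proof (cases "z \<in> B")
          case True
          have "(\<integral>\<^sup>+y. G y z t \<partial>lborel) = (\<integral>\<^sup>+y\<in>A. f ((1 - t) *\<^sub>R z + t *\<^sub>R y) \<partial>lborel)"
            unfolding G_def using t True by (intro nn_integral_cong) (auto simp: indicator_def algebra_simps)
          also have "\<dots> \<le> 2 ^ DIM('a) * I" unfolding I_def
          proof (rule nn_integral_contraction)
            show "(1 - t) *\<^sub>R z + t *\<^sub>R x \<in> S" if "x \<in> A" for x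
              using seg[OF that True, of t] t by (simp add: algebra_simps)
          qed (use t in auto)
          finally show ?thesis using True by simp
        qed (simp add: G_def)
      qed
      also have "\<dots> = emeasure lborel B * (2 ^ DIM('a) * I)"
        by (subst nn_integral_cmult_indicator) (auto simp: mult.commute)
      finally show ?thesis .
    qed
    show "(\<integral>\<^sup>+y. (\<integral>\<^sup>+z. G y z t \<partial>lborel) \<partial>lborel) \<le>
      2 ^ DIM('a) * (emeasure lborel A + emeasure lborel B) * I * indicator {0..1} t"
    proof -
      consider "0 \<le> t" "t \<le> 1/2" | "1/2 \<le> t" "t \<le> 1" | "t \<notin> {0..1}" by fastforce
      then show ?thesis
      proof cases
        case 1
        have "emeasure lborel A * (2 ^ DIM('a) * I) \<le> (emeasure lborel A + emeasure lborel B) * (2 ^ DIM('a) * I)"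
          by (intro mult_right_mono) auto
        then show ?thesis using near[OF 1] 1 by (auto simp: ac_simps)
      next
        case 2
        have "emeasure lborel B * (2 ^ DIM('a) * I) \<le> (emeasure lborel A + emeasure lborel B) * (2 ^ DIM('a) * I)"
          by (intro mult_right_mono) auto
        then show ?thesis using far[OF 2] 2 by (auto simp: ac_simps)
      next
        case 3
        then have "indicator {0..1} t = (0::ennreal)" by simp
        then show ?thesis by (simp add: G_def)
      qed
    qed
  qed
  also have "\<dots> = 2 ^ DIM('a) * (emeasure lborel A + emeasure lborel B) * I"
    by (subst nn_integral_cmult_indicator) auto
  finally have 2: "(\<integral>\<^sup>+y. (\<integral>\<^sup>+z. (\<integral>\<^sup>+t. G y z t \<partial>lborel) \<partial>lborel) \<partial>lborel) \<le>
    2 ^ DIM('a) * (emeasure lborel A + emeasure lborel B) * I" .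
  show ?thesis
    using order_trans[OF 1 mult_left_mono[OF 2, of "ennreal (D\<^sup>2)"]]
    unfolding I_def f_def by (simp add: ac_simps)
qed

lemma ennreal_square_scale:
  assumes "ennreal ((k * x)\<^sup>2) \<le> ennreal (k\<^sup>2 * b) * I" "k \<noteq> 0" "0 \<le> b"
  shows "ennreal (x\<^sup>2) \<le> ennreal b * I"
proof -
  have "ennreal (x\<^sup>2) = ennreal (1 / k\<^sup>2) * ennreal ((k * x)\<^sup>2)"
    using assms(2) by (simp add: ennreal_mult[symmetric] power_mult_distrib)
  also have "\<dots> \<le> ennreal (1 / k\<^sup>2) * (ennreal (k\<^sup>2 * b) * I)"
    by (rule mult_left_mono[OF assms(1)]) simp
  also have "\<dots> = ennreal b * I"
    using assms(2,3) by (simp add: mult.assoc[symmetric] ennreal_mult[symmetric])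
  finally show ?thesis .
qed

text \<open>With \<open>a\<close> and \<open>b\<close> the volumes of \<open>A\<close> and
  \<open>B\<close>, two uses of Cauchy-Schwarz cost \<open>a * b\<close>, \<open>nn_poincare\<close>
  contributes \<open>a + b\<close>, and dividing by \<open>(a * b)\<^sup>2\<close> leaves
  \<open>1 / a + 1 / b\<close>.\<close>

lemma avg_poincare:
  fixes \<phi> :: "'a::euclidean_space \<Rightarrow> real"
  assumes \<phi>: "C1_gradient \<phi> D\<phi>"
    and A: "A \<in> sets borel" "bounded A" "0 < measure lborel A"
    and B: "B \<in> sets borel" "bounded B" "0 < measure lborel B"
    and S: "S \<in> sets borel" and seg: "\<And>y z t. y \<in> A \<Longrightarrow> z \<in> B \<Longrightarrow> 0 \<le> t \<Longrightarrow> t \<le> 1 \<Longrightarrow> z + t *\<^sub>R (y - z) \<in> S"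
    and D: "\<And>y z. y \<in> A \<Longrightarrow> z \<in> B \<Longrightarrow> norm (y - z) \<le> D"
  shows "ennreal ((avg A \<phi> - avg B \<phi>)\<^sup>2) \<le>
    ennreal (D\<^sup>2 * 2 ^ DIM('a) * (1 / measure lborel A + 1 / measure lborel B)) * (\<integral>\<^sup>+x\<in>S. ennreal ((norm (D\<phi> x))\<^sup>2) \<partial>lborel)"
proof -
  define I where "I = (\<integral>\<^sup>+x\<in>S. ennreal ((norm (D\<phi> x))\<^sup>2) \<partial>lborel)"
  define a where "a = measure lborel A"
  define b where "b = measure lborel B"
  have ab: "0 < a" "0 < b" using A B by (auto simp: a_def b_def)
  have eA: "emeasure lborel A < \<infinity>" and eB: "emeasure lborel B < \<infinity>"
    using emeasure_bounded_finite[OF A(2)] emeasure_bounded_finite[OF B(2)] by auto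
  have ea: "emeasure lborel A = ennreal a" "emeasure lborel B = ennreal b"
    using eA eB by (auto simp: a_def b_def emeasure_eq_ennreal_measure)
  have cont: "continuous_on UNIV \<phi>" using C1_gradient_continuous[OF \<phi>] by simp
  have [measurable]: "\<phi> \<in> borel_measurable borel"
    using cont by (auto intro: borel_measurable_continuous_onI)
  have int: "integrable (restrict_space lborel E) \<phi>" if E: "E \<in> sets borel" "bounded E" for E
  proof -
    have "compact (closure E)" using E by simp
    then have "set_integrable lborel (closure E) \<phi>"
      unfolding set_integrable_def by (rule borel_integrable_compact) (auto intro: continuous_on_subset[OF cont])
    then have "set_integrable lborel E \<phi>"
      by (rule set_integrable_subset) (use E closure_subset in auto)
    then show ?thesis using E by (simp add: set_integrable_def integrable_restrict_space)
  qed
  define X where "X = b * integral\<^sup>L (restrict_space lborel A) \<phi> - a * integral\<^sup>L (restrict_space lborel B) \<phi>"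
  have X: "X = (a * b) * (avg A \<phi> - avg B \<phi>)" using ab by (simp add: X_def avg_def a_def b_def field_simps)
  interpret fA: finite_measure "restrict_space lborel A" by (rule finite_measure_restrict_lborel[OF A(1) eA])
  interpret fB: finite_measure "restrict_space lborel B" by (rule finite_measure_restrict_lborel[OF B(1) eB])
  have [measurable]: "\<phi> \<in> borel_measurable (restrict_space lborel A)" "\<phi> \<in> borel_measurable (restrict_space lborel B)"
    by (auto intro: measurable_restrict_space1)
  let ?A = "restrict_space lborel A" and ?B = "restrict_space lborel B"
  have sp: "emeasure ?A (space ?A) = ennreal a" "emeasure ?B (space ?B) = ennreal b"
    using A B by (auto simp: emeasure_restrict_space ea)
  have "ennreal (X\<^sup>2) = (ennreal \<bar>X\<bar>)\<^sup>2" by (simp add: ennreal_power)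
  also have "\<dots> \<le> (\<integral>\<^sup>+y. \<integral>\<^sup>+z. ennreal \<bar>\<phi> y - \<phi> z\<bar> \<partial>?B \<partial>?A)\<^sup>2"
    unfolding X_def a_def b_def
    by (rule power_mono[OF avg_diff_nn_bound[OF A(1) eA B(1) eB int[OF A(1,2)] int[OF B(1,2)]]]) simp
  also have "\<dots> \<le> ennreal a * (\<integral>\<^sup>+y. (\<integral>\<^sup>+z. ennreal \<bar>\<phi> y - \<phi> z\<bar> \<partial>?B)\<^sup>2 \<partial>?A)"
    unfolding sp(1)[symmetric] by (rule nn_integral_square_le) measurable
  also have "\<dots> \<le> ennreal a * (\<integral>\<^sup>+y. ennreal b * (\<integral>\<^sup>+z. (ennreal \<bar>\<phi> y - \<phi> z\<bar>)\<^sup>2 \<partial>?B) \<partial>?A)"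
    unfolding sp(2)[symmetric] by (intro mult_left_mono nn_integral_mono nn_integral_square_le) auto
  also have "\<dots> = ennreal a * (ennreal b * (\<integral>\<^sup>+y. (\<integral>\<^sup>+z. ennreal ((\<phi> y - \<phi> z)\<^sup>2) \<partial>?B) \<partial>?A))"
    by (subst nn_integral_cmult) (auto simp: ennreal_power)
  also have "\<dots> \<le> ennreal a * (ennreal b * (ennreal (D\<^sup>2) * (2 ^ DIM('a) * (emeasure lborel A + emeasure lborel B)) * I))"
    unfolding I_def by (intro mult_left_mono nn_poincare[OF \<phi> A(1) eA B(1) eB S seg D]) auto
  also have "\<dots> = ennreal ((a * b)\<^sup>2 * (D\<^sup>2 * 2 ^ DIM('a) * (1 / a + 1 / b))) * I"
  proof -
    have "(2::ennreal) ^ DIM('a) = ennreal (2 ^ DIM('a))" by (simp add: ennreal_power[symmetric])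
    then have "ennreal a * (ennreal b * (ennreal (D\<^sup>2) * (2 ^ DIM('a) * (emeasure lborel A + emeasure lborel B)) * I)) =
      ennreal (a * b * (D\<^sup>2 * 2 ^ DIM('a) * (a + b))) * I"
      using ab by (simp add: ea ennreal_mult ac_simps ennreal_plus[symmetric] del: ennreal_plus)
    also have "a * b * (D\<^sup>2 * 2 ^ DIM('a) * (a + b)) = (a * b)\<^sup>2 * (D\<^sup>2 * 2 ^ DIM('a) * (1 / a + 1 / b))"
      using ab by (simp add: field_simps power2_eq_square)
    finally show ?thesis .
  qed
  finally have "ennreal (((a * b) * (avg A \<phi> - avg B \<phi>))\<^sup>2) \<le> ennreal ((a * b)\<^sup>2 * (D\<^sup>2 * 2 ^ DIM('a) * (1 / a + 1 / b))) * I"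
    unfolding X .
  from ennreal_square_scale[OF this] ab show ?thesis by (simp add: I_def a_def b_def)
qed

section \<open>Mean over a flat set against the mean over a ball\<close>

definition hyp_avg :: "'a::euclidean_space \<Rightarrow> real \<Rightarrow> 'a set \<Rightarrow> ('a \<Rightarrow> real) \<Rightarrow> real" where
  "hyp_avg \<nu> c A f = (LINT q:A|hyp_borel \<nu> c. f q) / measure (hyp_borel \<nu> c) A"

text \<open>By the divergence identity with \<open>k = 0\<close> and the volume formula
  \<open>d * a = e * \<mu>\<close>, the two means differ exactly by the mean of
  \<open>D\<phi> x \<bullet> (x - z)\<close> over the cone, divided by \<open>d\<close>.
  Cauchy-Schwarz finishes; the factor \<open>1 / d\<^sup>2\<close> is discarded by
  \<open>1 \<le> d\<close>.\<close>

lemma hyp_avg_cone: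
  fixes \<phi> :: "'a::euclidean_space \<Rightarrow> real"
  assumes \<phi>: "C1_gradient \<phi> D\<phi>" and \<nu>: "norm \<nu> = 1" and z: "\<nu> \<bullet> z \<noteq> c"
    and A: "A \<in> sets borel" "A \<subseteq> {x. \<nu> \<bullet> x = c}" "0 < measure (hyp_borel \<nu> c) A"
    and R: "\<And>q. q \<in> A \<Longrightarrow> dist z q \<le> R"
    and S: "S \<in> sets borel" "open_cone z A \<subseteq> S"
  shows "ennreal ((hyp_avg \<nu> c A \<phi> - avg (open_cone z A) \<phi>)\<^sup>2) \<le>
    ennreal (R\<^sup>2 / measure lborel (open_cone z A)) * (\<integral>\<^sup>+x\<in>S. ennreal ((norm (D\<phi> x))\<^sup>2) \<partial>lborel)"
proof -
  define C where "C = open_cone z A"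
  define a where "a = measure lborel C"
  define e where "e = \<bar>c - \<nu> \<bullet> z\<bar>"
  define \<mu> where "\<mu> = measure (hyp_borel \<nu> c) A"
  define d where "d = real (DIM('a))"
  have bA: "bounded A" using R unfolding bounded_def by blast
  have C[measurable]: "C \<in> sets borel" unfolding C_def by (rule open_cone_borel[OF A(2) z A(1)])
  have da: "d * a = e * \<mu>"
    using measure_open_cone(2)[OF \<nu> z A(1) bA A(2)] by (simp add: d_def a_def C_def e_def \<mu>_def)
  have pos: "0 < e" "0 < \<mu>" "1 \<le> d" using z A(3) DIM_positive[where 'a='a] by (auto simp: e_def \<mu>_def d_def Suc_leI)
  have apos: "0 < a" using da pos by (metis mult_pos_pos zero_less_mult_pos less_le_trans zero_less_one)
  have Cb: "C \<subseteq> cball z R" unfolding C_def by (rule open_cone_subset_cball[OF R])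
  have fin: "emeasure lborel C < \<infinity>" by (rule emeasure_bounded_finite) (use Cb bounded_cball bounded_subset in blast)
  have cont: "continuous_on UNIV \<phi>" "continuous_on UNIV D\<phi>" using C1_gradient_continuous[OF \<phi>] by auto
  have [measurable]: "\<phi> \<in> borel_measurable borel" "D\<phi> \<in> borel_measurable borel"
    using cont by (auto intro: borel_measurable_continuous_onI)
  have int: "set_integrable lborel C f" if "continuous_on UNIV f" for f :: "'a \<Rightarrow> real"
  proof -
    have "set_integrable lborel (cball z R) f"
      unfolding set_integrable_def by (rule borel_integrable_compact) (auto intro: continuous_on_subset[OF that])
    then show ?thesis by (rule set_integrable_subset) (use Cb C in auto)
  qed
  define h where "h = (\<lambda>x. D\<phi> x \<bullet> (x - z))"
  have ch: "continuous_on UNIV h" unfolding h_def by (intro continuous_intros cont)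
  have [measurable]: "h \<in> borel_measurable borel" using ch by (rule borel_measurable_continuous_onI)
  have "(LINT x:C|lborel. d * \<phi> x + h x) = e * (LINT q:A|hyp_borel \<nu> c. \<phi> q)"
    using cone_divergence(2)[OF \<phi> \<nu> z A(1) bA A(2), of 0] by (simp add: C_def d_def h_def e_def)
  also have "(LINT x:C|lborel. d * \<phi> x + h x) = d * (LINT x:C|lborel. \<phi> x) + (LINT x:C|lborel. h x)"
    using int[OF cont(1)] int[OF ch] by (subst set_integral_add) auto
  finally have "(LINT x:C|lborel. h x) = e * (LINT q:A|hyp_borel \<nu> c. \<phi> q) - d * (LINT x:C|lborel. \<phi> x)" by simp
  also have "\<dots> = e * \<mu> * hyp_avg \<nu> c A \<phi> - d * a * avg C \<phi>"
    using pos apos by (simp add: hyp_avg_def avg_def \<mu>_def a_def integral_restrict_lborel[OF C])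
  finally have hX: "(LINT x:C|lborel. h x) = (d * a) * (hyp_avg \<nu> c A \<phi> - avg C \<phi>)" unfolding da[symmetric] by (simp add: algebra_simps)
  have "ennreal ((LINT x:C|lborel. h x)\<^sup>2) = (ennreal \<bar>LINT x|lborel. indicator C x *\<^sub>R h x\<bar>)\<^sup>2"
    by (simp add: ennreal_power set_lebesgue_integral_def)
  also have "\<dots> \<le> (\<integral>\<^sup>+x. ennreal (norm (indicator C x *\<^sub>R h x)) \<partial>lborel)\<^sup>2"
    using integral_norm_bound_ennreal[OF int[OF ch, unfolded set_integrable_def]] by (intro power_mono) auto
  also have "(\<integral>\<^sup>+x. ennreal (norm (indicator C x *\<^sub>R h x)) \<partial>lborel) = (\<integral>\<^sup>+x. indicator C x * (ennreal \<bar>h x\<bar> * indicator C x) \<partial>lborel)"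
    by (intro nn_integral_cong) (auto simp: indicator_def)
  also have "\<dots>\<^sup>2 \<le> (\<integral>\<^sup>+x. (indicator C x)\<^sup>2 \<partial>lborel) * (\<integral>\<^sup>+x. (ennreal \<bar>h x\<bar> * indicator C x)\<^sup>2 \<partial>lborel)"
    by (rule Cauchy_Schwarz_nn_integral) auto
  also have "(\<integral>\<^sup>+x. (indicator C x)\<^sup>2 \<partial>lborel) = (\<integral>\<^sup>+x. indicator C (x::'a) \<partial>lborel)"
    by (intro nn_integral_cong) (auto simp: indicator_def)
  also have "\<dots> = ennreal a" using fin by (simp add: a_def emeasure_eq_ennreal_measure)
  also have "ennreal a * (\<integral>\<^sup>+x. (ennreal \<bar>h x\<bar> * indicator C x)\<^sup>2 \<partial>lborel) \<le>
      ennreal a * (\<integral>\<^sup>+x. ennreal (R\<^sup>2) * (ennreal ((norm (D\<phi> x))\<^sup>2) * indicator S x) \<partial>lborel)"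
  proof (intro mult_left_mono nn_integral_mono)
    fix x
    show "(ennreal \<bar>h x\<bar> * indicator C x)\<^sup>2 \<le> ennreal (R\<^sup>2) * (ennreal ((norm (D\<phi> x))\<^sup>2) * indicator S x)"
    proof (cases "x \<in> C")
      case True
      then have xR: "norm (x - z) \<le> R" using Cb by (auto simp: dist_norm norm_minus_commute)
      have "\<bar>h x\<bar> \<le> norm (D\<phi> x) * norm (x - z)" unfolding h_def by (rule Cauchy_Schwarz_ineq2)
      also have "\<dots> \<le> norm (D\<phi> x) * R" by (intro mult_left_mono xR) auto
      finally have "\<bar>h x\<bar>\<^sup>2 \<le> (R * norm (D\<phi> x))\<^sup>2" by (intro power_mono) (auto simp: mult.commute)
      then have "ennreal (\<bar>h x\<bar>\<^sup>2) \<le> ennreal (R\<^sup>2 * (norm (D\<phi> x))\<^sup>2)"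
        by (intro ennreal_leI) (simp add: power_mult_distrib)
      then show ?thesis using True S(2) by (auto simp: C_def indicator_def ennreal_power ennreal_mult)
    qed simp
  qed simp
  also have "\<dots> = ennreal a * (ennreal (R\<^sup>2) * (\<integral>\<^sup>+x\<in>S. ennreal ((norm (D\<phi> x))\<^sup>2) \<partial>lborel))"
    using S(1) by (subst nn_integral_cmult) auto
  also have "\<dots> \<le> ennreal ((d * a)\<^sup>2 * (R\<^sup>2 / a)) * (\<integral>\<^sup>+x\<in>S. ennreal ((norm (D\<phi> x))\<^sup>2) \<partial>lborel)"
  proof -
    have "1 * (a * R\<^sup>2) \<le> d\<^sup>2 * (a * R\<^sup>2)" using pos(3) apos
      by (intro mult_right_mono) (auto simp: one_le_power)
    also have "\<dots> = (d * a)\<^sup>2 * (R\<^sup>2 / a)" using apos by (simp add: power2_eq_square)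
    finally have "ennreal (a * R\<^sup>2) \<le> ennreal ((d * a)\<^sup>2 * (R\<^sup>2 / a))" by (intro ennreal_leI) simp
    from mult_right_mono[OF this, of "\<integral>\<^sup>+x\<in>S. ennreal ((norm (D\<phi> x))\<^sup>2) \<partial>lborel"]
    show ?thesis using apos by (simp add: ennreal_mult mult.assoc)
  qed
  finally have sq: "ennreal (((d * a) * (hyp_avg \<nu> c A \<phi> - avg C \<phi>))\<^sup>2) \<le>
    ennreal ((d * a)\<^sup>2 * (R\<^sup>2 / a)) * (\<integral>\<^sup>+x\<in>S. ennreal ((norm (D\<phi> x))\<^sup>2) \<partial>lborel)"
    unfolding hX .
  have "d * a \<noteq> 0" "0 \<le> R\<^sup>2 / a" using pos apos by auto
  from ennreal_square_scale[OF sq this] show ?thesis by (simp add: C_def a_def)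
qed

text \<open>The constant of \<open>hyp_avg_ball\<close>. The summand 2 stems from the step from base
  to cone, \<open>8 * 2 ^ d\<close> from the step from cone to ball with segments of length at most
  \<open>2 * D\<close>, and \<open>1 / \<rho> ^ d\<close> from the volume ratio of the balls of
  radius \<open>D\<close> and \<open>\<rho> * D\<close>. The prefactor combines
  \<open>\<mu> / a = d / e\<close> with \<open>D \<le> e / \<rho>\<close>.\<close>

definition trace_const :: "nat \<Rightarrow> real \<Rightarrow> real" where
  "trace_const d \<rho> = real d / \<rho>\<^sup>2 * (2 + 8 * 2 ^ d * (1 + 1 / \<rho> ^ d))"

lemma trace_const_pos: "0 < d \<Longrightarrow> 0 < \<rho> \<Longrightarrow> 0 < trace_const d \<rho>"
  by (auto simp: trace_const_def intro!: mult_pos_pos divide_pos_pos add_pos_pos)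

text \<open>Via the mean over the cone with apex at the centre of the ball.\<close>

lemma hyp_avg_ball:
  fixes \<phi> :: "'a::euclidean_space \<Rightarrow> real"
  assumes \<phi>: "C1_gradient \<phi> D\<phi>" and \<nu>: "norm \<nu> = 1"
    and A: "A \<in> sets borel" "A \<subseteq> {x. \<nu> \<bullet> x = c}"
    and D: "0 < D" "\<And>q. q \<in> A \<Longrightarrow> dist z q \<le> D" and \<rho>: "0 < \<rho>" "\<rho> \<le> 1" "\<rho> * D \<le> \<bar>c - \<nu> \<bullet> z\<bar>"
    and S: "S \<in> sets borel"
    and seg: "\<And>y p t. y \<in> open_cone z A \<Longrightarrow> p \<in> ball z (\<rho> * D) \<Longrightarrow> 0 \<le> t \<Longrightarrow> t \<le> 1 \<Longrightarrow> p + t *\<^sub>R (y - p) \<in> S"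
  shows "ennreal (measure (hyp_borel \<nu> c) A * (hyp_avg \<nu> c A \<phi> - avg (ball z (\<rho> * D)) \<phi>)\<^sup>2) \<le>
    ennreal (\<bar>c - \<nu> \<bullet> z\<bar> * trace_const DIM('a) \<rho>) * (\<integral>\<^sup>+x\<in>S. ennreal ((norm (D\<phi> x))\<^sup>2) \<partial>lborel)"
proof (cases "0 < measure (hyp_borel \<nu> c) A")
  case False
  then have "measure (hyp_borel \<nu> c) A = 0" by (simp add: measure_le_0_iff not_less)
  then show ?thesis by simp
next
  case True
  define C where "C = open_cone z A"
  define B where "B = ball z (\<rho> * D)"
  define a where "a = measure lborel C"
  define b where "b = measure lborel B"
  define e where "e = \<bar>c - \<nu> \<bullet> z\<bar>"
  define \<mu> where "\<mu> = measure (hyp_borel \<nu> c) A"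
  define d where "d = real (DIM('a))"
  define I where "I = (\<integral>\<^sup>+x\<in>S. ennreal ((norm (D\<phi> x))\<^sup>2) \<partial>lborel)"
  have r: "0 < \<rho> * D" using \<rho> D by simp
  then have pos: "0 < e" "0 < \<mu>" "1 \<le> d" using \<rho> True DIM_positive[where 'a='a] by (auto simp: e_def \<mu>_def d_def Suc_leI)
  have z: "\<nu> \<bullet> z \<noteq> c" using pos(1) by (auto simp: e_def)
  have bA: "bounded A" using D(2) unfolding bounded_def by blast
  have C[measurable]: "C \<in> sets borel" unfolding C_def by (rule open_cone_borel[OF A(2) z A(1)])
  have da: "d * a = e * \<mu>"
    using measure_open_cone(2)[OF \<nu> z A(1) bA A(2)] by (simp add: d_def a_def C_def e_def \<mu>_def)
  have apos: "0 < a" using da pos by (metis mult_pos_pos zero_less_mult_pos less_le_trans zero_less_one)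
  have Cb: "C \<subseteq> cball z D" unfolding C_def by (rule open_cone_subset_cball[OF D(2)])
  have bpos: "0 < b" unfolding b_def B_def using r by (simp add: content_ball_pos)
  \<comment> \<open>The cone lies in the ball of radius \<open>D\<close>, the concentric enlargement
    of \<open>B\<close> by \<open>1 / \<rho>\<close>; this bounds \<open>1 / b\<close> in terms of
    \<open>1 / a\<close>.\<close>
  have "a \<le> measure lborel (cball z D)"
    unfolding a_def by (rule measure_mono_fmeasurable[OF Cb]) (auto intro!: fmeasurableI emeasure_bounded_finite)
  also have "\<dots> = b / \<rho> ^ DIM('a)"
    using \<rho> D by (simp add: b_def B_def content_ball content_cball power_mult_distrib)
  finally have ab: "1 / b \<le> (1 / a) * (1 / \<rho> ^ DIM('a))" using apos bpos \<rho> by (simp add: field_simps)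
  have zB: "z \<in> B" using r by (simp add: B_def)
  have CS: "C \<subseteq> S" using seg[of _ z 1] zB by (auto simp: C_def B_def)
  have 1: "ennreal ((hyp_avg \<nu> c A \<phi> - avg C \<phi>)\<^sup>2) \<le> ennreal (D\<^sup>2 / a) * I"
    unfolding C_def I_def a_def
    by (rule hyp_avg_cone[OF \<phi> \<nu> z A True D(2) S]) (use CS C_def in auto)
  have 2: "ennreal ((avg C \<phi> - avg B \<phi>)\<^sup>2) \<le> ennreal ((2 * D)\<^sup>2 * 2 ^ DIM('a) * (1 / a + 1 / b)) * I"
    unfolding I_def a_def b_def
  proof (rule avg_poincare[OF \<phi> C])
    show "bounded C" using Cb bounded_cball bounded_subset by blast
    show "norm (y - p) \<le> 2 * D" if "y \<in> C" "p \<in> B" for y p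
    proof -
      have "dist y z \<le> D" "dist z p \<le> D"
        using that Cb \<rho> D(1) by (auto simp: B_def dist_commute) (smt (verit) mult_left_le_one_le)
      then show ?thesis using dist_triangle[of y p z] by (simp add: dist_norm)
    qed
  qed (use apos bpos S seg in \<open>auto simp: a_def b_def B_def C_def\<close>)
  have "(hyp_avg \<nu> c A \<phi> - avg B \<phi>)\<^sup>2 \<le> 2 * (hyp_avg \<nu> c A \<phi> - avg C \<phi>)\<^sup>2 + 2 * (avg C \<phi> - avg B \<phi>)\<^sup>2"
    using sum_squares_bound[of "hyp_avg \<nu> c A \<phi> - avg C \<phi>" "avg C \<phi> - avg B \<phi>"]
    by (simp add: power2_eq_square algebra_simps)
  then have "ennreal (\<mu> * (hyp_avg \<nu> c A \<phi> - avg B \<phi>)\<^sup>2) \<le>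
    ennreal \<mu> * (ennreal 2 * ennreal ((hyp_avg \<nu> c A \<phi> - avg C \<phi>)\<^sup>2) + ennreal 2 * ennreal ((avg C \<phi> - avg B \<phi>)\<^sup>2))"
    using pos by (simp add: ennreal_mult[symmetric] ennreal_plus[symmetric] del: ennreal_plus ennreal_numeral)
  also have "\<dots> \<le> ennreal \<mu> * (ennreal 2 * (ennreal (D\<^sup>2 / a) * I) + ennreal 2 * (ennreal ((2 * D)\<^sup>2 * 2 ^ DIM('a) * (1 / a + 1 / b)) * I))"
    by (intro mult_left_mono add_mono 1 2) auto
  also have "\<dots> = ennreal (\<mu> * (2 * (D\<^sup>2 / a) + 2 * ((2 * D)\<^sup>2 * 2 ^ DIM('a) * (1 / a + 1 / b)))) * I"
  proof -
    have "ennreal \<mu> * (ennreal 2 * (ennreal x * I) + ennreal 2 * (ennreal y * I)) = ennreal (\<mu> * (2 * x + 2 * y)) * I"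
      if "0 \<le> x" "0 \<le> y" for x y
      using pos that by (simp add: ennreal_mult ennreal_plus distrib_left distrib_right mult.assoc del: ennreal_numeral)
    then show ?thesis using apos bpos by simp
  qed
  also have "\<dots> \<le> ennreal (e * trace_const DIM('a) \<rho>) * I"
  proof (intro mult_right_mono ennreal_leI)
    have "2 * (D\<^sup>2 / a) + 2 * ((2 * D)\<^sup>2 * 2 ^ DIM('a) * (1 / a + 1 / b)) \<le>
      2 * (D\<^sup>2 / a) + 2 * ((2 * D)\<^sup>2 * 2 ^ DIM('a) * (1 / a + (1 / a) * (1 / \<rho> ^ DIM('a))))"
      using ab by (intro add_left_mono mult_left_mono) auto
    also have "\<dots> = D\<^sup>2 / a * (2 + 8 * 2 ^ DIM('a) * (1 + 1 / \<rho> ^ DIM('a)))"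
      by (simp add: algebra_simps power2_eq_square)
    finally have "\<mu> * (2 * (D\<^sup>2 / a) + 2 * ((2 * D)\<^sup>2 * 2 ^ DIM('a) * (1 / a + 1 / b))) \<le>
       \<mu> * (D\<^sup>2 / a * (2 + 8 * 2 ^ DIM('a) * (1 + 1 / \<rho> ^ DIM('a))))"
      using pos by (intro mult_left_mono) auto
    also have "\<mu> * (D\<^sup>2 / a * (2 + 8 * 2 ^ DIM('a) * (1 + 1 / \<rho> ^ DIM('a)))) =
       (\<mu> / a * D\<^sup>2) * (2 + 8 * 2 ^ DIM('a) * (1 + 1 / \<rho> ^ DIM('a)))" by simp
    \<comment> \<open>Here the scale disappears: the cone volume gives
      \<open>\<mu> / a = d / e\<close>, and \<open>\<rho> * D \<le> e\<close> trades
      \<open>D\<^sup>2\<close> for \<open>e\<^sup>2\<close>. Only one factor \<open>e\<close>, the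
      distance from the centre to the hyperplane, survives, and \<open>edge_dist\<close> will absorb
      it.\<close>
    also have "\<dots> \<le> (e * d / \<rho>\<^sup>2) * (2 + 8 * 2 ^ DIM('a) * (1 + 1 / \<rho> ^ DIM('a)))"
    proof (rule mult_right_mono)
      have "(\<rho> * D)\<^sup>2 \<le> e\<^sup>2" using \<rho>(3) r by (intro power_mono) (auto simp: e_def)
      then have "D\<^sup>2 \<le> e\<^sup>2 / \<rho>\<^sup>2" using \<rho>(1) by (simp add: power_mult_distrib field_simps)
      moreover have "\<mu> / a = d / e" using da apos pos by (simp add: field_simps)
      ultimately have "\<mu> / a * D\<^sup>2 \<le> d / e * (e\<^sup>2 / \<rho>\<^sup>2)" using pos by (intro mult_mono) auto
      also have "\<dots> = e * d / \<rho>\<^sup>2" using pos by (simp add: power2_eq_square)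
      finally show "\<mu> / a * D\<^sup>2 \<le> e * d / \<rho>\<^sup>2" .
    qed (use \<rho> in auto)
    finally show "\<mu> * (2 * (D\<^sup>2 / a) + 2 * ((2 * D)\<^sup>2 * 2 ^ DIM('a) * (1 / a + 1 / b))) \<le> e * trace_const DIM('a) \<rho>"
      by (simp add: trace_const_def d_def)
  qed simp
  finally show ?thesis by (simp add: \<mu>_def B_def e_def I_def)
qed

section \<open>Mollification\<close>

text \<open>Kernels are of class C1, like the test functions in \<open>weak_gradient\<close>. The
  common bound on \<open>\<eta>\<close> and \<open>D\<eta>\<close> supplies the dominating functions
  for limits under the integral.\<close>

definition mollifier :: "real \<Rightarrow> ('a::euclidean_space \<Rightarrow> real) \<Rightarrow> ('a \<Rightarrow> 'a) \<Rightarrow> bool" where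
  "mollifier \<epsilon> \<eta> D\<eta> \<longleftrightarrow> C1_gradient \<eta> D\<eta> \<and> (\<forall>x. 0 \<le> \<eta> x) \<and> (\<forall>x. \<epsilon> < norm x \<longrightarrow> \<eta> x = 0) \<and>
     (\<integral>\<^sup>+x. ennreal (\<eta> x) \<partial>lborel) = 1 \<and> (\<exists>B. \<forall>x. \<bar>\<eta> x\<bar> \<le> B \<and> norm (D\<eta> x) \<le> B)"

lemma GDERIV_inner_self: "GDERIV (\<lambda>x::'a::euclidean_space. x \<bullet> x) x :> 2 *\<^sub>R x"
  unfolding gderiv_def
  by (rule derivative_eq_intros refl | simp add: inner_commute)+

lemma DERIV_max0_square: "((\<lambda>s::real. (max 0 s)\<^sup>2) has_real_derivative 2 * max 0 s) (at s)"
proof -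
  consider "s < 0" | "s = 0" | "0 < s" by linarith
  then show ?thesis
  proof cases
    case 1
    have "((\<lambda>s::real. 0) has_real_derivative 0) (at s)" by simp
    then have "((\<lambda>s::real. (max 0 s)\<^sup>2) has_real_derivative 0) (at s)"
      by (rule has_field_derivative_transform_within_open[where S="{..<0}"]) (use 1 in auto)
    then show ?thesis using 1 by simp
  next
    case 2
    have "((\<lambda>h::real. (max 0 h)\<^sup>2 / h) \<longlongrightarrow> 0) (at 0)"
    proof (rule tendsto_rabs_zero_cancel, rule tendsto_sandwich[of "\<lambda>_. 0" _ _ "\<lambda>h. \<bar>h\<bar>"])
      show "\<forall>\<^sub>F h::real in at 0. \<bar>(max 0 h)\<^sup>2 / h\<bar> \<le> \<bar>h\<bar>"
        by (rule always_eventually) (auto simp: max_def power2_eq_square)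
      show "((\<lambda>h::real. \<bar>h\<bar>) \<longlongrightarrow> 0) (at 0)" by (rule tendsto_rabs_zero) (rule tendsto_ident_at)
    qed auto
    then show ?thesis using 2 by (simp add: has_field_derivative_iff)
  next
    case 3
    have "((\<lambda>s::real. s\<^sup>2) has_real_derivative 2 * s) (at s)" by (auto intro!: derivative_eq_intros)
    then have "((\<lambda>s::real. (max 0 s)\<^sup>2) has_real_derivative 2 * s) (at s)"
      by (rule has_field_derivative_transform_within_open[where S="{0<..}"]) (use 3 in auto)
    then show ?thesis using 3 by simp
  qed
qed

text \<open>The kernel is the normalised square of the positive part of
  \<open>\<epsilon>\<^sup>2 - x \<bullet> x\<close>; squaring makes it C1 across the sphere.\<close>

lemma mollifier_exists:
  assumes \<epsilon>: "0 < \<epsilon>"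
  obtains \<eta> :: "'a::euclidean_space \<Rightarrow> real" and D\<eta> where "mollifier \<epsilon> \<eta> D\<eta>"
proof -
  define s where "s = (\<lambda>x::'a. \<epsilon>\<^sup>2 - x \<bullet> x)"
  define \<rho> where "\<rho> = (\<lambda>x. (max 0 (s x))\<^sup>2)"
  define D\<rho> where "D\<rho> = (\<lambda>x. (2 * max 0 (s x)) *\<^sub>R (0 - 2 *\<^sub>R x))"
  have D: "GDERIV \<rho> x :> D\<rho> x" for x
    unfolding \<rho>_def D\<rho>_def
    by (rule GDERIV_DERIV_compose[OF _ DERIV_max0_square])
       (unfold s_def, intro GDERIV_diff GDERIV_const GDERIV_inner_self)
  have c: "continuous_on UNIV D\<rho>" unfolding D\<rho>_def s_def by (intro continuous_intros)
  have c\<rho>: "continuous_on UNIV \<rho>" unfolding \<rho>_def s_def by (intro continuous_intros)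
  have out: "s x < 0" if "\<epsilon> < norm x" for x
    using power_strict_mono[OF that, of 2] \<epsilon> by (simp add: s_def power2_norm_eq_inner[symmetric])
  have out\<rho>: "\<rho> x = 0" "D\<rho> x = 0" if "\<epsilon> < norm x" for x using out[OF that] by (auto simp: \<rho>_def D\<rho>_def)
  have comp: "compact (cball (0::'a) \<epsilon>)" by simp
  obtain B1 where "\<forall>x\<in>cball 0 \<epsilon>. norm (\<rho> x) \<le> B1"
    using compact_imp_bounded[OF compact_continuous_image[OF continuous_on_subset[OF c\<rho>] comp]]
    by (auto simp: bounded_iff simp del: mem_cball)
  then have B1: "norm (\<rho> x) \<le> B1" if "x \<in> cball 0 \<epsilon>" for x using that by blast
  obtain B2 where "\<forall>x\<in>cball 0 \<epsilon>. norm (D\<rho> x) \<le> B2"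
    using compact_imp_bounded[OF compact_continuous_image[OF continuous_on_subset[OF c] comp]]
    by (auto simp: bounded_iff simp del: mem_cball)
  then have B2: "norm (D\<rho> x) \<le> B2" if "x \<in> cball 0 \<epsilon>" for x using that by blast
  have z: "(0::'a) \<in> cball 0 \<epsilon>" using \<epsilon> by simp
  define B where "B = max B1 B2"
  have Bnn: "0 \<le> B" using order_trans[OF norm_ge_zero B1[OF z]] by (simp add: B_def max.coboundedI1)
  have "\<bar>\<rho> x\<bar> \<le> B \<and> norm (D\<rho> x) \<le> B" for x
    using B1[of x] B2[of x] out\<rho>[of x] Bnn by (cases "\<epsilon> < norm x") (auto simp: B_def max.coboundedI1 max.coboundedI2)
  then have B: "\<bar>\<rho> x\<bar> \<le> B" "norm (D\<rho> x) \<le> B" for x by auto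
  have [measurable]: "\<rho> \<in> borel_measurable borel" using c\<rho> by (rule borel_measurable_continuous_onI)
  have nn: "0 \<le> \<rho> x" for x by (simp add: \<rho>_def)
  define N where "N = (\<integral>\<^sup>+x. ennreal (\<rho> x) \<partial>lborel)"
  have "N \<le> (\<integral>\<^sup>+x. ennreal B * indicator (cball (0::'a) \<epsilon>) x \<partial>lborel)"
    unfolding N_def
  proof (intro nn_integral_mono)
    fix x show "ennreal (\<rho> x) \<le> ennreal B * indicator (cball 0 \<epsilon>) x"
      using B(1)[of x] nn[of x] out\<rho>(1)[of x] by (auto simp: indicator_def intro: ennreal_leI)
  qed
  also have "\<dots> = ennreal B * emeasure lborel (cball (0::'a) \<epsilon>)" by (simp add: nn_integral_cmult_indicator)
  also have "\<dots> < \<infinity>"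
    using emeasure_lborel_cball_finite[of "0::'a" \<epsilon>] by (simp add: ennreal_mult_less_top)
  finally have Nfin: "N < \<infinity>" .
  have N0: "N \<noteq> 0"
  proof
    assume "N = 0"
    then have "AE x in lborel. ennreal (\<rho> x) = 0" unfolding N_def by (simp add: nn_integral_0_iff_AE)
    then have "AE x in lborel. x \<notin> ball (0::'a) \<epsilon>"
    proof eventually_elim
      case (elim x)
      then have "\<rho> x = 0" using nn[of x] by (simp add: ennreal_eq_0_iff)
      then have "s x \<le> 0" by (simp add: \<rho>_def max_def split: if_splits)
      then have "\<epsilon>\<^sup>2 \<le> (norm x)\<^sup>2" by (simp add: s_def power2_norm_eq_inner)
      then have "\<epsilon> \<le> norm x" using \<epsilon> by (simp add: power2_le_iff_abs_le)
      then show ?case by simp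
    qed
    then have "emeasure lborel (ball (0::'a) \<epsilon>) = 0"
      by (subst (asm) AE_iff_null_sets[symmetric]) auto
    moreover have "0 < measure lborel (ball (0::'a) \<epsilon>)" using \<epsilon> by (simp add: content_ball_pos)
    ultimately show False by (simp add: measure_def)
  qed
  define n where "n = enn2real N"
  have n: "N = ennreal n" "0 < n" using Nfin N0 by (auto simp: n_def enn2real_positive_iff less_top zero_less_iff_neq_zero)
  define \<eta> where "\<eta> = (\<lambda>x. \<rho> x * (1 / n))"
  define D\<eta> where "D\<eta> = (\<lambda>x. \<rho> x *\<^sub>R 0 + (1 / n) *\<^sub>R D\<rho> x)"
  have "mollifier \<epsilon> \<eta> D\<eta>"
    unfolding mollifier_def
  proof (intro conjI allI impI exI[of _ "B / n"])
    show "C1_gradient \<eta> D\<eta>"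
      unfolding C1_gradient_def \<eta>_def D\<eta>_def
      by (intro conjI allI GDERIV_mult D GDERIV_const continuous_intros c c\<rho>)
    show "(\<integral>\<^sup>+x. ennreal (\<eta> x) \<partial>lborel) = 1"
    proof -
      have "(\<integral>\<^sup>+x. ennreal (\<eta> x) \<partial>lborel) = (\<integral>\<^sup>+x. ennreal (\<rho> x) * ennreal (1 / n) \<partial>lborel)"
        using nn n by (intro nn_integral_cong) (simp add: \<eta>_def ennreal_mult[symmetric])
      also have "\<dots> = N * ennreal (1 / n)" unfolding N_def by (rule nn_integral_multc) measurable
      also have "\<dots> = 1" using n by (simp add: ennreal_mult[symmetric])
      finally show ?thesis .
    qed
  qed (use nn n out\<rho> B in \<open>auto simp: \<eta>_def D\<eta>_def abs_mult divide_right_mono\<close>)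
  then show thesis by (rule that)
qed

lemma mollifierD:
  assumes "mollifier \<epsilon> \<eta> D\<eta>"
  shows "C1_gradient \<eta> D\<eta>" "0 \<le> \<eta> x" "\<epsilon> < norm x \<Longrightarrow> \<eta> x = 0" "(\<integral>\<^sup>+x. ennreal (\<eta> x) \<partial>lborel) = 1"
    "\<eta> \<in> borel_measurable borel" "D\<eta> \<in> borel_measurable borel"
proof -
  show 1: "C1_gradient \<eta> D\<eta>" "0 \<le> \<eta> x" "\<epsilon> < norm x \<Longrightarrow> \<eta> x = 0" "(\<integral>\<^sup>+x. ennreal (\<eta> x) \<partial>lborel) = 1"
    using assms by (auto simp: mollifier_def)
  show "\<eta> \<in> borel_measurable borel" "D\<eta> \<in> borel_measurable borel"
    using C1_gradient_continuous[OF 1(1)] by (auto intro: borel_measurable_continuous_onI)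
qed

lemma mollifier_nn_shift:
  fixes x :: "'a::euclidean_space"
  assumes "mollifier \<epsilon> \<eta> D\<eta>"
  shows "(\<integral>\<^sup>+y. ennreal (\<eta> (x - y)) \<partial>lborel) = 1" "(\<integral>\<^sup>+y. ennreal (\<eta> (y - x)) \<partial>lborel) = 1"
proof -
  note [measurable] = mollifierD(5)[OF assms]
  have "(\<integral>\<^sup>+y. ennreal (\<eta> y) \<partial>lborel) = ennreal (\<bar>-1\<bar> ^ DIM('a)) * (\<integral>\<^sup>+y. ennreal (\<eta> (x + (-1) *\<^sub>R y)) \<partial>lborel)"
    by (rule nn_integral_lborel_scale) auto
  then show "(\<integral>\<^sup>+y. ennreal (\<eta> (x - y)) \<partial>lborel) = 1" using mollifierD(4)[OF assms] by simp
  show "(\<integral>\<^sup>+y. ennreal (\<eta> (y - x)) \<partial>lborel) = 1"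
    using nn_integral_lborel_shift[of "\<lambda>y. ennreal (\<eta> y)" "-x"] mollifierD(4)[OF assms] by simp
qed

section \<open>Mollified functions\<close>

definition moll :: "('a::euclidean_space \<Rightarrow> real) \<Rightarrow> ('a \<Rightarrow> real) \<Rightarrow> 'a \<Rightarrow> real" where
  "moll \<eta> v x = (\<integral>y. v y * \<eta> (x - y) \<partial>lborel)"

definition Dmoll :: "('a::euclidean_space \<Rightarrow> 'a) \<Rightarrow> ('a \<Rightarrow> real) \<Rightarrow> 'a \<Rightarrow> 'a" where
  "Dmoll D\<eta> v x = (\<integral>y. v y *\<^sub>R D\<eta> (x - y) \<partial>lborel)"

text \<open>Differentiation under the integral, checked along sequences. The bound \<open>B\<close>
  on the gradient makes \<open>\<eta>\<close> Lipschitz, so the remainders of the difference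
  quotients are dominated by \<open>2 * B * \<bar>v y\<bar>\<close>.\<close>

lemma moll_C1:
  assumes m: "mollifier \<epsilon> \<eta> D\<eta>" and v: "integrable lborel v"
  shows "C1_gradient (moll \<eta> v) (Dmoll D\<eta> v)"
proof -
  note [measurable] = mollifierD(5,6)[OF m] borel_measurable_integrable[OF v]
  obtain B where B: "\<And>x. \<bar>\<eta> x\<bar> \<le> B" "\<And>x. norm (D\<eta> x) \<le> B" using m unfolding mollifier_def by blast
  have Bnn: "0 \<le> B" using B(2)[of 0] norm_ge_zero order_trans by blast
  have D: "(\<eta> has_derivative (\<lambda>h. h \<bullet> D\<eta> x)) (at x)" for x
    using mollifierD(1)[OF m] by (simp add: C1_gradient_def gderiv_def)
  have lip: "\<bar>\<eta> a - \<eta> b\<bar> \<le> B * norm (a - b)" for a b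
  proof -
    have "norm (\<eta> a - \<eta> b) \<le> B * norm (a - b)"
    proof (rule differentiable_bound[of UNIV \<eta> "\<lambda>x h. h \<bullet> D\<eta> x"])
      show "onorm (\<lambda>h. h \<bullet> D\<eta> x) \<le> B" for x
      proof (rule onorm_bound)
        fix h show "norm (h \<bullet> D\<eta> x) \<le> B * norm h"
          using Cauchy_Schwarz_ineq2[of h "D\<eta> x"] B(2)[of x] mult_left_mono[OF B(2)[of x], of "norm h"]
          by (simp add: mult.commute)
      qed (use Bnn in auto)
    qed (use D in auto)
    then show ?thesis by simp
  qed
  have vB: "integrable lborel (\<lambda>y. 2 * B * \<bar>v y\<bar>)" using v by simp
  have key: "\<bar>a\<bar> * t \<le> 2 * B * \<bar>a\<bar>" if "t \<le> B" for a t
  proof -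
    have "\<bar>a\<bar> * t \<le> \<bar>a\<bar> * (2 * B)" using that Bnn by (intro mult_left_mono) auto
    then show ?thesis by (simp add: ac_simps)
  qed
  have i1: "integrable lborel (\<lambda>y. v y * \<eta> (x - y))" for x
  proof (rule Bochner_Integration.integrable_bound[OF vB])
    show "AE y in lborel. norm (v y * \<eta> (x - y)) \<le> norm (2 * B * \<bar>v y\<bar>)"
    proof (rule AE_I2)
      fix y show "norm (v y * \<eta> (x - y)) \<le> norm (2 * B * \<bar>v y\<bar>)"
        using key[OF B(1)[of "x - y"], of "v y"] Bnn by (simp add: abs_mult)
    qed
  qed measurable
  have i2: "integrable lborel (\<lambda>y. v y *\<^sub>R D\<eta> (x - y))" for x
  proof (rule Bochner_Integration.integrable_bound[OF vB])
    show "AE y in lborel. norm (v y *\<^sub>R D\<eta> (x - y)) \<le> norm (2 * B * \<bar>v y\<bar>)"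
    proof (rule AE_I2)
      fix y show "norm (v y *\<^sub>R D\<eta> (x - y)) \<le> norm (2 * B * \<bar>v y\<bar>)"
        using key[OF B(2)[of "x - y"], of "v y"] Bnn by (simp add: abs_mult)
    qed
  qed measurable
  have der: "(moll \<eta> v has_derivative (\<lambda>h. h \<bullet> Dmoll D\<eta> v x)) (at x)" for x
    unfolding has_derivative_at
  proof
    show "bounded_linear (\<lambda>h. h \<bullet> Dmoll D\<eta> v x)" by (rule bounded_linear_inner_left)
    show "((\<lambda>h. norm (moll \<eta> v (x + h) - moll \<eta> v x - h \<bullet> Dmoll D\<eta> v x) / norm h) \<longlongrightarrow> 0) (at 0)"
      unfolding tendsto_at_iff_sequentially
    proof (intro allI impI)
      fix X :: "nat \<Rightarrow> 'a" assume X: "\<forall>i. X i \<in> UNIV - {0}" "X \<longlonglongrightarrow> 0"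
      define r where "r = (\<lambda>i y. v y * ((\<eta> (x + X i - y) - \<eta> (x - y) - X i \<bullet> D\<eta> (x - y)) / norm (X i)))"
      have eq: "(\<integral>y. r i y \<partial>lborel) = (moll \<eta> v (x + X i) - moll \<eta> v x - X i \<bullet> Dmoll D\<eta> v x) / norm (X i)" for i
      proof -
        have "X i \<bullet> Dmoll D\<eta> v x = (\<integral>y. X i \<bullet> (v y *\<^sub>R D\<eta> (x - y)) \<partial>lborel)"
          unfolding Dmoll_def by (rule integral_inner_right[symmetric]) (rule i2)
        moreover have i3: "integrable lborel (\<lambda>y. v y * (X i \<bullet> D\<eta> (x - y)))"
          using integrable_inner_right[of "X i", OF i2[of x]] by simp
        ultimately have "moll \<eta> v (x + X i) - moll \<eta> v x - X i \<bullet> Dmoll D\<eta> v x =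
          (\<integral>y. v y * \<eta> (x + X i - y) - v y * \<eta> (x - y) - X i \<bullet> (v y *\<^sub>R D\<eta> (x - y)) \<partial>lborel)"
          unfolding moll_def using i1 i3 by simp
        moreover have "r i = (\<lambda>y. (v y * \<eta> (x + X i - y) - v y * \<eta> (x - y) - X i \<bullet> (v y *\<^sub>R D\<eta> (x - y))) / norm (X i))"
          by (simp add: r_def fun_eq_iff algebra_simps)
        ultimately show ?thesis by simp
      qed
      have "(\<lambda>i. \<integral>y. r i y \<partial>lborel) \<longlonglongrightarrow> integral\<^sup>L lborel (\<lambda>_::'a. 0)"
      proof (rule integral_dominated_convergence[where w="\<lambda>y. 2 * B * \<bar>v y\<bar>"])
        show "AE y in lborel. (\<lambda>i. r i y) \<longlonglongrightarrow> 0"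
        proof (rule AE_I2)
          fix y
          have "((\<lambda>h. norm (\<eta> (x - y + h) - \<eta> (x - y) - h \<bullet> D\<eta> (x - y)) / norm h) \<longlongrightarrow> 0) (at 0)"
            using D[of "x - y"] by (simp add: has_derivative_at)
          with X have "(\<lambda>i. norm (\<eta> (x - y + X i) - \<eta> (x - y) - X i \<bullet> D\<eta> (x - y)) / norm (X i)) \<longlonglongrightarrow> 0"
            unfolding tendsto_at_iff_sequentially comp_def by blast
          then have "(\<lambda>i. \<bar>(\<eta> (x - y + X i) - \<eta> (x - y) - X i \<bullet> D\<eta> (x - y)) / norm (X i)\<bar>) \<longlonglongrightarrow> 0"
            by simp
          then have "(\<lambda>i. (\<eta> (x - y + X i) - \<eta> (x - y) - X i \<bullet> D\<eta> (x - y)) / norm (X i)) \<longlonglongrightarrow> 0"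
            by (rule tendsto_rabs_zero_cancel)
          from tendsto_mult_right_zero[OF this, of "v y"]
          show "(\<lambda>i. r i y) \<longlonglongrightarrow> 0" by (simp add: r_def algebra_simps)
        qed
        show "AE y in lborel. norm (r i y) \<le> 2 * B * \<bar>v y\<bar>" for i
        proof (rule AE_I2)
          fix y
          have nz: "0 < norm (X i)" using X by simp
          have "\<bar>\<eta> (x + X i - y) - \<eta> (x - y)\<bar> \<le> B * norm (X i)"
            using lip[of "x + X i - y" "x - y"] by simp
          moreover have "\<bar>X i \<bullet> D\<eta> (x - y)\<bar> \<le> norm (X i) * B"
            by (rule order_trans[OF Cauchy_Schwarz_ineq2 mult_left_mono[OF B(2)]]) simp
          ultimately have "\<bar>\<eta> (x + X i - y) - \<eta> (x - y) - X i \<bullet> D\<eta> (x - y)\<bar> \<le> B * norm (X i) + norm (X i) * B"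
            by linarith
          then have "\<bar>(\<eta> (x + X i - y) - \<eta> (x - y) - X i \<bullet> D\<eta> (x - y)) / norm (X i)\<bar> \<le> 2 * B"
            using nz by (simp add: field_simps)
          from mult_left_mono[OF this, of "\<bar>v y\<bar>"] show "norm (r i y) \<le> 2 * B * \<bar>v y\<bar>"
            by (simp add: r_def abs_mult mult.commute)
        qed
        show "r i \<in> borel_measurable lborel" for i unfolding r_def by measurable
      qed (use vB in auto)
      then have "(\<lambda>i. \<integral>y. r i y \<partial>lborel) \<longlonglongrightarrow> 0" by simp
      from tendsto_rabs_zero[OF this]
      show "((\<lambda>h. norm (moll \<eta> v (x + h) - moll \<eta> v x - h \<bullet> Dmoll D\<eta> v x) / norm h) \<circ> X) \<longlonglongrightarrow> 0"
        unfolding eq comp_def by simp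
    qed
  qed
  have "continuous_on UNIV (Dmoll D\<eta> v)"
    unfolding continuous_on_eq_continuous_at[OF open_UNIV]
  proof (intro ballI)
    fix x
    have cont: "isCont D\<eta> z" for z
      using C1_gradient_continuous(2)[OF mollifierD(1)[OF m]] by (simp add: continuous_on_eq_continuous_at)
    show "isCont (Dmoll D\<eta> v) x"
      unfolding continuous_at_sequentially comp_def
    proof (intro allI impI)
      fix X assume X: "X \<longlonglongrightarrow> x"
      show "(\<lambda>n. Dmoll D\<eta> v (X n)) \<longlonglongrightarrow> Dmoll D\<eta> v x"
        unfolding Dmoll_def
      proof (rule integral_dominated_convergence[where w="\<lambda>y. 2 * B * \<bar>v y\<bar>"])
        show "AE y in lborel. (\<lambda>n. v y *\<^sub>R D\<eta> (X n - y)) \<longlonglongrightarrow> v y *\<^sub>R D\<eta> (x - y)"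
          by (intro AE_I2 tendsto_scaleR tendsto_const isCont_tendsto_compose[OF cont] tendsto_diff X)
        show "AE y in lborel. norm (v y *\<^sub>R D\<eta> (X n - y)) \<le> 2 * B * \<bar>v y\<bar>" for n
        proof (rule AE_I2)
          fix y show "norm (v y *\<^sub>R D\<eta> (X n - y)) \<le> 2 * B * \<bar>v y\<bar>"
            using key[OF B(2)[of "X n - y"], of "v y"] by simp
        qed
      qed (use vB in auto)
    qed
  qed
  then show ?thesis using der by (simp add: C1_gradient_def gderiv_def)
qed

text \<open>Fubini on products of \<open>lborel\<close> asks for Borel functions. Extension by zero
  makes the representative a function on the whole space, which can be convolved.\<close>

lemma borel_representative:
  fixes u :: "'a::euclidean_space \<Rightarrow> real"
  assumes "open \<Omega>" "u \<in> borel_measurable (lebesgue_on \<Omega>)"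
  obtains v where "v \<in> borel_measurable borel" "AE x in lborel. indicator \<Omega> x * u x = v x"
proof -
  have "\<Omega> \<inter> space lebesgue \<in> sets lebesgue" using assms(1) by (simp add: borel_open)
  then have "(\<lambda>x. indicator \<Omega> x * u x) \<in> borel_measurable lebesgue"
    using borel_measurable_restrict_space_iff[of \<Omega> lebesgue u] assms(2) by simp
  from completion_ex_borel_measurable_real[OF this] show thesis using that by auto
qed

lemma nn_integral_lebesgue_on_rep:
  fixes f :: "'a::euclidean_space \<Rightarrow> ennreal"
  assumes "open \<Omega>" and "AE x in lborel. f x * indicator \<Omega> x = g x"
  shows "(\<integral>\<^sup>+x. f x \<partial>lebesgue_on \<Omega>) = (\<integral>\<^sup>+x. g x \<partial>lborel)"
proof -
  have "(\<integral>\<^sup>+x. f x \<partial>lebesgue_on \<Omega>) = (\<integral>\<^sup>+x. f x * indicator \<Omega> x \<partial>lebesgue)"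
    using assms(1) by (intro nn_integral_restrict_space) (simp add: borel_open)
  also have "\<dots> = (\<integral>\<^sup>+x. f x * indicator \<Omega> x \<partial>lborel)" by (rule nn_integral_completion)
  also have "\<dots> = (\<integral>\<^sup>+x. g x \<partial>lborel)" by (rule nn_integral_cong_AE[OF assms(2)])
  finally show ?thesis .
qed

lemma integral_lebesgue_on_rep:
  fixes f :: "'a::euclidean_space \<Rightarrow> real"
  assumes B: "B \<in> sets borel" "B \<subseteq> \<Omega>" and \<Omega>: "open \<Omega>" and f: "f \<in> borel_measurable (lebesgue_on \<Omega>)"
    and ae: "AE x in lborel. indicator \<Omega> x * f x = g x" and g: "g \<in> borel_measurable borel"
  shows "integral\<^sup>L (lebesgue_on B) f = (LINT x:B|lborel. g x)"
    and "integrable (lebesgue_on B) f \<longleftrightarrow> set_integrable lborel B g"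
proof -
  have Bs: "B \<inter> space lebesgue \<in> sets lebesgue" using B(1) by simp
  have "\<Omega> \<inter> space lebesgue \<in> sets lebesgue" using \<Omega> by (simp add: borel_open)
  then have m: "(\<lambda>x. indicator \<Omega> x * f x) \<in> borel_measurable lebesgue"
    using borel_measurable_restrict_space_iff[of \<Omega> lebesgue f] f by simp
  have Bl: "B \<in> sets lebesgue" using B(1) by simp
  have eq: "indicator B x * f x = indicator B x * (indicator \<Omega> x * f x)" for x
    using B(2) by (auto simp: indicator_def)
  have m1: "(\<lambda>x. indicator B x *\<^sub>R f x) \<in> borel_measurable lebesgue"
    unfolding real_scaleR_def eq by (rule borel_measurable_times[OF borel_measurable_indicator[OF Bl] m])
  have m2': "(\<lambda>x. indicator B x *\<^sub>R g x) \<in> borel_measurable lborel" using g B(1) by simp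
  then have m2: "(\<lambda>x. indicator B x *\<^sub>R g x) \<in> borel_measurable lebesgue" by (rule measurable_completion)
  have ae': "AE x in lebesgue. indicator B x *\<^sub>R f x = indicator B x *\<^sub>R g x"
    using AE_completion[OF ae] by eventually_elim (simp add: eq)
  have "integral\<^sup>L (lebesgue_on B) f = (\<integral>x. indicator B x *\<^sub>R f x \<partial>lebesgue)"
    by (rule integral_restrict_space[OF Bs])
  also have "\<dots> = (\<integral>x. indicator B x *\<^sub>R g x \<partial>lebesgue)" by (rule integral_cong_AE[OF m1 m2 ae'])
  also have "\<dots> = (LINT x:B|lborel. g x)"
    unfolding set_lebesgue_integral_def by (rule integral_completion[OF m2'])
  finally show "integral\<^sup>L (lebesgue_on B) f = (LINT x:B|lborel. g x)" .
  have "integrable (lebesgue_on B) f \<longleftrightarrow> integrable lebesgue (\<lambda>x. indicator B x *\<^sub>R f x)"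
    by (rule integrable_restrict_space[OF Bs])
  also have "\<dots> \<longleftrightarrow> integrable lebesgue (\<lambda>x. indicator B x *\<^sub>R g x)" by (rule integrable_cong_AE[OF m1 m2 ae'])
  also have "\<dots> \<longleftrightarrow> set_integrable lborel B g"
    unfolding set_integrable_def by (rule integrable_completion[OF m2'])
  finally show "integrable (lebesgue_on B) f \<longleftrightarrow> set_integrable lborel B g" .
qed

text \<open>Fubini moves the mollification from \<open>v\<close> to the indicator of
  \<open>B\<close>. The mollified indicator \<open>F n y\<close> equals the indicator for large
  \<open>n\<close> unless \<open>y\<close> is on the frontier, which is null because
  \<open>B\<close> is convex.\<close>

lemma moll_integral_limit:
  fixes v :: "'a::euclidean_space \<Rightarrow> real"
  assumes v: "integrable lborel v" and B: "convex B" "bounded B" "B \<in> sets borel"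
    and m: "\<And>n. mollifier (\<epsilon> n) (\<eta> n) (D\<eta> n)" and \<epsilon>: "\<epsilon> \<longlonglongrightarrow> 0"
  shows "(\<lambda>n. LINT x:B|lborel. moll (\<eta> n) v x) \<longlonglongrightarrow> (LINT x:B|lborel. v x)"
proof -
  note [measurable] = mollifierD(5)[OF m] borel_measurable_integrable[OF v] B(3)
  define F where "F = (\<lambda>n y. \<integral>x. indicator B x * \<eta> n (x - y) \<partial>lborel)"
  have i\<eta>: "integrable lborel (\<lambda>x. \<eta> n (x - y))" for n y
    using mollifier_nn_shift(2)[OF m, of n y] mollifierD(2)[OF m]
    by (intro integrableI_bounded) auto
  have iF: "integrable lborel (\<lambda>x. indicator B x * \<eta> n (x - y))" for n y
    by (rule Bochner_Integration.integrable_bound[OF i\<eta>[of n y]]) (auto simp: indicator_def)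
  have I\<eta>: "(\<integral>x. \<eta> n (x - y) \<partial>lborel) = 1" for n y
    using mollifier_nn_shift(2)[OF m, of n y] mollifierD(2)[OF m] by (subst integral_eq_nn_integral) auto
  have F01: "0 \<le> F n y" "F n y \<le> 1" for n y
  proof -
    show "0 \<le> F n y" unfolding F_def using mollifierD(2)[OF m] by (intro integral_nonneg_AE AE_I2) auto
    have "F n y \<le> (\<integral>x. \<eta> n (x - y) \<partial>lborel)" unfolding F_def
      by (rule integral_mono[OF iF i\<eta>]) (use mollifierD(2)[OF m] in \<open>auto simp: indicator_def\<close>)
    then show "F n y \<le> 1" by (simp add: I\<eta>)
  qed
  have swap: "(LINT x:B|lborel. moll (\<eta> n) v x) = (\<integral>y. v y * F n y \<partial>lborel)" for n
  proof -
    define g where "g = (\<lambda>x y. indicator B x * (v y * \<eta> n (x - y)))"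
    have gm: "case_prod g \<in> borel_measurable (lborel \<Otimes>\<^sub>M lborel)" unfolding g_def by measurable
    have "(\<integral>\<^sup>+p. ennreal (norm (case_prod g p)) \<partial>(lborel \<Otimes>\<^sub>M lborel)) =
      (\<integral>\<^sup>+y. \<integral>\<^sup>+x. ennreal (norm (case_prod g (x, y))) \<partial>lborel \<partial>lborel)"
      unfolding g_def by (intro lborel_pair.nn_integral_snd[symmetric]) measurable
    also have "\<dots> \<le> (\<integral>\<^sup>+y. \<integral>\<^sup>+x. ennreal \<bar>v y\<bar> * ennreal (\<eta> n (x - y)) \<partial>lborel \<partial>lborel)"
    proof (intro nn_integral_mono)
      fix x y show "ennreal (norm (case_prod g (x, y))) \<le> ennreal \<bar>v y\<bar> * ennreal (\<eta> n (x - y))"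
        using mollifierD(2)[OF m, of n "x - y"]
        by (auto simp: g_def indicator_def abs_mult ennreal_mult[symmetric])
    qed
    also have "\<dots> = (\<integral>\<^sup>+y. ennreal \<bar>v y\<bar> \<partial>lborel)"
      by (intro nn_integral_cong) (simp add: nn_integral_cmult mollifier_nn_shift(2)[OF m])
    also have "\<dots> < \<infinity>" using v by (simp add: integrable_iff_bounded)
    finally have int: "integrable (lborel \<Otimes>\<^sub>M lborel) (case_prod g)" using gm by (intro integrableI_bounded) auto
    have "(LINT x:B|lborel. moll (\<eta> n) v x) = (\<integral>x. \<integral>y. g x y \<partial>lborel \<partial>lborel)"
      unfolding set_lebesgue_integral_def moll_def g_def by (simp add: integral_mult_right_zero)
    also have "\<dots> = (\<integral>y. \<integral>x. g x y \<partial>lborel \<partial>lborel)"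
      by (rule lborel_pair.Fubini_integral[OF int, symmetric])
    also have "\<dots> = (\<integral>y. v y * F n y \<partial>lborel)"
      unfolding g_def F_def by (simp add: mult.left_commute integral_mult_right_zero)
    finally show ?thesis .
  qed
  have limF: "(\<lambda>n. F n y) \<longlonglongrightarrow> indicator B y" if y: "y \<notin> frontier B" for y
  proof -
    have "eventually (\<lambda>n. F n y = indicator B y) sequentially"
    proof -
      consider "y \<in> interior B" | "y \<notin> closure B"
        using y by (auto simp: frontier_def)
      then show ?thesis
      proof cases
        case 1
        then obtain e where e: "0 < e" "cball y e \<subseteq> B" by (auto simp: mem_interior_cball)
        have "eventually (\<lambda>n. \<epsilon> n < e) sequentially" using \<epsilon> e(1) by (rule order_tendstoD)
        then show ?thesis
        proof eventually_elim
          case (elim n)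
          have "indicator B x * \<eta> n (x - y) = \<eta> n (x - y)" for x
          proof (cases "x \<in> B")
            case False
            then have "e < dist y x" using e by (auto simp: subset_iff not_le[symmetric])
            then have "\<epsilon> n < norm (x - y)" using elim by (simp add: dist_norm norm_minus_commute)
            then show ?thesis using mollifierD(3)[OF m] by simp
          qed simp
          then have "(\<lambda>x. indicator B x * \<eta> n (x - y)) = (\<lambda>x. \<eta> n (x - y))" by (intro ext)
          then have "F n y = 1" unfolding F_def by (simp only: I\<eta>)
          then show ?case using e by (auto simp: subset_iff)
        qed
      next
        case 2
        then obtain e where e: "0 < e" "cball y e \<subseteq> - closure B"
          using open_contains_cball[of "- closure B"] by auto
        have "eventually (\<lambda>n. \<epsilon> n < e) sequentially" using \<epsilon> e(1) by (rule order_tendstoD)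
        then show ?thesis
        proof eventually_elim
          case (elim n)
          have "indicator B x * \<eta> n (x - y) = 0" for x
          proof (cases "x \<in> B")
            case True
            then have "x \<notin> cball y e" using e closure_subset by blast
            then have "\<epsilon> n < norm (x - y)" using elim by (simp add: dist_norm norm_minus_commute)
            then show ?thesis using mollifierD(3)[OF m] by simp
          qed simp
          then have "(\<lambda>x. indicator B x * \<eta> n (x - y)) = (\<lambda>x. 0)" by (intro ext)
          then have "F n y = 0" unfolding F_def by (simp only: Bochner_Integration.integral_zero)
          then show ?case using 2 closure_subset by (auto simp: indicator_def)
        qed
      qed
    qed
    then show ?thesis by (rule tendsto_eventually)
  qed
  have "(\<lambda>n. \<integral>y. v y * F n y \<partial>lborel) \<longlonglongrightarrow> (\<integral>y. v y * indicator B y \<partial>lborel)"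
  proof (rule integral_dominated_convergence[where w="\<lambda>y. \<bar>v y\<bar>"])
    have "AE y in lborel. y \<notin> frontier B"
    proof -
      have "frontier B \<in> sets lborel" by (simp add: borel_closed frontier_closed)
      then have "frontier B \<in> null_sets lborel"
        using negligible_convex_frontier[OF B(1)]
        by (simp add: negligible_iff_null_sets null_sets_completion_iff)
      then show ?thesis by (rule AE_not_in)
    qed
    then show "AE y in lborel. (\<lambda>n. v y * F n y) \<longlonglongrightarrow> v y * indicator B y"
      by eventually_elim (intro tendsto_mult tendsto_const limF)
    show "AE y in lborel. norm (v y * F n y) \<le> \<bar>v y\<bar>" for n
      using F01 by (intro AE_I2) (simp add: abs_mult mult_left_le)
    show "(\<lambda>y. v y * F n y) \<in> borel_measurable lborel" for n
      unfolding F_def by measurable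
  qed (use v in auto)
  then show ?thesis unfolding swap by (simp add: set_lebesgue_integral_def mult.commute)
qed

section \<open>Gradients of mollified functions and the transfer of estimates\<close>

lemma mollifier_test:
  assumes m: "mollifier \<epsilon> \<eta> D\<eta>"
  shows "C1_gradient (\<lambda>y. \<eta> (x - y)) (\<lambda>y. - D\<eta> (x - y))"
  unfolding C1_gradient_def
proof (intro conjI allI)
  fix y
  have "(\<eta> has_derivative (\<lambda>h. h \<bullet> D\<eta> (x - y))) (at (x - y))"
    using mollifierD(1)[OF m] by (simp add: C1_gradient_def gderiv_def)
  moreover have "((\<lambda>y. x - y) has_derivative (\<lambda>h. - h)) (at y)" by (auto intro!: derivative_eq_intros)
  ultimately have "((\<lambda>y. \<eta> (x - y)) has_derivative (\<lambda>h. (- h) \<bullet> D\<eta> (x - y))) (at y)"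
    by (rule has_derivative_compose[rotated])
  then show "GDERIV (\<lambda>y. \<eta> (x - y)) y :> - D\<eta> (x - y)" by (simp add: gderiv_def)
  show "continuous_on UNIV (\<lambda>y. - D\<eta> (x - y))"
    by (intro continuous_intros continuous_on_compose2[OF C1_gradient_continuous(2)[OF mollifierD(1)[OF m]]]) auto
qed

lemma weak_gradientD:
  assumes "weak_gradient \<Omega> u w" "C1_gradient \<phi> D\<phi>" "compact C" "C \<subseteq> \<Omega>" "\<And>x. x \<notin> C \<Longrightarrow> \<phi> x = 0" "i \<in> Basis"
  shows "(LINT x|lebesgue_on \<Omega>. u x * (D\<phi> x \<bullet> i)) = - (LINT x|lebesgue_on \<Omega>. (w x \<bullet> i) * \<phi> x)"
  using assms unfolding weak_gradient_def by blast

text \<open>As long as the ball of radius \<open>\<epsilon>\<close> about \<open>x\<close> stays in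
  \<open>\<Omega>\<close>, \<open>\<eta> (x - y)\<close> is an admissible test function of
  \<open>y\<close>; the sign of its gradient cancels the sign in
  \<open>weak_gradient\<close>.\<close>

lemma Dmoll_weak_gradient:
  fixes u :: "'a::euclidean_space \<Rightarrow> real"
  assumes \<Omega>: "open \<Omega>" "bounded \<Omega>" and u: "u \<in> L2 \<Omega>" and w: "weak_gradient \<Omega> u w"
    and v: "v \<in> borel_measurable borel" "AE x in lborel. indicator \<Omega> x * u x = v x"
    and m: "mollifier \<epsilon> \<eta> D\<eta>" and x: "cball x \<epsilon> \<subseteq> \<Omega>" and \<epsilon>: "0 < \<epsilon>"
  shows "integrable lborel v"
    and "i \<in> Basis \<Longrightarrow> Dmoll D\<eta> v x \<bullet> i = (LINT y|lebesgue_on \<Omega>. \<eta> (x - y) * (w y \<bullet> i))"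
    and "integrable (lebesgue_on \<Omega>) (\<lambda>y. \<eta> (x - y) *\<^sub>R w y)"
proof -
  note [measurable] = mollifierD(5,6)[OF m] v(1)
  obtain B where B: "\<And>x. \<bar>\<eta> x\<bar> \<le> B" "\<And>x. norm (D\<eta> x) \<le> B" using m unfolding mollifier_def by blast
  have wL: "w \<in> L2 \<Omega>" using w by (simp add: weak_gradient_def)
  have ou: "\<Omega> \<in> sets borel" using \<Omega> by (simp add: borel_open)
  have "integrable (lebesgue_on \<Omega>) u"
    using L2_integrable[OF \<Omega> u, of "\<lambda>_. 1" 1] by simp
  then have "set_integrable lborel \<Omega> v"
    using integral_lebesgue_on_rep(2)[OF ou order_refl \<Omega>(1) L2_measurable[OF u] v(2,1)] by simp
  then have "integrable lborel (\<lambda>x. indicator \<Omega> x * v x)" by (simp add: set_integrable_def)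
  moreover have "AE x in lborel. indicator \<Omega> x * v x = v x"
    using v(2) by eventually_elim (auto simp: indicator_def)
  ultimately show iv: "integrable lborel v"
    using ou by (subst (asm) integrable_cong_AE) auto
  show "integrable (lebesgue_on \<Omega>) (\<lambda>y. \<eta> (x - y) *\<^sub>R w y)"
  proof -
    have "(\<lambda>x. norm (w x)) \<in> L2 \<Omega>" using wL by (auto simp: L2_def)
    from L2_integrable[OF \<Omega> this, of "\<lambda>y. \<eta> (x - y)" B]
    have i: "integrable (lebesgue_on \<Omega>) (\<lambda>y. \<eta> (x - y) * norm (w y))" using B by simp
    note [measurable] = L2_measurable[OF wL] borel_measurable_lebesgue_on[of "\<lambda>y. \<eta> (x - y)" \<Omega>]
    show ?thesis
      by (rule Bochner_Integration.integrable_bound[OF i]) (auto simp: abs_mult)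
  qed
  assume i: "i \<in> Basis"
  have iD: "integrable lborel (\<lambda>y. v y *\<^sub>R D\<eta> (x - y))"
  proof (rule Bochner_Integration.integrable_bound)
    show "integrable lborel (\<lambda>y. B * \<bar>v y\<bar>)" using iv by simp
    show "AE y in lborel. norm (v y *\<^sub>R D\<eta> (x - y)) \<le> norm (B * \<bar>v y\<bar>)"
    proof (rule AE_I2)
      fix y
      have "norm (v y *\<^sub>R D\<eta> (x - y)) \<le> \<bar>v y\<bar> * B" using B(2)[of "x - y"] by (simp add: mult_left_mono)
      also have "\<dots> \<le> norm (B * \<bar>v y\<bar>)" by (simp add: mult.commute)
      finally show "norm (v y *\<^sub>R D\<eta> (x - y)) \<le> norm (B * \<bar>v y\<bar>)" .
    qed
  qed measurable
  have "Dmoll D\<eta> v x \<bullet> i = (\<integral>y. (v y *\<^sub>R D\<eta> (x - y)) \<bullet> i \<partial>lborel)"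
    unfolding Dmoll_def by (rule integral_inner_left[symmetric]) (rule iD)
  also have "\<dots> = (LINT y:\<Omega>|lborel. v y * (D\<eta> (x - y) \<bullet> i))"
    unfolding set_lebesgue_integral_def
  proof (rule integral_cong_AE)
    show "AE y in lborel. v y *\<^sub>R D\<eta> (x - y) \<bullet> i = indicator \<Omega> y *\<^sub>R (v y * (D\<eta> (x - y) \<bullet> i))"
      using v(2) by eventually_elim (auto simp: indicator_def)
  qed (use ou in measurable)
  also have "\<dots> = (LINT y|lebesgue_on \<Omega>. u y * (D\<eta> (x - y) \<bullet> i))"
  proof (rule integral_lebesgue_on_rep(1)[OF ou order_refl \<Omega>(1), symmetric])
    show "AE y in lborel. indicator \<Omega> y * (u y * (D\<eta> (x - y) \<bullet> i)) = v y * (D\<eta> (x - y) \<bullet> i)"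
      using v(2) by eventually_elim (metis mult.assoc)
    note [measurable] = L2_measurable[OF u] borel_measurable_lebesgue_on[of "\<lambda>y. D\<eta> (x - y) \<bullet> i" \<Omega>]
    show "(\<lambda>y. u y * (D\<eta> (x - y) \<bullet> i)) \<in> borel_measurable (lebesgue_on \<Omega>)" by measurable
  qed measurable
  also have "\<dots> = - (LINT y|lebesgue_on \<Omega>. u y * ((- D\<eta> (x - y)) \<bullet> i))" by simp
  also have "\<dots> = (LINT y|lebesgue_on \<Omega>. (w y \<bullet> i) * \<eta> (x - y))"
  proof -
    note mollifier_test[OF m, of x]
    moreover have "\<eta> (x - y) = 0" if "y \<notin> cball x \<epsilon>" for y
      using that mollifierD(3)[OF m, of "x - y"] by (simp add: dist_norm)
    ultimately have "(LINT y|lebesgue_on \<Omega>. u y * ((- D\<eta> (x - y)) \<bullet> i)) = - (LINT y|lebesgue_on \<Omega>. (w y \<bullet> i) * \<eta> (x - y))"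
      by (rule weak_gradientD[OF w _ compact_cball x _ i])
    then show ?thesis by simp
  qed
  finally show "Dmoll D\<eta> v x \<bullet> i = (LINT y|lebesgue_on \<Omega>. \<eta> (x - y) * (w y \<bullet> i))" by (simp add: mult.commute)
qed

lemma mollifier_sequence:
  obtains \<eta> :: "nat \<Rightarrow> 'a::euclidean_space \<Rightarrow> real" and D\<eta>
  where "\<And>n. mollifier (inverse (real (Suc n))) (\<eta> n) (D\<eta> n)"
proof -
  have "\<exists>p. mollifier (inverse (real (Suc n))) (fst p) (snd p :: 'a \<Rightarrow> 'a)" for n
  proof -
    obtain \<eta> :: "'a \<Rightarrow> real" and D\<eta> where "mollifier (inverse (real (Suc n))) \<eta> D\<eta>"
      using mollifier_exists[of "inverse (real (Suc n))"] by (metis inverse_positive_iff_positive of_nat_0_less_iff zero_less_Suc)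
    then show ?thesis by (intro exI[of _ "(\<eta>, D\<eta>)"]) simp
  qed
  then obtain p where "\<And>n. mollifier (inverse (real (Suc n))) (fst (p n)) (snd (p n) :: 'a \<Rightarrow> 'a)" by metis
  then show thesis by (rule that)
qed

text \<open>Counterpart of \<open>avg\<close> over \<open>lebesgue_on\<close>, because members of
  \<open>L2\<close> are only Lebesgue measurable.\<close>

definition lavg :: "'a::euclidean_space set \<Rightarrow> ('a \<Rightarrow> real) \<Rightarrow> real" where
  "lavg A f = integral\<^sup>L (lebesgue_on A) f / measure lborel A"

text \<open>Jensen's inequality for the probability density \<open>\<eta> (x - y)\<close> in
  \<open>y\<close>, obtained as Cauchy-Schwarz for the measure with that density.\<close>

lemma Dmoll_norm_bound:
  fixes u :: "'a::euclidean_space \<Rightarrow> real"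
  assumes \<Omega>: "open \<Omega>" "bounded \<Omega>" and u: "u \<in> L2 \<Omega>" and w: "weak_gradient \<Omega> u w"
    and v: "v \<in> borel_measurable borel" "AE x in lborel. indicator \<Omega> x * u x = v x"
    and p: "p \<in> borel_measurable borel" "AE x in lborel. indicator \<Omega> x * norm (w x) = p x"
    and m: "mollifier \<epsilon> \<eta> D\<eta>" and x: "cball x \<epsilon> \<subseteq> \<Omega>" and \<epsilon>: "0 < \<epsilon>"
  shows "ennreal ((norm (Dmoll D\<eta> v x))\<^sup>2) \<le> (\<integral>\<^sup>+y. ennreal (\<eta> (x - y)) * ennreal ((p y)\<^sup>2) \<partial>lborel)"
proof -
  note [measurable] = mollifierD(5)[OF m] p(1)
  note D = Dmoll_weak_gradient[OF \<Omega> u w v m x \<epsilon>]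
  have "Dmoll D\<eta> v x = (LINT y|lebesgue_on \<Omega>. \<eta> (x - y) *\<^sub>R w y)"
  proof (rule euclidean_eqI)
    fix i :: 'a assume i: "i \<in> Basis"
    have "(LINT y|lebesgue_on \<Omega>. \<eta> (x - y) *\<^sub>R w y) \<bullet> i = (LINT y|lebesgue_on \<Omega>. (\<eta> (x - y) *\<^sub>R w y) \<bullet> i)"
      by (rule integral_inner_left[symmetric]) (rule D(3))
    then show "Dmoll D\<eta> v x \<bullet> i = (LINT y|lebesgue_on \<Omega>. \<eta> (x - y) *\<^sub>R w y) \<bullet> i"
      using D(2)[OF i] by simp
  qed
  then have "ennreal (norm (Dmoll D\<eta> v x)) \<le> (\<integral>\<^sup>+y. norm (\<eta> (x - y) *\<^sub>R w y) \<partial>lebesgue_on \<Omega>)"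
    using integral_norm_bound_ennreal[OF D(3)] by simp
  also have "\<dots> = (\<integral>\<^sup>+y. ennreal (\<eta> (x - y)) * ennreal (p y) \<partial>lborel)"
  proof (rule nn_integral_lebesgue_on_rep[OF \<Omega>(1)])
    show "AE y in lborel. ennreal (norm (\<eta> (x - y) *\<^sub>R w y)) * indicator \<Omega> y = ennreal (\<eta> (x - y)) * ennreal (p y)"
      using p(2) by eventually_elim
        (auto simp: indicator_def ennreal_mult'[symmetric] mollifierD(2)[OF m])
  qed
  also have "\<dots> = (\<integral>\<^sup>+y. ennreal (p y) \<partial>density lborel (\<lambda>y. ennreal (\<eta> (x - y))))"
    by (rule nn_integral_density[symmetric]) measurable
  finally have "(ennreal (norm (Dmoll D\<eta> v x)))\<^sup>2 \<le> (\<integral>\<^sup>+y. ennreal (p y) \<partial>density lborel (\<lambda>y. ennreal (\<eta> (x - y))))\<^sup>2"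
    by (rule power_mono) simp
  also have "\<dots> \<le> emeasure (density lborel (\<lambda>y. ennreal (\<eta> (x - y)))) UNIV *
      (\<integral>\<^sup>+y. (ennreal (p y))\<^sup>2 \<partial>density lborel (\<lambda>y. ennreal (\<eta> (x - y))))"
    using nn_integral_square_le[of "\<lambda>y. ennreal (p y)" "density lborel (\<lambda>y. ennreal (\<eta> (x - y)))"] by simp
  also have "emeasure (density lborel (\<lambda>y. ennreal (\<eta> (x - y)))) UNIV = 1"
    by (subst emeasure_density) (auto simp: mollifier_nn_shift(1)[OF m])
  also have "(\<integral>\<^sup>+y. (ennreal (p y))\<^sup>2 \<partial>density lborel (\<lambda>y. ennreal (\<eta> (x - y)))) =
    (\<integral>\<^sup>+y. ennreal (\<eta> (x - y)) * (ennreal (p y))\<^sup>2 \<partial>lborel)"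
    by (rule nn_integral_density) measurable
  also have "\<dots> \<le> (\<integral>\<^sup>+y. ennreal (\<eta> (x - y)) * ennreal ((p y)\<^sup>2) \<partial>lborel)"
  proof (intro nn_integral_mono mult_left_mono)
    fix y show "(ennreal (p y))\<^sup>2 \<le> ennreal ((p y)\<^sup>2)"
      by (cases "0 \<le> p y") (auto simp: ennreal_power ennreal_neg)
  qed simp
  finally show ?thesis by (simp add: ennreal_power)
qed

text \<open>An estimate for the difference of two means that holds for \<open>C\<^sup>1\<close> functions carries over
  to weakly differentiable functions by mollification.\<close>

lemma weak_gradient_transfer:
  fixes u :: "'a::euclidean_space \<Rightarrow> real"
  assumes \<Omega>: "open \<Omega>" "bounded \<Omega>" and u: "u \<in> L2 \<Omega>" and w: "weak_gradient \<Omega> u w"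
    and C: "compact C" "C \<subseteq> \<Omega>" "C \<noteq> {}"
    and B1: "convex B1" "B1 \<in> sets borel" "B1 \<subseteq> \<Omega>" and B2: "convex B2" "B2 \<in> sets borel" "B2 \<subseteq> \<Omega>"
    and est: "\<And>\<phi> D\<phi>. C1_gradient \<phi> D\<phi> \<Longrightarrow> ennreal (\<mu> * (avg B1 \<phi> - avg B2 \<phi>)\<^sup>2) \<le>
       ennreal k * (\<integral>\<^sup>+x\<in>C. ennreal ((norm (D\<phi> x))\<^sup>2) \<partial>lborel)"
  shows "ennreal (\<mu> * (lavg B1 u - lavg B2 u)\<^sup>2) \<le> ennreal k * (\<integral>\<^sup>+x\<in>C. ennreal ((norm (w x))\<^sup>2) \<partial>lebesgue_on \<Omega>)"
proof -
  have wL: "w \<in> L2 \<Omega>" using w by (simp add: weak_gradient_def)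
  obtain v where v: "v \<in> borel_measurable borel" "AE x in lborel. indicator \<Omega> x * u x = v x"
    using borel_representative[OF \<Omega>(1) L2_measurable[OF u]] by blast
  have "(\<lambda>x. norm (w x)) \<in> borel_measurable (lebesgue_on \<Omega>)" using L2_measurable[OF wL] by measurable
  from borel_representative[OF \<Omega>(1) this]
  obtain p where p: "p \<in> borel_measurable borel" "AE x in lborel. indicator \<Omega> x * norm (w x) = p x" by blast
  obtain \<eta> :: "nat \<Rightarrow> 'a \<Rightarrow> real" and D\<eta> where m': "\<And>n. mollifier (inverse (real (Suc n))) (\<eta> n) (D\<eta> n)"
    using mollifier_sequence by blast
  define \<epsilon> where "\<epsilon> = (\<lambda>n. inverse (real (Suc n)))"
  have \<epsilon>0: "\<epsilon> \<longlonglongrightarrow> 0" unfolding \<epsilon>_def by (rule LIMSEQ_inverse_real_of_nat)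
  have \<epsilon>p: "0 < \<epsilon> n" for n by (simp add: \<epsilon>_def)
  have m: "mollifier (\<epsilon> n) (\<eta> n) (D\<eta> n)" for n using m' unfolding \<epsilon>_def .
  note [measurable] = mollifierD(5)[OF m] p(1) v(1)
  \<comment> \<open>Points within distance \<open>e\<close> of \<open>C\<close> are in
    \<open>\<Omega>\<close>, so for \<open>\<epsilon> n < e\<close> the mollified gradient on
    \<open>C\<close> uses only values inside \<open>\<Omega>\<close>.\<close>
  obtain e where e: "0 < e" "\<forall>x\<in>C. cball x e \<subseteq> \<Omega>"
    using compact_subset_open_imp_cball_epsilon_subset[OF C(1) \<Omega>(1) C(2)] by (auto simp: UN_subset_iff)
  have ev: "eventually (\<lambda>n. \<epsilon> n < e) sequentially" using \<epsilon>0 e(1) by (rule order_tendstoD)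
  then obtain N0 where N0: "\<epsilon> N0 < e" by (auto simp: eventually_sequentially)
  obtain x0 where "x0 \<in> C" using C(3) by blast
  with e(2) N0 have "cball x0 (\<epsilon> N0) \<subseteq> \<Omega>" using subset_cball[of "\<epsilon> N0" e x0] by force
  from Dmoll_weak_gradient(1)[OF \<Omega> u w v m this \<epsilon>p] have iv: "integrable lborel v" .
  \<comment> \<open>Mollification spreads the gradient over these neighbourhoods. They shrink to
    \<open>C\<close> because \<open>C\<close> is closed; for a set that is not closed they would
    shrink to its closure.\<close>
  define Cn where "Cn = (\<lambda>n. {y. infdist y C \<le> \<epsilon> n})"
  have Cn[measurable]: "Cn n \<in> sets borel" for n
    unfolding Cn_def by (intro borel_closed closed_Collect_le continuous_intros)
  have Cs[measurable]: "C \<in> sets borel" using C(1) by (simp add: borel_compact)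
  define q where "q = (\<lambda>y. ennreal ((p y)\<^sup>2))"
  have [measurable]: "q \<in> borel_measurable borel" unfolding q_def by measurable
  have qC: "(\<integral>\<^sup>+y. q y * indicator A y \<partial>lborel) = (\<integral>\<^sup>+x\<in>A. ennreal ((norm (w x))\<^sup>2) \<partial>lebesgue_on \<Omega>)" for A
    by (rule nn_integral_lebesgue_on_rep[OF \<Omega>(1), symmetric])
      (use p(2) in \<open>eventually_elim, auto simp: indicator_def q_def\<close>)
  have qfin: "(\<integral>\<^sup>+y. q y \<partial>lborel) < \<infinity>"
  proof -
    have "(\<integral>\<^sup>+y. q y \<partial>lborel) = (\<integral>\<^sup>+x. ennreal ((norm (w x))\<^sup>2) \<partial>lebesgue_on \<Omega>)"
      using qC[of UNIV] by simp
    also have "\<dots> < \<infinity>" using wL by (simp add: L2_def integrable_iff_bounded)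
    finally show ?thesis .
  qed
  have bound: "ennreal (\<mu> * (avg B1 (moll (\<eta> n) v) - avg B2 (moll (\<eta> n) v))\<^sup>2) \<le>
     ennreal k * (\<integral>\<^sup>+y. q y * indicator (Cn n) y \<partial>lborel)" if n: "\<epsilon> n < e" for n
  proof -
    have "(\<integral>\<^sup>+x\<in>C. ennreal ((norm (Dmoll (D\<eta> n) v x))\<^sup>2) \<partial>lborel) \<le>
      (\<integral>\<^sup>+x. \<integral>\<^sup>+y. indicator C x * (ennreal (\<eta> n (x - y)) * q y) \<partial>lborel \<partial>lborel)"
    proof (intro nn_integral_mono)
      fix x show "ennreal ((norm (Dmoll (D\<eta> n) v x))\<^sup>2) * indicator C x \<le> (\<integral>\<^sup>+y. indicator C x * (ennreal (\<eta> n (x - y)) * q y) \<partial>lborel)"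
      proof (cases "x \<in> C")
        case True
        have "cball x (\<epsilon> n) \<subseteq> \<Omega>" using bspec[OF e(2) True] n by force
        from Dmoll_norm_bound[OF \<Omega> u w v p m this \<epsilon>p] show ?thesis using True by (simp add: q_def)
      qed simp
    qed
    also have "\<dots> = (\<integral>\<^sup>+y. \<integral>\<^sup>+x. indicator C x * (ennreal (\<eta> n (x - y)) * q y) \<partial>lborel \<partial>lborel)"
      by (rule lborel_pair.Fubini') measurable
    also have "\<dots> \<le> (\<integral>\<^sup>+y. \<integral>\<^sup>+x. ennreal (\<eta> n (x - y)) * (q y * indicator (Cn n) y) \<partial>lborel \<partial>lborel)"
    proof (intro nn_integral_mono)
      fix x y
      show "indicator C x * (ennreal (\<eta> n (x - y)) * q y) \<le> ennreal (\<eta> n (x - y)) * (q y * indicator (Cn n) y)"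
      proof (cases "x \<in> C \<and> norm (x - y) \<le> \<epsilon> n")
        case True
        then have "infdist y C \<le> \<epsilon> n" using infdist_le[of x C y] by (simp add: dist_norm norm_minus_commute)
        then show ?thesis using True by (simp add: Cn_def)
      next
        case False
        then have "x \<notin> C \<or> \<eta> n (x - y) = 0" using mollifierD(3)[OF m] by auto
        then show ?thesis by auto
      qed
    qed
    also have "\<dots> = (\<integral>\<^sup>+y. q y * indicator (Cn n) y \<partial>lborel)"
      by (intro nn_integral_cong) (simp add: nn_integral_multc mollifier_nn_shift(2)[OF m])
    finally have "(\<integral>\<^sup>+x\<in>C. ennreal ((norm (Dmoll (D\<eta> n) v x))\<^sup>2) \<partial>lborel) \<le> (\<integral>\<^sup>+y. q y * indicator (Cn n) y \<partial>lborel)" .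
    from order_trans[OF est[OF moll_C1[OF m iv]] mult_left_mono[OF this]] show ?thesis by simp
  qed
  have lim_avg: "(\<lambda>n. avg B (moll (\<eta> n) v)) \<longlonglongrightarrow> lavg B u"
    if B: "convex B" "B \<in> sets borel" "B \<subseteq> \<Omega>" for B
  proof -
    have "bounded B" using B(3) \<Omega>(2) bounded_subset by blast
    from moll_integral_limit[OF iv B(1) this B(2) m \<epsilon>0]
    have "(\<lambda>n. LINT x:B|lborel. moll (\<eta> n) v x) \<longlonglongrightarrow> integral\<^sup>L (lebesgue_on B) u"
      using integral_lebesgue_on_rep(1)[OF B(2,3) \<Omega>(1) L2_measurable[OF u] v(2,1)] by simp
    then show ?thesis unfolding avg_def lavg_def integral_restrict_lborel[OF B(2)]
      by (cases "measure lborel B = 0") (auto intro!: tendsto_intros)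
  qed
  have L: "(\<lambda>n. ennreal (\<mu> * (avg B1 (moll (\<eta> n) v) - avg B2 (moll (\<eta> n) v))\<^sup>2)) \<longlonglongrightarrow>
    ennreal (\<mu> * (lavg B1 u - lavg B2 u)\<^sup>2)"
    by (intro tendsto_ennrealI tendsto_intros lim_avg B1 B2)
  have "(\<lambda>n. \<integral>\<^sup>+y. q y * indicator (Cn n) y \<partial>lborel) \<longlonglongrightarrow> (\<integral>\<^sup>+y. q y * indicator C y \<partial>lborel)"
  proof (rule nn_integral_dominated_convergence[where w=q])
    show "AE y in lborel. (\<lambda>n. q y * indicator (Cn n) y) \<longlonglongrightarrow> q y * indicator C y"
    proof (rule AE_I2)
      fix y
      have "eventually (\<lambda>n. (indicator (Cn n) y :: ennreal) = indicator C y) sequentially"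
      proof (cases "y \<in> C")
        case True
        then have "y \<in> Cn n" for n using \<epsilon>p[of n] by (simp add: Cn_def)
        then show ?thesis using True by simp
      next
        case False
        have "infdist y C \<noteq> 0" using False C in_closed_iff_infdist_zero[of C y] by (simp add: compact_imp_closed)
        then have "0 < infdist y C" using infdist_nonneg[of y C] by simp
        from order_tendstoD(2)[OF \<epsilon>0 this] show ?thesis
          by eventually_elim (use False in \<open>simp add: Cn_def\<close>)
      qed
      then show "(\<lambda>n. q y * indicator (Cn n) y) \<longlonglongrightarrow> q y * indicator C y"
        by (intro tendsto_eventually) (auto elim: eventually_mono)
    qed
    show "AE y in lborel. q y * indicator (Cn n) y \<le> q y" for n by (auto simp: indicator_def)
  qed (use qfin in auto)
  then have R: "(\<lambda>n. ennreal k * (\<integral>\<^sup>+y. q y * indicator (Cn n) y \<partial>lborel)) \<longlonglongrightarrow> ennreal k * (\<integral>\<^sup>+y. q y * indicator C y \<partial>lborel)"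
    by (intro ennreal_tendsto_cmult) auto
  have "ennreal (\<mu> * (lavg B1 u - lavg B2 u)\<^sup>2) \<le> ennreal k * (\<integral>\<^sup>+y. q y * indicator C y \<partial>lborel)"
    by (rule tendsto_le[OF _ R L]) (use ev bound in \<open>auto elim: eventually_mono\<close>)
  then show ?thesis unfolding qC .
qed

text \<open>On a fixed box, the positive and the negative part of \<open>v\<close> are densities of
  two measures that agree on all boxes, an intersection-stable generator of the Borel sets. So the
  measures and hence the densities coincide. Countably many closed boxes cover
  \<open>\<Omega>\<close>, and their frontiers are null.\<close>

lemma box_integrals_zero:
  fixes v :: "'a::euclidean_space \<Rightarrow> real"
  assumes v: "integrable lborel v" and \<Omega>: "open \<Omega>"
    and 0: "\<And>a b. cbox a b \<subseteq> \<Omega> \<Longrightarrow> (LINT x:box a b|lborel. v x) = 0"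
  shows "AE x in lborel. x \<in> \<Omega> \<longrightarrow> v x = 0"
proof -
  note [measurable] = borel_measurable_integrable[OF v]
  have box: "AE x in lborel. x \<in> box a b \<longrightarrow> v x = 0" if ab: "cbox a b \<subseteq> \<Omega>" for a b
  proof -
    \<comment> \<open>\<open>ennreal\<close> sends negative reals to 0, so \<open>f 1\<close> and
      \<open>f (-1)\<close> are the positive and the negative part of \<open>v\<close> on the
      box.\<close>
    define f where "f = (\<lambda>s x. ennreal (s * v x) * indicator (box a b) x)"
    have [measurable]: "f s \<in> borel_measurable borel" for s unfolding f_def by measurable
    have int: "set_integrable lborel (box l u) v" for l u
      unfolding set_integrable_def by (rule integrable_mult_indicator[OF _ v]) simp
    have eq: "density lborel (f 1) = density lborel (f (-1))"
    proof (rule measure_eqI_generator_eq)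
      let ?E = "range (\<lambda>(a, b). box a b::'a set)"
      show "Int_stable ?E" by (auto simp: Int_stable_def box_Int_box)
      show "?E \<subseteq> Pow UNIV" "sets (density lborel (f 1)) = sigma_sets UNIV ?E" "sets (density lborel (f (-1))) = sigma_sets UNIV ?E"
        by (simp_all add: borel_eq_box)
      let ?A = "\<lambda>n::nat. box (- (real n *\<^sub>R One)) (real n *\<^sub>R One) :: 'a set"
      show "range ?A \<subseteq> ?E" "(\<Union>i. ?A i) = UNIV" unfolding UN_box_eq_UNIV by auto
      have em: "emeasure (density lborel (f s)) (box l u) = (\<integral>\<^sup>+x. ennreal (s * (indicator (box a b \<inter> box l u) x *\<^sub>R v x)) \<partial>lborel)" for s l u
        by (subst emeasure_density) (auto intro!: nn_integral_cong simp: f_def indicator_def)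
      have fin: "(\<integral>\<^sup>+x. ennreal (s * (indicator (box a b \<inter> box l u) x *\<^sub>R v x)) \<partial>lborel) \<noteq> \<infinity>" for s l u
      proof -
        have "integrable lborel (\<lambda>x. s * (indicator (box a b \<inter> box l u) x *\<^sub>R v x))"
          using int[unfolded set_integrable_def] by (simp add: box_Int_box)
        from integrableD(2)[OF this] show ?thesis .
      qed
      show "emeasure (density lborel (f 1)) (?A i) \<noteq> \<infinity>" for i
        unfolding em by (rule fin)
      show "emeasure (density lborel (f 1)) X = emeasure (density lborel (f (-1))) X" if "X \<in> ?E" for X
      proof -
        from that obtain l u where X: "X = box l u" by auto
        obtain l' u' where lu: "box a b \<inter> box l u = box l' u'" "box l' u' \<noteq> {} \<longrightarrow> cbox l' u' \<subseteq> cbox a b"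
        proof -
          obtain l' u' where b: "box a b \<inter> box l u = box l' u'" unfolding box_Int_box by blast
          have "cbox l' u' \<subseteq> cbox a b" if ne: "box l' u' \<noteq> {}"
          proof -
            have "cbox l' u' = closure (box l' u')" using ne by simp
            also have "\<dots> \<subseteq> closure (box a b)" using b by (intro closure_mono) auto
            also have "\<dots> = cbox a b" using ne b by (intro closure_box) auto
            finally show ?thesis .
          qed
          with b show thesis by (intro that) auto
        qed
        have "(LINT x:box l' u'|lborel. v x) = 0"
        proof (cases "box l' u' = {}")
          case False then show ?thesis using 0[of l' u'] lu(2) ab by blast
        qed (simp add: set_lebesgue_integral_def)
        then have z: "(\<integral>x. indicator (box a b \<inter> box l u) x *\<^sub>R v x \<partial>lborel) = 0"
          by (simp add: set_lebesgue_integral_def lu(1))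
        have i: "integrable lborel (\<lambda>x. indicator (box a b \<inter> box l u) x *\<^sub>R v x)"
          using int[of l' u'] unfolding set_integrable_def lu(1) .
        have "enn2real (\<integral>\<^sup>+x. ennreal (1 * (indicator (box a b \<inter> box l u) x *\<^sub>R v x)) \<partial>lborel) =
          enn2real (\<integral>\<^sup>+x. ennreal (-1 * (indicator (box a b \<inter> box l u) x *\<^sub>R v x)) \<partial>lborel)"
          using real_lebesgue_integral_def[OF i] z by simp
        moreover have "P = N" if "enn2real P = enn2real N" "P \<noteq> \<infinity>" "N \<noteq> \<infinity>" for P N :: ennreal
          using that by (cases P; cases N) auto
        ultimately show ?thesis
          unfolding X em using fin[of 1 l u] fin[of "-1" l u] by blast
      qed
    qed
    have "AE x in lborel. f 1 x = f (-1) x"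
      using eq by (subst (asm) sigma_finite_measure.density_unique_iff[OF lborel.sigma_finite_measure_axioms]) auto
    then show ?thesis
    proof eventually_elim
      case (elim x)
      show ?case
      proof
        assume "x \<in> box a b"
        then have "ennreal (v x) = ennreal (- v x)" using elim by (simp add: f_def)
        then show "v x = 0"
          by (cases "0 \<le> v x") (auto simp: ennreal_neg ennreal_eq_0_iff eq_commute[of "0::ennreal"])
      qed
    qed
  qed
  obtain \<D> where \<D>: "countable \<D>" "\<D> \<subseteq> Pow \<Omega>" "\<And>X. X \<in> \<D> \<Longrightarrow> \<exists>a b. X = cbox a b" "\<Union>\<D> = \<Omega>"
    using open_countable_Union_open_cbox[OF \<Omega>] by metis
  have "AE x in lborel. \<forall>X\<in>\<D>. x \<in> X \<longrightarrow> v x = 0"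
  proof (subst AE_ball_countable[OF \<D>(1)], rule ballI)
    fix X assume X: "X \<in> \<D>"
    then obtain a b where ab: "X = cbox a b" using \<D>(3) by blast
    have "AE x in lborel. x \<notin> cbox a b - box a b"
    proof (rule AE_not_in)
      have "cbox a b - box a b \<in> sets borel" by simp
      then show "cbox a b - box a b \<in> null_sets lborel"
        using negligible_frontier_interval[of a b]
        by (simp add: negligible_iff_null_sets null_sets_completion_iff)
    qed
    moreover have "AE x in lborel. x \<in> box a b \<longrightarrow> v x = 0" using box X \<D>(2) ab by blast
    ultimately show "AE x in lborel. x \<in> X \<longrightarrow> v x = 0"
      by eventually_elim (auto simp: ab)
  qed
  then show ?thesis by eventually_elim (use \<D>(4) in blast)
qed

section \<open>Restriction and uniqueness of weak gradients\<close>

lemma L2_subset: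
  fixes u :: "'a::euclidean_space \<Rightarrow> 'b::euclidean_space"
  assumes "u \<in> L2 \<Omega>" "open \<Omega>" "open K" "K \<subseteq> \<Omega>"
  shows "u \<in> L2 K"
proof -
  have r: "lebesgue_on K = restrict_space (lebesgue_on \<Omega>) K"
    using assms by (simp add: restrict_restrict_space Int_absorb1 borel_open)
  have K: "K \<inter> space (lebesgue_on \<Omega>) \<in> sets (lebesgue_on \<Omega>)"
    using assms by (auto simp: sets_restrict_space borel_open)
  have Ks: "K \<in> sets (lebesgue_on \<Omega>)"
    using K assms(4) by (simp add: Int_absorb2 space_restrict_space)
  have "u \<in> borel_measurable (lebesgue_on K)"
    unfolding r by (rule measurable_restrict_space1) (use assms(1) in \<open>simp add: L2_def\<close>)
  moreover have "integrable (lebesgue_on K) (\<lambda>x. (norm (u x))\<^sup>2)"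
    unfolding r integrable_restrict_space[OF K]
    by (rule integrable_mult_indicator[OF Ks]) (use assms(1) in \<open>simp add: L2_def\<close>)
  ultimately show ?thesis by (simp add: L2_def)
qed

lemma integral_lebesgue_on_support:
  fixes f :: "'a::euclidean_space \<Rightarrow> real"
  assumes "open \<Omega>" "open K" "K \<subseteq> \<Omega>" "\<And>x. x \<notin> K \<Longrightarrow> f x = 0"
  shows "integral\<^sup>L (lebesgue_on \<Omega>) f = integral\<^sup>L (lebesgue_on K) f"
  using assms
  by (auto simp: integral_restrict_space borel_open indicator_def intro!: Bochner_Integration.integral_cong)

text \<open>A test function supported in \<open>K\<close> is also one for \<open>\<Omega>\<close>.
  The point to check is that its gradient vanishes off \<open>K\<close>: there the function is
  locally zero, because its support is closed.\<close>

lemma weak_gradient_subset: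
  assumes w: "weak_gradient \<Omega> u w" and K: "open \<Omega>" "open K" "K \<subseteq> \<Omega>"
  shows "weak_gradient K u w"
  unfolding weak_gradient_def
proof (intro conjI allI impI ballI)
  show "w \<in> L2 K" by (rule L2_subset[OF _ K]) (use w in \<open>simp add: weak_gradient_def\<close>)
  fix \<phi> D\<phi> C and i :: 'a
  assume A: "C1_gradient \<phi> D\<phi> \<and> compact C \<and> C \<subseteq> K \<and> (\<forall>x. x \<notin> C \<longrightarrow> \<phi> x = 0)" and i: "i \<in> Basis"
  have D0: "D\<phi> x = 0" if x: "x \<notin> K" for x
  proof -
    have "open (- C)" "x \<in> - C" using A x by (auto simp: compact_imp_closed)
    moreover have "((\<lambda>_. 0) has_derivative (\<lambda>h. 0)) (at x)" by simp
    ultimately have "(\<phi> has_derivative (\<lambda>h. 0)) (at x)"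
      using A by (intro has_derivative_transform_within_open[where f="\<lambda>_. 0" and s="- C" and t=UNIV and g=\<phi>, simplified]) auto
    moreover have "(\<phi> has_derivative (\<lambda>h. h \<bullet> D\<phi> x)) (at x)" using A by (simp add: C1_gradient_def gderiv_def)
    ultimately have "(\<lambda>h. h \<bullet> D\<phi> x) = (\<lambda>h. 0)" by (rule has_derivative_unique[symmetric])
    from fun_cong[OF this, of "D\<phi> x"] show ?thesis by simp
  qed
  have "(LINT x|lebesgue_on \<Omega>. u x * (D\<phi> x \<bullet> i)) = - (LINT x|lebesgue_on \<Omega>. (w x \<bullet> i) * \<phi> x)"
    by (rule weak_gradientD[OF w, of _ _ C]) (use A K i in auto)
  moreover have "(LINT x|lebesgue_on \<Omega>. u x * (D\<phi> x \<bullet> i)) = (LINT x|lebesgue_on K. u x * (D\<phi> x \<bullet> i))"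
    by (rule integral_lebesgue_on_support[OF K]) (simp add: D0)
  moreover have "(LINT x|lebesgue_on \<Omega>. (w x \<bullet> i) * \<phi> x) = (LINT x|lebesgue_on K. (w x \<bullet> i) * \<phi> x)"
    by (rule integral_lebesgue_on_support[OF K]) (use A in auto)
  ultimately show "(LINT x|lebesgue_on K. u x * (D\<phi> x \<bullet> i)) = - (LINT x|lebesgue_on K. (w x \<bullet> i) * \<phi> x)" by simp
qed

text \<open>Testing with \<open>\<eta> n (x - y)\<close> shows that the mollified difference of each
  component vanishes on a closed box in \<open>\<Omega>\<close> for large \<open>n\<close>; the
  limit gives zero integrals over boxes. Uniqueness matters because \<open>trace_on\<close> brings a
  weak gradient of its own.\<close>

lemma weak_gradient_unique:
  fixes u :: "'a::euclidean_space \<Rightarrow> real"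
  assumes \<Omega>: "open \<Omega>" "bounded \<Omega>" and w: "weak_gradient \<Omega> u w" "weak_gradient \<Omega> u w'"
  shows "AE x in lebesgue_on \<Omega>. w x = w' x"
proof -
  have wL: "w \<in> L2 \<Omega>" "w' \<in> L2 \<Omega>" using w by (auto simp: weak_gradient_def)
  note [measurable] = L2_measurable[OF wL(1)] L2_measurable[OF wL(2)]
  have oB: "\<Omega> \<in> sets borel" using \<Omega> by (simp add: borel_open)
  have comp: "AE x in lebesgue_on \<Omega>. w x \<bullet> i = w' x \<bullet> i" if i: "i \<in> Basis" for i
  proof -
    define f where "f = (\<lambda>x. w x \<bullet> i - w' x \<bullet> i)"
    have fm[measurable]: "f \<in> borel_measurable (lebesgue_on \<Omega>)" unfolding f_def by measurable
    have mi: "integrable (lebesgue_on \<Omega>) (\<lambda>x. b x * (w x \<bullet> i))" "integrable (lebesgue_on \<Omega>) (\<lambda>x. b x * (w' x \<bullet> i))"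
      if b: "b \<in> borel_measurable borel" "\<And>x. \<bar>b x\<bar> \<le> B" for b :: "'a \<Rightarrow> real" and B
    proof -
      have "(\<lambda>x. w x \<bullet> i) \<in> L2 \<Omega>" "(\<lambda>x. w' x \<bullet> i) \<in> L2 \<Omega>"
      proof -
        have *: "(\<lambda>x. y x \<bullet> i) \<in> L2 \<Omega>" if y: "y \<in> L2 \<Omega>" for y
        proof -
          note [measurable] = L2_measurable[OF y]
          have "integrable (lebesgue_on \<Omega>) (\<lambda>x. (norm (y x))\<^sup>2)" using y by (simp add: L2_def)
          then have "integrable (lebesgue_on \<Omega>) (\<lambda>x. (norm (y x \<bullet> i))\<^sup>2)"
            by (rule Bochner_Integration.integrable_bound) 
              (use Basis_le_norm[OF i] in \<open>auto intro!: AE_I2 simp: abs_le_square_iff[symmetric]\<close>)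
          then show ?thesis by (simp add: L2_def)
        qed
        show "(\<lambda>x. w x \<bullet> i) \<in> L2 \<Omega>" "(\<lambda>x. w' x \<bullet> i) \<in> L2 \<Omega>" using * wL by auto
      qed
      with L2_integrable[OF \<Omega> _ b(1), of _ B] b(2)
      show "integrable (lebesgue_on \<Omega>) (\<lambda>x. b x * (w x \<bullet> i))" "integrable (lebesgue_on \<Omega>) (\<lambda>x. b x * (w' x \<bullet> i))" by auto
    qed
    obtain v where v: "v \<in> borel_measurable borel" "AE x in lborel. indicator \<Omega> x * f x = v x"
      using borel_representative[OF \<Omega>(1) fm] by blast
    have "integrable (lebesgue_on \<Omega>) f"
      using mi[of "\<lambda>_. 1" 1] unfolding f_def by simp
    then have "set_integrable lborel \<Omega> v"
      using integral_lebesgue_on_rep(2)[OF oB order_refl \<Omega>(1) fm v(2,1)] by simp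
    then have "integrable lborel (\<lambda>x. indicator \<Omega> x * v x)" by (simp add: set_integrable_def)
    moreover have "AE x in lborel. indicator \<Omega> x * v x = v x"
      using v(2) by eventually_elim (auto simp: indicator_def)
    ultimately have iv: "integrable lborel v"
      using oB v(1) by (subst (asm) integrable_cong_AE) auto
    obtain \<eta> :: "nat \<Rightarrow> 'a \<Rightarrow> real" and D\<eta> where m': "\<And>n. mollifier (inverse (real (Suc n))) (\<eta> n) (D\<eta> n)"
      using mollifier_sequence by blast
    define \<epsilon> where "\<epsilon> = (\<lambda>n. inverse (real (Suc n)))"
    have \<epsilon>0: "\<epsilon> \<longlonglongrightarrow> 0" unfolding \<epsilon>_def by (rule LIMSEQ_inverse_real_of_nat)
    have m: "mollifier (\<epsilon> n) (\<eta> n) (D\<eta> n)" for n using m' unfolding \<epsilon>_def .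
    have "AE x in lborel. x \<in> \<Omega> \<longrightarrow> v x = 0"
    proof (rule box_integrals_zero[OF iv \<Omega>(1)])
      fix a b :: 'a assume ab: "cbox a b \<subseteq> \<Omega>"
      obtain e where e: "0 < e" "\<forall>x\<in>cbox a b. cball x e \<subseteq> \<Omega>"
        using compact_subset_open_imp_cball_epsilon_subset[OF compact_cbox \<Omega>(1) ab] by (auto simp: UN_subset_iff)
      have z: "moll (\<eta> n) v x = 0" if n: "\<epsilon> n < e" and x: "x \<in> cbox a b" for n x
      proof -
        have sub: "cball x (\<epsilon> n) \<subseteq> \<Omega>" using bspec[OF e(2) x] n by force
        have out: "\<eta> n (x - y) = 0" if "y \<notin> cball x (\<epsilon> n)" for y
          using that mollifierD(3)[OF m, of n "x - y"] by (simp add: dist_norm)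
        obtain B where B: "\<And>x. \<bar>\<eta> n x\<bar> \<le> B" using m[of n] unfolding mollifier_def by blast
        have [measurable]: "\<eta> n \<in> borel_measurable borel" by (rule mollifierD(5)[OF m])
        have bm: "(\<lambda>y. \<eta> n (x - y)) \<in> borel_measurable borel" by measurable
        have wg: "(LINT y|lebesgue_on \<Omega>. u y * ((- D\<eta> n (x - y)) \<bullet> i)) = - (LINT y|lebesgue_on \<Omega>. (w y \<bullet> i) * \<eta> n (x - y))"
          by (rule weak_gradientD[OF w(1) mollifier_test[OF m] compact_cball sub out i])
        have wg': "(LINT y|lebesgue_on \<Omega>. u y * ((- D\<eta> n (x - y)) \<bullet> i)) = - (LINT y|lebesgue_on \<Omega>. (w' y \<bullet> i) * \<eta> n (x - y))"
          by (rule weak_gradientD[OF w(2) mollifier_test[OF m] compact_cball sub out i])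
        have "moll (\<eta> n) v x = (LINT y:\<Omega>|lborel. v y * \<eta> n (x - y))"
          unfolding moll_def set_lebesgue_integral_def
        proof (rule integral_cong_AE)
          show "AE y in lborel. v y * \<eta> n (x - y) = indicator \<Omega> y *\<^sub>R (v y * \<eta> n (x - y))"
            using v(2) by eventually_elim (auto simp: indicator_def)
        qed (use oB v(1) bm in measurable)
        also have "\<dots> = (LINT y|lebesgue_on \<Omega>. f y * \<eta> n (x - y))"
        proof (rule integral_lebesgue_on_rep(1)[OF oB order_refl \<Omega>(1), symmetric])
          show "AE y in lborel. indicator \<Omega> y * (f y * \<eta> n (x - y)) = v y * \<eta> n (x - y)"
            using v(2) by eventually_elim (metis mult.assoc)
          note [measurable] = borel_measurable_lebesgue_on[OF bm, of \<Omega>]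
          show "(\<lambda>y. f y * \<eta> n (x - y)) \<in> borel_measurable (lebesgue_on \<Omega>)" by measurable
          show "(\<lambda>y. v y * \<eta> n (x - y)) \<in> borel_measurable borel" using v(1) bm by measurable
        qed
        also have "\<dots> = (LINT y|lebesgue_on \<Omega>. (w y \<bullet> i) * \<eta> n (x - y)) - (LINT y|lebesgue_on \<Omega>. (w' y \<bullet> i) * \<eta> n (x - y))"
          using mi[OF bm B] unfolding f_def
          by (subst Bochner_Integration.integral_diff[symmetric]) (simp_all add: algebra_simps)
        also have "\<dots> = 0" using wg wg' by simp
        finally show ?thesis .
      qed
      have "eventually (\<lambda>n. (LINT x:box a b|lborel. moll (\<eta> n) v x) = 0) sequentially"
        using order_tendstoD(2)[OF \<epsilon>0 e(1)]
      proof eventually_elim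
        case (elim n)
        have "(\<lambda>x. indicator (box a b) x *\<^sub>R moll (\<eta> n) v x) = (\<lambda>x. 0)"
          using z[OF elim] box_subset_cbox[of a b] by (auto simp: fun_eq_iff indicator_def)
        then show ?case by (simp add: set_lebesgue_integral_def)
      qed
      then have "(\<lambda>n. LINT x:box a b|lborel. moll (\<eta> n) v x) \<longlonglongrightarrow> 0" by (rule tendsto_eventually)
      moreover have "(\<lambda>n. LINT x:box a b|lborel. moll (\<eta> n) v x) \<longlonglongrightarrow> (LINT x:box a b|lborel. v x)"
        by (rule moll_integral_limit[OF iv _ _ _ m \<epsilon>0]) auto
      ultimately show "(LINT x:box a b|lborel. v x) = 0" by (metis LIMSEQ_unique)
    qed
    then have "AE x in lborel. x \<in> \<Omega> \<longrightarrow> f x = 0" using v(2) by eventually_elim auto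
    then have "AE x in lebesgue. x \<in> \<Omega> \<longrightarrow> f x = 0" by (rule AE_completion)
    then show ?thesis using oB by (subst AE_restrict_space_iff) (auto simp: f_def elim: eventually_mono)
  qed
  have "AE x in lebesgue_on \<Omega>. \<forall>i\<in>Basis. w x \<bullet> i = w' x \<bullet> i"
    by (rule AE_finite_allI) (use comp in auto)
  then show ?thesis by eventually_elim (auto intro: euclidean_eqI)
qed

text \<open>At a boundary edge mollification would reach outside \<open>\<Omega>\<close>, so the C1
  functions that define the trace are used for the approximation. Their gradients converge to
  \<open>w'\<close>, which agrees with \<open>w\<close> almost everywhere. The factor 2 comes from
  bounding the square of \<open>D\<phi> j\<close> by twice the squares of \<open>w\<close> and of
  \<open>D\<phi> j - w'\<close>; the latter term vanishes in the limit.\<close>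

lemma trace_mean_estimate:
  fixes u :: "'a::euclidean_space \<Rightarrow> real"
  assumes K: "open K" "bounded K" "convex K" "z \<in> K"
    and \<sigma>: "\<sigma> \<subseteq> closure K" "\<sigma> \<subseteq> {x. \<nu> \<bullet> x = c}" "surf \<sigma> = completion (hyp_borel \<nu> c)" "0 < surf_meas \<sigma>"
    and \<nu>: "norm \<nu> = 1"
    and D: "0 < D" "\<And>q. q \<in> \<sigma> \<Longrightarrow> dist z q \<le> D" and \<rho>: "0 < \<rho>" "\<rho> \<le> 1" "\<rho> * D \<le> \<bar>c - \<nu> \<bullet> z\<bar>"
    and B: "ball z (\<rho> * D) \<subseteq> K"
    and u: "trace_mean K \<sigma> u a" and w: "weak_gradient K u w"
  shows "ennreal (surf_meas \<sigma> * (a - lavg (ball z (\<rho> * D)) u)\<^sup>2) \<le>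
    ennreal (\<bar>c - \<nu> \<bullet> z\<bar> * trace_const DIM('a) \<rho>) * (2 * (\<integral>\<^sup>+x. ennreal ((norm (w x))\<^sup>2) \<partial>lebesgue_on K))"
proof -
  let ?A = "main_part (hyp_borel \<nu> c) \<sigma>" and ?B = "ball z (\<rho> * D)"
  interpret finite_measure "lebesgue_on K" by (rule finite_measure_lebesgue_on[OF K(1,2)])
  obtain g where g: "trace_on K \<sigma> u g" "set_lebesgue_integral (surf \<sigma>) \<sigma> g = a * surf_meas \<sigma>"
    using trace_mean_integral[OF u \<sigma>(4)] .
  obtain w' \<phi> D\<phi> where w': "weak_gradient K u w'" and \<phi>: "\<And>j::nat. C1_gradient (\<phi> j) (D\<phi> j)"
    and lu: "(\<lambda>k. \<integral>\<^sup>+x. ennreal ((\<phi> k x - u x)\<^sup>2) \<partial>lebesgue_on K) \<longlonglongrightarrow> 0"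
    and lw: "(\<lambda>k. \<integral>\<^sup>+x. ennreal ((norm (D\<phi> k x - w' x))\<^sup>2) \<partial>lebesgue_on K) \<longlonglongrightarrow> 0"
    and lg: "(\<lambda>k. \<integral>\<^sup>+x. ennreal ((\<phi> k x - g x)\<^sup>2) * indicator \<sigma> x \<partial>surf \<sigma>) \<longlonglongrightarrow> 0"
    and uL: "u \<in> L2 K" and gm: "g \<in> borel_measurable (surf \<sigma>)"
    using g(1) unfolding trace_on_def by blast
  have wL: "w \<in> L2 K" using w by (simp add: weak_gradient_def)
  note mp = main_part_flat[OF \<sigma>(3,4)]
  have b\<sigma>: "bounded \<sigma>" using K(2) \<sigma>(1) bounded_closure bounded_subset by blast
  have \<phi>m[measurable]: "\<phi> j \<in> borel_measurable borel" "D\<phi> j \<in> borel_measurable borel" for j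
    using C1_gradient_continuous[OF \<phi>] by (auto intro: borel_measurable_continuous_onI)
  have [measurable]: "\<phi> j \<in> borel_measurable (lebesgue_on K)" "D\<phi> j \<in> borel_measurable (lebesgue_on K)" for j
    by (auto intro: borel_measurable_lebesgue_on)
  note [measurable] = L2_measurable[OF uL] L2_measurable[OF wL]
  have KB: "K \<in> sets borel" using K(1) by (simp add: borel_open)
  have est: "ennreal (surf_meas \<sigma> * (hyp_avg \<nu> c ?A (\<phi> j) - avg ?B (\<phi> j))\<^sup>2) \<le>
    ennreal (\<bar>c - \<nu> \<bullet> z\<bar> * trace_const DIM('a) \<rho>) * (2 * (\<integral>\<^sup>+x. ennreal ((norm (w x))\<^sup>2) \<partial>lebesgue_on K)
      + 2 * (\<integral>\<^sup>+x. ennreal ((norm (D\<phi> j x - w' x))\<^sup>2) \<partial>lebesgue_on K))" for j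
  proof -
    have seg: "p + t *\<^sub>R (y - p) \<in> K" if "y \<in> open_cone z ?A" "p \<in> ?B" "0 \<le> t" "t \<le> 1" for y p t
    proof -
      have "open_cone z ?A \<subseteq> K" using mp(2) \<sigma>(1) by (intro open_cone_subset_convex[OF K(1,3,4)]) auto
      then have "y \<in> K" "p \<in> K" using that B by auto
      then have "(1 - t) *\<^sub>R p + t *\<^sub>R y \<in> K" using K(3) that by (intro convexD_alt) auto
      then show ?thesis by (simp add: algebra_simps)
    qed
    have le: "ennreal (surf_meas \<sigma> * (hyp_avg \<nu> c ?A (\<phi> j) - avg ?B (\<phi> j))\<^sup>2) \<le>
      ennreal (\<bar>c - \<nu> \<bullet> z\<bar> * trace_const DIM('a) \<rho>) * (\<integral>\<^sup>+x\<in>K. ennreal ((norm (D\<phi> j x))\<^sup>2) \<partial>lborel)"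
      unfolding mp(4)[symmetric]
      by (rule hyp_avg_ball[OF \<phi> \<nu> mp(3) _ D(1) _ \<rho> KB seg]) (use mp(2) \<sigma>(2) D(2) in auto)
    have "(\<integral>\<^sup>+x\<in>K. ennreal ((norm (D\<phi> j x))\<^sup>2) \<partial>lborel) = (\<integral>\<^sup>+x. ennreal ((norm (D\<phi> j x))\<^sup>2) \<partial>lebesgue_on K)"
      by (rule nn_integral_lebesgue_on_rep[OF K(1), symmetric]) simp
    also have "\<dots> \<le> (\<integral>\<^sup>+x. 2 * ennreal ((norm (w x))\<^sup>2) + 2 * ennreal ((norm (D\<phi> j x - w' x))\<^sup>2) \<partial>lebesgue_on K)"
    proof (rule nn_integral_mono_AE)
      show "AE x in lebesgue_on K. ennreal ((norm (D\<phi> j x))\<^sup>2) \<le> 2 * ennreal ((norm (w x))\<^sup>2) + 2 * ennreal ((norm (D\<phi> j x - w' x))\<^sup>2)"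
        using weak_gradient_unique[OF K(1,2) w w']
      proof eventually_elim
        case (elim x)
        have "norm (D\<phi> j x) \<le> norm (w x) + norm (D\<phi> j x - w' x)"
          using norm_triangle_ineq[of "w' x" "D\<phi> j x - w' x"] elim by simp
        then have "(norm (D\<phi> j x))\<^sup>2 \<le> (norm (w x) + norm (D\<phi> j x - w' x))\<^sup>2" by (intro power_mono) auto
        also have "\<dots> \<le> 2 * (norm (w x))\<^sup>2 + 2 * (norm (D\<phi> j x - w' x))\<^sup>2"
          using sum_squares_bound[of "norm (w x)" "norm (D\<phi> j x - w' x)"] by (simp add: power2_sum)
        finally have "ennreal ((norm (D\<phi> j x))\<^sup>2) \<le> ennreal (2 * (norm (w x))\<^sup>2 + 2 * (norm (D\<phi> j x - w' x))\<^sup>2)"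
          by (rule ennreal_leI)
        then show ?case by (simp add: ennreal_plus ennreal_mult)
      qed
    qed
    also have "\<dots> = 2 * (\<integral>\<^sup>+x. ennreal ((norm (w x))\<^sup>2) \<partial>lebesgue_on K)
      + 2 * (\<integral>\<^sup>+x. ennreal ((norm (D\<phi> j x - w' x))\<^sup>2) \<partial>lebesgue_on K)"
    proof -
      have [measurable]: "w' \<in> borel_measurable (lebesgue_on K)"
        using w' by (auto simp: weak_gradient_def intro: L2_measurable)
      show ?thesis by (subst nn_integral_add) (auto simp: nn_integral_cmult)
    qed
    finally show ?thesis by (intro order_trans[OF le mult_left_mono]) auto
  qed
  have "(\<lambda>j. hyp_avg \<nu> c ?A (\<phi> j)) \<longlonglongrightarrow> a"
  proof -
    have "(\<lambda>j. LINT q:?A|hyp_borel \<nu> c. \<phi> j q) \<longlonglongrightarrow> a * surf_meas \<sigma>"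
      using trace_surf_limit[OF \<phi> b\<sigma> \<sigma>(3,4) \<nu> lg gm] g(2) by simp
    then have "(\<lambda>j. (LINT q:?A|hyp_borel \<nu> c. \<phi> j q) / surf_meas \<sigma>) \<longlonglongrightarrow> a * surf_meas \<sigma> / surf_meas \<sigma>"
      using \<sigma>(4) by (intro tendsto_intros) auto
    then show ?thesis using \<sigma>(4) by (simp add: hyp_avg_def mp(4))
  qed
  moreover have "(\<lambda>j. avg ?B (\<phi> j)) \<longlonglongrightarrow> lavg ?B u"
  proof -
    have Bb: "?B \<in> sets borel" by simp
    have ib: "(indicator ?B :: 'a \<Rightarrow> real) \<in> borel_measurable borel" by (rule borel_measurable_indicator) simp
    have sbm: "set_borel_measurable borel ?B (\<phi> j)" for j
      unfolding set_borel_measurable_def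
      using ib \<phi>m(1)[of j] by (rule borel_measurable_scaleR)
    have int: "integrable (lebesgue_on K) (\<lambda>x. indicator ?B x * \<phi> j x)" for j
    proof -
      have "set_integrable lborel (cball z (\<rho> * D)) (\<phi> j)"
        unfolding set_integrable_def by (rule borel_integrable_compact)
          (auto intro: continuous_on_subset[OF C1_gradient_continuous(1)[OF \<phi>]])
      then have "set_integrable lborel ?B (\<phi> j)" by (rule set_integrable_subset) auto
      then show ?thesis using integral_lebesgue_on_borel(2)[OF K(1) B Bb sbm[of j]] by blast
    qed
    have iB[measurable]: "(indicator ?B :: 'a \<Rightarrow> real) \<in> borel_measurable (lebesgue_on K)"
      by (rule borel_measurable_lebesgue_on[OF ib])
    have lim: "(\<lambda>j. LINT x|lebesgue_on K. indicator ?B x * \<phi> j x) \<longlonglongrightarrow> (LINT x|lebesgue_on K. indicator ?B x * u x)"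
    proof (rule integral_tendsto_L2(2)[OF int])
      show "(\<lambda>x. indicator ?B x * u x) \<in> borel_measurable (lebesgue_on K)" by measurable
      show "(\<lambda>j. \<integral>\<^sup>+x. ennreal ((indicator ?B x * \<phi> j x - indicator ?B x * u x)\<^sup>2) \<partial>lebesgue_on K) \<longlonglongrightarrow> 0"
        by (rule tendsto_sandwich[OF _ _ tendsto_const lu])
          (auto intro!: always_eventually nn_integral_mono simp: indicator_def)
    qed
    have 1: "(LINT x|lebesgue_on K. indicator ?B x * \<phi> j x) = integral\<^sup>L (restrict_space lborel ?B) (\<phi> j)" for j
      using integral_lebesgue_on_borel(1)[OF K(1) B Bb sbm[of j]] integral_restrict_lborel[OF Bb, of "\<phi> j"] by simp
    have 2: "(LINT x|lebesgue_on K. indicator ?B x * u x) = integral\<^sup>L (lebesgue_on ?B) u"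
    proof -
      have "(LINT x|lebesgue_on K. indicator ?B x * u x) = (LINT x|lebesgue_on ?B. indicator ?B x * u x)"
        by (rule integral_lebesgue_on_support[OF K(1) open_ball B]) simp
      also have "\<dots> = integral\<^sup>L (lebesgue_on ?B) u"
        by (rule Bochner_Integration.integral_cong) (auto simp: space_restrict_space)
      finally show ?thesis .
    qed
    have "0 < \<rho> * D" using D(1) \<rho>(1) by simp
    then have nz: "measure lborel ?B \<noteq> 0" using content_ball_pos[of "\<rho> * D" z] by simp
    show ?thesis unfolding avg_def lavg_def using lim unfolding 1 2 by (intro tendsto_divide tendsto_const nz)
  qed
  ultimately have L: "(\<lambda>j. ennreal (surf_meas \<sigma> * (hyp_avg \<nu> c ?A (\<phi> j) - avg ?B (\<phi> j))\<^sup>2)) \<longlonglongrightarrow>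
    ennreal (surf_meas \<sigma> * (a - lavg ?B u)\<^sup>2)"
    by (intro tendsto_ennrealI tendsto_intros)
  let ?W = "\<integral>\<^sup>+x. ennreal ((norm (w x))\<^sup>2) \<partial>lebesgue_on K"
  have "(\<lambda>j. ennreal (\<bar>c - \<nu> \<bullet> z\<bar> * trace_const DIM('a) \<rho>) * (2 * ?W
      + 2 * (\<integral>\<^sup>+x. ennreal ((norm (D\<phi> j x - w' x))\<^sup>2) \<partial>lebesgue_on K))) \<longlonglongrightarrow>
      ennreal (\<bar>c - \<nu> \<bullet> z\<bar> * trace_const DIM('a) \<rho>) * (2 * ?W + 2 * 0)"
    by (intro ennreal_tendsto_cmult tendsto_add tendsto_const lw) auto
  then have R: "(\<lambda>j. ennreal (\<bar>c - \<nu> \<bullet> z\<bar> * trace_const DIM('a) \<rho>) * (2 * ?W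
      + 2 * (\<integral>\<^sup>+x. ennreal ((norm (D\<phi> j x - w' x))\<^sup>2) \<partial>lebesgue_on K))) \<longlonglongrightarrow>
      ennreal (\<bar>c - \<nu> \<bullet> z\<bar> * trace_const DIM('a) \<rho>) * (2 * ?W)" by simp
  show ?thesis by (rule tendsto_le[OF _ R L]) (use est in auto)
qed

text \<open>The union of all segments from \<open>B\<close> to \<open>S\<close>. Their end points
  are included to make it compact, as \<open>weak_gradient_transfer\<close> demands.\<close>

definition join_set :: "'a::euclidean_space set \<Rightarrow> 'a set \<Rightarrow> 'a set" where
  "join_set B S = (\<lambda>(p, q, t). (1 - t) *\<^sub>R p + t *\<^sub>R q) ` (B \<times> S \<times> {0..1})"

lemma compact_join_set: "compact B \<Longrightarrow> compact S \<Longrightarrow> compact (join_set B S)"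
  unfolding join_set_def
  by (intro compact_continuous_image compact_Times compact_Icc)
     (auto simp: case_prod_unfold intro!: continuous_intros)

lemma join_set_subset:
  assumes "open K" "convex K" "B \<subseteq> K" "S \<subseteq> closure K"
  shows "join_set B S \<subseteq> K \<union> S"
proof
  fix x assume "x \<in> join_set B S"
  then obtain p q t where x: "x = (1 - t) *\<^sub>R p + t *\<^sub>R q" and pq: "p \<in> B" "q \<in> S" and t: "0 \<le> t" "t \<le> 1"
    by (auto simp: join_set_def)
  show "x \<in> K \<union> S"
  proof (cases "t = 1 \<or> t = 0 \<or> p = q")
    case True
    then show ?thesis using x pq assms(3) by (auto simp: scaleR_collapse)
  next
    case False
    have "p \<in> interior K" using assms pq by (auto simp: interior_open)
    then have "open_segment p q \<subseteq> interior K"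
      using assms pq by (intro in_interior_closure_convex_segment) auto
    moreover have "x \<in> open_segment p q" unfolding in_segment using x False t by (intro conjI exI[of _ t]) auto
    ultimately show ?thesis using interior_subset by blast
  qed
qed

text \<open>A point between \<open>p\<close> and \<open>z + s *\<^sub>R (q - z)\<close> is a convex
  combination of \<open>p\<close>, \<open>z\<close> and \<open>q\<close> with weight
  \<open>t * s\<close> on \<open>q\<close>. The remaining weight is carried by \<open>p'\<close>, a
  convex combination of \<open>p\<close> and \<open>z\<close>, which lies in
  \<open>B\<close>.\<close>

lemma join_set_segment:
  assumes "y \<in> open_cone z S" "p \<in> B" "z \<in> B" "convex B" "0 \<le> t" "t \<le> 1"
  shows "p + t *\<^sub>R (y - p) \<in> join_set B S"
proof -
  obtain s q where y: "y = z + s *\<^sub>R (q - z)" "q \<in> S" "0 < s" "s < 1" using assms(1) by (auto simp: open_cone_def)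
  have ts: "t * s < 1" using y(3,4) assms(5,6) by (metis mult_le_one mult_left_le_one_le less_eq_real_def mult_1 mult_le_cancel_right2 not_less le_less_trans)
  define p' where "p' = ((1 - t) / (1 - t * s)) *\<^sub>R p + (t * (1 - s) / (1 - t * s)) *\<^sub>R z"
  have "p' \<in> B" unfolding p'_def
  proof (rule convexD[OF assms(4,2,3)])
    have "(1 - t) + t * (1 - s) = 1 - t * s" by (simp add: algebra_simps)
    then show "(1 - t) / (1 - t * s) + t * (1 - s) / (1 - t * s) = 1" using ts by (simp add: add_divide_distrib[symmetric])
  qed (use ts y assms in auto)
  moreover have "(1 - t * s) *\<^sub>R p' = (1 - t) *\<^sub>R p + (t * (1 - s)) *\<^sub>R z"
    unfolding p'_def scaleR_add_right scaleR_scaleR using ts by simp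
  then have "p + t *\<^sub>R (y - p) = (1 - t * s) *\<^sub>R p' + (t * s) *\<^sub>R q"
    unfolding y(1) by (simp add: algebra_simps)
  moreover have "0 \<le> t * s" using y assms by simp
  ultimately show ?thesis unfolding join_set_def using y(2) ts
    by (intro image_eqI[of _ _ "(p', q, t * s)"]) auto
qed

text \<open>Both ball means are compared with the mean over the common flat set \<open>S\<close>.
  Taking \<open>S\<close> compact and inside \<open>\<Omega>\<close> makes the two join sets compact
  subsets of \<open>\<Omega>\<close>, so the C1 estimate transfers. Outside
  \<open>K \<union> L\<close> these sets contain only points of \<open>S\<close>, which is null in
  full dimension.\<close>

lemma interior_edge_estimate:
  fixes u :: "'a::euclidean_space \<Rightarrow> real"
  assumes \<Omega>: "open \<Omega>" "bounded \<Omega>" and u: "u \<in> L2 \<Omega>" and w: "weak_gradient \<Omega> u w"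
    and K: "open K" "convex K" "K \<subseteq> \<Omega>" and L: "open L" "convex L" "L \<subseteq> \<Omega>"
    and \<nu>: "norm \<nu> = 1" and S: "compact S" "S \<subseteq> {x. \<nu> \<bullet> x = c}" "S \<subseteq> \<Omega>" "S \<subseteq> closure K" "S \<subseteq> closure L"
    and \<rho>: "0 < \<rho>" "\<rho> \<le> 1"
    and x: "cball x (\<rho> * D) \<subseteq> K" "0 < D" "\<And>q. q \<in> S \<Longrightarrow> dist x q \<le> D" "\<rho> * D \<le> \<bar>c - \<nu> \<bullet> x\<bar>"
    and y: "cball y (\<rho> * E) \<subseteq> L" "0 < E" "\<And>q. q \<in> S \<Longrightarrow> dist y q \<le> E" "\<rho> * E \<le> \<bar>c - \<nu> \<bullet> y\<bar>"
  shows "ennreal (measure (hyp_borel \<nu> c) S * (lavg (ball x (\<rho> * D)) u - lavg (ball y (\<rho> * E)) u)\<^sup>2) \<le>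
    ennreal (2 * (\<bar>c - \<nu> \<bullet> x\<bar> + \<bar>c - \<nu> \<bullet> y\<bar>) * trace_const DIM('a) \<rho>) *
    (\<integral>\<^sup>+x\<in>K \<union> L. ennreal ((norm (w x))\<^sup>2) \<partial>lebesgue_on \<Omega>)"
proof (cases "S = {}")
  case True then show ?thesis by simp
next
  case False
  define \<mu> where "\<mu> = measure (hyp_borel \<nu> c) S"
  define c0 where "c0 = trace_const DIM('a) \<rho>"
  have c0: "0 < c0" unfolding c0_def using \<rho> by (intro trace_const_pos) auto
  define X where "X = join_set (cball x (\<rho> * D)) S"
  define Y where "Y = join_set (cball y (\<rho> * E)) S"
  have rx: "0 < \<rho> * D" "0 < \<rho> * E" using \<rho> x(2) y(2) by auto
  have cXY: "compact X" "compact Y" unfolding X_def Y_def using S(1) by (auto intro: compact_join_set)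
  have X: "X \<subseteq> K \<union> S" unfolding X_def by (rule join_set_subset[OF K(1,2) x(1) S(4)])
  have Y: "Y \<subseteq> L \<union> S" unfolding Y_def by (rule join_set_subset[OF L(1,2) y(1) S(5)])
  have Sb: "S \<in> sets borel" using S(1) by (simp add: borel_compact)
  have XYb: "X \<in> sets borel" "Y \<in> sets borel" using cXY by (auto simp: borel_compact)
  have "ennreal (\<mu> * (lavg (ball x (\<rho> * D)) u - lavg (ball y (\<rho> * E)) u)\<^sup>2) \<le>
     ennreal (2 * (\<bar>c - \<nu> \<bullet> x\<bar> + \<bar>c - \<nu> \<bullet> y\<bar>) * c0) * (\<integral>\<^sup>+z\<in>X \<union> Y. ennreal ((norm (w z))\<^sup>2) \<partial>lebesgue_on \<Omega>)"
  proof (rule weak_gradient_transfer[OF \<Omega> u w])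
    show "compact (X \<union> Y)" using cXY by (rule compact_Un)
    show "X \<union> Y \<subseteq> \<Omega>" using X Y K(3) L(3) S(3) by blast
    show "X \<union> Y \<noteq> {}" using False rx unfolding X_def join_set_def by auto
    show "ball x (\<rho> * D) \<subseteq> \<Omega>" "ball y (\<rho> * E) \<subseteq> \<Omega>" using x(1) y(1) K(3) L(3) ball_subset_cball by blast+
    fix \<phi> D\<phi> assume \<phi>: "C1_gradient \<phi> (D\<phi> :: 'a \<Rightarrow> 'a)"
    define I where "I = (\<lambda>A. \<integral>\<^sup>+z\<in>A. ennreal ((norm (D\<phi> z))\<^sup>2) \<partial>lborel)"
    define a where "a = hyp_avg \<nu> c S \<phi>"
    have 1: "ennreal (\<mu> * (a - avg (ball x (\<rho> * D)) \<phi>)\<^sup>2) \<le> ennreal (\<bar>c - \<nu> \<bullet> x\<bar> * c0) * I X"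
      unfolding \<mu>_def a_def c0_def I_def
    proof (rule hyp_avg_ball[OF \<phi> \<nu> Sb S(2) x(2,3) \<rho> x(4) XYb(1)])
      show "p + t *\<^sub>R (y - p) \<in> X" if "y \<in> open_cone x S" "p \<in> ball x (\<rho> * D)" "0 \<le> t" "t \<le> 1" for y p t
        unfolding X_def by (rule join_set_segment[OF that(1)]) (use that rx in auto)
    qed
    have 2: "ennreal (\<mu> * (a - avg (ball y (\<rho> * E)) \<phi>)\<^sup>2) \<le> ennreal (\<bar>c - \<nu> \<bullet> y\<bar> * c0) * I Y"
      unfolding \<mu>_def a_def c0_def I_def
    proof (rule hyp_avg_ball[OF \<phi> \<nu> Sb S(2) y(2,3) \<rho> y(4) XYb(2)])
      show "p + t *\<^sub>R (z - p) \<in> Y" if "z \<in> open_cone y S" "p \<in> ball y (\<rho> * E)" "0 \<le> t" "t \<le> 1" for z p t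
        unfolding Y_def by (rule join_set_segment[OF that(1)]) (use that rx in auto)
    qed
    have mono: "I X \<le> I (X \<union> Y)" "I Y \<le> I (X \<union> Y)"
      unfolding I_def by (auto intro!: nn_integral_mono simp: indicator_def)
    have "(avg (ball x (\<rho> * D)) \<phi> - avg (ball y (\<rho> * E)) \<phi>)\<^sup>2 \<le>
      2 * (a - avg (ball x (\<rho> * D)) \<phi>)\<^sup>2 + 2 * (a - avg (ball y (\<rho> * E)) \<phi>)\<^sup>2"
      using zero_le_power2[of "(a - avg (ball x (\<rho> * D)) \<phi>) + (a - avg (ball y (\<rho> * E)) \<phi>)"]
      by (simp add: power2_eq_square algebra_simps)
    then have "\<mu> * (avg (ball x (\<rho> * D)) \<phi> - avg (ball y (\<rho> * E)) \<phi>)\<^sup>2 \<le>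
      \<mu> * (2 * (a - avg (ball x (\<rho> * D)) \<phi>)\<^sup>2 + 2 * (a - avg (ball y (\<rho> * E)) \<phi>)\<^sup>2)"
      by (rule mult_left_mono) (simp add: \<mu>_def)
    then have "ennreal (\<mu> * (avg (ball x (\<rho> * D)) \<phi> - avg (ball y (\<rho> * E)) \<phi>)\<^sup>2) \<le>
      ennreal (2 * (\<mu> * (a - avg (ball x (\<rho> * D)) \<phi>)\<^sup>2) + 2 * (\<mu> * (a - avg (ball y (\<rho> * E)) \<phi>)\<^sup>2))"
      by (intro ennreal_leI) (simp add: algebra_simps)
    also have "\<dots> = 2 * ennreal (\<mu> * (a - avg (ball x (\<rho> * D)) \<phi>)\<^sup>2) + 2 * ennreal (\<mu> * (a - avg (ball y (\<rho> * E)) \<phi>)\<^sup>2)"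
      by (simp add: ennreal_plus ennreal_mult \<mu>_def)
    also have "\<dots> \<le> 2 * (ennreal (\<bar>c - \<nu> \<bullet> x\<bar> * c0) * I (X \<union> Y)) + 2 * (ennreal (\<bar>c - \<nu> \<bullet> y\<bar> * c0) * I (X \<union> Y))"
      by (intro add_mono mult_left_mono order_trans[OF 1] order_trans[OF 2] mono) auto
    also have "\<dots> = ennreal (2 * (\<bar>c - \<nu> \<bullet> x\<bar> + \<bar>c - \<nu> \<bullet> y\<bar>) * c0) * I (X \<union> Y)"
    proof -
      have "2 * (ennreal p * I (X \<union> Y)) + 2 * (ennreal q * I (X \<union> Y)) = ennreal (2 * (p + q)) * I (X \<union> Y)"
        if "0 \<le> p" "0 \<le> q" for p q
        using that by (simp add: ennreal_mult ennreal_plus distrib_left distrib_right mult.assoc)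
      from this[of "\<bar>c - \<nu> \<bullet> x\<bar> * c0" "\<bar>c - \<nu> \<bullet> y\<bar> * c0"] show ?thesis using c0 by (simp add: algebra_simps)
    qed
    finally show "ennreal (\<mu> * (avg (ball x (\<rho> * D)) \<phi> - avg (ball y (\<rho> * E)) \<phi>)\<^sup>2) \<le>
      ennreal (2 * (\<bar>c - \<nu> \<bullet> x\<bar> + \<bar>c - \<nu> \<bullet> y\<bar>) * c0) * (\<integral>\<^sup>+z\<in>X \<union> Y. ennreal ((norm (D\<phi> z))\<^sup>2) \<partial>lborel)"
      unfolding I_def .
  qed auto
  also have "\<dots> \<le> ennreal (2 * (\<bar>c - \<nu> \<bullet> x\<bar> + \<bar>c - \<nu> \<bullet> y\<bar>) * c0) * (\<integral>\<^sup>+z\<in>K \<union> L. ennreal ((norm (w z))\<^sup>2) \<partial>lebesgue_on \<Omega>)"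
  proof (intro mult_left_mono nn_integral_mono_AE)
    have "negligible S"
      using negligible_subset[OF negligible_hyperplane S(2)] \<nu> by force
    then have "S \<in> null_sets lebesgue" by (simp add: negligible_iff_null_sets)
    then have "AE z in lebesgue. z \<notin> S" by (rule AE_not_in)
    then have "AE z in lebesgue_on \<Omega>. z \<notin> S"
      using \<Omega> by (subst AE_restrict_space_iff) (auto simp: borel_open elim: eventually_mono)
    then show "AE z in lebesgue_on \<Omega>. ennreal ((norm (w z))\<^sup>2) * indicator (X \<union> Y) z \<le> ennreal ((norm (w z))\<^sup>2) * indicator (K \<union> L) z"
      by eventually_elim (use X Y in \<open>auto simp: indicator_def\<close>)
  qed simp
  finally show ?thesis by (simp add: \<mu>_def c0_def)
qed

section \<open>Discrete \<open>H\<^sup>1\<close> bound on a regular mesh\<close>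

locale regular_mesh =
  fixes \<Omega> \<Gamma>D \<Gamma>N :: "'a::euclidean_space set" and \<M> :: "'a mesh" and \<xi> \<beta> :: real
  assumes \<Omega>: "open \<Omega>" "bounded \<Omega>"
    and adm: "admissible_mesh \<Omega> \<Gamma>D \<Gamma>N \<M>"
    and \<xi>: "0 < \<xi>" and reg: "\<And>K \<sigma>. K \<in> cells \<M> \<Longrightarrow> \<sigma> \<in> cell_edges \<M> K \<Longrightarrow> \<xi> * diameter K \<le> infdist (center \<M> K) \<sigma>"
    and \<beta>: "0 < \<beta>" and card_edges: "\<And>K. K \<in> cells \<M> \<Longrightarrow> real (card (cell_edges \<M> K)) \<le> \<beta>"
begin

abbreviation "E \<equiv> cell_edges \<M>"
abbreviation "xc \<equiv> center \<M>"

lemma admissible: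
  "finite (cells \<M>)" "disjoint (cells \<M>)" "\<forall>K\<in>cells \<M>. polytopal_cell K \<and> K \<subseteq> \<Omega>" "finite (edges \<M>)"
  "\<forall>\<sigma>\<in>edges \<M>. \<sigma> \<subseteq> closure \<Omega> \<and> flat \<sigma> \<and> 0 < surf_meas \<sigma>"
  "\<forall>K\<in>cells \<M>. frontier K = (\<Union>\<sigma>\<in>E K. closure \<sigma>)" "edges \<M> = (\<Union>K\<in>cells \<M>. E K)"
  "\<forall>K\<in>cells \<M>. xc K \<in> closure K"
  "\<forall>\<sigma>\<in>int_edges \<M>. measure (surf \<sigma>) (closure \<sigma> \<inter> frontier \<Omega>) = 0"
  using adm unfolding admissible_mesh_def by - (elim conjE, assumption)+

lemmas finite_cells = admissible(1) and finite_edges = admissible(4) and edges_eq = admissible(7)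
  and disjoint_cells = admissible(2)

text \<open>Every frontier point lies in the closure of an edge, so regularity keeps it at distance
  at least \<open>\<xi> * diameter K\<close> from the centre. The centre, a priori only in the
  closure, is thus interior, and a connected ball meeting \<open>K\<close> but not its frontier
  stays in \<open>K\<close>.\<close>

lemma cell:
  assumes K: "K \<in> cells \<M>"
  shows "open K" "convex K" "bounded K" "K \<subseteq> \<Omega>" "frontier K = (\<Union>\<sigma>\<in>E K. closure \<sigma>)" "K \<noteq> {}"
    "0 < diameter K" "ball (xc K) (\<xi> * diameter K) \<subseteq> K"
proof -
  show oK: "open K" and cK: "convex K" and sub: "K \<subseteq> \<Omega>" and fr: "frontier K = (\<Union>\<sigma>\<in>E K. closure \<sigma>)"
    using admissible(3,6) K by (auto simp: polytopal_cell_def)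
  show bK: "bounded K" using sub \<Omega>(2) bounded_subset by blast
  have xcl: "xc K \<in> closure K" using admissible(8) K by simp
  then show ne: "K \<noteq> {}" by auto
  then obtain a where "a \<in> K" by blast
  with oK obtain r where a: "0 < r" "ball a r \<subseteq> K" by (rule openE)
  show dK: "0 < diameter K"
    using diameter_subset[OF a(2) bK] a(1) diameter_ball[of a r] by (simp split: if_splits)
  have far: "\<xi> * diameter K \<le> dist (xc K) q" if "q \<in> frontier K" for q
  proof -
    have "q \<in> (\<Union>\<sigma>\<in>E K. closure \<sigma>)" using that fr by simp
    then obtain \<sigma> where \<sigma>: "\<sigma> \<in> E K" "q \<in> closure \<sigma>" by (rule UN_E)
    have "closed {p. infdist (xc K) \<sigma> \<le> dist (xc K) p}"
      by (intro closed_Collect_le continuous_intros)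
    then have "closure \<sigma> \<subseteq> {p. infdist (xc K) \<sigma> \<le> dist (xc K) p}"
      by (intro closure_minimal) (auto intro: infdist_le)
    then have "infdist (xc K) \<sigma> \<le> dist (xc K) q" using \<sigma>(2) by (rule subsetD[THEN CollectD])
    then show ?thesis using reg[OF K \<sigma>(1)] by simp
  qed
  have pos: "0 < \<xi> * diameter K" using \<xi> dK by simp
  have "xc K \<notin> frontier K" using far[of "xc K"] pos by auto
  then have xK: "xc K \<in> K" using xcl oK by (auto simp: frontier_def interior_open)
  show "ball (xc K) (\<xi> * diameter K) \<subseteq> K"
  proof (rule ccontr)
    assume "\<not> ?thesis"
    then have "ball (xc K) (\<xi> * diameter K) - K \<noteq> {}" by auto
    moreover have "xc K \<in> ball (xc K) (\<xi> * diameter K)" using pos by simp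
    then have "ball (xc K) (\<xi> * diameter K) \<inter> K \<noteq> {}" using xK by blast
    ultimately have "ball (xc K) (\<xi> * diameter K) \<inter> frontier K \<noteq> {}"
      by (intro connected_Int_frontier) auto
    then show False using far by (force simp: not_less[symmetric])
  qed
qed

text \<open>Strictly below \<open>\<xi>\<close>, so that even the closed ball of radius
  \<open>rad K\<close> lies in the cell, and at most 1, as \<open>hyp_avg_ball\<close>
  requires.\<close>

definition "\<rho> = min (\<xi> / 2) 1"

lemma \<rho>: "0 < \<rho>" "\<rho> \<le> 1" "\<rho> < \<xi>"
  using \<xi> by (auto simp: \<rho>_def)

definition "rad K = \<rho> * diameter K"

lemma cell_ball:
  assumes K: "K \<in> cells \<M>"
  shows "cball (xc K) (rad K) \<subseteq> K" "ball (xc K) (rad K) \<subseteq> K" "0 < rad K" "xc K \<in> K"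
proof -
  have "rad K < \<xi> * diameter K" using \<rho>(3) cell(7)[OF K] by (simp add: rad_def)
  then have "cball (xc K) (rad K) \<subseteq> ball (xc K) (\<xi> * diameter K)" by (auto simp: subset_iff)
  then show 1: "cball (xc K) (rad K) \<subseteq> K" using cell(8)[OF K] by blast
  then show "ball (xc K) (rad K) \<subseteq> K" using ball_subset_cball by blast
  show "0 < rad K" using \<rho>(1) cell(7)[OF K] by (simp add: rad_def)
  then show "xc K \<in> K" using 1 by auto
qed

lemma edge:
  assumes K: "K \<in> cells \<M>" and \<sigma>: "\<sigma> \<in> E K"
  shows "\<sigma> \<subseteq> frontier K" "flat \<sigma>" "0 < surf_meas \<sigma>" "\<sigma> \<in> edges \<M>"
    "\<And>q. q \<in> closure K \<Longrightarrow> dist (xc K) q \<le> diameter K"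
proof -
  show e: "\<sigma> \<in> edges \<M>" using edges_eq K \<sigma> by blast
  show "\<sigma> \<subseteq> frontier K" using cell(5)[OF K] \<sigma> closure_subset by blast
  show "flat \<sigma>" "0 < surf_meas \<sigma>" using admissible(5) e by auto
  fix q assume q: "q \<in> closure K"
  have "dist (xc K) q \<le> diameter (closure K)"
    using q cell(3)[OF K] cell_ball(4)[OF K] closure_subset by (intro diameter_bounded_bound) (auto simp: bounded_closure)
  then show "dist (xc K) q \<le> diameter K" using cell(3)[OF K] by (simp add: diameter_closure)
qed

text \<open>Otherwise the projection of the centre onto the hyperplane would lie in the closed ball
  and therefore in \<open>K\<close>.\<close>

lemma hyperplane_dist:
  assumes K: "K \<in> cells \<M>" and \<nu>: "norm \<nu> = 1" and av: "\<And>x. x \<in> K \<Longrightarrow> \<nu> \<bullet> x \<noteq> c"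
  shows "rad K \<le> \<bar>c - \<nu> \<bullet> xc K\<bar>"
proof (rule ccontr)
  assume "\<not> ?thesis"
  then have "\<bar>c - \<nu> \<bullet> xc K\<bar> \<le> rad K" by simp
  then have "xc K + (c - \<nu> \<bullet> xc K) *\<^sub>R \<nu> \<in> cball (xc K) (rad K)" using \<nu> by (simp add: dist_norm)
  then have "xc K + (c - \<nu> \<bullet> xc K) *\<^sub>R \<nu> \<in> K" using cell_ball(1)[OF K] by blast
  from av[OF this] show False using \<nu> by (simp add: inner_add_right inner_unit_self)
qed

lemma edge_hyperplane:
  assumes K: "K \<in> cells \<M>" and \<sigma>: "\<sigma> \<in> E K"
  obtains \<nu> c where "norm \<nu> = 1" "\<sigma> \<subseteq> {x. \<nu> \<bullet> x = c}" "surf \<sigma> = completion (hyp_borel \<nu> c)"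
    "\<forall>J\<in>cells \<M>. \<sigma> \<in> E J \<longrightarrow> (\<forall>x\<in>J. \<nu> \<bullet> x \<noteq> c)"
proof -
  obtain \<nu> c where \<nu>: "norm \<nu> = 1" "\<sigma> \<subseteq> {x. \<nu> \<bullet> x = c}" "surf \<sigma> = completion (hyp_borel \<nu> c)"
    using surf_flat[OF edge(2)[OF K \<sigma>]] .
  note mp = main_part_flat[OF \<nu>(3) edge(3)[OF K \<sigma>]]
  have "\<nu> \<bullet> x \<noteq> c" if J: "J \<in> cells \<M>" "\<sigma> \<in> E J" and x: "x \<in> J" for J x
    by (rule hyperplane_disjoint_convex[OF \<nu>(1) mp(3) _ _ cell(1,2)[OF J(1)] _ x])
      (use mp \<nu>(2) edge[OF J] in auto)
  with \<nu> show thesis by (intro that) auto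
qed

text \<open>Some hyperplane separates the disjoint convex cells, and the common edge lies in it. As
  the edge has positive measure, \<open>hyperplane_unique\<close> identifies this hyperplane with
  that of the edge; strictness holds because neither open cell meets it.\<close>

lemma opposite_sides:
  assumes K: "K \<in> cells \<M>" "\<sigma> \<in> E K" and L: "L \<in> cells \<M>" "\<sigma> \<in> E L" and KL: "K \<noteq> L"
    and \<nu>: "norm \<nu> = 1" "\<sigma> \<subseteq> {x. \<nu> \<bullet> x = c}" "surf \<sigma> = completion (hyp_borel \<nu> c)"
    and av: "\<forall>J\<in>cells \<M>. \<sigma> \<in> E J \<longrightarrow> (\<forall>x\<in>J. \<nu> \<bullet> x \<noteq> c)"
  shows "(\<forall>x\<in>K. \<nu> \<bullet> x < c) \<and> (\<forall>x\<in>L. c < \<nu> \<bullet> x) \<or> (\<forall>x\<in>K. c < \<nu> \<bullet> x) \<and> (\<forall>x\<in>L. \<nu> \<bullet> x < c)"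
proof -
  have dis: "K \<inter> L = {}" using disjoint_cells K(1) L(1) KL by (auto simp: disjoint_def)
  obtain a b where ab: "a \<noteq> 0" "\<forall>x\<in>K. a \<bullet> x \<le> b" "\<forall>x\<in>L. b \<le> a \<bullet> x"
    using separating_hyperplane_sets[OF cell(2)[OF K(1)] cell(2)[OF L(1)] cell(6)[OF K(1)] cell(6)[OF L(1)] dis] by blast
  have cl: "closure K \<subseteq> {x. a \<bullet> x \<le> b}" "closure L \<subseteq> {x. a \<bullet> x \<ge> b}"
    by (rule closure_minimal; use ab in \<open>simp add: closed_halfspace_le closed_halfspace_ge subset_iff\<close>)+
  note mp = main_part_flat[OF \<nu>(3) edge(3)[OF K]]
  have sub: "main_part (hyp_borel \<nu> c) \<sigma> \<subseteq> {x. a \<bullet> x = b}"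
  proof
    fix q assume "q \<in> main_part (hyp_borel \<nu> c) \<sigma>"
    then have "q \<in> closure K" "q \<in> closure L" using mp(2) edge(1)[OF K] edge(1)[OF L] by (auto simp: frontier_def)
    with cl have "q \<in> {x. a \<bullet> x \<le> b}" "q \<in> {x. a \<bullet> x \<ge> b}" by blast+
    then show "q \<in> {x. a \<bullet> x = b}" by simp
  qed
  obtain s where s: "s \<noteq> 0" "a = s *\<^sub>R \<nu>" "b = s * c"
    by (rule hyperplane_unique[OF \<nu>(1) mp(3) order_trans[OF mp(2) \<nu>(2)] _ ab(1) sub])
      (use mp(4) edge(3)[OF K] in simp)
  have K': "s * (\<nu> \<bullet> x) \<le> s * c" "\<nu> \<bullet> x \<noteq> c" if "x \<in> K" for x
    using bspec[OF ab(2) that] that av K unfolding s(2,3) by (simp, blast)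
  have L': "s * c \<le> s * (\<nu> \<bullet> x)" "\<nu> \<bullet> x \<noteq> c" if "x \<in> L" for x
    using bspec[OF ab(3) that] that av L unfolding s(2,3) by (simp, blast)
  show ?thesis
  proof (cases "0 < s")
    case True
    then show ?thesis using K' L' by (auto simp: less_le)
  next
    case False
    then have "s < 0" using s by simp
    then show ?thesis using K' L' by (auto simp: less_le mult_le_cancel_left)
  qed
qed

text \<open>Three cells cannot lie pairwise on opposite sides of one hyperplane. This makes the
  definite description in \<open>neighbour\<close> meaningful.\<close>

lemma int_edge_two_cells:
  assumes "K \<in> cells \<M>" "\<sigma> \<in> E K" "L \<in> cells \<M>" "\<sigma> \<in> E L" "J \<in> cells \<M>" "\<sigma> \<in> E J" "K \<noteq> L"
  shows "J = K \<or> J = L"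
proof (rule ccontr)
  assume ne: "\<not> ?thesis"
  obtain \<nu> c where \<nu>: "norm \<nu> = 1" "\<sigma> \<subseteq> {x. \<nu> \<bullet> x = c}" "surf \<sigma> = completion (hyp_borel \<nu> c)"
    "\<forall>J\<in>cells \<M>. \<sigma> \<in> E J \<longrightarrow> (\<forall>x\<in>J. \<nu> \<bullet> x \<noteq> c)"
    using edge_hyperplane[OF assms(1,2)] by blast
  have x: "xc K \<in> K" "xc L \<in> L" "xc J \<in> J" using cell_ball(4) assms by auto
  from ne have "K \<noteq> J" "L \<noteq> J" by auto
  note opp = opposite_sides[OF assms(1-4,7) \<nu>] opposite_sides[OF assms(1,2,5,6) \<open>K \<noteq> J\<close> \<nu>]
    opposite_sides[OF assms(3-6) \<open>L \<noteq> J\<close> \<nu>]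
  have "\<nu> \<bullet> xc K < c \<and> c < \<nu> \<bullet> xc L \<or> c < \<nu> \<bullet> xc K \<and> \<nu> \<bullet> xc L < c"
    "\<nu> \<bullet> xc K < c \<and> c < \<nu> \<bullet> xc J \<or> c < \<nu> \<bullet> xc K \<and> \<nu> \<bullet> xc J < c"
    "\<nu> \<bullet> xc L < c \<and> c < \<nu> \<bullet> xc J \<or> c < \<nu> \<bullet> xc L \<and> \<nu> \<bullet> xc J < c"
    using opp x by blast+
  then show False by linarith
qed

lemma neighbour:
  assumes \<sigma>: "\<sigma> \<in> int_edges \<M>" and K: "K \<in> cells \<M>" "\<sigma> \<in> E K"
  shows "neighbour \<M> K \<sigma> \<in> cells \<M>" "neighbour \<M> K \<sigma> \<noteq> K" "\<sigma> \<in> E (neighbour \<M> K \<sigma>)"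
    "\<And>J. J \<in> cells \<M> \<Longrightarrow> \<sigma> \<in> E J \<Longrightarrow> J = K \<or> J = neighbour \<M> K \<sigma>"
    "neighbour \<M> (neighbour \<M> K \<sigma>) \<sigma> = K"
proof -
  have ex: "\<exists>L. L \<in> cells \<M> \<and> L \<noteq> K \<and> \<sigma> \<in> E L" using \<sigma> unfolding int_edges_def by blast
  then obtain L where L: "L \<in> cells \<M>" "L \<noteq> K" "\<sigma> \<in> E L" by blast
  have uniq: "J = K \<or> J = L" if "J \<in> cells \<M>" "\<sigma> \<in> E J" for J
    using int_edge_two_cells[OF K L(1,3) that] L(2) by blast
  have "neighbour \<M> K \<sigma> = L" unfolding neighbour_def
    by (rule the_equality) (use L uniq in auto)
  moreover have "neighbour \<M> L \<sigma> = K" unfolding neighbour_def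
    by (rule the_equality) (use L K uniq in auto)
  ultimately show "neighbour \<M> K \<sigma> \<in> cells \<M>" "neighbour \<M> K \<sigma> \<noteq> K" "\<sigma> \<in> E (neighbour \<M> K \<sigma>)"
    "\<And>J. J \<in> cells \<M> \<Longrightarrow> \<sigma> \<in> E J \<Longrightarrow> J = K \<or> J = neighbour \<M> K \<sigma>"
    "neighbour \<M> (neighbour \<M> K \<sigma>) \<sigma> = K" using L uniq by auto
qed

lemma side:
  assumes "\<sigma> \<in> edges \<M>"
  shows "side \<M> \<sigma> \<in> cells \<M>" "\<sigma> \<in> E (side \<M> \<sigma>)"
proof -
  have "\<exists>K. K \<in> cells \<M> \<and> \<sigma> \<in> E K" using assms edges_eq by blast
  from someI_ex[OF this] show "side \<M> \<sigma> \<in> cells \<M>" "\<sigma> \<in> E (side \<M> \<sigma>)" by (auto simp: side_def)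
qed

lemma ext_edge_one_cell:
  assumes "\<sigma> \<notin> int_edges \<M>" "K \<in> cells \<M>" "\<sigma> \<in> E K" "J \<in> cells \<M>" "\<sigma> \<in> E J"
  shows "J = K"
  using assms unfolding int_edges_def by blast

lemma edge_dist_int:
  assumes \<sigma>: "\<sigma> \<in> int_edges \<M>" and K: "K \<in> cells \<M>" "\<sigma> \<in> E K"
  shows "edge_dist \<M> \<sigma> = dist (xc K) (xc (neighbour \<M> K \<sigma>))"
proof -
  have e: "\<sigma> \<in> edges \<M>" using edge(4)[OF K] .
  note s = side[OF e] and n = neighbour[OF \<sigma> K]
  have "side \<M> \<sigma> = K \<or> side \<M> \<sigma> = neighbour \<M> K \<sigma>" using n(4)[OF s] .
  then show ?thesis using \<sigma> n(5) by (auto simp: edge_dist_def Let_def dist_commute)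
qed

text \<open>The centres are on opposite sides, so their distances to the hyperplane add up to the
  normal component of \<open>xc K - xc L\<close>.\<close>

lemma edge_dist_int_ge:
  assumes \<sigma>: "\<sigma> \<in> int_edges \<M>" and K: "K \<in> cells \<M>" "\<sigma> \<in> E K"
    and \<nu>: "norm \<nu> = 1" "\<sigma> \<subseteq> {x. \<nu> \<bullet> x = c}" "surf \<sigma> = completion (hyp_borel \<nu> c)"
    and av: "\<forall>J\<in>cells \<M>. \<sigma> \<in> E J \<longrightarrow> (\<forall>x\<in>J. \<nu> \<bullet> x \<noteq> c)"
  shows "\<bar>c - \<nu> \<bullet> xc K\<bar> + \<bar>c - \<nu> \<bullet> xc (neighbour \<M> K \<sigma>)\<bar> \<le> edge_dist \<M> \<sigma>"
proof -
  note n = neighbour[OF \<sigma> K]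
  define L where "L = neighbour \<M> K \<sigma>"
  have "xc K \<in> K" "xc L \<in> L" using cell_ball(4) K n by (auto simp: L_def)
  with opposite_sides[OF K n(1,3) n(2)[symmetric] \<nu> av]
  have "\<nu> \<bullet> xc K < c \<and> c < \<nu> \<bullet> xc L \<or> c < \<nu> \<bullet> xc K \<and> \<nu> \<bullet> xc L < c"
    unfolding L_def by blast
  then have "\<bar>c - \<nu> \<bullet> xc K\<bar> + \<bar>c - \<nu> \<bullet> xc L\<bar> = \<bar>\<nu> \<bullet> (xc K - xc L)\<bar>"
    by (auto simp: inner_diff_right)
  also have "\<dots> \<le> norm (xc K - xc L)" using Cauchy_Schwarz_ineq2[of \<nu> "xc K - xc L"] \<nu>(1) by simp
  finally show ?thesis using edge_dist_int[OF \<sigma> K] by (simp add: L_def dist_norm)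
qed

lemma edge_dist_ext:
  assumes \<sigma>: "\<sigma> \<notin> int_edges \<M>" and K: "K \<in> cells \<M>" "\<sigma> \<in> E K"
  shows "edge_dist \<M> \<sigma> = infdist (xc K) \<sigma>"
proof -
  have e: "\<sigma> \<in> edges \<M>" using edge(4)[OF K] .
  have "side \<M> \<sigma> = K" using ext_edge_one_cell[OF \<sigma> K side[OF e]] .
  then show ?thesis using \<sigma> by (simp add: edge_dist_def)
qed

lemma edge_dist_ext_ge:
  assumes \<sigma>: "\<sigma> \<notin> int_edges \<M>" and K: "K \<in> cells \<M>" "\<sigma> \<in> E K"
    and \<nu>: "norm \<nu> = 1" "\<sigma> \<subseteq> {x. \<nu> \<bullet> x = c}"
  shows "\<bar>c - \<nu> \<bullet> xc K\<bar> \<le> edge_dist \<M> \<sigma>"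
proof -
  have ne: "\<sigma> \<noteq> {}" using edge(3)[OF K] by (auto simp: surf_meas_def)
  show ?thesis unfolding edge_dist_ext[OF \<sigma> K] infdist_notempty[OF ne]
  proof (rule cINF_greatest[OF ne])
    fix q assume "q \<in> \<sigma>"
    then have "c - \<nu> \<bullet> xc K = \<nu> \<bullet> (q - xc K)" using \<nu>(2) by (auto simp: inner_diff_right)
    also have "\<bar>\<dots>\<bar> \<le> norm (q - xc K)" using Cauchy_Schwarz_ineq2[of \<nu> "q - xc K"] \<nu>(1) by simp
    finally show "\<bar>c - \<nu> \<bullet> xc K\<bar> \<le> dist (xc K) q" by (simp add: dist_norm norm_minus_commute)
  qed
qed

lemma edge_dist_pos:
  assumes "\<sigma> \<in> edges \<M>"
  shows "0 < edge_dist \<M> \<sigma>" "0 < transm \<M> \<sigma>"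
proof -
  define K where "K = side \<M> \<sigma>"
  have K: "K \<in> cells \<M>" "\<sigma> \<in> E K" using side[OF assms] by (auto simp: K_def)
  obtain \<nu> c where \<nu>: "norm \<nu> = 1" "\<sigma> \<subseteq> {x. \<nu> \<bullet> x = c}" "surf \<sigma> = completion (hyp_borel \<nu> c)"
    "\<forall>J\<in>cells \<M>. \<sigma> \<in> E J \<longrightarrow> (\<forall>x\<in>J. \<nu> \<bullet> x \<noteq> c)"
    using edge_hyperplane[OF K] by blast
  have "0 < rad K" by (rule cell_ball(3)[OF K(1)])
  also have "\<dots> \<le> \<bar>c - \<nu> \<bullet> xc K\<bar>" by (rule hyperplane_dist[OF K(1) \<nu>(1)]) (use \<nu>(4) K in auto)
  also have "\<dots> \<le> edge_dist \<M> \<sigma>"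
  proof (cases "\<sigma> \<in> int_edges \<M>")
    case True
    from edge_dist_int_ge[OF True K \<nu>] show ?thesis by linarith
  next
    case False
    from edge_dist_ext_ge[OF False K \<nu>(1,2)] show ?thesis .
  qed
  finally show "0 < edge_dist \<M> \<sigma>" .
  then show "0 < transm \<M> \<sigma>" using edge(3)[OF K] by (simp add: transm_def)
qed

end

context regular_mesh
begin

section \<open>Discretised data and their energy\<close>

definition cell_avg :: "('a \<Rightarrow> real) \<Rightarrow> 'a set \<Rightarrow> real" where
  "cell_avg u K = lavg (ball (xc K) (rad K)) u"

definition h1_const :: real where
  "h1_const = 2 * trace_const DIM('a) \<rho>"

lemma h1_const_pos: "0 < h1_const"
  using trace_const_pos[of "DIM('a)" \<rho>] \<rho>(1) by (simp add: h1_const_def)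

lemma closure_edge:
  assumes K: "K \<in> cells \<M>" "\<sigma> \<in> E K"
  shows "closure \<sigma> \<subseteq> closure K" "bounded \<sigma>"
proof -
  have "\<sigma> \<subseteq> closure K" using edge(1)[OF K] by (auto simp: frontier_def)
  then show "closure \<sigma> \<subseteq> closure K" by (simp add: closure_minimal)
  then show "bounded \<sigma>" using cell(3)[OF K(1)] bounded_closure bounded_subset closure_subset by meson
qed

text \<open>The part of an interior edge lying in \<open>\<Omega>\<close> has full measure; it is exhausted by the compact sets of
  its points at distance at least \<open>1/n\<close> from the boundary of \<open>\<Omega>\<close>.\<close>

lemma interior_edge_exhaustion:
  assumes \<sigma>: "\<sigma> \<in> int_edges \<M>" and K: "K \<in> cells \<M>" "\<sigma> \<in> E K"
    and \<nu>: "norm \<nu> = 1" "\<sigma> \<subseteq> {x. \<nu> \<bullet> x = c}" "surf \<sigma> = completion (hyp_borel \<nu> c)"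
  obtains S where "\<And>n::nat. compact (S n)" "\<And>n. S n \<subseteq> closure \<sigma>" "\<And>n. S n \<subseteq> \<Omega>"
    "\<And>n. S n \<subseteq> {x. \<nu> \<bullet> x = c}" "\<exists>s\<ge>surf_meas \<sigma>. (\<lambda>n. measure (hyp_borel \<nu> c) (S n)) \<longlonglongrightarrow> s"
proof -
  define F where "F = frontier \<Omega>"
  have "\<Omega> \<noteq> {}" using cell(4,6)[OF K(1)] by blast
  moreover have "\<Omega> \<noteq> UNIV" using \<Omega>(2) by auto
  ultimately have F: "F \<noteq> {}" "closed F" by (auto simp: F_def frontier_eq_empty frontier_closed)
  define S where "S = (\<lambda>n. closure \<sigma> \<inter> {y. inverse (real (Suc n)) \<le> infdist y F})"
  have cl\<sigma>: "closed (closure \<sigma>)" "compact (closure \<sigma>)" using closure_edge(2)[OF K] by auto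
  have clI: "closed {y. r \<le> infdist y F}" for r by (intro closed_Collect_le continuous_intros)
  have "\<sigma> \<subseteq> closure \<Omega>" using admissible(5) edge(4)[OF K] by blast
  then have cl\<Omega>: "closure \<sigma> \<subseteq> closure \<Omega>" by (simp add: closure_minimal)
  have clH: "closure \<sigma> \<subseteq> {x. \<nu> \<bullet> x = c}"
    by (rule closure_minimal[OF \<nu>(2)]) (simp add: closed_hyperplane)
  have 1: "compact (S n)" for n unfolding S_def using cl\<sigma>(2) clI by (rule compact_Int_closed)
  have Sb: "S n \<in> sets borel" for n using 1 by (simp add: borel_compact)
  have nF: "y \<notin> F" if "y \<in> S n" for y n
  proof
    assume "y \<in> F"
    then have "infdist y F = 0" by simp
    moreover have "0 < inverse (real (Suc n))" by simp
    ultimately show False using that by (simp add: S_def)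
  qed
  have U: "(\<Union>n. S n) = closure \<sigma> - F"
  proof (intro equalityI subsetI)
    fix y assume y: "y \<in> closure \<sigma> - F"
    then have "infdist y F \<noteq> 0" using in_closed_iff_infdist_zero[OF F(2,1)] by simp
    then have "0 < infdist y F" using infdist_nonneg[of y F] by simp
    then obtain n where "inverse (real (Suc n)) < infdist y F" using reals_Archimedean by blast
    then show "y \<in> (\<Union>n. S n)" using y by (auto simp: S_def intro!: exI[of _ n])
  next
    fix y assume "y \<in> (\<Union>n. S n)"
    then obtain n where "y \<in> S n" by blast
    then show "y \<in> closure \<sigma> - F" using nF[of y n] by (auto simp: S_def)
  qed
  have inc: "incseq S"
  proof (rule incseq_SucI, rule subsetI)
    fix n y assume y: "y \<in> S n"
    have "inverse (real (Suc (Suc n))) \<le> inverse (real (Suc n))" by (rule le_imp_inverse_le) auto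
    also have "\<dots> \<le> infdist y F" using y by (simp add: S_def)
    finally show "y \<in> S (Suc n)" using y by (simp add: S_def)
  qed
  define \<mu> where "\<mu> = hyp_borel \<nu> c"
  have fin: "emeasure \<mu> A \<noteq> \<infinity>" if "A \<subseteq> closure \<sigma>" for A
    unfolding \<mu>_def using emeasure_hyp_borel_bounded[OF \<nu>(1), of A c] that closure_edge(2)[OF K]
    by (metis bounded_closure bounded_subset less_irrefl)
  have lim: "(\<lambda>n. measure \<mu> (S n)) \<longlonglongrightarrow> measure \<mu> (\<Union>n. S n)"
    by (rule Lim_measure_incseq[OF _ inc fin]) (use Sb U in \<open>auto simp: \<mu>_def\<close>)
  have Fb: "F \<in> sets borel" using F(2) by (simp add: borel_closed)
  have "surf_meas \<sigma> = measure \<mu> (main_part \<mu> \<sigma>)"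
    unfolding \<mu>_def using main_part_flat(4)[OF \<nu>(3) edge(3)[OF K]] by simp
  also have "\<dots> \<le> measure \<mu> (closure \<sigma>)"
  proof (rule measure_mono_fmeasurable)
    show "main_part \<mu> \<sigma> \<subseteq> closure \<sigma>" unfolding \<mu>_def using main_part_flat(2)[OF \<nu>(3) edge(3)[OF K]] closure_subset by blast
    show "main_part \<mu> \<sigma> \<in> sets \<mu>" unfolding \<mu>_def using main_part_flat(3)[OF \<nu>(3) edge(3)[OF K]] by simp
    show "closure \<sigma> \<in> fmeasurable \<mu>" using fin[of "closure \<sigma>"] 
      by (intro fmeasurableI) (auto simp: \<mu>_def borel_closed less_top)
  qed
  also have "\<dots> = measure \<mu> (closure \<sigma> - F) + measure \<mu> (closure \<sigma> \<inter> F)"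
  proof -
    have "closure \<sigma> = (closure \<sigma> - F) \<union> (closure \<sigma> \<inter> F)" by blast
    also have "measure \<mu> \<dots> = measure \<mu> (closure \<sigma> - F) + measure \<mu> (closure \<sigma> \<inter> F)"
      by (rule measure_Union) (use fin[of "closure \<sigma> - F"] fin[of "closure \<sigma> \<inter> F"] Fb in \<open>auto simp: \<mu>_def borel_closed\<close>)
    finally show ?thesis .
  qed
  \<comment> \<open>Here the clause of admissibility that excludes cracks of \<open>\<Omega>\<close>
    along interior edges enters.\<close>
  also have "measure \<mu> (closure \<sigma> \<inter> F) = 0"
  proof -
    have "measure (surf \<sigma>) (closure \<sigma> \<inter> frontier \<Omega>) = 0" using admissible(9) \<sigma> by blast
    then show ?thesis unfolding \<nu>(3) using Fb by (simp add: \<mu>_def F_def borel_closed measure_completion)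
  qed
  finally have "surf_meas \<sigma> \<le> measure \<mu> (\<Union>n. S n)" by (simp add: U)
  with lim have 5: "\<exists>s\<ge>surf_meas \<sigma>. (\<lambda>n. measure (hyp_borel \<nu> c) (S n)) \<longlonglongrightarrow> s" unfolding \<mu>_def by blast
  show thesis
  proof (rule that[OF 1 _ _ _ 5])
    show "S n \<subseteq> closure \<sigma>" for n by (auto simp: S_def)
    show "S n \<subseteq> {x. \<nu> \<bullet> x = c}" for n using clH by (auto simp: S_def)
    show "S n \<subseteq> \<Omega>" for n
    proof
      fix y assume y: "y \<in> S n"
      then have "y \<in> closure \<Omega>" "y \<notin> frontier \<Omega>" using nF[OF y] cl\<Omega> by (auto simp: F_def S_def)
      then show "y \<in> \<Omega>" using interior_subset by (auto simp: frontier_def)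
    qed
  qed
qed

context
  fixes u :: "'a \<Rightarrow> real" and w :: "'a \<Rightarrow> 'a"
  assumes u: "u \<in> L2 \<Omega>" and w: "weak_gradient \<Omega> u w"
begin

definition energy :: "'a set \<Rightarrow> real" where
  "energy A = (LINT x|lebesgue_on \<Omega>. indicator A x * (norm (w x))\<^sup>2)"

lemma wL: "w \<in> L2 \<Omega>" using w by (simp add: weak_gradient_def)

lemma energy_integrable: "A \<in> sets borel \<Longrightarrow> integrable (lebesgue_on \<Omega>) (\<lambda>x. indicator A x * (norm (w x))\<^sup>2)"
proof -
  assume A: "A \<in> sets borel"
  have i: "integrable (lebesgue_on \<Omega>) (\<lambda>x. (norm (w x))\<^sup>2)" using wL by (simp add: L2_def)
  have [measurable]: "w \<in> borel_measurable (lebesgue_on \<Omega>)" using wL by (rule L2_measurable)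
  have "(indicator A :: 'a \<Rightarrow> real) \<in> borel_measurable (lebesgue_on \<Omega>)"
    by (rule borel_measurable_lebesgue_on[OF borel_measurable_indicator[OF A]])
  then have [measurable]: "(indicator A :: 'a \<Rightarrow> real) \<in> borel_measurable (lebesgue_on \<Omega>)" .
  have "(\<lambda>x. indicator A x * (norm (w x))\<^sup>2) \<in> borel_measurable (lebesgue_on \<Omega>)" by measurable
  then show ?thesis by (rule Bochner_Integration.integrable_bound[OF i]) (auto simp: indicator_def)
qed

lemma energy_nn:
  assumes "A \<in> sets borel"
  shows "(\<integral>\<^sup>+x\<in>A. ennreal ((norm (w x))\<^sup>2) \<partial>lebesgue_on \<Omega>) = ennreal (energy A)"
proof -
  have "(\<integral>\<^sup>+x\<in>A. ennreal ((norm (w x))\<^sup>2) \<partial>lebesgue_on \<Omega>) = (\<integral>\<^sup>+x. ennreal (indicator A x * (norm (w x))\<^sup>2) \<partial>lebesgue_on \<Omega>)"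
    by (intro nn_integral_cong) (auto simp: indicator_def)
  also have "\<dots> = ennreal (energy A)" unfolding energy_def
    by (rule nn_integral_eq_integral[OF energy_integrable[OF assms]]) auto
  finally show ?thesis .
qed

lemma energy_nonneg: "0 \<le> energy A"
  unfolding energy_def by (intro integral_nonneg_AE AE_I2) auto

text \<open>The estimate holds on each compact piece \<open>S n\<close> and passes to the limit of
  their measures, which is at least \<open>surf_meas \<sigma>\<close>. The distances from the
  centres to the hyperplane sum to \<open>e\<close>, and \<open>e\<close> is at most
  \<open>edge_dist \<M> \<sigma>\<close>, so division by \<open>edge_dist\<close> leaves no length
  scale.\<close>

lemma interior_edge_bound:
  assumes \<sigma>: "\<sigma> \<in> int_edges \<M>" and K: "K \<in> cells \<M>" "\<sigma> \<in> E K"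
  shows "transm \<M> \<sigma> * (cell_avg u (neighbour \<M> K \<sigma>) - cell_avg u K)\<^sup>2 \<le> h1_const * (energy K + energy (neighbour \<M> K \<sigma>))"
proof -
  define L where "L = neighbour \<M> K \<sigma>"
  have L: "L \<in> cells \<M>" "\<sigma> \<in> E L" "L \<noteq> K" using neighbour[OF \<sigma> K] by (auto simp: L_def)
  obtain \<nu> c where \<nu>: "norm \<nu> = 1" "\<sigma> \<subseteq> {x. \<nu> \<bullet> x = c}" "surf \<sigma> = completion (hyp_borel \<nu> c)"
    "\<forall>J\<in>cells \<M>. \<sigma> \<in> E J \<longrightarrow> (\<forall>x\<in>J. \<nu> \<bullet> x \<noteq> c)"
    using edge_hyperplane[OF K] by blast
  obtain S where S: "\<And>n::nat. compact (S n)" "\<And>n. S n \<subseteq> closure \<sigma>" "\<And>n. S n \<subseteq> \<Omega>"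
    "\<And>n. S n \<subseteq> {x. \<nu> \<bullet> x = c}" "\<exists>s\<ge>surf_meas \<sigma>. (\<lambda>n. measure (hyp_borel \<nu> c) (S n)) \<longlonglongrightarrow> s"
    using interior_edge_exhaustion[OF \<sigma> K \<nu>(1-3)] by blast
  obtain s where s: "surf_meas \<sigma> \<le> s" "(\<lambda>n. measure (hyp_borel \<nu> c) (S n)) \<longlonglongrightarrow> s" using S(5) by blast
  define X where "X = (cell_avg u K - cell_avg u L)\<^sup>2"
  define e where "e = \<bar>c - \<nu> \<bullet> xc K\<bar> + \<bar>c - \<nu> \<bullet> xc L\<bar>"
  have SK: "S n \<subseteq> closure K" "S n \<subseteq> closure L" for n
    using S(2)[of n] closure_edge(1)[OF K] closure_edge(1)[OF L(1,2)] by auto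
  have dis: "K \<inter> L = {}" using disjoint_cells K(1) L by (auto simp: disjoint_def)
  have bKL: "K \<in> sets borel" "L \<in> sets borel" using cell(1) K(1) L(1) by (auto simp: borel_open)
  have est: "measure (hyp_borel \<nu> c) (S n) * X \<le> (e * h1_const) * (energy K + energy L)" for n
  proof -
    have "ennreal (measure (hyp_borel \<nu> c) (S n) * X) \<le>
      ennreal (2 * e * trace_const DIM('a) \<rho>) * (\<integral>\<^sup>+x\<in>K \<union> L. ennreal ((norm (w x))\<^sup>2) \<partial>lebesgue_on \<Omega>)"
      unfolding X_def e_def cell_avg_def rad_def
    proof (rule interior_edge_estimate[OF \<Omega> u w cell(1,2,4)[OF K(1)] cell(1,2,4)[OF L(1)] \<nu>(1) S(1,4,3) SK \<rho>(1,2)])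
      show "cball (xc K) (\<rho> * diameter K) \<subseteq> K" "cball (xc L) (\<rho> * diameter L) \<subseteq> L"
        using cell_ball(1)[OF K(1)] cell_ball(1)[OF L(1)] by (auto simp: rad_def)
      show "0 < diameter K" "0 < diameter L" using cell(7) K(1) L(1) by auto
      show "dist (xc K) q \<le> diameter K" "dist (xc L) q \<le> diameter L" if "q \<in> S n" for q
        using that SK[of n] edge(5)[OF K] edge(5)[OF L(1,2)] by auto
      show "\<rho> * diameter K \<le> \<bar>c - \<nu> \<bullet> xc K\<bar>" "\<rho> * diameter L \<le> \<bar>c - \<nu> \<bullet> xc L\<bar>"
        using hyperplane_dist[OF K(1) \<nu>(1)] hyperplane_dist[OF L(1) \<nu>(1)] \<nu>(4) K L by (auto simp: rad_def)
    qed
    also have "(\<integral>\<^sup>+x\<in>K \<union> L. ennreal ((norm (w x))\<^sup>2) \<partial>lebesgue_on \<Omega>) = ennreal (energy K + energy L)"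
    proof -
      have "(\<integral>\<^sup>+x\<in>K \<union> L. ennreal ((norm (w x))\<^sup>2) \<partial>lebesgue_on \<Omega>) = ennreal (energy (K \<union> L))"
        by (rule energy_nn) (use bKL in auto)
      also have "energy (K \<union> L) = energy K + energy L"
      proof -
        have "(\<lambda>x. indicator (K \<union> L) x * (norm (w x))\<^sup>2) = (\<lambda>x. indicator K x * (norm (w x))\<^sup>2 + indicator L x * (norm (w x))\<^sup>2)"
          using dis by (intro ext) (auto simp: indicator_def)
        then show ?thesis unfolding energy_def
          using Bochner_Integration.integral_add[OF energy_integrable[OF bKL(1)] energy_integrable[OF bKL(2)]] by simp
      qed
      finally show ?thesis .
    qed
    also have "ennreal (2 * e * trace_const DIM('a) \<rho>) * ennreal (energy K + energy L) =
      ennreal (2 * e * trace_const DIM('a) \<rho> * (energy K + energy L))"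
      by (rule ennreal_mult[symmetric])
        (use trace_const_pos[of "DIM('a)" \<rho>] \<rho>(1) energy_nonneg in \<open>auto simp: e_def less_imp_le\<close>)
    also have "2 * e * trace_const DIM('a) \<rho> * (energy K + energy L) = (e * h1_const) * (energy K + energy L)"
      by (simp add: h1_const_def)
    finally have "ennreal (measure (hyp_borel \<nu> c) (S n) * X) \<le> ennreal ((e * h1_const) * (energy K + energy L))" .
    then show ?thesis
      using h1_const_pos energy_nonneg by (subst (asm) ennreal_le_iff) (auto simp: e_def)
  qed
  have "s * X \<le> (e * h1_const) * (energy K + energy L)"
    by (rule LIMSEQ_le_const2[OF tendsto_mult[OF s(2) tendsto_const]]) (use est in auto)
  moreover have "surf_meas \<sigma> * X \<le> s * X" using s(1) by (intro mult_right_mono) (auto simp: X_def)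
  moreover have "(e * h1_const) * (energy K + energy L) \<le> (edge_dist \<M> \<sigma> * h1_const) * (energy K + energy L)"
    using edge_dist_int_ge[OF \<sigma> K \<nu>] h1_const_pos energy_nonneg
    by (intro mult_right_mono) (auto simp: e_def L_def)
  ultimately have "surf_meas \<sigma> * X \<le> edge_dist \<M> \<sigma> * (h1_const * (energy K + energy L))" by simp
  then have "transm \<M> \<sigma> * X \<le> h1_const * (energy K + energy L)"
    using edge_dist_pos(1)[OF edge(4)[OF K]] by (simp add: transm_def field_simps)
  then show ?thesis unfolding X_def L_def by (simp add: power2_commute)
qed

lemma dirichlet_edge_bound:
  assumes \<sigma>: "\<sigma> \<notin> int_edges \<M>" and K: "K \<in> cells \<M>" "\<sigma> \<in> E K" and a: "trace_mean K \<sigma> u a"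
  shows "transm \<M> \<sigma> * (a - cell_avg u K)\<^sup>2 \<le> h1_const * energy K"
proof -
  obtain \<nu> c where \<nu>: "norm \<nu> = 1" "\<sigma> \<subseteq> {x. \<nu> \<bullet> x = c}" "surf \<sigma> = completion (hyp_borel \<nu> c)"
    "\<forall>J\<in>cells \<M>. \<sigma> \<in> E J \<longrightarrow> (\<forall>x\<in>J. \<nu> \<bullet> x \<noteq> c)"
    using edge_hyperplane[OF K] by blast
  define X where "X = (a - cell_avg u K)\<^sup>2"
  define e where "e = \<bar>c - \<nu> \<bullet> xc K\<bar>"
  have \<sigma>c: "\<sigma> \<subseteq> closure K" using edge(1)[OF K] by (auto simp: frontier_def)
  have bK: "K \<in> sets borel" using cell(1) K(1) by (simp add: borel_open)
  have wK: "weak_gradient K u w" by (rule weak_gradient_subset[OF w \<Omega>(1) cell(1,4)[OF K(1)]])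
  have "ennreal (surf_meas \<sigma> * X) \<le>
    ennreal (e * trace_const DIM('a) \<rho>) * (2 * (\<integral>\<^sup>+x. ennreal ((norm (w x))\<^sup>2) \<partial>lebesgue_on K))"
    unfolding X_def e_def cell_avg_def rad_def
  proof (rule trace_mean_estimate[OF cell(1,3,2)[OF K(1)] cell_ball(4)[OF K(1)] \<sigma>c \<nu>(2,3) edge(3)[OF K] \<nu>(1) cell(7)[OF K(1)] _ \<rho>(1,2) _ _ a wK])
    show "dist (xc K) q \<le> diameter K" if "q \<in> \<sigma>" for q using that \<sigma>c edge(5)[OF K] by auto
    show "\<rho> * diameter K \<le> \<bar>c - \<nu> \<bullet> xc K\<bar>"
      using hyperplane_dist[OF K(1) \<nu>(1)] \<nu>(4) K by (auto simp: rad_def)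
    show "ball (xc K) (\<rho> * diameter K) \<subseteq> K" using cell_ball(2)[OF K(1)] by (simp add: rad_def)
  qed
  also have "(\<integral>\<^sup>+x. ennreal ((norm (w x))\<^sup>2) \<partial>lebesgue_on K) = ennreal (energy K)"
  proof -
    have "(\<integral>\<^sup>+x. ennreal ((norm (w x))\<^sup>2) \<partial>lebesgue_on K) = (\<integral>\<^sup>+x. ennreal ((norm (w x))\<^sup>2) * indicator K x \<partial>lborel)"
      by (rule nn_integral_lebesgue_on_rep[OF cell(1)[OF K(1)]]) simp
    also have "\<dots> = (\<integral>\<^sup>+x\<in>K. ennreal ((norm (w x))\<^sup>2) \<partial>lebesgue_on \<Omega>)"
      by (rule nn_integral_lebesgue_on_rep[OF \<Omega>(1), symmetric])
        (use cell(4)[OF K(1)] in \<open>auto simp: indicator_def\<close>)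
    also have "\<dots> = ennreal (energy K)" by (rule energy_nn[OF bK])
    finally show ?thesis .
  qed
  also have "ennreal (e * trace_const DIM('a) \<rho>) * (2 * ennreal (energy K)) =
      ennreal (e * trace_const DIM('a) \<rho>) * ennreal (2 * energy K)"
    using energy_nonneg[of K] by (simp add: ennreal_mult)
  also have "\<dots> = ennreal (e * trace_const DIM('a) \<rho> * (2 * energy K))"
    by (rule ennreal_mult[symmetric])
      (use trace_const_pos[of "DIM('a)" \<rho>] \<rho>(1) energy_nonneg in \<open>auto simp: e_def less_imp_le\<close>)
  also have "e * trace_const DIM('a) \<rho> * (2 * energy K) = e * (h1_const * energy K)"
    by (simp add: h1_const_def)
  finally have "ennreal (surf_meas \<sigma> * X) \<le> ennreal (e * (h1_const * energy K))" .
  then have "surf_meas \<sigma> * X \<le> e * (h1_const * energy K)"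
    using h1_const_pos energy_nonneg by (subst (asm) ennreal_le_iff) (auto simp: e_def)
  also have "\<dots> \<le> edge_dist \<M> \<sigma> * (h1_const * energy K)"
    using edge_dist_ext_ge[OF \<sigma> K \<nu>(1,2)] h1_const_pos energy_nonneg by (intro mult_right_mono) (auto simp: e_def)
  finally show ?thesis
    using edge_dist_pos(1)[OF edge(4)[OF K]] by (simp add: transm_def X_def field_simps)
qed

lemma sum_energy_le: "(\<Sum>K\<in>cells \<M>. energy K) \<le> energy \<Omega>"
proof -
  have bK: "K \<in> sets borel" if "K \<in> cells \<M>" for K using cell(1)[OF that] by (simp add: borel_open)
  have "(\<Sum>K\<in>cells \<M>. energy K) = (LINT x|lebesgue_on \<Omega>. (\<Sum>K\<in>cells \<M>. indicator K x * (norm (w x))\<^sup>2))"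
    unfolding energy_def by (rule Bochner_Integration.integral_sum[symmetric]) (use bK energy_integrable in auto)
  also have "\<dots> \<le> (LINT x|lebesgue_on \<Omega>. indicator \<Omega> x * (norm (w x))\<^sup>2)"
  proof (rule integral_mono)
    show "integrable (lebesgue_on \<Omega>) (\<lambda>x. \<Sum>K\<in>cells \<M>. indicator K x * (norm (w x))\<^sup>2)"
      using bK energy_integrable by (intro Bochner_Integration.integrable_sum) auto
    show "integrable (lebesgue_on \<Omega>) (\<lambda>x. indicator \<Omega> x * (norm (w x))\<^sup>2)"
      using \<Omega>(1) by (intro energy_integrable) (simp add: borel_open)
    fix x assume "x \<in> space (lebesgue_on \<Omega>)"
    then have x: "x \<in> \<Omega>" by (simp add: space_restrict_space)
    have "(\<Sum>K\<in>cells \<M>. indicator K x) = (indicator (\<Union>(cells \<M>)) x :: real)"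
    proof -
      have "disjoint_family_on id (cells \<M>)"
        using disjoint_cells by (auto simp: disjoint_family_on_def disjoint_def)
      then have "(indicator (\<Union>(id ` cells \<M>)) x :: real) = (\<Sum>K\<in>cells \<M>. indicator (id K) x)"
        by (rule indicator_UN_disjoint[OF finite_cells])
      then show ?thesis by simp
    qed
    then have "(\<Sum>K\<in>cells \<M>. indicator K x * (norm (w x))\<^sup>2) = indicator (\<Union>(cells \<M>)) x * (norm (w x))\<^sup>2"
      by (simp add: sum_distrib_right[symmetric])
    then show "(\<Sum>K\<in>cells \<M>. indicator K x * (norm (w x))\<^sup>2) \<le> indicator \<Omega> x * (norm (w x))\<^sup>2"
      using x by (auto simp: indicator_def)
  qed
  finally show ?thesis by (simp add: energy_def)
qed

text \<open>Each edge is charged to the cells that have it as an edge. A cell is charged at most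
  \<open>\<beta>\<close> times, and the cells are disjoint, so their energies add up to at most that
  of \<open>\<Omega>\<close>.\<close>

theorem discrete_H1:
  assumes b: "\<And>K \<sigma>. K \<in> cells \<M> \<Longrightarrow> \<sigma> \<in> E K \<Longrightarrow> \<sigma> \<in> dirichlet_edges \<Omega> \<Gamma>D \<M> \<Longrightarrow> trace_mean K \<sigma> u (b \<sigma>)"
  shows "(\<Sum>\<sigma>\<in>edges \<M>. transm \<M> \<sigma> * (Dabs \<Omega> \<Gamma>D \<M> (cell_avg u, b) \<sigma>)\<^sup>2) \<le> h1_const * \<beta> * energy \<Omega>"
proof -
  have edge_le: "transm \<M> \<sigma> * (Dabs \<Omega> \<Gamma>D \<M> (cell_avg u, b) \<sigma>)\<^sup>2 \<le> (\<Sum>K\<in>{K\<in>cells \<M>. \<sigma> \<in> E K}. h1_const * energy K)"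
    if \<sigma>: "\<sigma> \<in> edges \<M>" for \<sigma>
  proof -
    define K where "K = side \<M> \<sigma>"
    have K: "K \<in> cells \<M>" "\<sigma> \<in> E K" using side[OF \<sigma>] by (auto simp: K_def)
    have nn: "0 \<le> h1_const * energy J" for J using h1_const_pos energy_nonneg by simp
    have fin: "finite {K\<in>cells \<M>. \<sigma> \<in> E K}" using finite_cells by simp
    have *: "h1_const * energy K \<le> (\<Sum>K\<in>{K\<in>cells \<M>. \<sigma> \<in> E K}. h1_const * energy K)"
      by (rule member_le_sum) (use K nn fin in auto)
    show ?thesis
    proof (cases "\<sigma> \<in> int_edges \<M>")
      case True
      note n = neighbour[OF True K]
      have "transm \<M> \<sigma> * (Dabs \<Omega> \<Gamma>D \<M> (cell_avg u, b) \<sigma>)\<^sup>2 \<le> h1_const * (energy K + energy (neighbour \<M> K \<sigma>))"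
        using interior_edge_bound[OF True K] True by (simp add: Dabs_def Ddiff_def nbval_def K_def)
      also have "\<dots> = (\<Sum>J\<in>{K, neighbour \<M> K \<sigma>}. h1_const * energy J)" using n(2) by (simp add: distrib_left)
      also have "\<dots> \<le> (\<Sum>K\<in>{K\<in>cells \<M>. \<sigma> \<in> E K}. h1_const * energy K)"
        by (rule sum_mono2[OF fin]) (use K n nn in auto)
      finally show ?thesis .
    next
      case False
      show ?thesis
      proof (cases "\<sigma> \<in> dirichlet_edges \<Omega> \<Gamma>D \<M>")
        case True
        have "transm \<M> \<sigma> * (Dabs \<Omega> \<Gamma>D \<M> (cell_avg u, b) \<sigma>)\<^sup>2 \<le> h1_const * energy K"
          using dirichlet_edge_bound[OF False K b[OF K True]] True False by (simp add: Dabs_def Ddiff_def nbval_def K_def)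
        with * show ?thesis by simp
      next
        case nd: False
        then have "Dabs \<Omega> \<Gamma>D \<M> (cell_avg u, b) \<sigma> = 0" using False by (simp add: Dabs_def Ddiff_def nbval_def)
        then show ?thesis using * nn[of K] by simp
      qed
    qed
  qed
  have "(\<Sum>\<sigma>\<in>edges \<M>. transm \<M> \<sigma> * (Dabs \<Omega> \<Gamma>D \<M> (cell_avg u, b) \<sigma>)\<^sup>2) \<le>
    (\<Sum>\<sigma>\<in>edges \<M>. \<Sum>K\<in>{K\<in>cells \<M>. \<sigma> \<in> E K}. h1_const * energy K)"
    by (rule sum_mono[OF edge_le])
  also have "\<dots> = (\<Sum>K\<in>cells \<M>. \<Sum>\<sigma>\<in>{\<sigma>\<in>edges \<M>. \<sigma> \<in> E K}. h1_const * energy K)"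
    by (rule sum.swap_restrict[OF finite_edges finite_cells])
  also have "\<dots> = (\<Sum>K\<in>cells \<M>. real (card (E K)) * (h1_const * energy K))"
  proof (rule sum.cong[OF refl])
    fix K assume "K \<in> cells \<M>"
    then have "{\<sigma>\<in>edges \<M>. \<sigma> \<in> E K} = E K" using edges_eq by blast
    then show "(\<Sum>\<sigma>\<in>{\<sigma>\<in>edges \<M>. \<sigma> \<in> E K}. h1_const * energy K) = real (card (E K)) * (h1_const * energy K)" by simp
  qed
  also have "\<dots> \<le> (\<Sum>K\<in>cells \<M>. \<beta> * (h1_const * energy K))"
    using card_edges h1_const_pos energy_nonneg by (intro sum_mono mult_right_mono) auto
  also have "\<dots> = \<beta> * h1_const * (\<Sum>K\<in>cells \<M>. energy K)" by (simp add: sum_distrib_left mult.assoc)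
  also have "\<dots> \<le> \<beta> * h1_const * energy \<Omega>"
    using sum_energy_le h1_const_pos \<beta> by (intro mult_left_mono) auto
  finally show ?thesis by (simp add: mult.commute mult.left_commute)
qed

end

end

section \<open>The Scharfetter--Gummel flux and the relative entropy\<close>

lemma bernoulli_fun_pos: "0 < bernoulli_fun x"
  by (cases "0 < x") (auto simp: bernoulli_fun_def zero_less_divide_iff)

lemma bernoulli_fun_minus: "bernoulli_fun (- x) = exp x * bernoulli_fun x"
proof (cases "x = 0")
  case False
  then have "exp x \<noteq> 1" "exp (- x) \<noteq> 1" by auto
  then show ?thesis using False by (simp add: bernoulli_fun_def exp_minus field_simps)
qed (simp add: bernoulli_fun_def)

lemma bernoulli_fun_minus_add: "bernoulli_fun (- x) = bernoulli_fun x + x"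
proof (cases "x = 0")
  case False
  then have "exp x \<noteq> 1" by auto
  then have "exp x * (x / (exp x - 1)) = x / (exp x - 1) + x" by (simp add: field_simps)
  then show ?thesis using False unfolding bernoulli_fun_minus by (simp add: bernoulli_fun_def)
qed (simp add: bernoulli_fun_def)

lemma bernoulli_fun_exp: "x = bernoulli_fun x * (exp x - 1)"
  by (simp add: bernoulli_fun_def)

lemma bernoulli_fun_ge_1: "x \<le> 0 \<Longrightarrow> 1 \<le> bernoulli_fun x"
proof (cases "x = 0")
  case False
  assume "x \<le> 0"
  with False have x: "x < 0" by simp
  have "exp x - 1 < 0" using x by simp
  moreover have "x \<le> exp x - 1" using exp_ge_add_one_self[of x] by linarith
  ultimately show ?thesis using False by (simp add: bernoulli_fun_def le_divide_eq)
qed (simp add: bernoulli_fun_def)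

lemma bernoulli_fun_le_1: "0 \<le> x \<Longrightarrow> bernoulli_fun x \<le> 1"
proof -
  assume "0 \<le> x"
  moreover have "x \<le> exp x - 1" using exp_ge_add_one_self[of x] by linarith
  ultimately show ?thesis by (cases "x = 0") (auto simp: bernoulli_fun_def divide_le_eq)
qed

text \<open>The derivative is computed away from 0 only. An interval that contains 0 is handled by
  the value 1, which separates the two half-lines.\<close>

lemma bernoulli_fun_antimono:
  assumes "x \<le> y"
  shows "bernoulli_fun y \<le> bernoulli_fun x"
proof -
  have deriv: "\<exists>d. (bernoulli_fun has_real_derivative d) (at t) \<and> d \<le> 0" if t: "t \<noteq> 0" for t :: real
  proof -
    have ne: "exp t - 1 \<noteq> 0" using t by simp
    have "((\<lambda>t. t / (exp t - 1)) has_real_derivative ((exp t - 1 - t * exp t) / (exp t - 1)\<^sup>2)) (at t)"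
      by (auto intro!: derivative_eq_intros simp: t power2_eq_square)
    moreover have "eventually (\<lambda>s. t / (exp t - 1) = t / (exp t - 1)) (nhds t)" by simp
    ultimately have "(bernoulli_fun has_real_derivative ((exp t - 1 - t * exp t) / (exp t - 1)\<^sup>2)) (at t)"
      by (rule_tac has_field_derivative_transform_within_open[where S="- {0}"])
        (use t in \<open>auto simp: bernoulli_fun_def\<close>)
    moreover have "exp t - 1 - t * exp t \<le> 0"
    proof -
      have "(1 - t) * exp t \<le> exp (- t) * exp t" using exp_ge_add_one_self[of "- t"] by (intro mult_right_mono) auto
      then show ?thesis by (simp add: exp_minus algebra_simps)
    qed
    ultimately show ?thesis by (intro exI conjI) (auto simp: divide_nonpos_nonneg)
  qed
  consider "x \<le> 0" "0 \<le> y" | "0 < x" | "y < 0" using assms by linarith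
  then show ?thesis
  proof cases
    case 1
    then show ?thesis using bernoulli_fun_ge_1 bernoulli_fun_le_1 order_trans by blast
  next
    case 2
    show ?thesis by (rule DERIV_nonpos_imp_nonincreasing[OF assms]) (use 2 deriv in force)
  next
    case 3
    show ?thesis by (rule DERIV_nonpos_imp_nonincreasing[OF assms]) (use 3 deriv in force)
  qed
qed

lemma bernoulli_mean_ge_abs: "\<bar>x\<bar> / 2 \<le> (bernoulli_fun x + bernoulli_fun (- x)) / 2"
proof -
  have "\<bar>x\<bar> \<le> bernoulli_fun x + bernoulli_fun (- x)"
    using bernoulli_fun_minus_add[of x] bernoulli_fun_pos[of x] bernoulli_fun_pos[of "- x"] by linarith
  then show ?thesis by simp
qed

text \<open>The mean is \<open>(x / 2) * coth (x / 2)\<close>, an even function. For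
  \<open>x > 0\<close> the claim becomes \<open>exp x * (2 - x) \<le> 2 + x\<close>, which follows
  from monotonicity of the difference \<open>f\<close> of the two sides.\<close>

lemma bernoulli_mean_ge_1: "1 \<le> (bernoulli_fun x + bernoulli_fun (- x)) / 2"
proof -
  have pos: "2 \<le> 2 * bernoulli_fun x + x" if x: "0 < x" for x :: real
  proof -
    define f where "f = (\<lambda>x::real. 2 + x - exp x * (2 - x))"
    have "f 0 \<le> f x"
    proof (rule DERIV_nonneg_imp_nondecreasing[where f=f])
      fix t :: real
      have "(f has_real_derivative 1 - exp t * (1 - t)) (at t)"
        unfolding f_def by (auto intro!: derivative_eq_intros simp: algebra_simps)
      moreover have "exp t * (1 - t) \<le> exp t * exp (- t)" using exp_ge_add_one_self[of "- t"] by (intro mult_left_mono) auto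
      then have "0 \<le> 1 - exp t * (1 - t)" by (simp add: exp_minus)
      ultimately show "\<exists>y. (f has_real_derivative y) (at t) \<and> 0 \<le> y" by blast
    qed (use x in simp)
    then have "(2 - x) * (exp x - 1) \<le> 2 * x" by (simp add: f_def algebra_simps)
    then have "2 - x \<le> 2 * x / (exp x - 1)" using x by (simp add: le_divide_eq)
    then show ?thesis using x by (simp add: bernoulli_fun_def)
  qed
  consider "x = 0" | "0 < x" | "0 < - x" by linarith
  then show ?thesis
  proof cases
    case 1 then show ?thesis by (simp add: bernoulli_fun_def)
  next
    case 2 then show ?thesis using pos[OF 2] bernoulli_fun_minus_add[of x] by simp
  next
    case 3 then show ?thesis using pos[OF 3] bernoulli_fun_minus_add[of "- x"] by simp
  qed
qed

text \<open>The Scharfetter--Gummel flux is \<open>- R X\<close>, with \<open>X\<close> the difference of the quasi-Fermi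
  potentials and \<open>R\<close> between the two densities.\<close>

lemma scharfetter_gummel:
  fixes a b d :: real
  assumes a: "0 < a" and b: "0 < b"
  defines "X \<equiv> ln b - ln a - d"
  defines "F \<equiv> bernoulli_fun (- d) * a - bernoulli_fun d * b"
  obtains R where "F = - R * X" "min a b \<le> R" "R \<le> max a b"
proof (cases "X = 0")
  case True
  have "F = bernoulli_fun d * (exp d * a - b)" unfolding F_def bernoulli_fun_minus by (simp add: algebra_simps)
  moreover have "exp d * a = b"
  proof -
    have "d = ln b - ln a" using True by (simp add: X_def)
    then show ?thesis using a b by (simp add: exp_diff)
  qed
  ultimately show thesis using True by (intro that[of a]) auto
next
  case False
  \<comment> \<open>\<open>F\<close> equals \<open>bernoulli_fun d * b * (exp (- X) - 1)\<close>,
    and the last factor is \<open>- X / bernoulli_fun (- X)\<close>; \<open>R\<close> is what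
    remains next to \<open>- X\<close>.\<close>
  define R where "R = b * bernoulli_fun d / bernoulli_fun (- X)"
  have pos: "0 < bernoulli_fun (- X)" "0 < bernoulli_fun d" by (rule bernoulli_fun_pos)+
  have "exp (- X) * b = exp d * a"
    using a b by (simp add: X_def exp_diff exp_minus exp_add field_simps)
  then have "F = bernoulli_fun d * b * (exp (- X) - 1)"
    unfolding F_def bernoulli_fun_minus by (simp add: algebra_simps)
  moreover have "exp (- X) - 1 = - X / bernoulli_fun (- X)"
    using bernoulli_fun_exp[of "- X"] pos(1) by (simp add: field_simps)
  ultimately have F: "F = - R * X" by (simp add: R_def)
  \<comment> \<open>The sign of \<open>c\<close> tells which density is larger. Since
    \<open>d = c - X\<close>, the same sign orders \<open>d\<close> against \<open>- X\<close> and
    \<open>X - c\<close> against \<open>X\<close>, and antimonotonicity of the Bernoulli function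
    yields the two bounds on \<open>R\<close>.\<close>
  define c where "c = ln b - ln a"
  have d: "d = c - X" by (simp add: X_def c_def)
  have bc: "b = a * exp c" using a b by (simp add: c_def exp_diff)
  have aR: "a * exp c * bernoulli_fun d = exp X * (a * bernoulli_fun (X - c))"
    using bernoulli_fun_minus[of d] by (simp add: d exp_diff)
  have aX: "a * bernoulli_fun (- X) = exp X * (a * bernoulli_fun X)"
    by (simp add: bernoulli_fun_minus)
  show thesis
  proof (cases "0 \<le> c")
    case True
    have ab: "a \<le> b" using a True bc by simp
    have "bernoulli_fun d \<le> bernoulli_fun (- X)" unfolding d by (rule bernoulli_fun_antimono) (use True in simp)
    then have "R \<le> b" using b pos by (simp add: R_def divide_le_eq)
    moreover have "bernoulli_fun X \<le> bernoulli_fun (X - c)" by (rule bernoulli_fun_antimono) (use True in simp)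
    then have "a * bernoulli_fun (- X) \<le> b * bernoulli_fun d" unfolding bc aR aX using a by simp
    then have "a \<le> R" using pos by (simp add: R_def le_divide_eq)
    ultimately show thesis using F ab by (intro that[of R]) auto
  next
    case False
    have ab: "b \<le> a" using a False bc by simp
    have "bernoulli_fun (- X) \<le> bernoulli_fun d" unfolding d by (rule bernoulli_fun_antimono) (use False in simp)
    then have "b \<le> R" using b pos by (simp add: R_def le_divide_eq)
    moreover have "bernoulli_fun (X - c) \<le> bernoulli_fun X" by (rule bernoulli_fun_antimono) (use False in simp)
    then have "b * bernoulli_fun d \<le> a * bernoulli_fun (- X)" unfolding bc aR aX using a by simp
    then have "R \<le> a" using pos by (simp add: R_def divide_le_eq)
    ultimately show thesis using F ab by (intro that[of R]) auto
  qed
qed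

lemma young: "0 < e \<Longrightarrow> x * y \<le> e / 2 * x\<^sup>2 + 1 / (2 * e) * y\<^sup>2" for x y e :: real
proof -
  assume e: "0 < e"
  have "0 \<le> (e * x - y)\<^sup>2" by simp
  then have "2 * e * (x * y) \<le> e\<^sup>2 * x\<^sup>2 + y\<^sup>2" by (simp add: power2_diff power_mult_distrib algebra_simps)
  then have "x * y \<le> (e\<^sup>2 * x\<^sup>2 + y\<^sup>2) / (2 * e)" using e by (simp add: field_simps)
  also have "\<dots> = e / 2 * x\<^sup>2 + 1 / (2 * e) * y\<^sup>2" using e by (simp add: field_simps power2_eq_square)
  finally show ?thesis .
qed

text \<open>Since \<open>F = - R * X\<close> with \<open>R\<close> between \<open>m\<close> and
  \<open>M\<close>, the product \<open>F * (X - Y)\<close> is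
  \<open>- R * X\<^sup>2 + R * X * Y\<close>, and Young's inequality with parameter \<open>m\<close>
  gives up half of the quadratic term. In the entropy estimate \<open>Y\<close> is the reference
  quasi-Fermi difference; in the energy estimate \<open>Z\<close> is the reference density
  difference.\<close>

lemma scharfetter_gummel_young:
  fixes a b d m M :: real
  assumes ab: "0 < m" "m \<le> a" "a \<le> M" "m \<le> b" "b \<le> M"
  defines "X \<equiv> ln b - ln a - d"
  defines "F \<equiv> bernoulli_fun (- d) * a - bernoulli_fun d * b"
  shows "F * (X - Y) \<le> - (m / 2) * X\<^sup>2 + M\<^sup>2 / (2 * m) * Y\<^sup>2" "- (F * Z) \<le> M\<^sup>2 / 2 * X\<^sup>2 + Z\<^sup>2 / 2"
proof -
  have "0 < a" "0 < b" using ab by auto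
  then obtain R where R: "F = - R * X" "min a b \<le> R" "R \<le> max a b"
    unfolding F_def X_def by (rule scharfetter_gummel)
  have Rm: "m \<le> R" "R \<le> M" using R ab by auto
  have RXY: "R * X * Z \<le> e / 2 * X\<^sup>2 + M\<^sup>2 / (2 * e) * Z\<^sup>2" if "0 < e" for Z e
  proof -
    have "R * X * Z = X * (R * Z)" by simp
    also have "\<dots> \<le> e / 2 * X\<^sup>2 + 1 / (2 * e) * (R * Z)\<^sup>2" by (rule young[OF that])
    also have "(R * Z)\<^sup>2 \<le> M\<^sup>2 * Z\<^sup>2"
      using Rm ab(1) by (auto simp: power_mult_distrib intro!: mult_right_mono power_mono)
    finally show ?thesis using that by (simp add: divide_right_mono)
  qed
  have "m * X\<^sup>2 \<le> R * X\<^sup>2" using Rm by (intro mult_right_mono) auto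
  moreover have "F * (X - Y) = - (R * X\<^sup>2) + R * X * Y" unfolding R(1) by (simp add: algebra_simps power2_eq_square)
  ultimately show "F * (X - Y) \<le> - (m / 2) * X\<^sup>2 + M\<^sup>2 / (2 * m) * Y\<^sup>2" using RXY[OF ab(1), of Y] by simp
  show "- (F * Z) \<le> M\<^sup>2 / 2 * X\<^sup>2 + Z\<^sup>2 / 2"
  proof -
    have "- (F * Z) = (R * X) * Z" unfolding R(1) by simp
    also have "\<dots> \<le> 1 / 2 * (R * X)\<^sup>2 + 1 / (2 * 1) * Z\<^sup>2" by (rule young) simp
    also have "(R * X)\<^sup>2 \<le> M\<^sup>2 * X\<^sup>2"
      using Rm ab(1) by (auto simp: power_mult_distrib intro!: mult_right_mono power_mono)
    finally show ?thesis by simp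
  qed
qed

text \<open>The Bregman distance of the convex function \<open>s * ln s - s\<close>. Its derivative
  in \<open>x\<close> is \<open>ln x - ln y\<close>, the logarithmic part of the test function in
  \<open>species_entropy\<close>.\<close>

definition rel_entropy :: "real \<Rightarrow> real \<Rightarrow> real" where
  "rel_entropy x y = x * (ln x - ln y) - x + y"

lemma rel_entropy_bounds:
  assumes "0 < m" "m \<le> x" "x \<le> M" "m \<le> y" "y \<le> M"
  shows "0 \<le> rel_entropy x y" "rel_entropy x y \<le> (M - m)\<^sup>2 / m"
proof -
  have xy: "0 < x" "0 < y" using assms by auto
  have "ln (y / x) \<le> y / x - 1" using xy by (intro ln_le_minus_one) auto
  then have "x * ln (y / x) \<le> x * (y / x - 1)" using xy by (intro mult_left_mono) auto
  then show "0 \<le> rel_entropy x y" using xy by (simp add: rel_entropy_def ln_div algebra_simps)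
  have "ln (x / y) \<le> x / y - 1" using xy by (intro ln_le_minus_one) auto
  then have "x * ln (x / y) \<le> x * (x / y - 1)" using xy by (intro mult_left_mono) auto
  then have "rel_entropy x y \<le> x * (x / y - 1) - x + y" using xy by (simp add: rel_entropy_def ln_div)
  also have "\<dots> = (x - y)\<^sup>2 / y" using xy by (simp add: field_simps power2_eq_square)
  also have "\<dots> \<le> (M - m)\<^sup>2 / m"
    using assms xy by (intro frac_le) (auto simp: abs_le_square_iff[symmetric])
  finally show "rel_entropy x y \<le> (M - m)\<^sup>2 / m" .
qed

text \<open>Convexity in the first argument. The derivative is taken at the new value
  \<open>x\<close>, in accordance with the implicit time step.\<close>

lemma rel_entropy_diff:
  assumes "0 < x" "0 < x'"
  shows "rel_entropy x y - rel_entropy x' y \<le> (ln x - ln y) * (x - x')"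
proof -
  have "ln (x / x') \<le> x / x' - 1" using assms by (intro ln_le_minus_one) auto
  then have "x' * ln (x / x') \<le> x' * (x / x' - 1)" using assms by (intro mult_left_mono) auto
  then show ?thesis using assms by (simp add: rel_entropy_def ln_div algebra_simps)
qed

lemma ln_diff_square_le:
  fixes x y m :: real
  assumes "0 < m" "m \<le> x" "m \<le> y"
  shows "(ln x - ln y)\<^sup>2 \<le> (x - y)\<^sup>2 / m\<^sup>2"
proof -
  have le: "ln x - ln y \<le> \<bar>x - y\<bar> / m" if "m \<le> x" "m \<le> y" for x y :: real
  proof -
    have xy: "0 < x" "0 < y" using assms(1) that by auto
    have "ln x - ln y \<le> (x - y) / y" using xy ln_le_minus_one[of "x / y"] by (simp add: ln_div diff_divide_distrib)
    also have "\<dots> \<le> \<bar>x - y\<bar> / y" using xy by (intro divide_right_mono) auto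
    also have "\<dots> \<le> \<bar>x - y\<bar> / m" using assms(1) that by (intro divide_left_mono) auto
    finally show ?thesis .
  qed
  have "\<bar>ln x - ln y\<bar> \<le> \<bar>x - y\<bar> / m" using le[OF assms(2,3)] le[OF assms(3,2)] by (simp add: abs_minus_commute abs_le_iff)
  then have "\<bar>ln x - ln y\<bar>\<^sup>2 \<le> (\<bar>x - y\<bar> / m)\<^sup>2" by (intro power_mono) auto
  then show ?thesis by (simp add: power_divide)
qed

section \<open>Maximum principle\<close>

text \<open>By \<open>flux_P_eq\<close> the equation for P is that for N with reversed potential, so
  \<open>vneg\<close> allows each estimate to be proved for one species only.\<close>

definition vneg :: "'a dvec \<Rightarrow> 'a dvec" where
  "vneg u = (\<lambda>K. - fst u K, \<lambda>\<sigma>. - snd u \<sigma>)"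

definition vsub :: "'a dvec \<Rightarrow> 'a dvec \<Rightarrow> 'a dvec" where
  "vsub u v = (\<lambda>K. fst u K - fst v K, \<lambda>\<sigma>. snd u \<sigma> - snd v \<sigma>)"

definition vmap :: "(real \<Rightarrow> real) \<Rightarrow> 'a dvec \<Rightarrow> 'a dvec" where
  "vmap f u = (\<lambda>K. f (fst u K), \<lambda>\<sigma>. f (snd u \<sigma>))"

lemma fst_vops [simp]: "fst (vneg u) K = - fst u K" "fst (vsub u v) K = fst u K - fst v K" "fst (vmap f u) K = f (fst u K)"
  by (simp_all add: vneg_def vsub_def vmap_def)

lemma snd_vops [simp]: "snd (vneg u) \<sigma> = - snd u \<sigma>" "snd (vsub u v) \<sigma> = snd u \<sigma> - snd v \<sigma>" "snd (vmap f u) \<sigma> = f (snd u \<sigma>)"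
  by (simp_all add: vneg_def vsub_def vmap_def)

lemma vneg_vneg [simp]: "vneg (vneg u) = u"
  by (simp add: vneg_def)

context regular_mesh
begin

abbreviation "dir \<equiv> dirichlet_edges \<Omega> \<Gamma>D \<M>"
abbreviation "Dd \<equiv> Ddiff \<Omega> \<Gamma>D \<M>"
abbreviation "nb \<equiv> nbval \<Omega> \<Gamma>D \<M>"
abbreviation "\<tau> \<equiv> transm \<M>"
abbreviation "FN \<equiv> flux_N \<Omega> \<Gamma>D \<M>"
abbreviation "vol K \<equiv> measure lebesgue K"

lemma nb_vops [simp]: "nb (vneg u) K \<sigma> = - nb u K \<sigma>" "nb (vsub u v) K \<sigma> = nb u K \<sigma> - nb v K \<sigma>" "nb (vmap f u) K \<sigma> = f (nb u K \<sigma>)"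
  by (simp_all add: nbval_def)

lemma Dd_vops [simp]: "Dd (vneg u) K \<sigma> = - Dd u K \<sigma>" "Dd (vsub u v) K \<sigma> = Dd u K \<sigma> - Dd v K \<sigma>"
  "Dd (vmap f u) K \<sigma> = f (nb u K \<sigma>) - f (fst u K)"
  by (simp_all add: Ddiff_def)

lemma flux_P_eq: "flux_P \<Omega> \<Gamma>D \<M> P \<Psi> K \<sigma> = FN P (vneg \<Psi>) K \<sigma>"
  by (simp add: flux_P_def flux_N_def)

lemma nb_int:
  assumes "\<sigma> \<in> int_edges \<M>" "K \<in> cells \<M>" "\<sigma> \<in> E K"
  shows "nb u K \<sigma> = fst u (neighbour \<M> K \<sigma>)" "nb u (neighbour \<M> K \<sigma>) \<sigma> = fst u K"
    "Dd u (neighbour \<M> K \<sigma>) \<sigma> = - Dd u K \<sigma>"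
  using assms neighbour[OF assms] by (simp_all add: nbval_def Ddiff_def)

lemma nb_neumann: "\<sigma> \<notin> int_edges \<M> \<Longrightarrow> \<sigma> \<notin> dir \<Longrightarrow> nb u K \<sigma> = fst u K \<and> Dd u K \<sigma> = 0"
  by (simp add: nbval_def Ddiff_def)

lemma nb_cases:
  assumes K: "K \<in> cells \<M>" "\<sigma> \<in> E K"
    and "\<And>J. J \<in> cells \<M> \<Longrightarrow> Q (fst u J)" "\<And>\<sigma>. \<sigma> \<in> dir \<Longrightarrow> Q (snd u \<sigma>)"
  shows "Q (nb u K \<sigma>)"
  using assms neighbour(1)[OF _ K] by (simp add: nbval_def)

lemma vol_pos: "K \<in> cells \<M> \<Longrightarrow> 0 < vol K"
proof -
  assume K: "K \<in> cells \<M>"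
  have "0 < measure lborel (ball (xc K) (rad K))" using cell_ball(3)[OF K] by (simp add: content_ball_pos)
  also have "\<dots> \<le> measure lborel K"
    by (rule measure_mono_fmeasurable[OF cell_ball(2)[OF K]])
      (use cell(1,3)[OF K] in \<open>auto simp: borel_open intro!: fmeasurableI emeasure_bounded_finite\<close>)
  finally show ?thesis using cell(1)[OF K] by (simp add: borel_open)
qed

section \<open>Conservative fluxes and discrete integration by parts\<close>

definition conservative :: "('a set \<Rightarrow> 'a set \<Rightarrow> real) \<Rightarrow> bool" where
  "conservative F \<longleftrightarrow> (\<forall>\<sigma>\<in>int_edges \<M>. \<forall>K\<in>cells \<M>. \<sigma> \<in> E K \<longrightarrow> F (neighbour \<M> K \<sigma>) \<sigma> = - F K \<sigma>) \<and>
     (\<forall>\<sigma> K. \<sigma> \<notin> int_edges \<M> \<longrightarrow> \<sigma> \<notin> dir \<longrightarrow> F K \<sigma> = 0)"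

lemma conservative_flux: "conservative (FN N \<Psi>)"
  by (auto simp: conservative_def flux_N_def nb_int nb_neumann algebra_simps)

lemma conservative_diff: "conservative (\<lambda>K \<sigma>. \<tau> \<sigma> * Dd u K \<sigma>)"
  by (auto simp: conservative_def nb_int nb_neumann)

text \<open>Regrouping by edges, the opposite fluxes at an interior edge produce a difference of
  \<open>v\<close>. At a Dirichlet edge the missing outer value is 0 by assumption, and at a Neumann
  edge the flux vanishes.\<close>

lemma sum_by_parts:
  assumes F: "conservative F" and v: "\<And>\<sigma>. \<sigma> \<in> dir \<Longrightarrow> snd v \<sigma> = 0"
  shows "(\<Sum>K\<in>cells \<M>. fst v K * (\<Sum>\<sigma>\<in>E K. F K \<sigma>)) = - (\<Sum>\<sigma>\<in>edges \<M>. F (side \<M> \<sigma>) \<sigma> * Dd v (side \<M> \<sigma>) \<sigma>)"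
proof -
  have "(\<Sum>K\<in>cells \<M>. fst v K * (\<Sum>\<sigma>\<in>E K. F K \<sigma>)) = (\<Sum>K\<in>cells \<M>. \<Sum>\<sigma>\<in>{\<sigma>\<in>edges \<M>. \<sigma> \<in> E K}. F K \<sigma> * fst v K)"
  proof (rule sum.cong[OF refl])
    fix K assume "K \<in> cells \<M>"
    then have "{\<sigma>\<in>edges \<M>. \<sigma> \<in> E K} = E K" using edges_eq by blast
    then show "fst v K * (\<Sum>\<sigma>\<in>E K. F K \<sigma>) = (\<Sum>\<sigma>\<in>{\<sigma>\<in>edges \<M>. \<sigma> \<in> E K}. F K \<sigma> * fst v K)"
      by (simp add: sum_distrib_left mult.commute)
  qed
  also have "\<dots> = (\<Sum>\<sigma>\<in>edges \<M>. \<Sum>K\<in>{K\<in>cells \<M>. \<sigma> \<in> E K}. F K \<sigma> * fst v K)"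
    by (rule sum.swap_restrict[OF finite_cells finite_edges])
  also have "\<dots> = (\<Sum>\<sigma>\<in>edges \<M>. - (F (side \<M> \<sigma>) \<sigma> * Dd v (side \<M> \<sigma>) \<sigma>))"
  proof (rule sum.cong[OF refl])
    fix \<sigma> assume \<sigma>: "\<sigma> \<in> edges \<M>"
    define K where "K = side \<M> \<sigma>"
    have K: "K \<in> cells \<M>" "\<sigma> \<in> E K" using side[OF \<sigma>] by (auto simp: K_def)
    have "(\<Sum>K\<in>{K\<in>cells \<M>. \<sigma> \<in> E K}. F K \<sigma> * fst v K) = - (F K \<sigma> * Dd v K \<sigma>)"
    proof (cases "\<sigma> \<in> int_edges \<M>")
      case True
      note n = neighbour[OF True K]
      have set: "{K\<in>cells \<M>. \<sigma> \<in> E K} = {K, neighbour \<M> K \<sigma>}" using K n(1,3,4) by blast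
      have "F (neighbour \<M> K \<sigma>) \<sigma> = - F K \<sigma>" using F True K by (auto simp: conservative_def)
      then show ?thesis unfolding set using n(2) nb_int(1)[OF True K, of v]
        by (simp add: Ddiff_def algebra_simps)
    next
      case False
      have set: "{K\<in>cells \<M>. \<sigma> \<in> E K} = {K}" using K ext_edge_one_cell[OF False K] by blast
      show ?thesis
      proof (cases "\<sigma> \<in> dir")
        case True
        then have "nb v K \<sigma> = 0" using False v by (simp add: nbval_def)
        then show ?thesis unfolding set by (simp add: Ddiff_def)
      next
        case nd: False
        then have "F K \<sigma> = 0" using F False by (auto simp: conservative_def)
        then show ?thesis unfolding set by simp
      qed
    qed
    then show "(\<Sum>K\<in>{K\<in>cells \<M>. \<sigma> \<in> E K}. F K \<sigma> * fst v K) = - (F (side \<M> \<sigma>) \<sigma> * Dd v (side \<M> \<sigma>) \<sigma>)"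
      by (simp add: K_def)
  qed
  finally show ?thesis by (simp add: sum_negf)
qed

text \<open>Isolates a diffusive part with positive coefficient from a drift part proportional to
  the value in the cell. Summed over the edges of \<open>K\<close>, the drift part contains the
  left-hand side of the Poisson equation.\<close>

lemma flux_form: "FN N \<Psi> K \<sigma> = \<tau> \<sigma> * (bernoulli_fun (Dd \<Psi> K \<sigma>) * (fst N K - nb N K \<sigma>) + Dd \<Psi> K \<sigma> * fst N K)"
  using bernoulli_fun_minus_add[of "Dd \<Psi> K \<sigma>"] by (simp add: flux_N_def algebra_simps)

section \<open>Nonnegativity and two-sided bounds\<close>

definition poisson :: "real \<Rightarrow> 'a dvec \<Rightarrow> 'a dvec \<Rightarrow> 'a dvec \<Rightarrow> bool" where
  "poisson lam N P \<Psi> \<longleftrightarrow> (\<forall>K\<in>cells \<M>. - (lam\<^sup>2) * (\<Sum>\<sigma>\<in>E K. \<tau> \<sigma> * Dd \<Psi> K \<sigma>) = vol K * (fst P K - fst N K))"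

definition evol :: "real \<Rightarrow> 'a dvec \<Rightarrow> 'a dvec \<Rightarrow> 'a dvec \<Rightarrow> bool" where
  "evol dt N0 N \<Psi> \<longleftrightarrow> (\<forall>K\<in>cells \<M>. vol K * (fst N K - fst N0 K) + dt * (\<Sum>\<sigma>\<in>E K. FN N \<Psi> K \<sigma>) = 0)"

lemma poisson_swap: "poisson lam N P \<Psi> \<Longrightarrow> poisson lam P N (vneg \<Psi>)"
  by (auto simp: poisson_def sum_negf algebra_simps)

text \<open>The test function is the indicator of the cells with negative density. Positivity of the
  Bernoulli function makes every edge term nonnegative whatever the potential, while a cell with
  negative density would make the time term negative. Nonnegativity is what allows
  \<open>max_principle\<close> to keep the sign of the drift after multiplication by the
  density.\<close>

lemma evol_nonneg:
  assumes dt: "0 < dt" and ev: "evol dt N0 N \<Psi>"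
    and N0: "\<And>K. K \<in> cells \<M> \<Longrightarrow> 0 \<le> fst N0 K" and bd: "\<And>\<sigma>. \<sigma> \<in> dir \<Longrightarrow> 0 \<le> snd N \<sigma>"
    and K: "K \<in> cells \<M>"
  shows "0 \<le> fst N K"
proof (rule ccontr)
  assume neg: "\<not> 0 \<le> fst N K"
  define v :: "'a dvec" where "v = (\<lambda>K. if fst N K < 0 then 1 else 0, \<lambda>_. 0)"
  have "(\<Sum>K\<in>cells \<M>. fst v K * (vol K * (fst N K - fst N0 K))) + dt * (\<Sum>K\<in>cells \<M>. fst v K * (\<Sum>\<sigma>\<in>E K. FN N \<Psi> K \<sigma>))
    = (\<Sum>K\<in>cells \<M>. fst v K * (vol K * (fst N K - fst N0 K) + dt * (\<Sum>\<sigma>\<in>E K. FN N \<Psi> K \<sigma>)))"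
    by (simp add: sum_distrib_left sum.distrib[symmetric] algebra_simps)
  also have "\<dots> = 0" using ev by (intro sum.neutral) (auto simp: evol_def)
  finally have eq: "(\<Sum>K\<in>cells \<M>. fst v K * (vol K * (fst N K - fst N0 K))) =
    dt * (\<Sum>\<sigma>\<in>edges \<M>. FN N \<Psi> (side \<M> \<sigma>) \<sigma> * Dd v (side \<M> \<sigma>) \<sigma>)"
    by (subst (asm) sum_by_parts[OF conservative_flux]) (auto simp: v_def)
  have "0 \<le> (\<Sum>\<sigma>\<in>edges \<M>. FN N \<Psi> (side \<M> \<sigma>) \<sigma> * Dd v (side \<M> \<sigma>) \<sigma>)"
  proof (rule sum_nonneg)
    fix \<sigma> assume \<sigma>: "\<sigma> \<in> edges \<M>"
    define J where "J = side \<M> \<sigma>"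
    have J: "J \<in> cells \<M>" "\<sigma> \<in> E J" using side[OF \<sigma>] by (auto simp: J_def)
    define a where "a = fst N J"
    define b where "b = nb N J \<sigma>"
    have vb: "nb v J \<sigma> = (if b < 0 then 1 else 0)"
      using neighbour(1)[OF _ J] bd by (auto simp: v_def b_def nbval_def not_less)
    have F: "FN N \<Psi> J \<sigma> = \<tau> \<sigma> * (bernoulli_fun (- Dd \<Psi> J \<sigma>) * a - bernoulli_fun (Dd \<Psi> J \<sigma>) * b)"
      by (simp add: flux_N_def a_def b_def)
    note pos = edge_dist_pos(2)[OF \<sigma>] bernoulli_fun_pos[of "- Dd \<Psi> J \<sigma>"] bernoulli_fun_pos[of "Dd \<Psi> J \<sigma>"]
    have "0 \<le> FN N \<Psi> J \<sigma> * Dd v J \<sigma>"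
    proof -
      consider "a < 0" "0 \<le> b" | "0 \<le> a" "b < 0" | "a < 0 \<longleftrightarrow> b < 0" by linarith
      then show ?thesis
      proof cases
        case 1
        then have "bernoulli_fun (- Dd \<Psi> J \<sigma>) * a \<le> 0" "0 \<le> bernoulli_fun (Dd \<Psi> J \<sigma>) * b"
          using pos by (auto intro: mult_nonneg_nonpos less_imp_le)
        then have "FN N \<Psi> J \<sigma> \<le> 0" unfolding F using pos by (intro mult_nonneg_nonpos) auto
        then show ?thesis using 1 by (simp add: Ddiff_def vb) (simp add: v_def a_def)
      next
        case 2
        then have "0 \<le> bernoulli_fun (- Dd \<Psi> J \<sigma>) * a" "bernoulli_fun (Dd \<Psi> J \<sigma>) * b \<le> 0"
          using pos by (auto intro: mult_nonneg_nonpos less_imp_le)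
        then have "0 \<le> FN N \<Psi> J \<sigma>" unfolding F using pos by (intro mult_nonneg_nonneg) auto
        then show ?thesis using 2 by (simp add: Ddiff_def vb) (simp add: v_def a_def)
      next
        case 3
        then show ?thesis by (simp add: Ddiff_def vb) (simp add: v_def a_def)
      qed
    qed
    then show "0 \<le> FN N \<Psi> (side \<M> \<sigma>) \<sigma> * Dd v (side \<M> \<sigma>) \<sigma>" by (simp add: J_def)
  qed
  then have "0 \<le> (\<Sum>K\<in>cells \<M>. fst v K * (vol K * (fst N K - fst N0 K)))" using eq dt by simp
  moreover have "(\<Sum>K\<in>cells \<M>. fst v K * (vol K * (fst N K - fst N0 K))) < 0"
  proof -
    have le: "fst v J * (vol J * (fst N J - fst N0 J)) \<le> 0" if J: "J \<in> cells \<M>" for J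
      using N0[OF J] vol_pos[OF J] by (cases "fst N J < 0") (auto simp: v_def intro!: mult_nonneg_nonpos)
    have "fst v K * (vol K * (fst N K - fst N0 K)) < 0"
      using neg N0[OF K] vol_pos[OF K] by (auto simp: v_def mult_less_0_iff)
    then show ?thesis using sum_strict_mono_ex1[OF finite_cells, of "\<lambda>K. fst v K * (vol K * (fst N K - fst N0 K))" "\<lambda>_. 0"] le K by auto
  qed
  ultimately show False by simp
qed

text \<open>In the cell where the larger of the two densities is maximal, the drift term has a sign by
  the Poisson equation; for \<open>lam = 0\<close> the drift cancels in the sum of the two equations.\<close>

lemma max_principle:
  assumes dt: "0 < dt" and ev: "evol dt N0 N \<Psi>" "evol dt P0 P (vneg \<Psi>)" and po: "poisson lam N P \<Psi>"
    and K: "K \<in> cells \<M>" and nn: "0 \<le> fst N K" and s: "s = 1 \<or> s = -1"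
    and ext: "\<And>J. J \<in> cells \<M> \<Longrightarrow> s * fst N J \<le> s * fst N K \<and> s * fst P J \<le> s * fst N K"
    and old: "\<And>J. J \<in> cells \<M> \<Longrightarrow> s * fst N0 J \<le> s * C \<and> s * fst P0 J \<le> s * C"
    and bd: "\<And>\<sigma>. \<sigma> \<in> dir \<Longrightarrow> s * snd N \<sigma> \<le> s * C \<and> snd P \<sigma> = snd N \<sigma>"
  shows "s * fst N K \<le> s * C"
proof (rule ccontr)
  assume "\<not> ?thesis"
  then have gt: "s * C < s * fst N K" by simp
  have v: "0 < vol K" by (rule vol_pos[OF K])
  have nbN: "s * nb N K \<sigma> \<le> s * fst N K" if "\<sigma> \<in> E K" for \<sigma>
    by (rule nb_cases[OF K that]) (use ext bd gt in force)+
  have \<tau>: "0 < \<tau> \<sigma>" if "\<sigma> \<in> E K" for \<sigma> using edge_dist_pos(2) edge(4)[OF K that] by simp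
  have old1: "0 < s * (vol K * (fst N K - fst N0 K))"
  proof -
    have "0 < vol K * (s * fst N K - s * fst N0 K)" using v gt old[OF K] by (intro mult_pos_pos) auto
    then show ?thesis by (simp add: algebra_simps)
  qed
  have B: "0 \<le> s * (\<tau> \<sigma> * (b * (fst N K - nb N K \<sigma>)))" if "\<sigma> \<in> E K" "0 < b" for \<sigma> b
  proof -
    have "0 \<le> \<tau> \<sigma> * (b * (s * fst N K - s * nb N K \<sigma>))"
      using \<tau>[OF that(1)] nbN[OF that(1)] that(2) by (intro mult_nonneg_nonneg) auto
    then show ?thesis by (simp add: algebra_simps)
  qed
  have evN: "vol K * (fst N K - fst N0 K) + dt * (\<Sum>\<sigma>\<in>E K. FN N \<Psi> K \<sigma>) = 0" using ev(1) K by (simp add: evol_def)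
  show False
  proof (cases "lam = 0")
    case False
    have "0 \<le> s * (\<Sum>\<sigma>\<in>E K. FN N \<Psi> K \<sigma>)"
    proof -
      have "(\<Sum>\<sigma>\<in>E K. FN N \<Psi> K \<sigma>) = (\<Sum>\<sigma>\<in>E K. \<tau> \<sigma> * (bernoulli_fun (Dd \<Psi> K \<sigma>) * (fst N K - nb N K \<sigma>))) + fst N K * (\<Sum>\<sigma>\<in>E K. \<tau> \<sigma> * Dd \<Psi> K \<sigma>)"
        by (simp add: flux_form sum_distrib_left sum.distrib[symmetric] algebra_simps)
      moreover have "0 \<le> s * (\<Sum>\<sigma>\<in>E K. \<tau> \<sigma> * (bernoulli_fun (Dd \<Psi> K \<sigma>) * (fst N K - nb N K \<sigma>)))"
        unfolding sum_distrib_left by (rule sum_nonneg) (use B bernoulli_fun_pos in auto)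
      moreover have "0 \<le> s * (\<Sum>\<sigma>\<in>E K. \<tau> \<sigma> * Dd \<Psi> K \<sigma>)"
      proof -
        have "lam\<^sup>2 * (s * (\<Sum>\<sigma>\<in>E K. \<tau> \<sigma> * Dd \<Psi> K \<sigma>)) = vol K * (s * fst N K - s * fst P K)"
          using po K by (simp add: poisson_def algebra_simps)
        also have "0 \<le> vol K * (s * fst N K - s * fst P K)" using v ext[OF K] by simp
        finally have "lam\<^sup>2 * 0 \<le> lam\<^sup>2 * (s * (\<Sum>\<sigma>\<in>E K. \<tau> \<sigma> * Dd \<Psi> K \<sigma>))" by simp
        then show ?thesis using False by (subst (asm) mult_le_cancel_left_pos) auto
      qed
      ultimately show ?thesis using nn by (simp add: distrib_left mult.left_commute[of s])
    qed
    then have "0 \<le> dt * (s * (\<Sum>\<sigma>\<in>E K. FN N \<Psi> K \<sigma>))" using dt by simp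
    moreover have "s * (vol K * (fst N K - fst N0 K)) + dt * (s * (\<Sum>\<sigma>\<in>E K. FN N \<Psi> K \<sigma>)) = 0"
      using evN by (metis distrib_left mult.left_commute mult_zero_right)
    ultimately show False using old1 by linarith
  next
    case True
    have PN: "fst P J = fst N J" if "J \<in> cells \<M>" for J
      using bspec[OF po[unfolded poisson_def] that] vol_pos[OF that] True by simp
    have nbP: "nb P K \<sigma> = nb N K \<sigma>" if "\<sigma> \<in> E K" for \<sigma>
      using PN neighbour(1)[OF _ K that] PN[OF K] bd by (simp add: nbval_def)
    have evP: "vol K * (fst P K - fst P0 K) + dt * (\<Sum>\<sigma>\<in>E K. FN P (vneg \<Psi>) K \<sigma>) = 0" using ev(2) K by (simp add: evol_def)
    have sum: "(\<Sum>\<sigma>\<in>E K. FN N \<Psi> K \<sigma>) + (\<Sum>\<sigma>\<in>E K. FN P (vneg \<Psi>) K \<sigma>) =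
      (\<Sum>\<sigma>\<in>E K. \<tau> \<sigma> * ((bernoulli_fun (Dd \<Psi> K \<sigma>) + bernoulli_fun (- Dd \<Psi> K \<sigma>)) * (fst N K - nb N K \<sigma>)))"
      unfolding sum.distrib[symmetric]
      by (rule sum.cong[OF refl]) (simp add: flux_N_def nbP PN[OF K] algebra_simps)
    have "0 \<le> s * ((\<Sum>\<sigma>\<in>E K. FN N \<Psi> K \<sigma>) + (\<Sum>\<sigma>\<in>E K. FN P (vneg \<Psi>) K \<sigma>))"
      unfolding sum sum_distrib_left by (rule sum_nonneg) (use B bernoulli_fun_pos in \<open>auto simp: add_pos_pos\<close>)
    then have "0 \<le> dt * (s * ((\<Sum>\<sigma>\<in>E K. FN N \<Psi> K \<sigma>) + (\<Sum>\<sigma>\<in>E K. FN P (vneg \<Psi>) K \<sigma>)))" using dt by simp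
    moreover have "0 < s * (vol K * (fst P K - fst P0 K))"
    proof -
      have "0 < vol K * (s * fst P K - s * fst P0 K)" using v gt old[OF K] PN[OF K] by (intro mult_pos_pos) auto
      then show ?thesis by (simp add: algebra_simps)
    qed
    moreover have "s * (vol K * (fst N K - fst N0 K)) + s * (vol K * (fst P K - fst P0 K)) +
      dt * (s * ((\<Sum>\<sigma>\<in>E K. FN N \<Psi> K \<sigma>) + (\<Sum>\<sigma>\<in>E K. FN P (vneg \<Psi>) K \<sigma>))) =
      s * ((vol K * (fst N K - fst N0 K) + dt * (\<Sum>\<sigma>\<in>E K. FN N \<Psi> K \<sigma>)) + (vol K * (fst P K - fst P0 K) + dt * (\<Sum>\<sigma>\<in>E K. FN P (vneg \<Psi>) K \<sigma>)))"
      by (simp add: algebra_simps)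
    ultimately show False using old1 evN evP by simp
  qed
qed

text \<open>The extremum is taken over both densities at once, since the drift has a sign only where
  one density exceeds the other. If P attains it, the species are exchanged by \<open>vneg\<close>.
  The sign \<open>s = 1\<close> yields the upper bound, \<open>s = -1\<close> the lower one.\<close>

lemma two_sided_bounds:
  assumes dt: "0 < dt" and ev: "evol dt N0 N \<Psi>" "evol dt P0 P (vneg \<Psi>)" and po: "poisson lam N P \<Psi>"
    and m: "0 \<le> m"
    and old: "\<And>J. J \<in> cells \<M> \<Longrightarrow> m \<le> fst N0 J \<and> fst N0 J \<le> M \<and> m \<le> fst P0 J \<and> fst P0 J \<le> M"
    and bd: "\<And>\<sigma>. \<sigma> \<in> dir \<Longrightarrow> m \<le> snd N \<sigma> \<and> snd N \<sigma> \<le> M \<and> snd P \<sigma> = snd N \<sigma>"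
    and J: "J \<in> cells \<M>"
  shows "m \<le> fst N J \<and> fst N J \<le> M \<and> m \<le> fst P J \<and> fst P J \<le> M"
proof -
  have o0: "0 \<le> fst N0 K" "0 \<le> fst P0 K" if "K \<in> cells \<M>" for K using old[OF that] m by linarith+
  have b0: "0 \<le> snd N \<sigma>" "0 \<le> snd P \<sigma>" if "\<sigma> \<in> dir" for \<sigma> using bd[OF that] m by linarith+
  have nnN: "0 \<le> fst N K" if "K \<in> cells \<M>" for K
    by (rule evol_nonneg[OF dt ev(1) o0(1) b0(1) that])
  have nnP: "0 \<le> fst P K" if "K \<in> cells \<M>" for K
    by (rule evol_nonneg[OF dt ev(2) o0(2) b0(2) that])
  have bound: "s * fst N J \<le> s * C \<and> s * fst P J \<le> s * C"
    if s: "s = 1 \<or> s = -1" and o: "\<And>J. J \<in> cells \<M> \<Longrightarrow> s * fst N0 J \<le> s * C \<and> s * fst P0 J \<le> s * C"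
      and b: "\<And>\<sigma>. \<sigma> \<in> dir \<Longrightarrow> s * snd N \<sigma> \<le> s * C" for s C
  proof -
    define f where "f = (\<lambda>K. max (s * fst N K) (s * fst P K))"
    have "f ` cells \<M> \<noteq> {}" "finite (f ` cells \<M>)" using J finite_cells by auto
    from Max_in[OF this(2,1)] obtain K where K: "K \<in> cells \<M>" "f K = Max (f ` cells \<M>)" by auto
    have fK: "f J \<le> f K" if "J \<in> cells \<M>" for J using K that finite_cells by simp
    have "f K \<le> s * C"
    proof (cases "s * fst P K \<le> s * fst N K")
      case True
      then have e: "f K = s * fst N K" by (simp add: f_def)
      show ?thesis unfolding e
        by (rule max_principle[OF dt ev po K(1) nnN[OF K(1)] s _ o])
          (use fK[unfolded e] b bd in \<open>auto simp: f_def\<close>)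
    next
      case False
      then have e: "f K = s * fst P K" by (simp add: f_def)
      have ev': "evol dt N0 N (vneg (vneg \<Psi>))" using ev(1) by simp
      show ?thesis unfolding e
        by (rule max_principle[OF dt ev(2) ev' poisson_swap[OF po] K(1) nnP[OF K(1)] s])
          (use fK[unfolded e] b bd o in \<open>auto simp: f_def\<close>)
    qed
    with fK[OF J] show ?thesis by (auto simp: f_def)
  qed
  have "fst N J \<le> M \<and> fst P J \<le> M" using bound[of 1 M] old bd by simp
  moreover have "m \<le> fst N J \<and> m \<le> fst P J" using bound[of "-1" m] old bd by simp
  ultimately show ?thesis by simp
qed

end

section \<open>Entropy and energy estimates\<close>

lemma telescope_le:
  fixes e g :: "nat \<Rightarrow> real"
  assumes "\<And>n. n < NT \<Longrightarrow> e (Suc n) + g n \<le> e n + c" and "n \<le> NT"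
  shows "e n + (\<Sum>i<n. g i) \<le> e 0 + real n * c"
  using assms(2)
proof (induction n)
  case (Suc n)
  then have "e n + (\<Sum>i<n. g i) \<le> e 0 + real n * c" "e (Suc n) + g n \<le> e n + c" using assms(1)[of n] by auto
  then show ?case by (simp add: algebra_simps)
qed simp

text \<open>\<open>RD\<close> and \<open>RP\<close> are the discretised boundary data. Subtracting
  them gives test functions that vanish on Dirichlet edges at every time; one \<open>RD\<close>
  serves both densities because the boundary data are quasi-neutral.\<close>

locale scheme = regular_mesh \<Omega> \<Gamma>D \<Gamma>N \<M> \<xi> \<beta>
  for \<Omega> \<Gamma>D \<Gamma>N :: "'a::euclidean_space set" and \<M> \<xi> \<beta> +
  fixes N P \<Psi> :: "nat \<Rightarrow> 'a dvec" and RD RP :: "'a dvec" and dt lam m M :: real and NT :: nat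
  assumes dt: "0 < dt" and m: "0 < m"
    and ref: "\<And>K. K \<in> cells \<M> \<Longrightarrow> m \<le> fst RD K \<and> fst RD K \<le> M"
      "\<And>\<sigma>. \<sigma> \<in> dir \<Longrightarrow> m \<le> snd RD \<sigma> \<and> snd RD \<sigma> \<le> M"
    and init: "\<And>K. K \<in> cells \<M> \<Longrightarrow> m \<le> fst (N 0) K \<and> fst (N 0) K \<le> M \<and> fst (P 0) K = fst (N 0) K"
    and bd: "\<And>n \<sigma>. n \<le> NT \<Longrightarrow> \<sigma> \<in> dir \<Longrightarrow> snd (N n) \<sigma> = snd RD \<sigma> \<and> snd (P n) \<sigma> = snd RD \<sigma> \<and> snd (\<Psi> n) \<sigma> = snd RP \<sigma>"
    and evo: "\<And>n. n < NT \<Longrightarrow> evol dt (N n) (N (Suc n)) (\<Psi> (Suc n)) \<and> evol dt (P n) (P (Suc n)) (vneg (\<Psi> (Suc n)))"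
    and poi: "\<And>n. n \<le> NT \<Longrightarrow> poisson lam (N n) (P n) (\<Psi> n)"
begin

definition esum :: "('a set \<Rightarrow> real) \<Rightarrow> real" where
  "esum f = (\<Sum>\<sigma>\<in>edges \<M>. \<tau> \<sigma> * f \<sigma>)"

definition dd :: "'a dvec \<Rightarrow> 'a set \<Rightarrow> real" where
  "dd u \<sigma> = Dd u (side \<M> \<sigma>) \<sigma>"

lemma dd_vops [simp]: "dd (vneg u) \<sigma> = - dd u \<sigma>" "dd (vsub u v) \<sigma> = dd u \<sigma> - dd v \<sigma>"
  by (simp_all add: dd_def)

lemma esum_add: "esum (\<lambda>\<sigma>. f \<sigma> + g \<sigma>) = esum f + esum g"
  and esum_cmult: "esum (\<lambda>\<sigma>. c * f \<sigma>) = c * esum f"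
  by (simp_all add: esum_def sum.distrib distrib_left sum_distrib_left mult.left_commute)

lemma esum_mono: "(\<And>\<sigma>. \<sigma> \<in> edges \<M> \<Longrightarrow> f \<sigma> \<le> g \<sigma>) \<Longrightarrow> esum f \<le> esum g"
  unfolding esum_def by (intro sum_mono mult_left_mono) (auto simp: edge_dist_pos less_imp_le)

lemma esum_nonneg: "(\<And>\<sigma>. \<sigma> \<in> edges \<M> \<Longrightarrow> 0 \<le> f \<sigma>) \<Longrightarrow> 0 \<le> esum f"
  using esum_mono[of "\<lambda>_. 0" f] by (simp add: esum_def)

lemma bounds:
  assumes "n \<le> NT" "K \<in> cells \<M>"
  shows "m \<le> fst (N n) K \<and> fst (N n) K \<le> M \<and> m \<le> fst (P n) K \<and> fst (P n) K \<le> M"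
  using assms
proof (induction n arbitrary: K)
  case 0 then show ?case using init by simp
next
  case (Suc n)
  have n: "n < NT" "Suc n \<le> NT" using Suc by auto
  show ?case
  proof (rule two_sided_bounds[OF dt _ _ poi[OF n(2)] _ _ _ Suc.prems(2)])
    show "evol dt (N n) (N (Suc n)) (\<Psi> (Suc n))" "evol dt (P n) (P (Suc n)) (vneg (\<Psi> (Suc n)))"
      using evo[OF n(1)] by auto
    show "m \<le> fst (N n) J \<and> fst (N n) J \<le> M \<and> m \<le> fst (P n) J \<and> fst (P n) J \<le> M" if "J \<in> cells \<M>" for J
      using Suc.IH[OF _ that] n by simp
    show "m \<le> snd (N (Suc n)) \<sigma> \<and> snd (N (Suc n)) \<sigma> \<le> M \<and> snd (P (Suc n)) \<sigma> = snd (N (Suc n)) \<sigma>" if "\<sigma> \<in> dir" for \<sigma>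
      using bd[OF n(2) that] ref(2)[OF that] by simp
  qed (use m in simp)
qed

definition in_range :: "'a dvec \<Rightarrow> bool" where
  "in_range u \<longleftrightarrow> (\<forall>K\<in>cells \<M>. m \<le> fst u K \<and> fst u K \<le> M) \<and> (\<forall>\<sigma>\<in>dir. m \<le> snd u \<sigma> \<and> snd u \<sigma> \<le> M)"

lemma in_range: "n \<le> NT \<Longrightarrow> in_range (N n)" "n \<le> NT \<Longrightarrow> in_range (P n)" "in_range RD"
  using bounds bd ref by (auto simp: in_range_def)

lemma in_range_edge:
  assumes u: "in_range u" and \<sigma>: "\<sigma> \<in> edges \<M>"
  shows "m \<le> fst u (side \<M> \<sigma>)" "fst u (side \<M> \<sigma>) \<le> M" "m \<le> nb u (side \<M> \<sigma>) \<sigma>" "nb u (side \<M> \<sigma>) \<sigma> \<le> M"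
proof -
  show "m \<le> fst u (side \<M> \<sigma>)" "fst u (side \<M> \<sigma>) \<le> M" using u side[OF \<sigma>] by (auto simp: in_range_def)
  show "m \<le> nb u (side \<M> \<sigma>) \<sigma>" "nb u (side \<M> \<sigma>) \<sigma> \<le> M"
    by (rule nb_cases[OF side[OF \<sigma>]]; use u in \<open>auto simp: in_range_def\<close>)+
qed

lemma weak_evol:
  assumes ev: "evol dt N0 N1 Q" and v: "\<And>\<sigma>. \<sigma> \<in> dir \<Longrightarrow> snd v \<sigma> = 0"
  shows "(\<Sum>K\<in>cells \<M>. vol K * (fst N1 K - fst N0 K) * fst v K) = dt * (\<Sum>\<sigma>\<in>edges \<M>. FN N1 Q (side \<M> \<sigma>) \<sigma> * dd v \<sigma>)"
proof -
  have "(\<Sum>K\<in>cells \<M>. vol K * (fst N1 K - fst N0 K) * fst v K) = (\<Sum>K\<in>cells \<M>. - dt * (fst v K * (\<Sum>\<sigma>\<in>E K. FN N1 Q K \<sigma>)))"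
  proof (rule sum.cong[OF refl])
    fix K assume "K \<in> cells \<M>"
    then have "vol K * (fst N1 K - fst N0 K) = - dt * (\<Sum>\<sigma>\<in>E K. FN N1 Q K \<sigma>)" using ev by (auto simp: evol_def)
    then show "vol K * (fst N1 K - fst N0 K) * fst v K = - dt * (fst v K * (\<Sum>\<sigma>\<in>E K. FN N1 Q K \<sigma>))" by simp
  qed
  also have "\<dots> = - dt * (\<Sum>K\<in>cells \<M>. fst v K * (\<Sum>\<sigma>\<in>E K. FN N1 Q K \<sigma>))" by (simp only: sum_distrib_left)
  also have "\<dots> = dt * (\<Sum>\<sigma>\<in>edges \<M>. FN N1 Q (side \<M> \<sigma>) \<sigma> * dd v \<sigma>)"
    by (subst sum_by_parts[OF conservative_flux v]) (auto simp: dd_def)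
  finally show ?thesis .
qed

lemma weak_poisson:
  assumes po: "poisson lam N1 P1 Q" and v: "\<And>\<sigma>. \<sigma> \<in> dir \<Longrightarrow> snd v \<sigma> = 0"
  shows "lam\<^sup>2 * esum (\<lambda>\<sigma>. dd Q \<sigma> * dd v \<sigma>) = (\<Sum>K\<in>cells \<M>. vol K * (fst P1 K - fst N1 K) * fst v K)"
proof -
  have "lam\<^sup>2 * esum (\<lambda>\<sigma>. dd Q \<sigma> * dd v \<sigma>) = - (lam\<^sup>2) * (\<Sum>K\<in>cells \<M>. fst v K * (\<Sum>\<sigma>\<in>E K. \<tau> \<sigma> * Dd Q K \<sigma>))"
    by (subst sum_by_parts[OF conservative_diff v]) (auto simp: dd_def esum_def mult.assoc)
  also have "\<dots> = (\<Sum>K\<in>cells \<M>. fst v K * (- (lam\<^sup>2) * (\<Sum>\<sigma>\<in>E K. \<tau> \<sigma> * Dd Q K \<sigma>)))"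
    by (simp add: sum_distrib_left[of "lam\<^sup>2"] sum_negf mult.left_commute)
  also have "\<dots> = (\<Sum>K\<in>cells \<M>. vol K * (fst P1 K - fst N1 K) * fst v K)"
  proof (rule sum.cong[OF refl])
    fix K assume "K \<in> cells \<M>"
    then have "- (lam\<^sup>2) * (\<Sum>\<sigma>\<in>E K. \<tau> \<sigma> * Dd Q K \<sigma>) = vol K * (fst P1 K - fst N1 K)" using po by (auto simp: poisson_def)
    then show "fst v K * (- (lam\<^sup>2) * (\<Sum>\<sigma>\<in>E K. \<tau> \<sigma> * Dd Q K \<sigma>)) = vol K * (fst P1 K - fst N1 K) * fst v K" by simp
  qed
  finally show ?thesis .
qed

text \<open>\<open>qf u Q\<close> is the difference across an edge of the quasi-Fermi potential \<open>ln u - Q\<close>.\<close>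

definition qf :: "'a dvec \<Rightarrow> 'a dvec \<Rightarrow> 'a set \<Rightarrow> real" where
  "qf u Q \<sigma> = dd (vmap ln u) \<sigma> - dd Q \<sigma>"

text \<open>The test function is the quasi-Fermi potential minus its reference, which is zero on
  Dirichlet edges. Its logarithmic part produces the entropy difference by convexity. Its potential
  part is moved to the right-hand side, where it cancels against the electrostatic energy once both
  species are added.\<close>

lemma species_entropy:
  assumes ev: "evol dt N0 N1 Q" and rng: "in_range N0" "in_range N1"
    and b: "\<And>\<sigma>. \<sigma> \<in> dir \<Longrightarrow> snd N1 \<sigma> = snd RD \<sigma> \<and> snd Q \<sigma> = snd R \<sigma>"
  shows "(\<Sum>K\<in>cells \<M>. vol K * (rel_entropy (fst N1 K) (fst RD K) - rel_entropy (fst N0 K) (fst RD K))) \<le>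
    (\<Sum>K\<in>cells \<M>. vol K * (fst N1 K - fst N0 K) * (fst Q K - fst R K)) +
    dt * (- (m / 2) * esum (\<lambda>\<sigma>. (qf N1 Q \<sigma>)\<^sup>2) + M\<^sup>2 / (2 * m) * esum (\<lambda>\<sigma>. (qf RD R \<sigma>)\<^sup>2))"
proof -
  define v where "v = vsub (vsub (vmap ln N1) Q) (vsub (vmap ln RD) R)"
  have v0: "snd v \<sigma> = 0" if "\<sigma> \<in> dir" for \<sigma> using b[OF that] by (simp add: v_def)
  have "(\<Sum>K\<in>cells \<M>. vol K * (rel_entropy (fst N1 K) (fst RD K) - rel_entropy (fst N0 K) (fst RD K))) \<le>
    (\<Sum>K\<in>cells \<M>. vol K * (fst N1 K - fst N0 K) * (fst Q K - fst R K) + vol K * (fst N1 K - fst N0 K) * fst v K)"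
  proof (rule sum_mono)
    fix K assume K: "K \<in> cells \<M>"
    have "vol K * (rel_entropy (fst N1 K) (fst RD K) - rel_entropy (fst N0 K) (fst RD K)) \<le>
      vol K * ((ln (fst N1 K) - ln (fst RD K)) * (fst N1 K - fst N0 K))"
      using rng K m by (intro mult_left_mono rel_entropy_diff) (auto simp: in_range_def intro: less_le_trans)
    then show "vol K * (rel_entropy (fst N1 K) (fst RD K) - rel_entropy (fst N0 K) (fst RD K)) \<le>
      vol K * (fst N1 K - fst N0 K) * (fst Q K - fst R K) + vol K * (fst N1 K - fst N0 K) * fst v K"
      by (simp add: v_def algebra_simps)
  qed
  also have "\<dots> = (\<Sum>K\<in>cells \<M>. vol K * (fst N1 K - fst N0 K) * (fst Q K - fst R K)) +
     dt * (\<Sum>\<sigma>\<in>edges \<M>. FN N1 Q (side \<M> \<sigma>) \<sigma> * dd v \<sigma>)"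
    unfolding sum.distrib using weak_evol[OF ev v0] by simp
  also have "(\<Sum>\<sigma>\<in>edges \<M>. FN N1 Q (side \<M> \<sigma>) \<sigma> * dd v \<sigma>) \<le>
    esum (\<lambda>\<sigma>. - (m / 2) * (qf N1 Q \<sigma>)\<^sup>2 + M\<^sup>2 / (2 * m) * (qf RD R \<sigma>)\<^sup>2)"
    unfolding esum_def
  proof (rule sum_mono)
    fix \<sigma> assume \<sigma>: "\<sigma> \<in> edges \<M>"
    note r = in_range_edge[OF rng(2) \<sigma>]
    have "FN N1 Q (side \<M> \<sigma>) \<sigma> * dd v \<sigma> = \<tau> \<sigma> *
      ((bernoulli_fun (- dd Q \<sigma>) * fst N1 (side \<M> \<sigma>) - bernoulli_fun (dd Q \<sigma>) * nb N1 (side \<M> \<sigma>) \<sigma>) *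
       ((ln (nb N1 (side \<M> \<sigma>) \<sigma>) - ln (fst N1 (side \<M> \<sigma>)) - dd Q \<sigma>) - qf RD R \<sigma>))"
      by (simp add: flux_N_def v_def qf_def dd_def)
    also have "\<dots> \<le> \<tau> \<sigma> * (- (m / 2) * (ln (nb N1 (side \<M> \<sigma>) \<sigma>) - ln (fst N1 (side \<M> \<sigma>)) - dd Q \<sigma>)\<^sup>2 + M\<^sup>2 / (2 * m) * (qf RD R \<sigma>)\<^sup>2)"
      by (intro mult_left_mono scharfetter_gummel_young(1) m r less_imp_le[OF edge_dist_pos(2)[OF \<sigma>]])
    also have "\<dots> = \<tau> \<sigma> * (- (m / 2) * (qf N1 Q \<sigma>)\<^sup>2 + M\<^sup>2 / (2 * m) * (qf RD R \<sigma>)\<^sup>2)"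
      by (simp add: qf_def dd_def)
    finally show "FN N1 Q (side \<M> \<sigma>) \<sigma> * dd v \<sigma> \<le> \<tau> \<sigma> * (- (m / 2) * (qf N1 Q \<sigma>)\<^sup>2 + M\<^sup>2 / (2 * m) * (qf RD R \<sigma>)\<^sup>2)" .
  qed
  also have "\<dots> = - (m / 2) * esum (\<lambda>\<sigma>. (qf N1 Q \<sigma>)\<^sup>2) + M\<^sup>2 / (2 * m) * esum (\<lambda>\<sigma>. (qf RD R \<sigma>)\<^sup>2)"
    unfolding esum_add esum_cmult ..
  finally show ?thesis using dt by simp
qed

text \<open>Because \<open>bernoulli_fun (- d) - bernoulli_fun d = d\<close>, testing with
  \<open>N1\<close> splits the flux term into the weighted square of the difference and a drift term
  that sees only the difference of \<open>N1\<^sup>2\<close>. The flux against \<open>RD\<close> is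
  controlled by the dissipation of the entropy.\<close>

lemma species_energy:
  assumes ev: "evol dt N0 N1 Q" and rng: "in_range N1"
    and b: "\<And>\<sigma>. \<sigma> \<in> dir \<Longrightarrow> snd N1 \<sigma> = snd RD \<sigma>"
  shows "(\<Sum>K\<in>cells \<M>. vol K * ((fst N1 K - fst RD K)\<^sup>2 - (fst N0 K - fst RD K)\<^sup>2)) / 2 \<le>
    dt * (- esum (\<lambda>\<sigma>. (bernoulli_fun (dd Q \<sigma>) + bernoulli_fun (- dd Q \<sigma>)) / 2 * (dd N1 \<sigma>)\<^sup>2)
       + esum (\<lambda>\<sigma>. dd Q \<sigma> * dd (vmap power2 N1) \<sigma>) / 2
       + M\<^sup>2 / 2 * esum (\<lambda>\<sigma>. (qf N1 Q \<sigma>)\<^sup>2) + esum (\<lambda>\<sigma>. (dd RD \<sigma>)\<^sup>2) / 2)"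
proof -
  define v where "v = vsub N1 RD"
  have v0: "snd v \<sigma> = 0" if "\<sigma> \<in> dir" for \<sigma> using b[OF that] by (simp add: v_def)
  have "(\<Sum>K\<in>cells \<M>. vol K * ((fst N1 K - fst RD K)\<^sup>2 - (fst N0 K - fst RD K)\<^sup>2)) / 2 \<le>
    (\<Sum>K\<in>cells \<M>. vol K * (fst N1 K - fst N0 K) * fst v K)"
    unfolding sum_divide_distrib
  proof (rule sum_mono)
    fix K assume K: "K \<in> cells \<M>"
    have "0 \<le> vol K * (fst N1 K - fst N0 K)\<^sup>2" by simp
    moreover have "vol K * ((fst N1 K - fst RD K)\<^sup>2 - (fst N0 K - fst RD K)\<^sup>2) / 2 =
      vol K * (fst N1 K - fst N0 K) * fst v K - vol K * (fst N1 K - fst N0 K)\<^sup>2 / 2"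
      by (simp add: v_def power2_eq_square field_simps)
    ultimately show "vol K * ((fst N1 K - fst RD K)\<^sup>2 - (fst N0 K - fst RD K)\<^sup>2) / 2 \<le> vol K * (fst N1 K - fst N0 K) * fst v K"
      by linarith
  qed
  also have "\<dots> = dt * (\<Sum>\<sigma>\<in>edges \<M>. FN N1 Q (side \<M> \<sigma>) \<sigma> * dd v \<sigma>)" by (rule weak_evol[OF ev v0])
  also have "\<dots> \<le> dt * esum (\<lambda>\<sigma>. - 1 * ((bernoulli_fun (dd Q \<sigma>) + bernoulli_fun (- dd Q \<sigma>)) / 2 * (dd N1 \<sigma>)\<^sup>2)
       + ((1 / 2) * (dd Q \<sigma> * dd (vmap power2 N1) \<sigma>) + (M\<^sup>2 / 2 * (qf N1 Q \<sigma>)\<^sup>2 + (1 / 2) * (dd RD \<sigma>)\<^sup>2)))"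
    unfolding esum_def
  proof (rule mult_left_mono[OF sum_mono])
    fix \<sigma> assume \<sigma>: "\<sigma> \<in> edges \<M>"
    note r = in_range_edge[OF rng \<sigma>]
    define a where "a = fst N1 (side \<M> \<sigma>)"
    define c where "c = nb N1 (side \<M> \<sigma>) \<sigma>"
    define d where "d = dd Q \<sigma>"
    define F where "F = bernoulli_fun (- d) * a - bernoulli_fun d * c"
    have "FN N1 Q (side \<M> \<sigma>) \<sigma> * dd v \<sigma> = \<tau> \<sigma> * (F * (c - a) + - (F * dd RD \<sigma>))"
      by (simp add: flux_N_def v_def dd_def F_def a_def c_def d_def Ddiff_def algebra_simps)
    also have "\<dots> \<le> \<tau> \<sigma> * (F * (c - a) + (M\<^sup>2 / 2 * (ln c - ln a - d)\<^sup>2 + (dd RD \<sigma>)\<^sup>2 / 2))"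
      unfolding F_def using r m
      by (intro mult_left_mono add_left_mono scharfetter_gummel_young(2) less_imp_le[OF edge_dist_pos(2)[OF \<sigma>]])
        (auto simp: a_def c_def)
    also have "F * (c - a) = - 1 * ((bernoulli_fun d + bernoulli_fun (- d)) / 2 * (c - a)\<^sup>2) + (1 / 2) * (d * (c\<^sup>2 - a\<^sup>2))"
    proof -
      have "d = bernoulli_fun (- d) - bernoulli_fun d" using bernoulli_fun_minus_add[of d] by simp
      then have "d * (c\<^sup>2 - a\<^sup>2) = (bernoulli_fun (- d) - bernoulli_fun d) * (c\<^sup>2 - a\<^sup>2)" by simp
      then show ?thesis unfolding F_def by (simp add: field_simps power2_eq_square)
    qed
    finally show "FN N1 Q (side \<M> \<sigma>) \<sigma> * dd v \<sigma> \<le> \<tau> \<sigma> * (- 1 * ((bernoulli_fun (dd Q \<sigma>) + bernoulli_fun (- dd Q \<sigma>)) / 2 * (dd N1 \<sigma>)\<^sup>2)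
       + ((1 / 2) * (dd Q \<sigma> * dd (vmap power2 N1) \<sigma>) + (M\<^sup>2 / 2 * (qf N1 Q \<sigma>)\<^sup>2 + (1 / 2) * (dd RD \<sigma>)\<^sup>2)))"
      by (simp add: a_def c_def d_def qf_def dd_def Ddiff_def[of \<Omega> \<Gamma>D \<M> N1] add.assoc diff_add_eq)
  qed (use dt in simp)
  also have "\<dots> = dt * (- esum (\<lambda>\<sigma>. (bernoulli_fun (dd Q \<sigma>) + bernoulli_fun (- dd Q \<sigma>)) / 2 * (dd N1 \<sigma>)\<^sup>2)
       + esum (\<lambda>\<sigma>. dd Q \<sigma> * dd (vmap power2 N1) \<sigma>) / 2
       + M\<^sup>2 / 2 * esum (\<lambda>\<sigma>. (qf N1 Q \<sigma>)\<^sup>2) + esum (\<lambda>\<sigma>. (dd RD \<sigma>)\<^sup>2) / 2)"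
    unfolding esum_add esum_cmult by simp
  finally show ?thesis .
qed

definition ref_dissipation :: real where
  "ref_dissipation = esum (\<lambda>\<sigma>. (qf RD RP \<sigma>)\<^sup>2) + esum (\<lambda>\<sigma>. (qf RD (vneg RP) \<sigma>)\<^sup>2)"

definition dissipation :: "nat \<Rightarrow> real" where
  "dissipation n = esum (\<lambda>\<sigma>. (qf (N n) (\<Psi> n) \<sigma>)\<^sup>2) + esum (\<lambda>\<sigma>. (qf (P n) (vneg (\<Psi> n)) \<sigma>)\<^sup>2)"

definition entropy :: "nat \<Rightarrow> real" where
  "entropy n = (\<Sum>K\<in>cells \<M>. vol K * rel_entropy (fst (N n) K) (fst RD K)) +
     (\<Sum>K\<in>cells \<M>. vol K * rel_entropy (fst (P n) K) (fst RD K)) +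
     lam\<^sup>2 / 2 * esum (\<lambda>\<sigma>. (dd (vsub (\<Psi> n) RP) \<sigma>)\<^sup>2)"

text \<open>The two species see opposite potentials, so their leftover terms combine to the
  increment of \<open>N - P\<close> tested with \<open>V1\<close>. The increment of the
  electrostatic energy is bounded by its negative, and the sum cancels.\<close>

lemma entropy_step:
  assumes n: "n < NT"
  shows "entropy (Suc n) + dt * (m / 2) * dissipation (Suc n) \<le> entropy n + dt * (M\<^sup>2 / (2 * m) * ref_dissipation)"
proof -
  have n': "Suc n \<le> NT" "n \<le> NT" using n by auto
  define V0 where "V0 = vsub (\<Psi> n) RP"
  define V1 where "V1 = vsub (\<Psi> (Suc n)) RP"
  have v1: "snd V1 \<sigma> = 0" if "\<sigma> \<in> dir" for \<sigma> using bd[OF n'(1) that] by (simp add: V1_def)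
  \<comment> \<open>Convexity of the square bounds the energy increment by the increment of the
    potential tested with \<open>V1\<close>; the difference of the Poisson equations at the two
    times then rewrites it in terms of the densities.\<close>
  have pot: "lam\<^sup>2 / 2 * esum (\<lambda>\<sigma>. (dd V1 \<sigma>)\<^sup>2) - lam\<^sup>2 / 2 * esum (\<lambda>\<sigma>. (dd V0 \<sigma>)\<^sup>2) \<le>
    (\<Sum>K\<in>cells \<M>. vol K * (fst (P (Suc n)) K - fst (P n) K) * fst V1 K) - (\<Sum>K\<in>cells \<M>. vol K * (fst (N (Suc n)) K - fst (N n) K) * fst V1 K)"
  proof -
    have "esum (\<lambda>\<sigma>. (dd V1 \<sigma>)\<^sup>2) \<le> esum (\<lambda>\<sigma>. (dd V0 \<sigma>)\<^sup>2 + 2 * (dd (\<Psi> (Suc n)) \<sigma> * dd V1 \<sigma> + - 1 * (dd (\<Psi> n) \<sigma> * dd V1 \<sigma>)))"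
    proof (rule esum_mono)
      fix \<sigma>
      have "0 \<le> (dd V1 \<sigma> - dd V0 \<sigma>)\<^sup>2" by simp
      moreover have "dd (\<Psi> (Suc n)) \<sigma> - dd (\<Psi> n) \<sigma> = dd V1 \<sigma> - dd V0 \<sigma>" by (simp add: V1_def V0_def)
      then have "dd (\<Psi> (Suc n)) \<sigma> * dd V1 \<sigma> + - 1 * (dd (\<Psi> n) \<sigma> * dd V1 \<sigma>) = (dd V1 \<sigma> - dd V0 \<sigma>) * dd V1 \<sigma>"
        by (simp add: left_diff_distrib[symmetric])
      ultimately show "(dd V1 \<sigma>)\<^sup>2 \<le> (dd V0 \<sigma>)\<^sup>2 + 2 * (dd (\<Psi> (Suc n)) \<sigma> * dd V1 \<sigma> + - 1 * (dd (\<Psi> n) \<sigma> * dd V1 \<sigma>))"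
        by (simp add: power2_eq_square algebra_simps)
    qed
    also have "\<dots> = esum (\<lambda>\<sigma>. (dd V0 \<sigma>)\<^sup>2) + 2 * (esum (\<lambda>\<sigma>. dd (\<Psi> (Suc n)) \<sigma> * dd V1 \<sigma>) + - 1 * esum (\<lambda>\<sigma>. dd (\<Psi> n) \<sigma> * dd V1 \<sigma>))"
      unfolding esum_add esum_cmult ..
    finally have "lam\<^sup>2 / 2 * esum (\<lambda>\<sigma>. (dd V1 \<sigma>)\<^sup>2) \<le> lam\<^sup>2 / 2 *
      (esum (\<lambda>\<sigma>. (dd V0 \<sigma>)\<^sup>2) + 2 * (esum (\<lambda>\<sigma>. dd (\<Psi> (Suc n)) \<sigma> * dd V1 \<sigma>) + - 1 * esum (\<lambda>\<sigma>. dd (\<Psi> n) \<sigma> * dd V1 \<sigma>)))"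
      by (rule mult_left_mono) simp
    then have "lam\<^sup>2 / 2 * esum (\<lambda>\<sigma>. (dd V1 \<sigma>)\<^sup>2) - lam\<^sup>2 / 2 * esum (\<lambda>\<sigma>. (dd V0 \<sigma>)\<^sup>2) \<le>
      lam\<^sup>2 * esum (\<lambda>\<sigma>. dd (\<Psi> (Suc n)) \<sigma> * dd V1 \<sigma>) - lam\<^sup>2 * esum (\<lambda>\<sigma>. dd (\<Psi> n) \<sigma> * dd V1 \<sigma>)"
      by (simp add: algebra_simps)
    also have "\<dots> = (\<Sum>K\<in>cells \<M>. vol K * (fst (P (Suc n)) K - fst (N (Suc n)) K) * fst V1 K) - (\<Sum>K\<in>cells \<M>. vol K * (fst (P n) K - fst (N n) K) * fst V1 K)"
      using weak_poisson[OF poi[OF n'(1)] v1] weak_poisson[OF poi[OF n'(2)] v1] by simp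
    also have "\<dots> = (\<Sum>K\<in>cells \<M>. vol K * (fst (P (Suc n)) K - fst (P n) K) * fst V1 K) - (\<Sum>K\<in>cells \<M>. vol K * (fst (N (Suc n)) K - fst (N n) K) * fst V1 K)"
      unfolding sum_subtractf[symmetric] by (rule sum.cong) (auto simp: algebra_simps)
    finally show ?thesis .
  qed
  have eN: "(\<Sum>K\<in>cells \<M>. vol K * (rel_entropy (fst (N (Suc n)) K) (fst RD K) - rel_entropy (fst (N n) K) (fst RD K))) \<le>
    (\<Sum>K\<in>cells \<M>. vol K * (fst (N (Suc n)) K - fst (N n) K) * (fst (\<Psi> (Suc n)) K - fst RP K)) +
    dt * (- (m / 2) * esum (\<lambda>\<sigma>. (qf (N (Suc n)) (\<Psi> (Suc n)) \<sigma>)\<^sup>2) + M\<^sup>2 / (2 * m) * esum (\<lambda>\<sigma>. (qf RD RP \<sigma>)\<^sup>2))"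
    by (rule species_entropy) (use evo[OF n] in_range(1) n' bd[OF n'(1)] in auto)
  have eP: "(\<Sum>K\<in>cells \<M>. vol K * (rel_entropy (fst (P (Suc n)) K) (fst RD K) - rel_entropy (fst (P n) K) (fst RD K))) \<le>
    (\<Sum>K\<in>cells \<M>. vol K * (fst (P (Suc n)) K - fst (P n) K) * (fst (vneg (\<Psi> (Suc n))) K - fst (vneg RP) K)) +
    dt * (- (m / 2) * esum (\<lambda>\<sigma>. (qf (P (Suc n)) (vneg (\<Psi> (Suc n))) \<sigma>)\<^sup>2) + M\<^sup>2 / (2 * m) * esum (\<lambda>\<sigma>. (qf RD (vneg RP) \<sigma>)\<^sup>2))"
    by (rule species_entropy) (use evo[OF n] in_range(2) n' bd[OF n'(1)] in auto)
  have sN: "(\<Sum>K\<in>cells \<M>. vol K * (fst (N (Suc n)) K - fst (N n) K) * (fst (\<Psi> (Suc n)) K - fst RP K)) =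
    (\<Sum>K\<in>cells \<M>. vol K * (fst (N (Suc n)) K - fst (N n) K) * fst V1 K)" by (simp add: V1_def)
  have sP: "(\<Sum>K\<in>cells \<M>. vol K * (fst (P (Suc n)) K - fst (P n) K) * (fst (vneg (\<Psi> (Suc n))) K - fst (vneg RP) K)) =
    - (\<Sum>K\<in>cells \<M>. vol K * (fst (P (Suc n)) K - fst (P n) K) * fst V1 K)"
    unfolding sum_negf[symmetric] by (rule sum.cong) (auto simp: V1_def algebra_simps)
  have split: "(\<Sum>K\<in>cells \<M>. vol K * (a K - c K)) = (\<Sum>K\<in>cells \<M>. vol K * a K) - (\<Sum>K\<in>cells \<M>. vol K * c K)" for a c
    by (simp add: right_diff_distrib sum_subtractf)
  show ?thesis
    using eN eP pot unfolding sN sP split entropy_def dissipation_def ref_dissipation_def V1_def V0_def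
    by (simp add: algebra_simps)
qed

text \<open>For \<open>lam \<noteq> 0\<close> the Poisson equation tested with
  \<open>N\<^sup>2 - P\<^sup>2\<close> yields minus the sum of
  \<open>vol K * (P - N)\<^sup>2 * (P + N)\<close>, divided by \<open>lam\<^sup>2\<close>. For
  \<open>lam = 0\<close> the densities coincide and the test function is zero.\<close>

lemma cross_term:
  assumes n: "n \<le> NT"
  shows "esum (\<lambda>\<sigma>. dd (\<Psi> n) \<sigma> * (dd (vmap power2 (N n)) \<sigma> - dd (vmap power2 (P n)) \<sigma>)) \<le> 0"
proof -
  define v where "v = vsub (vmap power2 (N n)) (vmap power2 (P n))"
  have v0: "snd v \<sigma> = 0" if "\<sigma> \<in> dir" for \<sigma> using bd[OF n that] by (simp add: v_def)
  have eq: "esum (\<lambda>\<sigma>. dd (\<Psi> n) \<sigma> * (dd (vmap power2 (N n)) \<sigma> - dd (vmap power2 (P n)) \<sigma>)) = esum (\<lambda>\<sigma>. dd (\<Psi> n) \<sigma> * dd v \<sigma>)"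
    by (simp add: v_def)
  show ?thesis
  proof (cases "lam = 0")
    case False
    have "lam\<^sup>2 * esum (\<lambda>\<sigma>. dd (\<Psi> n) \<sigma> * dd v \<sigma>) = (\<Sum>K\<in>cells \<M>. vol K * (fst (P n) K - fst (N n) K) * fst v K)"
      by (rule weak_poisson[OF poi[OF n] v0])
    also have "\<dots> \<le> 0"
    proof (rule sum_nonpos)
      fix K assume K: "K \<in> cells \<M>"
      have "0 \<le> vol K * ((fst (P n) K - fst (N n) K)\<^sup>2 * (fst (P n) K + fst (N n) K))"
        using bounds[OF n K] m by simp
      then show "vol K * (fst (P n) K - fst (N n) K) * fst v K \<le> 0"
        by (simp add: v_def power2_eq_square algebra_simps)
    qed
    finally show ?thesis using False unfolding eq by (simp add: mult_le_0_iff)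
  next
    case True
    have "fst (P n) K = fst (N n) K" if "K \<in> cells \<M>" for K
      using bspec[OF poi[OF n, unfolded poisson_def] that] vol_pos[OF that] True by simp
    then have z: "fst v K = 0" if "K \<in> cells \<M>" for K using that by (simp add: v_def)
    have "dd v \<sigma> = 0" if \<sigma>: "\<sigma> \<in> edges \<M>" for \<sigma>
    proof -
      have "nb v (side \<M> \<sigma>) \<sigma> = 0" by (rule nb_cases[OF side[OF \<sigma>]]) (use z v0 in auto)
      then show ?thesis using z side[OF \<sigma>] by (simp add: dd_def Ddiff_def)
    qed
    then show ?thesis unfolding eq by (simp add: esum_def)
  qed
qed

definition bmean :: "real \<Rightarrow> real" where
  "bmean x = (bernoulli_fun x + bernoulli_fun (- x)) / 2"

lemma energy_step:
  assumes n: "n < NT"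
  defines "Q \<equiv> \<lambda>n. (\<Sum>K\<in>cells \<M>. vol K * (fst (N n) K - fst RD K)\<^sup>2) / 2 + (\<Sum>K\<in>cells \<M>. vol K * (fst (P n) K - fst RD K)\<^sup>2) / 2"
  shows "Q (Suc n) + dt * esum (\<lambda>\<sigma>. bmean (dd (\<Psi> (Suc n)) \<sigma>) * ((dd (P (Suc n)) \<sigma>)\<^sup>2 + (dd (N (Suc n)) \<sigma>)\<^sup>2)) \<le>
    Q n + (dt * (M\<^sup>2 / 2) * dissipation (Suc n) + dt * esum (\<lambda>\<sigma>. (dd RD \<sigma>)\<^sup>2))"
proof -
  have n': "Suc n \<le> NT" "n \<le> NT" using n by auto
  let ?N = "N (Suc n)" and ?P = "P (Suc n)" and ?\<Psi> = "\<Psi> (Suc n)"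
  have eN: "(\<Sum>K\<in>cells \<M>. vol K * ((fst ?N K - fst RD K)\<^sup>2 - (fst (N n) K - fst RD K)\<^sup>2)) / 2 \<le>
    dt * (- esum (\<lambda>\<sigma>. (bernoulli_fun (dd ?\<Psi> \<sigma>) + bernoulli_fun (- dd ?\<Psi> \<sigma>)) / 2 * (dd ?N \<sigma>)\<^sup>2)
       + esum (\<lambda>\<sigma>. dd ?\<Psi> \<sigma> * dd (vmap power2 ?N) \<sigma>) / 2
       + M\<^sup>2 / 2 * esum (\<lambda>\<sigma>. (qf ?N ?\<Psi> \<sigma>)\<^sup>2) + esum (\<lambda>\<sigma>. (dd RD \<sigma>)\<^sup>2) / 2)"
    by (rule species_energy) (use evo[OF n] in_range(1) n' bd[OF n'(1)] in auto)
  have eP: "(\<Sum>K\<in>cells \<M>. vol K * ((fst ?P K - fst RD K)\<^sup>2 - (fst (P n) K - fst RD K)\<^sup>2)) / 2 \<le>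
    dt * (- esum (\<lambda>\<sigma>. (bernoulli_fun (dd (vneg ?\<Psi>) \<sigma>) + bernoulli_fun (- dd (vneg ?\<Psi>) \<sigma>)) / 2 * (dd ?P \<sigma>)\<^sup>2)
       + esum (\<lambda>\<sigma>. dd (vneg ?\<Psi>) \<sigma> * dd (vmap power2 ?P) \<sigma>) / 2
       + M\<^sup>2 / 2 * esum (\<lambda>\<sigma>. (qf ?P (vneg ?\<Psi>) \<sigma>)\<^sup>2) + esum (\<lambda>\<sigma>. (dd RD \<sigma>)\<^sup>2) / 2)"
    by (rule species_energy) (use evo[OF n] in_range(2) n' bd[OF n'(1)] in auto)
  have B: "esum (\<lambda>\<sigma>. bmean (dd ?\<Psi> \<sigma>) * ((dd ?P \<sigma>)\<^sup>2 + (dd ?N \<sigma>)\<^sup>2)) =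
     esum (\<lambda>\<sigma>. (bernoulli_fun (dd ?\<Psi> \<sigma>) + bernoulli_fun (- dd ?\<Psi> \<sigma>)) / 2 * (dd ?N \<sigma>)\<^sup>2) +
     esum (\<lambda>\<sigma>. (bernoulli_fun (dd (vneg ?\<Psi>) \<sigma>) + bernoulli_fun (- dd (vneg ?\<Psi>) \<sigma>)) / 2 * (dd ?P \<sigma>)\<^sup>2)"
    unfolding esum_add[symmetric] by (simp add: bmean_def distrib_left add.commute)
  have C: "esum (\<lambda>\<sigma>. dd ?\<Psi> \<sigma> * dd (vmap power2 ?N) \<sigma>) + esum (\<lambda>\<sigma>. dd (vneg ?\<Psi>) \<sigma> * dd (vmap power2 ?P) \<sigma>) \<le> 0"
    using cross_term[OF n'(1)] unfolding esum_add[symmetric] by (simp add: right_diff_distrib)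
  have split: "(\<Sum>K\<in>cells \<M>. vol K * (a K - c K)) = (\<Sum>K\<in>cells \<M>. vol K * a K) - (\<Sum>K\<in>cells \<M>. vol K * c K)" for a c
    by (simp add: right_diff_distrib sum_subtractf)
  define e1 where "e1 = esum (\<lambda>\<sigma>. dd ?\<Psi> \<sigma> * dd (vmap power2 ?N) \<sigma>)"
  define e2 where "e2 = esum (\<lambda>\<sigma>. dd (vneg ?\<Psi>) \<sigma> * dd (vmap power2 ?P) \<sigma>)"
  have "dt * (e1 / 2) + dt * (e2 / 2) \<le> 0"
    using C dt by (simp add: e1_def e2_def distrib_left[symmetric] add_divide_distrib[symmetric] mult_le_0_iff)
  then show ?thesis
    using eN eP unfolding B split Q_def dissipation_def e1_def[symmetric] e2_def[symmetric]
    by (simp add: algebra_simps add_divide_distrib diff_divide_distrib)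
qed

end

text \<open>\<open>A1\<close> and \<open>A2\<close> bound the squared differences of
  \<open>RD\<close> and \<open>RP\<close>. The bracket holds the initial entropies of the two
  densities, the initial electrostatic energy without its \<open>lam\<^sup>2\<close>, and the
  dissipation of the reference state up to time \<open>T\<close>; \<open>2 / m\<close> inverts the
  coefficient in \<open>entropy_step\<close>.\<close>

definition dissipation_const :: "real \<Rightarrow> real \<Rightarrow> real \<Rightarrow> real \<Rightarrow> real \<Rightarrow> real \<Rightarrow> real" where
  "dissipation_const V A1 A2 T m M =
     2 / m * (2 * V * ((M - m)\<^sup>2 / m) + A2 + T * (M\<^sup>2 / (2 * m) * (2 / m\<^sup>2 * A1 + 2 * A2)))"

definition energy_const :: "real \<Rightarrow> real \<Rightarrow> real \<Rightarrow> real \<Rightarrow> real \<Rightarrow> real \<Rightarrow> real" where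
  "energy_const V A1 A2 T m M = V * (M - m)\<^sup>2 + M\<^sup>2 / 2 * dissipation_const V A1 A2 T m M + T * A1"

text \<open>One number large enough for three bounds. The summand 2 stems from
  \<open>\<bar>x\<bar> \<le> 2 * bmean x\<close>; the summands with \<open>2 / m\<^sup>2\<close> and
  with the dissipation come from splitting the squared difference of the potential into those of
  \<open>ln N\<close> and of the quasi-Fermi potential.\<close>

definition apriori_const :: "real \<Rightarrow> real \<Rightarrow> real \<Rightarrow> real \<Rightarrow> real \<Rightarrow> real \<Rightarrow> real" where
  "apriori_const V A1 A2 T m M =
     (2 + 2 / m\<^sup>2) * energy_const V A1 A2 T m M + 2 * dissipation_const V A1 A2 T m M"

section \<open>Summation over the time levels\<close>

locale scheme_bounds = scheme +
  fixes V A1 A2 T :: real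
  assumes V: "(\<Sum>K\<in>cells \<M>. vol K) \<le> V"
    and A1: "esum (\<lambda>\<sigma>. (dd RD \<sigma>)\<^sup>2) \<le> A1" and A2: "esum (\<lambda>\<sigma>. (dd RP \<sigma>)\<^sup>2) \<le> A2"
    and T: "real NT * dt \<le> T"
begin

lemma A_nonneg: "0 \<le> A1" "0 \<le> A2" "0 \<le> T" "0 \<le> V"
proof -
  show "0 \<le> A1" by (rule order_trans[OF esum_nonneg A1]) simp
  show "0 \<le> A2" by (rule order_trans[OF esum_nonneg A2]) simp
  show "0 \<le> T" by (rule order_trans[OF _ T]) (use dt in simp)
  show "0 \<le> V" by (rule order_trans[OF _ V]) (simp add: sum_nonneg)
qed

lemma const_nonneg: "0 \<le> dissipation_const V A1 A2 T m M" "0 \<le> energy_const V A1 A2 T m M"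
proof -
  show d: "0 \<le> dissipation_const V A1 A2 T m M"
    unfolding dissipation_const_def using A_nonneg m by (intro mult_nonneg_nonneg add_nonneg_nonneg) auto
  show "0 \<le> energy_const V A1 A2 T m M"
    unfolding energy_const_def using A_nonneg d by (intro mult_nonneg_nonneg add_nonneg_nonneg) auto
qed

lemma dd_ln_le:
  assumes "in_range u" "\<sigma> \<in> edges \<M>"
  shows "(dd (vmap ln u) \<sigma>)\<^sup>2 \<le> (dd u \<sigma>)\<^sup>2 / m\<^sup>2"
proof -
  have "(dd (vmap ln u) \<sigma>)\<^sup>2 = (ln (nb u (side \<M> \<sigma>) \<sigma>) - ln (fst u (side \<M> \<sigma>)))\<^sup>2" by (simp add: dd_def)
  also have "\<dots> \<le> (nb u (side \<M> \<sigma>) \<sigma> - fst u (side \<M> \<sigma>))\<^sup>2 / m\<^sup>2"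
    by (rule ln_diff_square_le[OF m]) (use in_range_edge[OF assms] in auto)
  finally show ?thesis by (simp add: dd_def Ddiff_def)
qed

lemma ref_dissipation_le: "ref_dissipation \<le> 2 / m\<^sup>2 * A1 + 2 * A2"
proof -
  have "ref_dissipation \<le> esum (\<lambda>\<sigma>. 2 / m\<^sup>2 * (dd RD \<sigma>)\<^sup>2 + 2 * (dd RP \<sigma>)\<^sup>2)"
    unfolding ref_dissipation_def esum_add[symmetric]
  proof (rule esum_mono)
    fix \<sigma> assume \<sigma>: "\<sigma> \<in> edges \<M>"
    have "(qf RD RP \<sigma>)\<^sup>2 + (qf RD (vneg RP) \<sigma>)\<^sup>2 = 2 * (dd (vmap ln RD) \<sigma>)\<^sup>2 + 2 * (dd RP \<sigma>)\<^sup>2"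
      by (simp add: qf_def power2_eq_square algebra_simps)
    then show "(qf RD RP \<sigma>)\<^sup>2 + (qf RD (vneg RP) \<sigma>)\<^sup>2 \<le> 2 / m\<^sup>2 * (dd RD \<sigma>)\<^sup>2 + 2 * (dd RP \<sigma>)\<^sup>2"
      using dd_ln_le[OF in_range(3) \<sigma>] by simp
  qed
  also have "\<dots> = 2 / m\<^sup>2 * esum (\<lambda>\<sigma>. (dd RD \<sigma>)\<^sup>2) + 2 * esum (\<lambda>\<sigma>. (dd RP \<sigma>)\<^sup>2)" unfolding esum_add esum_cmult ..
  also have "\<dots> \<le> 2 / m\<^sup>2 * A1 + 2 * A2" using A1 A2 by (intro add_mono mult_left_mono) auto
  finally show ?thesis .
qed

lemma entropy_nonneg:
  assumes "n \<le> NT"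
  shows "0 \<le> entropy n"
  unfolding entropy_def
  using bounds[OF assms] ref(1) m
  by (intro add_nonneg_nonneg sum_nonneg mult_nonneg_nonneg esum_nonneg rel_entropy_bounds(1)[of m _ M]) auto

text \<open>Since P = N at time 0, the Poisson equation tested with \<open>v\<close> makes
  \<open>lam\<^sup>2\<close> times the pairing of \<open>\<Psi> 0\<close> with \<open>v\<close>
  vanish. A Dirichlet principle then compares the energy of \<open>v\<close> with that of
  \<open>RP\<close>. The common factor \<open>lam\<^sup>2\<close> keeps this valid for
  \<open>lam = 0\<close>, where the initial potential is unconstrained.\<close>

lemma entropy_0: "entropy 0 \<le> 2 * V * ((M - m)\<^sup>2 / m) + lam\<^sup>2 * A2"
proof -
  have e: "(\<Sum>K\<in>cells \<M>. vol K * rel_entropy (fst u K) (fst RD K)) \<le> V * ((M - m)\<^sup>2 / m)"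
    if "\<And>K. K \<in> cells \<M> \<Longrightarrow> m \<le> fst u K \<and> fst u K \<le> M" for u :: "'a dvec"
  proof -
    have "(\<Sum>K\<in>cells \<M>. vol K * rel_entropy (fst u K) (fst RD K)) \<le> (\<Sum>K\<in>cells \<M>. vol K * ((M - m)\<^sup>2 / m))"
      using that ref(1) m by (intro sum_mono mult_left_mono rel_entropy_bounds(2)) auto
    also have "\<dots> = (\<Sum>K\<in>cells \<M>. vol K) * ((M - m)\<^sup>2 / m)" by (simp only: sum_distrib_right)
    also have "\<dots> \<le> V * ((M - m)\<^sup>2 / m)" using V m by (intro mult_right_mono) auto
    finally show ?thesis .
  qed
  define v where "v = vsub (\<Psi> 0) RP"
  have v0: "snd v \<sigma> = 0" if "\<sigma> \<in> dir" for \<sigma> using bd[OF _ that, of 0] by (simp add: v_def)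
  have "lam\<^sup>2 * esum (\<lambda>\<sigma>. dd (\<Psi> 0) \<sigma> * dd v \<sigma>) = 0"
    using weak_poisson[OF poi[of 0] v0] init by (simp add: sum.neutral)
  moreover have "esum (\<lambda>\<sigma>. (dd v \<sigma>)\<^sup>2) \<le> esum (\<lambda>\<sigma>. 2 * (dd (\<Psi> 0) \<sigma> * dd v \<sigma>) + (dd RP \<sigma>)\<^sup>2)"
  proof (rule esum_mono)
    fix \<sigma>
    have "0 \<le> (dd v \<sigma> + dd RP \<sigma>)\<^sup>2" by simp
    then show "(dd v \<sigma>)\<^sup>2 \<le> 2 * (dd (\<Psi> 0) \<sigma> * dd v \<sigma>) + (dd RP \<sigma>)\<^sup>2"
      by (simp add: v_def power2_eq_square algebra_simps)
  qed
  then have "lam\<^sup>2 * esum (\<lambda>\<sigma>. (dd v \<sigma>)\<^sup>2) \<le> lam\<^sup>2 * (2 * esum (\<lambda>\<sigma>. dd (\<Psi> 0) \<sigma> * dd v \<sigma>) + esum (\<lambda>\<sigma>. (dd RP \<sigma>)\<^sup>2))"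
    unfolding esum_add esum_cmult by (rule mult_left_mono) simp
  ultimately have "lam\<^sup>2 * esum (\<lambda>\<sigma>. (dd v \<sigma>)\<^sup>2) \<le> lam\<^sup>2 * esum (\<lambda>\<sigma>. (dd RP \<sigma>)\<^sup>2)"
    by (simp only: distrib_left mult.left_commute[of "lam\<^sup>2" 2])
  also have "\<dots> \<le> lam\<^sup>2 * A2" by (intro mult_left_mono A2) simp
  finally have p: "lam\<^sup>2 * esum (\<lambda>\<sigma>. (dd v \<sigma>)\<^sup>2) \<le> lam\<^sup>2 * A2" .
  have "0 \<le> lam\<^sup>2 * A2" using A_nonneg by simp
  with p have "lam\<^sup>2 / 2 * esum (\<lambda>\<sigma>. (dd v \<sigma>)\<^sup>2) \<le> lam\<^sup>2 * A2" by simp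
  moreover have "(\<Sum>K\<in>cells \<M>. vol K * rel_entropy (fst (N 0) K) (fst RD K)) \<le> V * ((M - m)\<^sup>2 / m)"
    "(\<Sum>K\<in>cells \<M>. vol K * rel_entropy (fst (P 0) K) (fst RD K)) \<le> V * ((M - m)\<^sup>2 / m)"
    using init by (intro e; simp)+
  ultimately show ?thesis unfolding entropy_def v_def by linarith
qed

lemma dissipation_sum: "(\<Sum>n<NT. dt * dissipation (Suc n)) \<le> dissipation_const V A1 A2 T m M * (1 + lam\<^sup>2)"
proof -
  define c where "c = M\<^sup>2 / (2 * m) * (2 / m\<^sup>2 * A1 + 2 * A2)"
  have c: "M\<^sup>2 / (2 * m) * ref_dissipation \<le> c"
    unfolding c_def using m by (intro mult_left_mono ref_dissipation_le) simp
  have c0: "0 \<le> c"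
    unfolding c_def using m A_nonneg by (intro mult_nonneg_nonneg add_nonneg_nonneg) auto
  have "entropy NT + (\<Sum>n<NT. dt * (m / 2) * dissipation (Suc n)) \<le> entropy 0 + real NT * (dt * (M\<^sup>2 / (2 * m) * ref_dissipation))"
    by (rule telescope_le[of NT]) (use entropy_step in auto)
  moreover have "(\<Sum>n<NT. dt * (m / 2) * dissipation (Suc n)) = m / 2 * (\<Sum>n<NT. dt * dissipation (Suc n))"
    by (simp only: sum_distrib_left mult.assoc mult.left_commute[of dt])
  moreover have "real NT * (dt * (M\<^sup>2 / (2 * m) * ref_dissipation)) \<le> T * c"
  proof -
    have "real NT * dt * (M\<^sup>2 / (2 * m) * ref_dissipation) \<le> real NT * dt * c"
      using c dt by (intro mult_left_mono) auto
    also have "\<dots> \<le> T * c" using T c0 by (intro mult_right_mono) auto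
    finally show ?thesis by (simp only: mult.assoc)
  qed
  ultimately have "m / 2 * (\<Sum>n<NT. dt * dissipation (Suc n)) \<le> 2 * V * ((M - m)\<^sup>2 / m) + lam\<^sup>2 * A2 + T * c"
    using entropy_nonneg[of NT] entropy_0 by simp
  also have "\<dots> \<le> (2 * V * ((M - m)\<^sup>2 / m) + A2 + T * c) * (1 + lam\<^sup>2)"
  proof -
    have "0 \<le> (2 * V * ((M - m)\<^sup>2 / m) + T * c) * lam\<^sup>2" using A_nonneg c0 m by simp
    then show ?thesis using A_nonneg by (simp add: algebra_simps add_divide_distrib)
  qed
  finally have "2 / m * (m / 2 * (\<Sum>n<NT. dt * dissipation (Suc n))) \<le> 2 / m * ((2 * V * ((M - m)\<^sup>2 / m) + A2 + T * c) * (1 + lam\<^sup>2))"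
    using m by (intro mult_left_mono) auto
  moreover have "2 / m * (m / 2 * x) = x" for x :: real using m by simp
  ultimately show ?thesis unfolding dissipation_const_def c_def[symmetric] by (simp only: mult.assoc)
qed

abbreviation "weighted n \<equiv> esum (\<lambda>\<sigma>. bmean (dd (\<Psi> n) \<sigma>) * ((dd (P n) \<sigma>)\<^sup>2 + (dd (N n) \<sigma>)\<^sup>2))"

lemma weighted_sum: "(\<Sum>n<NT. dt * weighted (Suc n)) \<le> energy_const V A1 A2 T m M * (1 + lam\<^sup>2)"
proof -
  define Q where "Q = (\<lambda>n. (\<Sum>K\<in>cells \<M>. vol K * (fst (N n) K - fst RD K)\<^sup>2) / 2 + (\<Sum>K\<in>cells \<M>. vol K * (fst (P n) K - fst RD K)\<^sup>2) / 2)"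
  define D where "D = dissipation_const V A1 A2 T m M"
  define S where "S = esum (\<lambda>\<sigma>. (dd RD \<sigma>)\<^sup>2)"
  have step: "Q (Suc n) + (dt * weighted (Suc n) - dt * (M\<^sup>2 / 2) * dissipation (Suc n)) \<le> Q n + dt * S" if "n < NT" for n
    using energy_step[OF that] unfolding Q_def S_def by simp
  have "Q NT + (\<Sum>n<NT. dt * weighted (Suc n) - dt * (M\<^sup>2 / 2) * dissipation (Suc n)) \<le> Q 0 + real NT * (dt * S)"
    by (rule telescope_le[of NT]) (use step in auto)
  moreover have "0 \<le> Q NT" unfolding Q_def by (intro add_nonneg_nonneg divide_nonneg_nonneg sum_nonneg) auto
  moreover have "Q 0 \<le> V * (M - m)\<^sup>2"
  proof -
    have q: "(\<Sum>K\<in>cells \<M>. vol K * (fst u K - fst RD K)\<^sup>2) \<le> V * (M - m)\<^sup>2"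
      if "\<And>K. K \<in> cells \<M> \<Longrightarrow> m \<le> fst u K \<and> fst u K \<le> M" for u :: "'a dvec"
    proof -
      have "(\<Sum>K\<in>cells \<M>. vol K * (fst u K - fst RD K)\<^sup>2) \<le> (\<Sum>K\<in>cells \<M>. vol K * (M - m)\<^sup>2)"
      proof (intro sum_mono mult_left_mono)
        fix K assume "K \<in> cells \<M>"
        then have "\<bar>fst u K - fst RD K\<bar> \<le> M - m" using that[of K] ref(1)[of K] by (auto simp: abs_le_iff)
        then have "\<bar>fst u K - fst RD K\<bar>\<^sup>2 \<le> (M - m)\<^sup>2" by (intro power_mono) auto
        then show "(fst u K - fst RD K)\<^sup>2 \<le> (M - m)\<^sup>2" by simp
      qed simp
      also have "\<dots> = (\<Sum>K\<in>cells \<M>. vol K) * (M - m)\<^sup>2" by (simp only: sum_distrib_right)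
      also have "\<dots> \<le> V * (M - m)\<^sup>2" using V by (intro mult_right_mono) auto
      finally show ?thesis .
    qed
    have "(\<Sum>K\<in>cells \<M>. vol K * (fst (N 0) K - fst RD K)\<^sup>2) \<le> V * (M - m)\<^sup>2"
      "(\<Sum>K\<in>cells \<M>. vol K * (fst (P 0) K - fst RD K)\<^sup>2) \<le> V * (M - m)\<^sup>2"
      using init by (intro q; simp)+
    then show ?thesis unfolding Q_def by simp
  qed
  moreover have "(\<Sum>n<NT. dt * weighted (Suc n) - dt * (M\<^sup>2 / 2) * dissipation (Suc n)) =
     (\<Sum>n<NT. dt * weighted (Suc n)) - M\<^sup>2 / 2 * (\<Sum>n<NT. dt * dissipation (Suc n))"
    by (simp only: sum_subtractf sum_distrib_left mult.assoc mult.left_commute[of dt])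
  moreover have "real NT * (dt * S) \<le> T * A1"
  proof -
    have "real NT * dt * S \<le> T * A1" using T A1 A_nonneg dt by (intro mult_mono) (auto simp: S_def esum_nonneg)
    then show ?thesis by (simp add: mult.assoc)
  qed
  moreover have "M\<^sup>2 / 2 * (\<Sum>n<NT. dt * dissipation (Suc n)) \<le> M\<^sup>2 / 2 * (D * (1 + lam\<^sup>2))"
    unfolding D_def by (intro mult_left_mono dissipation_sum) simp
  ultimately have "(\<Sum>n<NT. dt * weighted (Suc n)) \<le> V * (M - m)\<^sup>2 + M\<^sup>2 / 2 * (D * (1 + lam\<^sup>2)) + T * A1" by linarith
  also have "\<dots> \<le> energy_const V A1 A2 T m M * (1 + lam\<^sup>2)"
  proof -
    have "0 \<le> (V * (M - m)\<^sup>2 + T * A1) * lam\<^sup>2" using A_nonneg by simp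
    then show ?thesis unfolding energy_const_def D_def[symmetric] by (simp add: algebra_simps add_divide_distrib)
  qed
  finally show ?thesis .
qed

lemma bmean_bounds: "1 \<le> bmean x" "\<bar>x\<bar> \<le> 2 * bmean x"
  using bernoulli_mean_ge_1[of x] bernoulli_mean_ge_abs[of x] by (auto simp: bmean_def)

theorem estimates:
  defines "K\<^sub>F \<equiv> apriori_const V A1 A2 T m M"
  shows "(\<Sum>n<NT. dt * esum (\<lambda>\<sigma>. \<bar>dd (\<Psi> (Suc n)) \<sigma>\<bar> * ((dd (P (Suc n)) \<sigma>)\<^sup>2 + (dd (N (Suc n)) \<sigma>)\<^sup>2))) \<le> K\<^sub>F * (1 + lam\<^sup>2)"
    and "(\<Sum>n<NT. dt * esum (\<lambda>\<sigma>. (dd (N (Suc n)) \<sigma>)\<^sup>2)) + (\<Sum>n<NT. dt * esum (\<lambda>\<sigma>. (dd (P (Suc n)) \<sigma>)\<^sup>2)) \<le> K\<^sub>F * (1 + lam\<^sup>2)"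
    and "(\<Sum>n<NT. dt * esum (\<lambda>\<sigma>. (dd (\<Psi> (Suc n)) \<sigma>)\<^sup>2)) \<le> K\<^sub>F * (1 + lam\<^sup>2)"
proof -
  define C where "C = energy_const V A1 A2 T m M"
  define D where "D = dissipation_const V A1 A2 T m M"
  have CD: "0 \<le> C" "0 \<le> D" using const_nonneg by (auto simp: C_def D_def)
  have K: "K\<^sub>F = (2 + 2 / m\<^sup>2) * C + 2 * D" by (simp add: K\<^sub>F_def apriori_const_def C_def D_def)
  have K1: "C \<le> K\<^sub>F" "2 * C \<le> K\<^sub>F" "2 / m\<^sup>2 * C + 2 * D \<le> K\<^sub>F"
    unfolding K using CD by (auto simp: distrib_right)
  have up: "a * (1 + lam\<^sup>2) \<le> K\<^sub>F * (1 + lam\<^sup>2)" if "a \<le> K\<^sub>F" for a using that by (intro mult_right_mono) auto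
  have W: "(\<Sum>n<NT. dt * weighted (Suc n)) \<le> C * (1 + lam\<^sup>2)" unfolding C_def by (rule weighted_sum)
  have "(\<Sum>n<NT. dt * esum (\<lambda>\<sigma>. \<bar>dd (\<Psi> (Suc n)) \<sigma>\<bar> * ((dd (P (Suc n)) \<sigma>)\<^sup>2 + (dd (N (Suc n)) \<sigma>)\<^sup>2))) \<le>
    (\<Sum>n<NT. dt * (2 * weighted (Suc n)))"
    unfolding esum_cmult[symmetric] mult.assoc[symmetric, of 2]
    using dt by (intro sum_mono mult_left_mono esum_mono mult_right_mono bmean_bounds) auto
  also have "\<dots> = 2 * (\<Sum>n<NT. dt * weighted (Suc n))" by (simp add: sum_distrib_left mult.left_commute)
  also have "\<dots> \<le> 2 * C * (1 + lam\<^sup>2)" using W by simp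
  finally show "(\<Sum>n<NT. dt * esum (\<lambda>\<sigma>. \<bar>dd (\<Psi> (Suc n)) \<sigma>\<bar> * ((dd (P (Suc n)) \<sigma>)\<^sup>2 + (dd (N (Suc n)) \<sigma>)\<^sup>2))) \<le> K\<^sub>F * (1 + lam\<^sup>2)"
    using up[OF K1(2)] by linarith
  have NP: "(\<Sum>n<NT. dt * esum (\<lambda>\<sigma>. (dd (N (Suc n)) \<sigma>)\<^sup>2)) + (\<Sum>n<NT. dt * esum (\<lambda>\<sigma>. (dd (P (Suc n)) \<sigma>)\<^sup>2)) \<le> C * (1 + lam\<^sup>2)"
  proof -
    have "(\<Sum>n<NT. dt * esum (\<lambda>\<sigma>. (dd (N (Suc n)) \<sigma>)\<^sup>2)) + (\<Sum>n<NT. dt * esum (\<lambda>\<sigma>. (dd (P (Suc n)) \<sigma>)\<^sup>2)) =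
      (\<Sum>n<NT. dt * esum (\<lambda>\<sigma>. 1 * ((dd (P (Suc n)) \<sigma>)\<^sup>2 + (dd (N (Suc n)) \<sigma>)\<^sup>2)))"
      by (simp add: sum.distrib[symmetric] distrib_left[symmetric] esum_add[symmetric] add.commute)
    also have "\<dots> \<le> (\<Sum>n<NT. dt * weighted (Suc n))"
      using dt by (intro sum_mono mult_left_mono esum_mono mult_right_mono bmean_bounds) auto
    finally show ?thesis using W by simp
  qed
  then show "(\<Sum>n<NT. dt * esum (\<lambda>\<sigma>. (dd (N (Suc n)) \<sigma>)\<^sup>2)) + (\<Sum>n<NT. dt * esum (\<lambda>\<sigma>. (dd (P (Suc n)) \<sigma>)\<^sup>2)) \<le> K\<^sub>F * (1 + lam\<^sup>2)"
    using up[OF K1(1)] by linarith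
  have nnP: "0 \<le> (\<Sum>n<NT. dt * esum (\<lambda>\<sigma>. (dd (P (Suc n)) \<sigma>)\<^sup>2))"
    using dt by (intro sum_nonneg mult_nonneg_nonneg esum_nonneg) auto
  \<comment> \<open>The difference of the potential is that of \<open>ln N\<close> minus the
    quasi-Fermi difference, and \<open>ln\<close> is Lipschitz with constant \<open>1 / m\<close> on
    the range of N.\<close>
  have "(\<Sum>n<NT. dt * esum (\<lambda>\<sigma>. (dd (\<Psi> (Suc n)) \<sigma>)\<^sup>2)) \<le>
    (\<Sum>n<NT. dt * (2 / m\<^sup>2 * esum (\<lambda>\<sigma>. (dd (N (Suc n)) \<sigma>)\<^sup>2) + 2 * dissipation (Suc n)))"
  proof (intro sum_mono mult_left_mono)
    fix n assume "n \<in> {..<NT}"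
    then have n: "Suc n \<le> NT" by simp
    have "esum (\<lambda>\<sigma>. (dd (\<Psi> (Suc n)) \<sigma>)\<^sup>2) \<le> esum (\<lambda>\<sigma>. 2 / m\<^sup>2 * (dd (N (Suc n)) \<sigma>)\<^sup>2 + 2 * (qf (N (Suc n)) (\<Psi> (Suc n)) \<sigma>)\<^sup>2)"
    proof (rule esum_mono)
      fix \<sigma> assume \<sigma>: "\<sigma> \<in> edges \<M>"
      define a where "a = dd (vmap ln (N (Suc n))) \<sigma>"
      define x where "x = qf (N (Suc n)) (\<Psi> (Suc n)) \<sigma>"
      have e: "dd (\<Psi> (Suc n)) \<sigma> = a - x" by (simp add: a_def x_def qf_def)
      have "0 \<le> (a + x)\<^sup>2" by simp
      then have "(dd (\<Psi> (Suc n)) \<sigma>)\<^sup>2 \<le> 2 * a\<^sup>2 + 2 * x\<^sup>2" unfolding e by (simp add: power2_eq_square algebra_simps)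
      also have "a\<^sup>2 \<le> (dd (N (Suc n)) \<sigma>)\<^sup>2 / m\<^sup>2" unfolding a_def by (rule dd_ln_le[OF in_range(1)[OF n] \<sigma>])
      finally show "(dd (\<Psi> (Suc n)) \<sigma>)\<^sup>2 \<le> 2 / m\<^sup>2 * (dd (N (Suc n)) \<sigma>)\<^sup>2 + 2 * (qf (N (Suc n)) (\<Psi> (Suc n)) \<sigma>)\<^sup>2"
        by (simp add: x_def)
    qed
    also have "\<dots> = 2 / m\<^sup>2 * esum (\<lambda>\<sigma>. (dd (N (Suc n)) \<sigma>)\<^sup>2) + 2 * esum (\<lambda>\<sigma>. (qf (N (Suc n)) (\<Psi> (Suc n)) \<sigma>)\<^sup>2)"
      unfolding esum_add esum_cmult ..
    also have "\<dots> \<le> 2 / m\<^sup>2 * esum (\<lambda>\<sigma>. (dd (N (Suc n)) \<sigma>)\<^sup>2) + 2 * dissipation (Suc n)"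
      by (simp add: dissipation_def esum_nonneg)
    finally show "esum (\<lambda>\<sigma>. (dd (\<Psi> (Suc n)) \<sigma>)\<^sup>2) \<le> 2 / m\<^sup>2 * esum (\<lambda>\<sigma>. (dd (N (Suc n)) \<sigma>)\<^sup>2) + 2 * dissipation (Suc n)" .
  qed (use dt in simp)
  also have "\<dots> = 2 / m\<^sup>2 * (\<Sum>n<NT. dt * esum (\<lambda>\<sigma>. (dd (N (Suc n)) \<sigma>)\<^sup>2)) + 2 * (\<Sum>n<NT. dt * dissipation (Suc n))"
    by (simp only: distrib_left sum.distrib sum_distrib_left mult.left_commute[of dt])
  also have "\<dots> \<le> 2 / m\<^sup>2 * (C * (1 + lam\<^sup>2)) + 2 * (D * (1 + lam\<^sup>2))"
    using NP nnP dissipation_sum unfolding D_def by (intro add_mono mult_left_mono) auto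
  also have "\<dots> = (2 / m\<^sup>2 * C + 2 * D) * (1 + lam\<^sup>2)" by (simp add: distrib_right)
  finally show "(\<Sum>n<NT. dt * esum (\<lambda>\<sigma>. (dd (\<Psi> (Suc n)) \<sigma>)\<^sup>2)) \<le> K\<^sub>F * (1 + lam\<^sup>2)" using up[OF K1(3)] by linarith
qed

end

section \<open>From the data to the estimates\<close>

lemma mean_bounds:
  fixes f :: "'a::euclidean_space \<Rightarrow> real"
  assumes A: "open A" "bounded A" "0 < measure lebesgue A" "A \<subseteq> \<Omega>" and \<Omega>: "open \<Omega>"
    and f: "f \<in> borel_measurable (lebesgue_on \<Omega>)" and ae: "AE x in lebesgue_on \<Omega>. m \<le> f x \<and> f x \<le> M"
  shows "AE x in lebesgue_on A. m \<le> f x \<and> f x \<le> M"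
    "m \<le> integral\<^sup>L (lebesgue_on A) f / measure lebesgue A" "integral\<^sup>L (lebesgue_on A) f / measure lebesgue A \<le> M"
proof -
  interpret finite_measure "lebesgue_on A" by (rule finite_measure_lebesgue_on[OF A(1,2)])
  have sA: "A \<in> sets lebesgue" "\<Omega> \<in> sets lebesgue" using A(1) \<Omega> by (auto simp: borel_open)
  show aeA: "AE x in lebesgue_on A. m \<le> f x \<and> f x \<le> M"
  proof -
    have "AE x in lebesgue. x \<in> \<Omega> \<longrightarrow> m \<le> f x \<and> f x \<le> M"
      by (rule iffD1[OF AE_restrict_space_iff ae]) (use sA in auto)
    then have "AE x in lebesgue. x \<in> A \<longrightarrow> m \<le> f x \<and> f x \<le> M"
      by eventually_elim (use A(4) in blast)
    then show ?thesis by (intro iffD2[OF AE_restrict_space_iff]) (use sA in auto)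
  qed
  have fA: "f \<in> borel_measurable (lebesgue_on A)" by (rule measurable_restrict_mono[OF f A(4)])
  have int: "integrable (lebesgue_on A) f"
    by (rule integrable_const_bound[of _ "\<bar>m\<bar> + \<bar>M\<bar>", OF _ fA]) (use aeA in eventually_elim, auto)
  have c: "(LINT x|lebesgue_on A. c) = c * measure lebesgue A" for c :: real
    using sA by (simp add: measure_restrict_space)
  have "(LINT x|lebesgue_on A. m) \<le> integral\<^sup>L (lebesgue_on A) f"
    by (rule integral_mono_AE[OF _ int]) (use aeA in \<open>auto elim: eventually_mono\<close>)
  then show "m \<le> integral\<^sup>L (lebesgue_on A) f / measure lebesgue A"
    unfolding c using A(3) by (simp add: pos_le_divide_eq)
  have "integral\<^sup>L (lebesgue_on A) f \<le> (LINT x|lebesgue_on A. M)"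
    by (rule integral_mono_AE[OF int]) (use aeA in \<open>auto elim: eventually_mono\<close>)
  then show "integral\<^sup>L (lebesgue_on A) f / measure lebesgue A \<le> M"
    unfolding c using A(3) by (simp add: pos_divide_le_eq)
qed

text \<open>Choosing one weak gradient turns the energy into a number attached to
  \<open>\<Omega>\<close> and \<open>u\<close> alone, as the constant of the theorem must be. The
  form of the integrand matches \<open>energy \<Omega>\<close>.\<close>

definition data_energy :: "'a::euclidean_space set \<Rightarrow> ('a \<Rightarrow> real) \<Rightarrow> real" where
  "data_energy \<Omega> u = (LINT x|lebesgue_on \<Omega>. indicator \<Omega> x * (norm ((SOME w. weak_gradient \<Omega> u w) x))\<^sup>2)"

text \<open>The bound of \<open>discrete_H1\<close> with \<open>\<rho>\<close> written out, so that
  it can be stated before any mesh is given.\<close>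

definition data_const :: "'a::euclidean_space set \<Rightarrow> ('a \<Rightarrow> real) \<Rightarrow> real \<Rightarrow> real \<Rightarrow> real" where
  "data_const \<Omega> u \<xi> \<beta> = 2 * trace_const DIM('a) (min (\<xi> / 2) 1) * \<beta> * data_energy \<Omega> u"

context regular_mesh
begin

lemma sum_vol_le: "(\<Sum>K\<in>cells \<M>. vol K) \<le> measure lebesgue \<Omega>"
proof -
  have fm: "A \<in> fmeasurable lebesgue" if "open A" "A \<subseteq> \<Omega>" for A
    using that \<Omega>(2) by (intro bounded_set_imp_lmeasurable) (auto simp: bounded_subset borel_open)
  have fK: "K \<in> fmeasurable lebesgue" if "K \<in> cells \<M>" for K using fm cell(1,4)[OF that] by blast
  have "(\<Sum>K\<in>cells \<M>. vol K) = measure lebesgue (\<Union>K\<in>cells \<M>. K)"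
  proof (rule measure_finite_Union[symmetric, OF finite_cells])
    show "(\<lambda>K. K) ` cells \<M> \<subseteq> sets lebesgue" using fK by (auto simp: fmeasurable_def)
    show "disjoint_family_on (\<lambda>K. K) (cells \<M>)" using disjoint_cells by (auto simp: disjoint_family_on_def disjoint_def)
    show "emeasure lebesgue K \<noteq> \<infinity>" if "K \<in> cells \<M>" for K
      unfolding infinity_ennreal_def by (rule fmeasurableD2[OF fK[OF that]])
  qed
  also have "\<dots> \<le> measure lebesgue \<Omega>"
    by (rule measure_mono_fmeasurable)
      (use cell(4) fK finite_cells fm[OF \<Omega>(1)] in \<open>auto intro!: sets.finite_UN simp: fmeasurable_def\<close>)
  finally show ?thesis .
qed

lemma data_bound:
  assumes u: "u \<in> H1 \<Omega>"
    and b: "\<And>K \<sigma>. K \<in> cells \<M> \<Longrightarrow> \<sigma> \<in> E K \<Longrightarrow> \<sigma> \<in> dir \<Longrightarrow> trace_mean K \<sigma> u (b \<sigma>)"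
  shows "(\<Sum>\<sigma>\<in>edges \<M>. \<tau> \<sigma> * (Dabs \<Omega> \<Gamma>D \<M> (cell_avg u, b) \<sigma>)\<^sup>2) \<le> data_const \<Omega> u \<xi> \<beta>"
proof -
  have "\<exists>w. weak_gradient \<Omega> u w" "u \<in> L2 \<Omega>" using u by (auto simp: H1_def)
  from discrete_H1[OF this(2) someI_ex[OF this(1)] b]
  show ?thesis by (simp add: data_const_def data_energy_def h1_const_def \<rho>_def energy_def[OF \<open>u \<in> L2 \<Omega>\<close> someI_ex[OF \<open>\<exists>w. weak_gradient \<Omega> u w\<close>]])
qed

theorem solution_estimates:
  assumes H: "hypotheses_H \<Omega> \<Gamma>D \<Gamma>N N0 P0 ND PD \<Psi>D m M"
    and PN0: "AE x in lebesgue_on \<Omega>. P0 x - N0 x = 0"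
    and PND: "zero_trace_on \<Omega> \<Gamma>D (\<lambda>x. PD x - ND x)"
    and dt: "0 < dt" and T: "real NT * dt \<le> T"
    and sol: "scheme_solution \<Omega> \<Gamma>D N0 P0 ND PD \<Psi>D \<M> dt lam NT N P \<Psi>"
  defines "C \<equiv> apriori_const (measure lebesgue \<Omega>) (data_const \<Omega> ND \<xi> \<beta>) (data_const \<Omega> \<Psi>D \<xi> \<beta>) T m M"
  shows "(\<Sum>n<NT. dt * (\<Sum>\<sigma>\<in>edges \<M>. \<tau> \<sigma> * Dabs \<Omega> \<Gamma>D \<M> (\<Psi> (Suc n)) \<sigma> *
              ((Dabs \<Omega> \<Gamma>D \<M> (P (Suc n)) \<sigma>)\<^sup>2 + (Dabs \<Omega> \<Gamma>D \<M> (N (Suc n)) \<sigma>)\<^sup>2)))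
            \<le> C * (1 + lam\<^sup>2)"
    and "(\<Sum>n<NT. dt * (\<Sum>\<sigma>\<in>edges \<M>. \<tau> \<sigma> * (Dabs \<Omega> \<Gamma>D \<M> (N (Suc n)) \<sigma>)\<^sup>2))
            + (\<Sum>n<NT. dt * (\<Sum>\<sigma>\<in>edges \<M>. \<tau> \<sigma> * (Dabs \<Omega> \<Gamma>D \<M> (P (Suc n)) \<sigma>)\<^sup>2))
            \<le> C * (1 + lam\<^sup>2)"
    and "(\<Sum>n<NT. dt * (\<Sum>\<sigma>\<in>edges \<M>. \<tau> \<sigma> * (Dabs \<Omega> \<Gamma>D \<M> (\<Psi> (Suc n)) \<sigma>)\<^sup>2))
            \<le> C * (1 + lam\<^sup>2)"
proof -
  have data: "0 < m" "ND \<in> H1 \<Omega>" "\<Psi>D \<in> H1 \<Omega>" "N0 \<in> borel_measurable (lebesgue_on \<Omega>)" "P0 \<in> borel_measurable (lebesgue_on \<Omega>)"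
    "ND \<in> borel_measurable (lebesgue_on \<Omega>)"
    "AE x in lebesgue_on \<Omega>. m \<le> N0 x \<and> N0 x \<le> M" "AE x in lebesgue_on \<Omega>. m \<le> ND x \<and> ND x \<le> M"
    using H by (auto simp: hypotheses_H_def Linf_def)
  have initial: "fst (N 0) K = integral\<^sup>L (lebesgue_on K) N0 / vol K" "fst (P 0) K = integral\<^sup>L (lebesgue_on K) P0 / vol K"
    if "K \<in> cells \<M>" for K
    using sol that by (auto simp: scheme_solution_def)
  have boundary: "trace_mean K \<sigma> ND (snd (N n) \<sigma>)" "trace_mean K \<sigma> PD (snd (P n) \<sigma>)" "trace_mean K \<sigma> \<Psi>D (snd (\<Psi> n) \<sigma>)"
    if "n \<le> NT" "K \<in> cells \<M>" "\<sigma> \<in> E K" "\<sigma> \<in> dir" for n K \<sigma>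
    using sol that by (auto simp: scheme_solution_def)
  \<comment> \<open>Cell values are ball means of the data. Edge values are taken from the solution
    at time 0; by \<open>bd\<close> they stand for all times, and in \<open>RD\<close> for both
    densities.\<close>
  define RD :: "'a dvec" where "RD = (cell_avg ND, snd (N 0))"
  define RP :: "'a dvec" where "RP = (cell_avg \<Psi>D, snd (\<Psi> 0))"
  have dir_cell: "\<exists>K\<in>cells \<M>. \<sigma> \<in> E K" if "\<sigma> \<in> dir" for \<sigma>
    using that edges_eq by (auto simp: dirichlet_edges_def ext_edges_def)
  have bd: "snd (N n) \<sigma> = snd RD \<sigma> \<and> snd (P n) \<sigma> = snd RD \<sigma> \<and> snd (\<Psi> n) \<sigma> = snd RP \<sigma>"
    if n: "n \<le> NT" and \<sigma>: "\<sigma> \<in> dir" for n \<sigma>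
  proof -
    obtain K where K: "K \<in> cells \<M>" "\<sigma> \<in> E K" using dir_cell[OF \<sigma>] by blast
    note c = cell(1,3,2)[OF K(1)] edge(1-3)[OF K]
    have "\<sigma> \<subseteq> frontier K \<inter> \<Gamma>D" using edge(1)[OF K] \<sigma> by (auto simp: dirichlet_edges_def)
    moreover have "polytopal_cell K" using admissible(3) K(1) by blast
    ultimately have "trace_on K \<sigma> (\<lambda>x. PD x - ND x) (\<lambda>_. 0)"
      using PND cell(4)[OF K(1)] edge(2,3)[OF K] by (auto simp: zero_trace_on_def)
    then have "snd (P n) \<sigma> = snd (N 0) \<sigma>"
      by (intro trace_mean_eq[OF c boundary(2)[OF n K \<sigma>] boundary(1)[OF le0 K \<sigma>]])
    then show ?thesis
      using trace_mean_unique[OF c boundary(1)[OF n K \<sigma>] boundary(1)[OF le0 K \<sigma>]]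
        trace_mean_unique[OF c boundary(3)[OF n K \<sigma>] boundary(3)[OF le0 K \<sigma>]] by (simp add: RD_def RP_def)
  qed
  have boundK: "AE x in lebesgue_on K. m \<le> ND x \<and> ND x \<le> M" "m \<le> fst (N 0) K" "fst (N 0) K \<le> M" if "K \<in> cells \<M>" for K
    unfolding initial[OF that]
    by (rule mean_bounds[OF cell(1,3)[OF that] vol_pos[OF that] cell(4)[OF that] \<Omega>(1)], use data in auto)+
  interpret scheme \<Omega> \<Gamma>D \<Gamma>N \<M> \<xi> \<beta> N P \<Psi> RD RP dt lam m M NT
  proof unfold_locales
    show "m \<le> fst RD K \<and> fst RD K \<le> M" if K: "K \<in> cells \<M>" for K
    proof -
      have b: "0 < measure lebesgue (ball (xc K) (rad K))" using cell_ball(3)[OF K] by (simp add: content_ball_pos)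
      have s: "ball (xc K) (rad K) \<subseteq> \<Omega>" using cell_ball(2)[OF K] cell(4)[OF K] by blast
      show ?thesis
        using mean_bounds(2,3)[OF open_ball bounded_ball b s \<Omega>(1) data(6,8)] by (simp add: RD_def cell_avg_def lavg_def)
    qed
    show "m \<le> snd RD \<sigma> \<and> snd RD \<sigma> \<le> M" if \<sigma>: "\<sigma> \<in> dir" for \<sigma>
    proof -
      obtain K where K: "K \<in> cells \<M>" "\<sigma> \<in> E K" using dir_cell[OF \<sigma>] by blast
      show ?thesis
        using trace_mean_bounds[OF cell(1,3,2)[OF K(1)] edge(1-3)[OF K] boundary(1)[OF le0 K \<sigma>] boundK(1)[OF K(1)]]
        by (simp add: RD_def)
    qed
    show "m \<le> fst (N 0) K \<and> fst (N 0) K \<le> M \<and> fst (P 0) K = fst (N 0) K" if K: "K \<in> cells \<M>" for K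
    proof -
      have "AE x in lebesgue_on K. P0 x = N0 x"
        using PN0 cell(1,4)[OF K] \<Omega>(1) by (auto simp: AE_restrict_space_iff borel_open elim!: eventually_mono)
      then have "integral\<^sup>L (lebesgue_on K) P0 = integral\<^sup>L (lebesgue_on K) N0"
        using data cell(4)[OF K] by (intro integral_cong_AE) (auto intro: measurable_restrict_mono)
      then show ?thesis using boundK[OF K] by (simp add: initial[OF K])
    qed
    show "evol dt (N n) (N (Suc n)) (\<Psi> (Suc n)) \<and> evol dt (P n) (P (Suc n)) (vneg (\<Psi> (Suc n)))" if n: "n < NT" for n
    proof -
      have scale: "v * a + dt * s = 0" if "v * (a / dt) + s = 0" for v a s :: real
      proof -
        have "v * a + dt * s = dt * (v * (a / dt) + s)" using dt by (simp add: field_simps)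
        then show ?thesis using that by simp
      qed
      show ?thesis
        using sol n unfolding evol_def flux_P_eq[symmetric] scheme_solution_def by (auto intro!: scale)
    qed
    show "poisson lam (N n) (P n) (\<Psi> n)" if "n \<le> NT" for n
      using sol that by (auto simp: poisson_def scheme_solution_def)
  qed (use dt data(1) bd in auto)
  interpret scheme_bounds \<Omega> \<Gamma>D \<Gamma>N \<M> \<xi> \<beta> N P \<Psi> RD RP dt lam m M NT "measure lebesgue \<Omega>" "data_const \<Omega> ND \<xi> \<beta>" "data_const \<Omega> \<Psi>D \<xi> \<beta>" T
  proof unfold_locales
    show "esum (\<lambda>\<sigma>. (dd RD \<sigma>)\<^sup>2) \<le> data_const \<Omega> ND \<xi> \<beta>"
      using data_bound[OF data(2) boundary(1)[OF le0]] by (simp add: esum_def dd_def RD_def Dabs_def)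
    show "esum (\<lambda>\<sigma>. (dd RP \<sigma>)\<^sup>2) \<le> data_const \<Omega> \<Psi>D \<xi> \<beta>"
      using data_bound[OF data(3) boundary(3)[OF le0]] by (simp add: esum_def dd_def RP_def Dabs_def)
  qed (use T sum_vol_le in auto)
  show "(\<Sum>n<NT. dt * (\<Sum>\<sigma>\<in>edges \<M>. \<tau> \<sigma> * Dabs \<Omega> \<Gamma>D \<M> (\<Psi> (Suc n)) \<sigma> *
              ((Dabs \<Omega> \<Gamma>D \<M> (P (Suc n)) \<sigma>)\<^sup>2 + (Dabs \<Omega> \<Gamma>D \<M> (N (Suc n)) \<sigma>)\<^sup>2)))
            \<le> C * (1 + lam\<^sup>2)"
    "(\<Sum>n<NT. dt * (\<Sum>\<sigma>\<in>edges \<M>. \<tau> \<sigma> * (Dabs \<Omega> \<Gamma>D \<M> (N (Suc n)) \<sigma>)\<^sup>2))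
            + (\<Sum>n<NT. dt * (\<Sum>\<sigma>\<in>edges \<M>. \<tau> \<sigma> * (Dabs \<Omega> \<Gamma>D \<M> (P (Suc n)) \<sigma>)\<^sup>2))
            \<le> C * (1 + lam\<^sup>2)"
    "(\<Sum>n<NT. dt * (\<Sum>\<sigma>\<in>edges \<M>. \<tau> \<sigma> * (Dabs \<Omega> \<Gamma>D \<M> (\<Psi> (Suc n)) \<sigma>)\<^sup>2))
            \<le> C * (1 + lam\<^sup>2)"
    using estimates unfolding esum_def dd_def C_def by (simp_all add: Dabs_def mult.assoc)
qed

end

theorem theorem1p3:
  fixes \<Omega> :: "(real ^ 'd) set"
    and ND PD \<Psi>D :: "real ^ 'd \<Rightarrow> real"
    and m M T \<xi> \<beta> :: real
  assumes "0 < T" and "0 < \<xi>" and "0 < \<beta>"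
  shows "\<exists>K\<^sub>F::real.
    \<forall>\<Gamma>D \<Gamma>N N0 P0.
      hypotheses_H \<Omega> \<Gamma>D \<Gamma>N N0 P0 ND PD \<Psi>D m M \<longrightarrow>
      (AE x in lebesgue_on \<Omega>. P0 x - N0 x = 0) \<longrightarrow>
      zero_trace_on \<Omega> \<Gamma>D (\<lambda>x. PD x - ND x) \<longrightarrow>
      (\<forall>\<M> \<Delta>t lam NT N P \<Psi>.
        admissible_mesh \<Omega> \<Gamma>D \<Gamma>N \<M> \<longrightarrow>
        (\<forall>K\<in>cells \<M>. \<forall>\<sigma>\<in>cell_edges \<M> K. \<xi> * diameter K \<le> infdist (center \<M> K) \<sigma>) \<longrightarrow>
        (\<forall>K\<in>cells \<M>. real (card (cell_edges \<M> K)) \<le> \<beta>) \<longrightarrow>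
        0 < \<Delta>t \<longrightarrow> 0 \<le> lam \<longrightarrow> NT = nat \<lfloor>T / \<Delta>t\<rfloor> \<longrightarrow>
        scheme_solution \<Omega> \<Gamma>D N0 P0 ND PD \<Psi>D \<M> \<Delta>t lam NT N P \<Psi> \<longrightarrow>
          (\<Sum>n<NT. \<Delta>t * (\<Sum>\<sigma>\<in>edges \<M>. transm \<M> \<sigma> * Dabs \<Omega> \<Gamma>D \<M> (\<Psi> (Suc n)) \<sigma> *
              ((Dabs \<Omega> \<Gamma>D \<M> (P (Suc n)) \<sigma>)\<^sup>2 + (Dabs \<Omega> \<Gamma>D \<M> (N (Suc n)) \<sigma>)\<^sup>2)))
            \<le> K\<^sub>F * (1 + lam\<^sup>2) \<and>
          (\<Sum>n<NT. \<Delta>t * (\<Sum>\<sigma>\<in>edges \<M>. transm \<M> \<sigma> * (Dabs \<Omega> \<Gamma>D \<M> (N (Suc n)) \<sigma>)\<^sup>2))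
            + (\<Sum>n<NT. \<Delta>t * (\<Sum>\<sigma>\<in>edges \<M>. transm \<M> \<sigma> * (Dabs \<Omega> \<Gamma>D \<M> (P (Suc n)) \<sigma>)\<^sup>2))
            \<le> K\<^sub>F * (1 + lam\<^sup>2) \<and>
          (\<Sum>n<NT. \<Delta>t * (\<Sum>\<sigma>\<in>edges \<M>. transm \<M> \<sigma> * (Dabs \<Omega> \<Gamma>D \<M> (\<Psi> (Suc n)) \<sigma>)\<^sup>2))
            \<le> K\<^sub>F * (1 + lam\<^sup>2))"
proof (intro exI allI impI)
  fix \<Gamma>D \<Gamma>N N0 P0 \<M> \<Delta>t lam NT N P \<Psi>
  assume H: "hypotheses_H \<Omega> \<Gamma>D \<Gamma>N N0 P0 ND PD \<Psi>D m M"
    and 0: "AE x in lebesgue_on \<Omega>. P0 x - N0 x = 0" "zero_trace_on \<Omega> \<Gamma>D (\<lambda>x. PD x - ND x)"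
    and mesh: "admissible_mesh \<Omega> \<Gamma>D \<Gamma>N \<M>"
      "\<forall>K\<in>cells \<M>. \<forall>\<sigma>\<in>cell_edges \<M> K. \<xi> * diameter K \<le> infdist (center \<M> K) \<sigma>"
      "\<forall>K\<in>cells \<M>. real (card (cell_edges \<M> K)) \<le> \<beta>"
    and dt: "0 < \<Delta>t" and NT: "NT = nat \<lfloor>T / \<Delta>t\<rfloor>"
    and sol: "scheme_solution \<Omega> \<Gamma>D N0 P0 ND PD \<Psi>D \<M> \<Delta>t lam NT N P \<Psi>"
  interpret regular_mesh \<Omega> \<Gamma>D \<Gamma>N \<M> \<xi> \<beta>
    by unfold_locales (use H mesh assms in \<open>auto simp: hypotheses_H_def\<close>)
  have "real NT \<le> T / \<Delta>t" unfolding NT using \<open>0 < T\<close> dt by simp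
  then have T: "real NT * \<Delta>t \<le> T" using dt by (simp add: pos_le_divide_eq)
  note est = solution_estimates[OF H 0 dt T sol]
  \<comment> \<open>The witness left open by \<open>exI\<close> becomes this constant. It mentions
    only \<open>\<Omega>\<close>, the data \<open>ND\<close> and \<open>\<Psi>D\<close>,
    \<open>\<xi>\<close>, \<open>\<beta>\<close>, \<open>T\<close>, \<open>m\<close> and
    \<open>M\<close>, and so may be chosen before the mesh, the time step and lam.\<close>
  let ?C = "apriori_const (measure lebesgue \<Omega>) (data_const \<Omega> ND \<xi> \<beta>) (data_const \<Omega> \<Psi>D \<xi> \<beta>) T m M"
  show "(\<Sum>n<NT. \<Delta>t * (\<Sum>\<sigma>\<in>edges \<M>. transm \<M> \<sigma> * Dabs \<Omega> \<Gamma>D \<M> (\<Psi> (Suc n)) \<sigma> *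
              ((Dabs \<Omega> \<Gamma>D \<M> (P (Suc n)) \<sigma>)\<^sup>2 + (Dabs \<Omega> \<Gamma>D \<M> (N (Suc n)) \<sigma>)\<^sup>2)))
            \<le> ?C * (1 + lam\<^sup>2) \<and>
          (\<Sum>n<NT. \<Delta>t * (\<Sum>\<sigma>\<in>edges \<M>. transm \<M> \<sigma> * (Dabs \<Omega> \<Gamma>D \<M> (N (Suc n)) \<sigma>)\<^sup>2))
            + (\<Sum>n<NT. \<Delta>t * (\<Sum>\<sigma>\<in>edges \<M>. transm \<M> \<sigma> * (Dabs \<Omega> \<Gamma>D \<M> (P (Suc n)) \<sigma>)\<^sup>2))
            \<le> ?C * (1 + lam\<^sup>2) \<and>
          (\<Sum>n<NT. \<Delta>t * (\<Sum>\<sigma>\<in>edges \<M>. transm \<M> \<sigma> * (Dabs \<Omega> \<Gamma>D \<M> (\<Psi> (Suc n)) \<sigma>)\<^sup>2))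
            \<le> ?C * (1 + lam\<^sup>2)"
    using est by blast
qed

end
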